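(* Let $\vec\psi$ satisfy (H1), $G_n\to_{lwc}\mu$, and $\mu$ satisfy (H2). Say that uniqueness holds at $(\beta,B)$ if for $\mu$-a.e. $T$ the set $\mathscr G_T$ of Gibbs measures for $(\psi^\beta,\bar\psi^B)$ on $T$ consists of a single measure. If uniqueness holds at $(\beta,B)$ then $\mathcal H^\star_\mu(\beta,B)$ is a singleton. Moreover: (a) if uniqueness holds on $[\beta_0,\beta_1]\times\{B\}$ and the unique fixed point $h$ satisfies (H3$^\beta$) on $[\beta_0,\beta_1]$, then $\lim_{n\to\infty}[\phi_n(\beta_1,B)-\phi_n(\beta_0,B)]=\Phi_\mu(\beta_1,B,h)-\Phi_\mu(\beta_0,B,h)$; (b) if uniqueness holds on $\{\beta\}\times[B_0,B_1]$ and the unique fixed point $h$ satisfies (H3$^B$) on $[B_0,B_1]$, then $\lim_{n\to\infty}[\phi_n(\beta,B_1)-\phi_n(\beta,B_0)]=\Phi_\mu(\beta,B_1,h)-\Phi_\mu(\beta,B_0,h)$.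
   Context: Graphs are undirected and locally finite; $\partial v$ neighbours, $D_v=|\partial v|$, $B_t(v)$ ball of radius $t$. $\mathcal T_*$: rooted trees $(T,o)$ up to isomorphism with the local metric; $T_t=B_t(o)$. A measure $\mu$ on rooted graphs is unimodular if $\mathbb E_\mu[\sum_x f(G,o,x)]=\mathbb E_\mu[\sum_x f(G,x,o)]$ for all nonnegative Borel $f$ on doubly-rooted graphs. "$G_n\to_{lwc}\mu$": random finite graphs $G_n=(V_n=[n],E_n)$, $I_n$ uniform on $V_n$; $(G_n)$ uniformly sparse ($\lim_L\limsup_n\mathbb E_n[D_{I_n}\mathbf 1\{D_{I_n}\ge L\}]=0$); $B_t(I_n)\to T_t$ in law for each $t$ where $T\sim\mu$ on $\mathcal T_*$ (unimodular); $\mu(D_o=0)<1$. Specification: finite $\mathscr X$; symmetric $\psi^\beta:\mathscr X^2\to[0,\infty)$, $\bar\psi^B:\mathscr X\to[0,\infty)$; $\xi=\log\psi$, $\bar\xi=\log\bar\psi$. Factor model on finite $G$: $\nu_G(\vec\sigma)=Z_G^{-1}\prod_{(ij)\in E}\psi^\beta(\sigma_i,\sigma_j)\prod_i\bar\psi^B(\sigma_i)$; $\phi_n=\frac1n\mathbb E_n\log Z_{G_n}$. (H1): $\bar\psi^B>0$; some $\sigma^{\mathrm{perm}}$ has $\min_\sigma\psi^\beta(\sigma,\sigma^{\mathrm{perm}})>0$; $\bar\xi^B(\sigma)$ is $C^1$ in $B$; each $\xi^\beta(\sigma,\sigma')$ is $\equiv-\infty$ or finite and $C^1$ in $\beta$.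 (H2): $\mathbb E_\mu D_o<\infty$, and if $\psi$ is not everywhere positive, $\mathbb E_\mu e^{cD_o}<\infty$ for all $c$. Gibbs measures: for $T\in\mathcal T_*$, $\mathscr G_T$ is the set of probability measures $\nu$ on $\mathscr X^{V(T)}$ such that for every finite $U\subset V(T)$, $\nu$-a.s. the conditional law of $\vec\sigma_U$ given $\vec\sigma_{V(T)\setminus U}$ is proportional to $\prod_{(ij)\in E(T),\{i,j\}\cap U\neq\emptyset}\psi(\sigma_i,\sigma_j)\prod_{i\in U}\bar\psi(\sigma_i)$. Messages: $\mathcal T_\to$ trees rooted at directed edge $x\to y$; $\mu^\uparrow$ law of $(T,J\to o)$ with $T\sim\mu$ conditioned on $D_o\ge1$, $J$ uniform on $\partial o$. A message is measurable $(T,x\to y)\mapsto h_{x\to y}\in\Delta_{\mathscr X}$ modulo $\mu^\uparrow$-null sets (possibly depending on $(\beta,B)$). $\mathcal H^\star_\mu(\beta,B)$ = messages with $h_{x\to y}(\sigma)\propto\bar\psi^B(\sigma)\prod_{v\in\partial x\setminus y}\sum_{\sigma_v}\psi^\beta(\sigma,\sigma_v)h_{v\to x}(\sigma_v)$ $\mu^\uparrow$-a.s. Bethe functional: $\Phi_T(\beta,B,h)=\log\{\sum_\sigma\bar\psi(\sigma)\prod_{j\in\partial o}\sum_{\sigma_j}\psi(\sigma,\sigma_j)h_{j\to o}(\sigma_j)\}-\frac12\sum_{j\in\partial o}\log\{\sum_{\sigma,\sigma_j}\psi(\sigma,\sigma_j)h_{j\to o}(\sigma_j)h_{o\to j}(\sigma)\}$,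 $\Phi_\mu=\mathbb E_\mu\Phi_T$. (H3$^\beta$) on $[\beta_0,\beta_1]$: $\mu^\uparrow$-a.s., for each $\sigma$, $\beta\mapsto h^{\beta,B}_{x\to y}(\sigma)$ is continuous on $[\beta_0,\beta_1]$ with total variation bounded by a deterministic constant depending only on $\beta_0,\beta_1$; (H3$^B$) is the analogous condition in $B$. *)

theory Defs
  imports "HOL-Probability.Probability"
begin

text \<open>A rooted locally finite tree is encoded as a prefix-closed set of words over nat
  whose children of each node w are exactly w@[0],...,w@[k-1] for some finite k.
  The root is the empty word. Every rooted locally finite tree is isomorphic to such a
  set; all notions below are isomorphism-invariant.\<close>

definition utree :: "nat list set \<Rightarrow> bool" where
  "utree T \<longleftrightarrow> [] \<in> T \<and> (\<forall>w i. w @ [i] \<in> T \<longrightarrow> w \<in> T)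
     \<and> (\<forall>w i j. w @ [i] \<in> T \<and> j < i \<longrightarrow> w @ [j] \<in> T)
     \<and> (\<forall>w\<in>T. finite {i. w @ [i] \<in> T})"

definition tadj :: "nat list \<Rightarrow> nat list \<Rightarrow> bool" where
  "tadj u v \<longleftrightarrow> (\<exists>i. v = u @ [i]) \<or> (\<exists>i. u = v @ [i])"

definition nbrs :: "nat list set \<Rightarrow> nat list \<Rightarrow> nat list set" where
  "nbrs T x = {v \<in> T. tadj x v}"

definition deg :: "nat list set \<Rightarrow> nat list \<Rightarrow> nat" where
  "deg T x = card (nbrs T x)"

definition treeM :: "nat list set measure" where
  "treeM = sigma (Collect utree) {{T. utree T \<and> w \<in> T} | w. True}"

text \<open>Isomorphism of doubly rooted graphs (vertex set, adjacency, two roots).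
  Single-rooted isomorphism is the case of equal roots.\<close>
definition riso2 :: "'a set \<Rightarrow> ('a \<Rightarrow> 'a \<Rightarrow> bool) \<Rightarrow> 'a \<Rightarrow> 'a \<Rightarrow>
                     'b set \<Rightarrow> ('b \<Rightarrow> 'b \<Rightarrow> bool) \<Rightarrow> 'b \<Rightarrow> 'b \<Rightarrow> bool" where
  "riso2 A adjA a1 a2 B adjB b1 b2 \<longleftrightarrow>
     (\<exists>f. bij_betw f A B \<and> f a1 = b1 \<and> f a2 = b2 \<and>
          (\<forall>u\<in>A. \<forall>v\<in>A. adjA u v = adjB (f u) (f v)))"

definition unimodular :: "nat list set measure \<Rightarrow> bool" where
  "unimodular \<mu> \<longleftrightarrow>
    (\<forall>f :: nat list set \<Rightarrow> nat list \<Rightarrow> nat list \<Rightarrow> ennreal.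
       (\<forall>x y. (\<lambda>T. f T x y) \<in> borel_measurable treeM) \<and>
       (\<forall>T T' x y x' y'. utree T \<and> utree T' \<and> x \<in> T \<and> y \<in> T \<and> x' \<in> T' \<and> y' \<in> T' \<and>
           riso2 T tadj x y T' tadj x' y' \<longrightarrow> f T x y = f T' x' y')
       \<longrightarrow> (\<integral>\<^sup>+T. (\<integral>\<^sup>+x. f T [] x \<partial>count_space T) \<partial>\<mu>)
         = (\<integral>\<^sup>+T. (\<integral>\<^sup>+x. f T x [] \<partial>count_space T) \<partial>\<mu>))"

fun gball :: "(nat \<Rightarrow> nat \<Rightarrow> bool) \<Rightarrow> nat \<Rightarrow> nat \<Rightarrow> nat set" where
  "gball G i 0 = {i}"
| "gball G i (Suc t) = gball G i t \<union> {v. \<exists>u\<in>gball G i t. G u v}"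

definition tball :: "nat list set \<Rightarrow> nat \<Rightarrow> nat list set" where
  "tball T t = {w \<in> T. length w \<le> t}"

definition gdeg :: "(nat \<Rightarrow> nat \<Rightarrow> bool) \<Rightarrow> nat \<Rightarrow> nat \<Rightarrow> nat" where
  "gdeg G n i = card {j \<in> {0..<n}. G i j}"

definition graph_on :: "nat \<Rightarrow> (nat \<Rightarrow> nat \<Rightarrow> bool) \<Rightarrow> bool" where
  "graph_on n G \<longleftrightarrow> (\<forall>i j. G i j \<longrightarrow> i < n \<and> j < n \<and> i \<noteq> j \<and> G j i)"

definition unif_sparse :: "(nat \<Rightarrow> (nat \<Rightarrow> nat \<Rightarrow> bool) pmf) \<Rightarrow> bool" where
  "unif_sparse Gn \<longleftrightarrow>
     ((\<lambda>L::nat. limsup (\<lambda>n. ereal (measure_pmf.expectation (Gn n)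
          (\<lambda>G. (\<Sum>i<n. real (gdeg G n i) * (if gdeg G n i \<ge> L then 1 else 0)) / real n))))
      \<longlongrightarrow> 0) sequentially"

definition lwc :: "(nat \<Rightarrow> (nat \<Rightarrow> nat \<Rightarrow> bool) pmf) \<Rightarrow> nat list set measure \<Rightarrow> bool" where
  "lwc Gn \<mu> \<longleftrightarrow>
     (\<forall>n. \<forall>G\<in>set_pmf (Gn n). graph_on n G) \<and>
     unif_sparse Gn \<and>
     prob_space \<mu> \<and> sets \<mu> = sets treeM \<and> unimodular \<mu> \<and>
     (\<forall>t \<tau>. utree \<tau> \<and> finite \<tau> \<longrightarrow>
        (\<lambda>n. measure_pmf.expectation (Gn n)
           (\<lambda>G. real (card {i \<in> {0..<n}. riso2 (gball G i t) G i i \<tau> tadj [] []}) / real n))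
        \<longlonglongrightarrow> measure \<mu> {T \<in> space \<mu>. riso2 (tball T t) tadj [] [] \<tau> tadj [] []}) \<and>
     measure \<mu> {T \<in> space \<mu>. deg T [] = 0} < 1"

definition H1 :: "(real \<Rightarrow> 'x::finite \<Rightarrow> 'x \<Rightarrow> real) \<Rightarrow> (real \<Rightarrow> 'x \<Rightarrow> real) \<Rightarrow> bool" where
  "H1 \<psi> \<psi>b \<longleftrightarrow>
     (\<forall>\<beta> a b. \<psi> \<beta> a b = \<psi> \<beta> b a \<and> \<psi> \<beta> a b \<ge> 0) \<and>
     (\<forall>B \<sigma>. \<psi>b B \<sigma> > 0) \<and>
     (\<exists>sp. \<forall>\<beta> \<sigma>. \<psi> \<beta> \<sigma> sp > 0) \<and>
     (\<forall>\<sigma>. (\<lambda>B. ln (\<psi>b B \<sigma>)) C1_differentiable_on UNIV) \<and>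
     (\<forall>a b. (\<forall>\<beta>. \<psi> \<beta> a b = 0) \<or>
            ((\<forall>\<beta>. \<psi> \<beta> a b > 0) \<and> (\<lambda>\<beta>. ln (\<psi> \<beta> a b)) C1_differentiable_on UNIV))"

definition H2 :: "(real \<Rightarrow> 'x::finite \<Rightarrow> 'x \<Rightarrow> real) \<Rightarrow> nat list set measure \<Rightarrow> bool" where
  "H2 \<psi> \<mu> \<longleftrightarrow>
     (\<integral>\<^sup>+T. ennreal (real (deg T [])) \<partial>\<mu>) < \<infinity> \<and>
     ((\<exists>\<beta> a b. \<psi> \<beta> a b = 0) \<longrightarrow>
        (\<forall>c::real. (\<integral>\<^sup>+T. ennreal (exp (c * real (deg T []))) \<partial>\<mu>) < \<infinity>))"

definition Zg :: "(real \<Rightarrow> 'x::finite \<Rightarrow> 'x \<Rightarrow> real) \<Rightarrow> (real \<Rightarrow> 'x \<Rightarrow> real) \<Rightarrow> real \<Rightarrow> real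
                  \<Rightarrow> nat \<Rightarrow> (nat \<Rightarrow> nat \<Rightarrow> bool) \<Rightarrow> real" where
  "Zg \<psi> \<psi>b \<beta> B n G =
     (\<Sum>\<sigma>\<in>{0..<n} \<rightarrow>\<^sub>E (UNIV::'x set).
        (\<Prod>e\<in>{(i, j). i < j \<and> j < n \<and> G i j}. \<psi> \<beta> (\<sigma> (fst e)) (\<sigma> (snd e))) *
        (\<Prod>i<n. \<psi>b B (\<sigma> i)))"

definition phin :: "(real \<Rightarrow> 'x::finite \<Rightarrow> 'x \<Rightarrow> real) \<Rightarrow> (real \<Rightarrow> 'x \<Rightarrow> real) \<Rightarrow>
                    (nat \<Rightarrow> (nat \<Rightarrow> nat \<Rightarrow> bool) pmf) \<Rightarrow> nat \<Rightarrow> real \<Rightarrow> real \<Rightarrow> real" where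
  "phin \<psi> \<psi>b Gn n \<beta> B = measure_pmf.expectation (Gn n) (\<lambda>G. ln (Zg \<psi> \<psi>b \<beta> B n G)) / real n"

definition cfgM :: "nat list set \<Rightarrow> (nat list \<Rightarrow> 'x) measure" where
  "cfgM T = Pi\<^sub>M T (\<lambda>_. count_space UNIV)"

definition outsideM :: "nat list set \<Rightarrow> nat list set \<Rightarrow> (nat list \<Rightarrow> 'x) measure" where
  "outsideM T U = sigma (space (cfgM T))
      {{\<eta> \<in> space (cfgM T). \<eta> v = a} | v a. v \<in> T - U}"

definition tedges :: "nat list set \<Rightarrow> nat list set \<Rightarrow> (nat list \<times> nat list) set" where
  "tedges T U = {(p, c). c \<in> T \<and> (\<exists>i. c = p @ [i]) \<and> (p \<in> U \<or> c \<in> U)}"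

definition wloc :: "(real \<Rightarrow> 'x::finite \<Rightarrow> 'x \<Rightarrow> real) \<Rightarrow> (real \<Rightarrow> 'x \<Rightarrow> real) \<Rightarrow> real \<Rightarrow> real
                    \<Rightarrow> nat list set \<Rightarrow> nat list set \<Rightarrow> (nat list \<Rightarrow> 'x) \<Rightarrow> (nat list \<Rightarrow> 'x) \<Rightarrow> real" where
  "wloc \<psi> \<psi>b \<beta> B T U \<tau> \<sigma> =
     (let \<eta> = (\<lambda>v. if v \<in> U then \<tau> v else \<sigma> v) in
       (\<Prod>e\<in>tedges T U. \<psi> \<beta> (\<eta> (fst e)) (\<eta> (snd e))) * (\<Prod>i\<in>U. \<psi>b B (\<tau> i)))"

definition Zloc :: "(real \<Rightarrow> 'x::finite \<Rightarrow> 'x \<Rightarrow> real) \<Rightarrow> (real \<Rightarrow> 'x \<Rightarrow> real) \<Rightarrow> real \<Rightarrow> real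
                    \<Rightarrow> nat list set \<Rightarrow> nat list set \<Rightarrow> (nat list \<Rightarrow> 'x) \<Rightarrow> real" where
  "Zloc \<psi> \<psi>b \<beta> B T U \<sigma> = (\<Sum>\<tau>\<in>U \<rightarrow>\<^sub>E (UNIV::'x set). wloc \<psi> \<psi>b \<beta> B T U \<tau> \<sigma>)"

text \<open>The set of Gibbs measures (DLR condition); "proportional to" means the
  normaliser is positive and the conditional law equals the normalised weight.\<close>
definition gibbs :: "(real \<Rightarrow> 'x::finite \<Rightarrow> 'x \<Rightarrow> real) \<Rightarrow> (real \<Rightarrow> 'x \<Rightarrow> real) \<Rightarrow> real \<Rightarrow> real
                     \<Rightarrow> nat list set \<Rightarrow> (nat list \<Rightarrow> 'x) measure set" where
  "gibbs \<psi> \<psi>b \<beta> B T = {\<nu>. sets \<nu> = sets (cfgM T) \<and> prob_space \<nu> \<and>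
     (\<forall>U. finite U \<and> U \<subseteq> T \<longrightarrow>
        (AE \<sigma> in \<nu>. Zloc \<psi> \<psi>b \<beta> B T U \<sigma> > 0 \<and>
           (\<forall>\<tau>\<in>U \<rightarrow>\<^sub>E (UNIV::'x set).
              real_cond_exp \<nu> (outsideM T U)
                 (indicator {\<eta> \<in> space (cfgM T). \<forall>v\<in>U. \<eta> v = \<tau> v} :: (nat list \<Rightarrow> 'x) \<Rightarrow> real) \<sigma>
              = wloc \<psi> \<psi>b \<beta> B T U \<tau> \<sigma> / Zloc \<psi> \<psi>b \<beta> B T U \<sigma>)))}"

definition uniq :: "(real \<Rightarrow> 'x::finite \<Rightarrow> 'x \<Rightarrow> real) \<Rightarrow> (real \<Rightarrow> 'x \<Rightarrow> real) \<Rightarrow>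
                    nat list set measure \<Rightarrow> real \<Rightarrow> real \<Rightarrow> bool" where
  "uniq \<psi> \<psi>b \<mu> \<beta> B \<longleftrightarrow> (AE T in \<mu>. \<exists>!\<nu>. \<nu> \<in> gibbs \<psi> \<psi>b \<beta> B T)"

text \<open>A message assigns to a tree T with directed edge x -> y a probability vector
  h T x y on the spin set; it must be measurable and isomorphism invariant (i.e. a function
  on the space of trees rooted at a directed edge).\<close>
definition is_message :: "(nat list set \<Rightarrow> nat list \<Rightarrow> nat list \<Rightarrow> 'x::finite \<Rightarrow> real) \<Rightarrow> bool" where
  "is_message h \<longleftrightarrow>
     (\<forall>x y \<sigma>. (\<lambda>T. h T x y \<sigma>) \<in> borel_measurable treeM) \<and>
     (\<forall>T x y. utree T \<and> x \<in> T \<and> y \<in> T \<and> tadj x y \<longrightarrow>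
        (\<forall>\<sigma>. h T x y \<sigma> \<ge> 0) \<and> (\<Sum>\<sigma>\<in>UNIV. h T x y \<sigma>) = 1) \<and>
     (\<forall>T T' x y x' y'. utree T \<and> utree T' \<and> x \<in> T \<and> y \<in> T \<and> tadj x y \<and>
        x' \<in> T' \<and> y' \<in> T' \<and> riso2 T tadj x y T' tadj x' y' \<longrightarrow> h T x y = h T' x' y')"

text \<open>mu-up almost surely: for mu-a.e. T and every child J of the root o, at the edge J -> o
  (this is the meaning of "almost surely" under the law of (T, J -> o)).\<close>
definition AE_up :: "nat list set measure \<Rightarrow> (nat list set \<Rightarrow> nat list \<Rightarrow> nat list \<Rightarrow> bool) \<Rightarrow> bool" where
  "AE_up \<mu> P \<longleftrightarrow> (AE T in \<mu>. \<forall>i. [i] \<in> T \<longrightarrow> P T [i] [])"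

definition bp_rhs :: "(real \<Rightarrow> 'x::finite \<Rightarrow> 'x \<Rightarrow> real) \<Rightarrow> (real \<Rightarrow> 'x \<Rightarrow> real) \<Rightarrow> real \<Rightarrow> real
     \<Rightarrow> (nat list set \<Rightarrow> nat list \<Rightarrow> nat list \<Rightarrow> 'x \<Rightarrow> real) \<Rightarrow> nat list set \<Rightarrow> nat list \<Rightarrow> nat list
     \<Rightarrow> 'x \<Rightarrow> real" where
  "bp_rhs \<psi> \<psi>b \<beta> B h T x y \<sigma> =
     \<psi>b B \<sigma> * (\<Prod>v\<in>nbrs T x - {y}. \<Sum>s\<in>UNIV. \<psi> \<beta> \<sigma> s * h T v x s)"

definition bp_fixed_at :: "(real \<Rightarrow> 'x::finite \<Rightarrow> 'x \<Rightarrow> real) \<Rightarrow> (real \<Rightarrow> 'x \<Rightarrow> real) \<Rightarrow> real \<Rightarrow> real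
     \<Rightarrow> (nat list set \<Rightarrow> nat list \<Rightarrow> nat list \<Rightarrow> 'x \<Rightarrow> real) \<Rightarrow> nat list set \<Rightarrow> nat list \<Rightarrow> nat list
     \<Rightarrow> bool" where
  "bp_fixed_at \<psi> \<psi>b \<beta> B h T x y \<longleftrightarrow>
     (\<Sum>\<sigma>\<in>UNIV. bp_rhs \<psi> \<psi>b \<beta> B h T x y \<sigma>) > 0 \<and>
     (\<forall>\<sigma>. h T x y \<sigma> = bp_rhs \<psi> \<psi>b \<beta> B h T x y \<sigma> / (\<Sum>\<sigma>'\<in>UNIV. bp_rhs \<psi> \<psi>b \<beta> B h T x y \<sigma>'))"

definition Hstar :: "(real \<Rightarrow> 'x::finite \<Rightarrow> 'x \<Rightarrow> real) \<Rightarrow> (real \<Rightarrow> 'x \<Rightarrow> real) \<Rightarrow>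
     nat list set measure \<Rightarrow> real \<Rightarrow> real \<Rightarrow> (nat list set \<Rightarrow> nat list \<Rightarrow> nat list \<Rightarrow> 'x \<Rightarrow> real) set" where
  "Hstar \<psi> \<psi>b \<mu> \<beta> B = {h. is_message h \<and> AE_up \<mu> (bp_fixed_at \<psi> \<psi>b \<beta> B h)}"

definition singleton_mod_null :: "nat list set measure \<Rightarrow>
     (nat list set \<Rightarrow> nat list \<Rightarrow> nat list \<Rightarrow> 'x::finite \<Rightarrow> real) set \<Rightarrow> bool" where
  "singleton_mod_null \<mu> H \<longleftrightarrow>
     (\<exists>h\<in>H. \<forall>h'\<in>H. AE_up \<mu> (\<lambda>T x y. \<forall>\<sigma>. h' T x y \<sigma> = h T x y \<sigma>))"

definition PhiT :: "(real \<Rightarrow> 'x::finite \<Rightarrow> 'x \<Rightarrow> real) \<Rightarrow> (real \<Rightarrow> 'x \<Rightarrow> real) \<Rightarrow> real \<Rightarrow> real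
     \<Rightarrow> (nat list set \<Rightarrow> nat list \<Rightarrow> nat list \<Rightarrow> 'x \<Rightarrow> real) \<Rightarrow> nat list set \<Rightarrow> real" where
  "PhiT \<psi> \<psi>b \<beta> B h T =
     ln (\<Sum>\<sigma>\<in>UNIV. \<psi>b B \<sigma> * (\<Prod>j\<in>nbrs T []. \<Sum>s\<in>UNIV. \<psi> \<beta> \<sigma> s * h T j [] s))
     - (1/2) * (\<Sum>j\<in>nbrs T []. ln (\<Sum>\<sigma>\<in>UNIV. \<Sum>s\<in>UNIV. \<psi> \<beta> \<sigma> s * h T j [] s * h T [] j \<sigma>))"

definition PhiMu :: "(real \<Rightarrow> 'x::finite \<Rightarrow> 'x \<Rightarrow> real) \<Rightarrow> (real \<Rightarrow> 'x \<Rightarrow> real) \<Rightarrow>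
     nat list set measure \<Rightarrow> real \<Rightarrow> real \<Rightarrow> (nat list set \<Rightarrow> nat list \<Rightarrow> nat list \<Rightarrow> 'x \<Rightarrow> real) \<Rightarrow> real" where
  "PhiMu \<psi> \<psi>b \<mu> \<beta> B h = (\<integral>T. PhiT \<psi> \<psi>b \<beta> B h T \<partial>\<mu>)"

definition tv_le :: "(real \<Rightarrow> real) \<Rightarrow> real \<Rightarrow> real \<Rightarrow> real \<Rightarrow> bool" where
  "tv_le f a b C \<longleftrightarrow>
     (\<forall>ts::real list. sorted ts \<and> set ts \<subseteq> {a..b} \<longrightarrow>
        (\<Sum>k<length ts - 1. \<bar>f (ts ! Suc k) - f (ts ! k)\<bar>) \<le> C)"

text \<open>(H3) for a parametrised family of messages on [a,b] (parameter beta or B).\<close>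
definition H3 :: "nat list set measure \<Rightarrow>
     (real \<Rightarrow> nat list set \<Rightarrow> nat list \<Rightarrow> nat list \<Rightarrow> 'x::finite \<Rightarrow> real) \<Rightarrow> real \<Rightarrow> real \<Rightarrow> bool" where
  "H3 \<mu> h a b \<longleftrightarrow>
     (\<exists>C. AE_up \<mu> (\<lambda>T x y. \<forall>\<sigma>. continuous_on {a..b} (\<lambda>p. h p T x y \<sigma>) \<and>
                                   tv_le (\<lambda>p. h p T x y \<sigma>) a b C))"

end

theory Submission
  imports Defs
begin

text \<open>If the Gibbs measure on a tree is unique, then by compactness
  the conditional laws on a finite ball, given any configuration far away, converge to it. Through
  the permissive spin the marginals of the unique measure determine a message on every edge, namely
  the limit of belief propagation from any initial data; it is measurable and solves the recursion,
  and each solution of the recursion defines a consistent family of marginals, hence equals it.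

  The derivative of the free energy in the parameter is the average of a local observable over the
  vertices. Bounding the law of a ball by the extreme boundary conditions, decorrelation and local
  convergence show that this average tends to the expectation of the observable at the root of the
  limit tree, which is a function g of the fixed point messages. Integrating over the parameter
  yields the integral of g.

  It remains to see that the Bethe functional has the increment given by the integral of g. The
  messages are only continuous and of bounded variation in the parameter, so increments are compared
  along finer and finer partitions. The first-order increment of the functional at the root
  is the explicit parameter derivative g plus terms containing the increments of the messages into
  and out of the root. By the fixed point equation the latter are differences c(o,j) - c(j,o) of an
  edge function and its reversal, and their expectation vanishes by unimodularity.\<close>

section \<open>Trees and their finite-volume weights\<close>

text \<open>An arbitrary Gibbs measure is never analysed. The work is done with tables of ball
  marginals (\<open>dsys\<close>); a table consistent at all levels extends to a Gibbs measure, so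
  uniqueness of the measure becomes uniqueness of the table. The conditional laws are stated as
  cross-multiplied ratios, which are closed conditions even when weights vanish, as compactness
  requires under hard constraints. Two obstacles shape the rest. Messages are controlled almost
  surely at edges into the root only, while the recursion and the Bethe functional also read deeper
  edges and edges out of the root; unimodularity spreads a property to all edges once it is
  measurable and invariant under isomorphism. And under hard constraints the lower bound for the
  edge normalisation decays exponentially in the root degree, whence the exponential moments. Both
  parts of the theorem are one: a single parameter drives edge and vertex weights, and the weight to
  be held fixed becomes a family constant in it. Averages over graphs are bounded from above only;
  the negated observable gives the lower bound.\<close>

definition lev :: "nat list set \<Rightarrow> nat \<Rightarrow> nat list set" where
  "lev T t = {v \<in> T. length v = t}"

definition kids :: "nat list set \<Rightarrow> nat list \<Rightarrow> nat list set" where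
  "kids T v = {x \<in> T. \<exists>i. x = v @ [i]}"

definition conf :: "nat list set \<Rightarrow> nat \<Rightarrow> (nat list \<Rightarrow> 'x) set" where
  "conf T t = PiE (tball T t) (\<lambda>_. UNIV)"

definition glue :: "'v set \<Rightarrow> ('v \<Rightarrow> 'x) \<Rightarrow> ('v \<Rightarrow> 'x) \<Rightarrow> 'v \<Rightarrow> 'x" where
  "glue A \<sigma> \<tau> v = (if v \<in> A then \<sigma> v else \<tau> v)"

lemma utreeD:
  assumes "utree T"
  shows "[] \<in> T" "w @ [i] \<in> T \<Longrightarrow> w \<in> T" "w @ [i] \<in> T \<Longrightarrow> j < i \<Longrightarrow> w @ [j] \<in> T"
    "w \<in> T \<Longrightarrow> finite {i. w @ [i] \<in> T}"
  using assms unfolding utree_def by blast+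

lemma utree_butlast: "utree T \<Longrightarrow> v \<in> T \<Longrightarrow> butlast v \<in> T"
  by (cases v rule: rev_cases) (auto dest: utreeD)

lemma finite_kids: "utree T \<Longrightarrow> v \<in> T \<Longrightarrow> finite (kids T v)"
proof -
  assume a: "utree T" "v \<in> T"
  have "kids T v = (\<lambda>i. v @ [i]) ` {i. v @ [i] \<in> T}" unfolding kids_def by auto
  then show ?thesis using utreeD(4)[OF a] by simp
qed

lemma lev_Suc: "utree T \<Longrightarrow> lev T (Suc t) = (\<Union>v\<in>lev T t. kids T v)"
proof (intro equalityI subsetI)
  fix x assume T: "utree T" and "x \<in> lev T (Suc t)"
  then have x: "x \<in> T" "length x = Suc t" by (auto simp: lev_def)
  then obtain y i where y: "x = y @ [i]" by (cases x rule: rev_cases) auto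
  then show "x \<in> (\<Union>v\<in>lev T t. kids T v)" using x utreeD(2)[OF T] by (auto simp: lev_def kids_def)
qed (auto simp: lev_def kids_def)

lemma finite_lev: "utree T \<Longrightarrow> finite (lev T t)"
proof (induction t)
  case 0
  have "lev T 0 \<subseteq> {[]}" by (auto simp: lev_def)
  then show ?case using finite_subset by blast
next
  case (Suc t)
  then show ?case by (auto simp: lev_Suc intro!: finite_kids) (auto simp: lev_def)
qed

lemma tball_0: "utree T \<Longrightarrow> tball T 0 = {[]}"
  by (auto simp: tball_def dest: utreeD)

lemma tball_Suc: "tball T (Suc t) = tball T t \<union> lev T (Suc t)"
  by (auto simp: tball_def lev_def)

lemma tball_lev_disj: "tball T t \<inter> lev T (Suc t) = {}"
  by (auto simp: tball_def lev_def)

lemma finite_tball: "utree T \<Longrightarrow> finite (tball T t)"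
proof (induction t)
  case 0 then show ?case by (simp add: tball_0)
next
  case (Suc t) then show ?case by (simp add: tball_Suc finite_lev)
qed

lemma tball_mono: "s \<le> t \<Longrightarrow> tball T s \<subseteq> tball T t"
  by (auto simp: tball_def)

lemma Nil_in_tball: "utree T \<Longrightarrow> [] \<in> tball T t"
  by (auto simp: tball_def dest: utreeD)

lemma finite_conf: "utree T \<Longrightarrow> finite (conf T t :: (nat list \<Rightarrow> 'x::finite) set)"
  unfolding conf_def by (intro finite_PiE finite_tball) auto

lemma nbrs_eq: "utree T \<Longrightarrow> x \<in> T \<Longrightarrow> nbrs T x = kids T x \<union> (if x = [] then {} else {butlast x})"
proof -
  assume a: "utree T" "x \<in> T"
  have "butlast x \<in> T" using utree_butlast[OF a] .
  then show ?thesis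
    by (cases x rule: rev_cases) (auto simp: nbrs_def kids_def tadj_def)
qed

lemma finite_nbrs: "utree T \<Longrightarrow> x \<in> T \<Longrightarrow> finite (nbrs T x)"
  by (auto simp: nbrs_eq finite_kids)

lemma nbrs_Nil: "nbrs T [] = kids T []"
  by (auto simp: nbrs_def kids_def tadj_def)

lemma kids_Nil: "utree T \<Longrightarrow> kids T [] = lev T (Suc 0)"
  by (auto simp: kids_def lev_def length_Suc_conv)

lemma nbrs_root: "utree T \<Longrightarrow> nbrs T [] = lev T (Suc 0)"
  by (simp add: nbrs_Nil kids_Nil)

lemma tadj_sym: "tadj u v \<longleftrightarrow> tadj v u"
  by (auto simp: tadj_def)

lemma sum_PiE_glue:
  fixes f :: "('a \<Rightarrow> 'c) \<Rightarrow> 'b::comm_monoid_add"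
  assumes "A \<inter> B = {}"
  shows "(\<Sum>\<omega>\<in>PiE (A \<union> B) (\<lambda>_. UNIV). f \<omega>) =
    (\<Sum>\<sigma>\<in>PiE A (\<lambda>_. UNIV). \<Sum>\<tau>\<in>PiE B (\<lambda>_. UNIV). f (glue A \<sigma> \<tau>))"
  unfolding sum.cartesian_product
proof (rule sum.reindex_bij_witness[where i="\<lambda>(\<sigma>,\<tau>). glue A \<sigma> \<tau>" and j="\<lambda>\<omega>. (restrict \<omega> A, restrict \<omega> B)"])
  fix \<omega> assume \<omega>: "\<omega> \<in> PiE (A \<union> B) (\<lambda>_. UNIV :: 'c set)"
  have g: "glue A (restrict \<omega> A) (restrict \<omega> B) = \<omega>"
    using \<omega> by (auto simp: glue_def PiE_iff extensional_def fun_eq_iff restrict_def)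
  then show "(case (restrict \<omega> A, restrict \<omega> B) of (\<sigma>, \<tau>) \<Rightarrow> glue A \<sigma> \<tau>) = \<omega>" by simp
  show "(case (restrict \<omega> A, restrict \<omega> B) of (\<sigma>, \<tau>) \<Rightarrow> f (glue A \<sigma> \<tau>)) = f \<omega>" using g by simp
qed (use assms in \<open>auto simp: glue_def PiE_iff extensional_def fun_eq_iff restrict_def\<close>)

lemma sum_conf_Suc:
  "(\<Sum>\<omega>\<in>conf T (Suc t). f \<omega>) =
    (\<Sum>\<sigma>\<in>conf T t. \<Sum>\<tau>\<in>PiE (lev T (Suc t)) (\<lambda>_. UNIV). f (glue (tball T t) \<sigma> \<tau>))"
  unfolding conf_def tball_Suc by (rule sum_PiE_glue) (rule tball_lev_disj)

lemma glue_conf: "\<sigma> \<in> conf T t \<Longrightarrow> \<tau> \<in> PiE (lev T (Suc t)) (\<lambda>_. UNIV) \<Longrightarrow> glue (tball T t) \<sigma> \<tau> \<in> conf T (Suc t)"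
  by (auto simp: conf_def tball_Suc glue_def PiE_iff extensional_def)

text \<open>The weight \<open>wloc\<close> of the specification, read off one configuration instead
  of an inside and an outside one; the DLR ratio becomes symmetric in the two configurations
  compared.\<close>

definition lw :: "('x \<Rightarrow> 'x \<Rightarrow> real) \<Rightarrow> ('x \<Rightarrow> real) \<Rightarrow> nat list set \<Rightarrow> nat list set \<Rightarrow> (nat list \<Rightarrow> 'x) \<Rightarrow> real" where
  "lw w b T U \<omega> = (\<Prod>e\<in>tedges T U. w (\<omega> (fst e)) (\<omega> (snd e))) * (\<Prod>i\<in>U. b (\<omega> i))"

lemma wloc_lw: "wloc \<psi> \<psi>b \<beta> B T U \<tau> \<sigma> = lw (\<psi> \<beta>) (\<psi>b B) T U (glue U \<tau> \<sigma>)"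
  unfolding wloc_def lw_def Let_def glue_def by (auto intro!: prod.cong arg_cong2[where f="(*)"])

text \<open>Weight of a configuration on the ball of radius t whose leaves receive the messages m
  from level t+1.\<close>

definition Fm :: "('x::finite \<Rightarrow> 'x \<Rightarrow> real) \<Rightarrow> ('x \<Rightarrow> real) \<Rightarrow> nat list set \<Rightarrow> nat \<Rightarrow> (nat list \<Rightarrow> 'x \<Rightarrow> real)
    \<Rightarrow> (nat list \<Rightarrow> 'x) \<Rightarrow> real" where
  "Fm w b T t m \<omega> = (\<Prod>v\<in>tball T t - {[]}. w (\<omega> (butlast v)) (\<omega> v)) * (\<Prod>v\<in>tball T t. b (\<omega> v))
     * (\<Prod>v\<in>lev T (Suc t). \<Sum>s\<in>UNIV. w (\<omega> (butlast v)) s * m v s)"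

text \<open>Unnormalised belief propagation update with all messages directed at the root: a message
  is then indexed by the vertex that emits it, and only the children enter.\<close>

definition BP :: "('x::finite \<Rightarrow> 'x \<Rightarrow> real) \<Rightarrow> ('x \<Rightarrow> real) \<Rightarrow> nat list set \<Rightarrow> (nat list \<Rightarrow> 'x \<Rightarrow> real)
    \<Rightarrow> nat list \<Rightarrow> 'x \<Rightarrow> real" where
  "BP w b T m v s = b s * (\<Prod>x\<in>kids T v. \<Sum>r\<in>UNIV. w s r * m x r)"

text \<open>Given the spins in the ball, the sum over the next level factorises over its vertices,
  and each factor contains the update \<open>BP\<close> that the hypothesis identifies with the
  incoming message. The scalars \<open>c v\<close> do not depend on the configuration, so normalised
  weights on successive balls are consistent.\<close>

lemma Fm_peel:
  assumes T: "utree T"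
    and m: "\<And>v s. v \<in> lev T (Suc t) \<Longrightarrow> m v s = c v * BP w b T m v s"
  shows "Fm w b T t m \<omega> = (\<Prod>v\<in>lev T (Suc t). c v) *
    (\<Sum>\<zeta>\<in>PiE (lev T (Suc t)) (\<lambda>_. UNIV). Fm w b T (Suc t) m (glue (tball T t) \<omega> \<zeta>))"
proof -
  let ?L = "lev T (Suc t)" and ?V = "tball T t"
  let ?A = "\<Prod>v\<in>?V - {[]}. w (\<omega> (butlast v)) (\<omega> v)" and ?B = "\<Prod>v\<in>?V. b (\<omega> v)"
  have fin: "finite ?L" "finite ?V" using finite_lev[OF T] finite_tball[OF T] by auto
  have disj: "?V \<inter> ?L = {}" by (rule tball_lev_disj)
  have nl: "v \<in> ?L \<Longrightarrow> v \<noteq> []" for v by (auto simp: lev_def)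
  have bl: "v \<in> ?V \<Longrightarrow> butlast v \<in> ?V" for v using utree_butlast[OF T] by (auto simp: tball_def)
  have bl2: "v \<in> ?L \<Longrightarrow> butlast v \<in> ?V" for v using utree_butlast[OF T] by (auto simp: tball_def lev_def)
  \<comment> \<open>Level t + 2 is grouped by parents: the messages of the children of a vertex of
    level t + 1, together with its vertex weight, form \<open>BP\<close> at that vertex.\<close>
  have F: "Fm w b T (Suc t) m (glue ?V \<omega> \<zeta>) = ?A * ?B * (\<Prod>v\<in>?L. w (\<omega> (butlast v)) (\<zeta> v) * BP w b T m v (\<zeta> v))" for \<zeta>
  proof -
    let ?g = "glue ?V \<omega> \<zeta>"
    have g1: "v \<in> ?V \<Longrightarrow> ?g v = \<omega> v" for v by (simp add: glue_def)
    have g2: "v \<in> ?L \<Longrightarrow> ?g v = \<zeta> v" for v using disj by (auto simp: glue_def)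
    have s: "tball T (Suc t) - {[]} = (?V - {[]}) \<union> ?L" using nl by (auto simp: tball_Suc)
    have 1: "(\<Prod>v\<in>tball T (Suc t) - {[]}. w (?g (butlast v)) (?g v)) = ?A * (\<Prod>v\<in>?L. w (\<omega> (butlast v)) (\<zeta> v))"
      unfolding s using fin disj
      by (subst prod.union_disjoint) (auto intro!: prod.cong arg_cong2[where f="(*)"] simp: g1 g2 bl bl2)
    have 2: "(\<Prod>v\<in>tball T (Suc t). b (?g v)) = ?B * (\<Prod>v\<in>?L. b (\<zeta> v))"
      unfolding tball_Suc using fin disj
      by (subst prod.union_disjoint) (auto intro!: prod.cong arg_cong2[where f="(*)"] simp: g1 g2)
    have "(\<Prod>v\<in>lev T (Suc (Suc t)). \<Sum>s\<in>UNIV. w (?g (butlast v)) s * m v s)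
        = (\<Prod>v\<in>?L. \<Prod>x\<in>kids T v. \<Sum>s\<in>UNIV. w (?g (butlast x)) s * m x s)"
      unfolding lev_Suc[OF T, of "Suc t"]
      by (rule prod.UNION_disjoint) (auto simp: fin finite_kids[OF T] kids_def, auto simp: lev_def finite_kids[OF T, unfolded kids_def])
    also have "\<dots> = (\<Prod>v\<in>?L. \<Prod>x\<in>kids T v. \<Sum>s\<in>UNIV. w (\<zeta> v) s * m x s)"
      by (intro prod.cong refl) (auto simp: kids_def g2)
    finally have 3: "(\<Prod>v\<in>lev T (Suc (Suc t)). \<Sum>s\<in>UNIV. w (?g (butlast v)) s * m v s)
        = (\<Prod>v\<in>?L. \<Prod>x\<in>kids T v. \<Sum>s\<in>UNIV. w (\<zeta> v) s * m x s)" .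
    show ?thesis unfolding Fm_def 1 2 3 BP_def by (simp add: prod.distrib mult_ac)
  qed
  have "(\<Sum>\<zeta>\<in>PiE ?L (\<lambda>_. UNIV). Fm w b T (Suc t) m (glue ?V \<omega> \<zeta>))
      = ?A * ?B * (\<Prod>v\<in>?L. \<Sum>s\<in>UNIV. w (\<omega> (butlast v)) s * BP w b T m v s)"
    unfolding F sum_distrib_left[symmetric] by (subst prod_sum_PiE) (auto simp: fin)
  moreover have "Fm w b T t m \<omega> = ?A * ?B * (\<Prod>v\<in>?L. c v * (\<Sum>s\<in>UNIV. w (\<omega> (butlast v)) s * BP w b T m v s))"
    unfolding Fm_def sum_distrib_left
    by (intro arg_cong2[where f="(*)" and a="?A * ?B"] prod.cong sum.cong refl) (simp add: m mult_ac)
  ultimately show ?thesis by (simp add: prod.distrib mult_ac)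
qed

text \<open>The ball weight is the local weight of U times a remainder \<open>R\<close> that reads
  no spin in U. Cross-multiplied, the identity needs no positive weight.\<close>

lemma Fm_factor:
  assumes T: "utree T" and U: "U \<subseteq> tball T t" "\<And>u. u \<in> U \<Longrightarrow> nbrs T u \<subseteq> tball T t"
    and eq: "\<And>v. v \<in> tball T t - U \<Longrightarrow> \<omega> v = \<omega>' v"
  shows "Fm w b T t m \<omega> * lw w b T U \<omega>' = Fm w b T t m \<omega>' * lw w b T U \<omega>"
proof -
  let ?V = "tball T t"
  let ?E = "{v \<in> ?V - {[]}. v \<in> U \<or> butlast v \<in> U}"
  have fin: "finite ?V" using finite_tball[OF T] .
  have bl: "v \<in> ?V \<Longrightarrow> butlast v \<in> ?V" for v using utree_butlast[OF T] by (auto simp: tball_def)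
  \<comment> \<open>Each vertex other than the root stands for the edge to its parent. The
    assumption on the neighbours of U keeps every edge that meets U inside the ball.\<close>
  have te: "bij_betw (\<lambda>v. (butlast v, v)) ?E (tedges T U)"
  proof (rule bij_betw_imageI)
    show "inj_on (\<lambda>v. (butlast v, v)) ?E" by (auto simp: inj_on_def)
    show "(\<lambda>v. (butlast v, v)) ` ?E = tedges T U"
    proof (intro equalityI subsetI)
      fix e assume "e \<in> (\<lambda>v. (butlast v, v)) ` ?E"
      then obtain v where v: "v \<in> ?E" "e = (butlast v, v)" by auto
      then have "v = butlast v @ [last v]" by simp
      then have "\<exists>i. v = butlast v @ [i]" by blast
      then show "e \<in> tedges T U" using v by (auto simp: tedges_def tball_def) 
    next
      fix e assume "e \<in> tedges T U"
      then obtain p i where e: "e = (p, p @ [i])" "p @ [i] \<in> T" "p \<in> U \<or> p @ [i] \<in> U"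
        by (auto simp: tedges_def)
      have "p @ [i] \<in> ?V" using e U(2)[of p] U(1) by (auto simp: nbrs_def tadj_def)
      then show "e \<in> (\<lambda>v. (butlast v, v)) ` ?E" using e by (auto simp: image_iff)
    qed
  qed
  define R where "R = (\<lambda>\<omega>. (\<Prod>v\<in>?V - {[]} - ?E. w (\<omega> (butlast v)) (\<omega> v)) * (\<Prod>v\<in>?V - U. b (\<omega> v))
     * (\<Prod>v\<in>lev T (Suc t). \<Sum>s\<in>UNIV. w (\<omega> (butlast v)) s * m v s))"
  have F: "Fm w b T t m \<omega> = lw w b T U \<omega> * R \<omega>" for \<omega>
  proof -
    have "(\<Prod>v\<in>?V - {[]}. w (\<omega> (butlast v)) (\<omega> v)) = (\<Prod>v\<in>?V - {[]} - ?E. w (\<omega> (butlast v)) (\<omega> v)) * (\<Prod>v\<in>?E. w (\<omega> (butlast v)) (\<omega> v))"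
      by (rule prod.subset_diff) (use fin in auto)
    moreover have "(\<Prod>v\<in>?E. w (\<omega> (butlast v)) (\<omega> v)) = (\<Prod>e\<in>tedges T U. w (\<omega> (fst e)) (\<omega> (snd e)))"
      by (subst prod.reindex_bij_betw[OF te, symmetric]) simp
    moreover have "(\<Prod>v\<in>?V. b (\<omega> v)) = (\<Prod>v\<in>?V - U. b (\<omega> v)) * (\<Prod>v\<in>U. b (\<omega> v))"
      by (rule prod.subset_diff) (use fin U in auto)
    ultimately show ?thesis unfolding Fm_def lw_def R_def by (simp add: mult_ac)
  qed
  \<comment> \<open>A vertex of level t + 1 with its parent in U would be a neighbour of U outside
    the ball; so the messages entering the ball are attached outside U.\<close>
  have lU: "v \<in> lev T (Suc t) \<Longrightarrow> butlast v \<in> ?V - U" for v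
  proof -
    assume v: "v \<in> lev T (Suc t)"
    then obtain y i where y: "v = y @ [i]" by (cases v rule: rev_cases) (auto simp: lev_def)
    have "v \<in> nbrs T y" "v \<notin> ?V" using v y by (auto simp: nbrs_def tadj_def lev_def tball_def)
    then have "y \<notin> U" using U(2)[of y] by blast
    then show ?thesis using v y utreeD(2)[OF T] by (auto simp: lev_def tball_def)
  qed
  have "R \<omega> = R \<omega>'"
    unfolding R_def
    by (intro arg_cong2[where f="(*)"] prod.cong sum.cong refl) (use eq bl lU in auto)
  then show ?thesis by (simp add: F)
qed

section \<open>Finite-volume Gibbs systems\<close>

text \<open>A system of marginals on the balls of radius at most n that is consistent and satisfies
  the DLR equations, the latter in the ratio form which needs no normalisation.\<close>

definition dsys :: "('x::finite \<Rightarrow> 'x \<Rightarrow> real) \<Rightarrow> ('x \<Rightarrow> real) \<Rightarrow> nat list set \<Rightarrow> nat \<Rightarrow>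
    (nat \<times> (nat list \<Rightarrow> 'x) \<Rightarrow> real) \<Rightarrow> bool" where
  "dsys w b T n q \<longleftrightarrow> (\<forall>c. 0 \<le> q c \<and> q c \<le> 1) \<and> (\<Sum>\<omega>\<in>conf T 0. q (0, \<omega>)) = 1 \<and>
     (\<forall>t<n. \<forall>\<omega>\<in>conf T t. q (t, \<omega>) = (\<Sum>\<zeta>\<in>PiE (lev T (Suc t)) (\<lambda>_. UNIV). q (Suc t, glue (tball T t) \<omega> \<zeta>))) \<and>
     (\<forall>t\<le>n. \<forall>U. U \<subseteq> tball T t \<and> (\<forall>u\<in>U. nbrs T u \<subseteq> tball T t) \<longrightarrow>
        (\<forall>\<omega>\<in>conf T t. \<forall>\<omega>'\<in>conf T t. (\<forall>v. v \<notin> U \<longrightarrow> \<omega> v = \<omega>' v) \<longrightarrow>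
           q (t, \<omega>) * lw w b T U \<omega>' = q (t, \<omega>') * lw w b T U \<omega>))"

lemma dsys_antimono: "dsys w b T n q \<Longrightarrow> m \<le> n \<Longrightarrow> dsys w b T m q"
  unfolding dsys_def by auto

lemma dsys_sum: "dsys w b T n q \<Longrightarrow> t \<le> n \<Longrightarrow> (\<Sum>\<omega>\<in>conf T t. q (t, \<omega>)) = 1"
proof (induction t)
  case 0 then show ?case by (simp add: dsys_def)
next
  case (Suc t)
  then have "(\<Sum>\<omega>\<in>conf T t. q (t, \<omega>)) = (\<Sum>\<omega>\<in>conf T (Suc t). q (Suc t, \<omega>))"
    unfolding sum_conf_Suc by (intro sum.cong refl) (auto simp: dsys_def)
  then show ?case using Suc by simp
qed

definition Zm where "Zm w b T t m = (\<Sum>\<omega>\<in>conf T t. Fm w b T t m \<omega>)"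

text \<open>\<open>dsys\<close> bounds every coordinate, also those of larger radius and those at
  functions outside \<open>conf\<close>, where the weight may be negative or the total weight not
  positive; the default 0 covers them.\<close>

definition gq :: "('x::finite \<Rightarrow> 'x \<Rightarrow> real) \<Rightarrow> ('x \<Rightarrow> real) \<Rightarrow> nat list set \<Rightarrow> (nat list \<Rightarrow> 'x \<Rightarrow> real)
    \<Rightarrow> nat \<times> (nat list \<Rightarrow> 'x) \<Rightarrow> real" where
  "gq w b T m c = (if snd c \<in> conf T (fst c) \<and> Zm w b T (fst c) m > 0 \<and> (\<forall>\<omega>\<in>conf T (fst c). Fm w b T (fst c) m \<omega> \<ge> 0)
     then Fm w b T (fst c) m (snd c) / Zm w b T (fst c) m else 0)"

text \<open>One specification at fixed parameters. Positivity of all normalisers rests on the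
  permissive spin, since edge weights between other spins may vanish.\<close>

locale spin =
  fixes w :: "'x::finite \<Rightarrow> 'x \<Rightarrow> real" and b :: "'x \<Rightarrow> real" and sp :: 'x
  assumes w_sym: "w a c = w c a" and w_nn: "0 \<le> w a c" and b_pos: "0 < b a" and w_sp: "0 < w a sp"
begin

lemma w_sp': "0 < w sp a" using w_sp[of a] w_sym[of a sp] by simp

lemma Fm_nn: "(\<And>v s. v \<in> lev T (Suc t) \<Longrightarrow> 0 \<le> m v s) \<Longrightarrow> 0 \<le> Fm w b T t m \<omega>"
  unfolding Fm_def
  by (intro mult_nonneg_nonneg prod_nonneg sum_nonneg ballI) (auto simp: w_nn less_imp_le[OF b_pos])

lemma sum_w_sp_pos: "(\<And>s. 0 \<le> f s) \<Longrightarrow> \<exists>s. 0 < f s \<Longrightarrow> 0 < (\<Sum>s\<in>UNIV. w sp s * f s)"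
  by (metis (no_types, lifting) finite UNIV_I mult_nonneg_nonneg mult_pos_pos sum_pos2 w_nn w_sp')

text \<open>With the permissive spin on the whole ball no edge inside is forbidden, and at the
  boundary it is compatible with whichever spin carries mass in the message.\<close>

lemma Fm_sp_pos:
  assumes "utree T" "\<And>v s. v \<in> lev T (Suc t) \<Longrightarrow> 0 \<le> m v s" "\<And>v. v \<in> lev T (Suc t) \<Longrightarrow> \<exists>s. 0 < m v s"
    and "\<And>v. v \<in> tball T t \<Longrightarrow> \<omega> v = sp"
  shows "0 < Fm w b T t m \<omega>"
proof -
  have bl: "v \<in> T \<Longrightarrow> butlast v \<in> T" for v using utree_butlast[OF assms(1)] .
  show ?thesis unfolding Fm_def
  proof (intro mult_pos_pos prod_pos)
    fix v assume v: "v \<in> lev T (Suc t)"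
    then have "\<omega> (butlast v) = sp" using bl by (intro assms(4)) (auto simp: lev_def tball_def)
    then show "0 < (\<Sum>s\<in>UNIV. w (\<omega> (butlast v)) s * m v s)"
      using sum_w_sp_pos assms(2,3)[OF v] by simp
  qed (auto simp: b_pos assms(4) w_sp)
qed

lemma Zm_pos:
  assumes "utree T" "\<And>v s. v \<in> lev T (Suc t) \<Longrightarrow> 0 \<le> m v s" "\<And>v. v \<in> lev T (Suc t) \<Longrightarrow> \<exists>s. 0 < m v s"
  shows "0 < Zm w b T t m"
proof -
  let ?\<omega> = "restrict (\<lambda>_. sp) (tball T t)"
  have "0 < Fm w b T t m ?\<omega>" by (rule Fm_sp_pos[OF assms]) auto
  moreover have "?\<omega> \<in> conf T t" by (auto simp: conf_def)
  ultimately show ?thesis unfolding Zm_def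
    by (intro sum_pos2[OF finite_conf[OF assms(1)]] Fm_nn[OF assms(2)]) auto
qed

text \<open>The recursion is required at depths 1 to n only, and only up to positive factors; at
  depth n + 1 the messages are free. Hence solutions of the recursion, truncated iterations and
  fixed boundary conditions all produce systems.\<close>

lemma dsys_gq:
  assumes T: "utree T"
    and nn: "\<And>v s. v \<in> T \<Longrightarrow> v \<noteq> [] \<Longrightarrow> length v \<le> Suc n \<Longrightarrow> 0 \<le> m v s"
    and ex: "\<And>v. v \<in> T \<Longrightarrow> v \<noteq> [] \<Longrightarrow> length v \<le> Suc n \<Longrightarrow> \<exists>s. 0 < m v s"
    and bp: "\<And>v. v \<in> T \<Longrightarrow> v \<noteq> [] \<Longrightarrow> length v \<le> n \<Longrightarrow> \<exists>c>0. \<forall>s. m v s = c * BP w b T m v s"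
  shows "dsys w b T n (gq w b T m)" "t \<le> n \<Longrightarrow> \<omega> \<in> conf T t \<Longrightarrow> gq w b T m (t, \<omega>) = Fm w b T t m \<omega> / Zm w b T t m"
proof -
  have nn': "0 \<le> m v s" if "v \<in> lev T (Suc t)" "t \<le> n" for v s t using that nn[of v] by (cases v) (auto simp: lev_def)
  have ex': "\<exists>s. 0 < m v s" if "v \<in> lev T (Suc t)" "t \<le> n" for v t using that ex[of v] by (cases v) (auto simp: lev_def)
  have Zp: "0 < Zm w b T t m" if "t \<le> n" for t by (rule Zm_pos[OF T nn' ex']) (use that in auto)
  have Fn: "0 \<le> Fm w b T t m \<omega>" if "t \<le> n" for t \<omega> by (rule Fm_nn[OF nn']) (use that in auto)
  have val: "gq w b T m (t, \<omega>) = Fm w b T t m \<omega> / Zm w b T t m" if "t \<le> n" "\<omega> \<in> conf T t" for t \<omega>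
    using that Zp Fn by (auto simp: gq_def)
  then show "t \<le> n \<Longrightarrow> \<omega> \<in> conf T t \<Longrightarrow> gq w b T m (t, \<omega>) = Fm w b T t m \<omega> / Zm w b T t m" .
  obtain c where c: "c v > 0" "m v s = c v * BP w b T m v s" if "v \<in> T" "v \<noteq> []" "length v \<le> n" for v s
    using bp by metis
  have peel: "Fm w b T t m \<omega> = (\<Prod>v\<in>lev T (Suc t). c v) *
    (\<Sum>\<zeta>\<in>PiE (lev T (Suc t)) (\<lambda>_. UNIV). Fm w b T (Suc t) m (glue (tball T t) \<omega> \<zeta>))" if "t < n" for t \<omega>
    proof (rule Fm_peel[OF T])
    show "m v s = c v * BP w b T m v s" if "v \<in> lev T (Suc t)" for v s
      by (rule c(2)) (use that \<open>t < n\<close> in \<open>auto simp: lev_def\<close>)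
  qed
  have cp: "0 < (\<Prod>v\<in>lev T (Suc t). c v)" if "t < n" for t
    proof (rule prod_pos)
    show "0 < c v" if "v \<in> lev T (Suc t)" for v
      by (rule c(1)) (use that \<open>t < n\<close> in \<open>auto simp: lev_def\<close>)
  qed
  \<comment> \<open>The partition sum loses the same factor as each weight, so the factor cancels in
    the normalised marginals.\<close>
  have Zpeel: "Zm w b T t m = (\<Prod>v\<in>lev T (Suc t). c v) * Zm w b T (Suc t) m" if "t < n" for t
    unfolding Zm_def sum_conf_Suc sum_distrib_left
    by (intro sum.cong refl) (simp add: peel[OF that] sum_distrib_left)
  show "dsys w b T n (gq w b T m)"
    unfolding dsys_def
  proof (intro conjI allI impI ballI)
    fix c show "0 \<le> gq w b T m c" by (auto simp: gq_def)
    show "gq w b T m c \<le> 1"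
    proof (cases "snd c \<in> conf T (fst c) \<and> Zm w b T (fst c) m > 0 \<and> (\<forall>\<omega>\<in>conf T (fst c). Fm w b T (fst c) m \<omega> \<ge> 0)")
      case True
      then have "Fm w b T (fst c) m (snd c) \<le> Zm w b T (fst c) m"
        unfolding Zm_def by (intro member_le_sum) (auto simp: finite_conf[OF T])
      then show ?thesis using True by (auto simp: gq_def divide_simps)
    qed (auto simp: gq_def)
  next
    have "(\<Sum>\<omega>\<in>conf T 0. gq w b T m (0, \<omega>)) = (\<Sum>\<omega>\<in>conf T 0. Fm w b T 0 m \<omega> / Zm w b T 0 m)"
      by (intro sum.cong refl) (simp add: val)
    also have "\<dots> = 1" using Zp[of 0] by (simp add: sum_divide_distrib[symmetric] Zm_def[symmetric])
    finally show "(\<Sum>\<omega>\<in>conf T 0. gq w b T m (0, \<omega>)) = 1" .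
  next
    fix t and \<omega> :: "nat list \<Rightarrow> 'x" assume t: "t < n" and \<omega>: "\<omega> \<in> conf T t"
    have "(\<Sum>\<zeta>\<in>PiE (lev T (Suc t)) (\<lambda>_. UNIV). gq w b T m (Suc t, glue (tball T t) \<omega> \<zeta>))
      = (\<Sum>\<zeta>\<in>PiE (lev T (Suc t)) (\<lambda>_. UNIV). Fm w b T (Suc t) m (glue (tball T t) \<omega> \<zeta>) / Zm w b T (Suc t) m)"
      using t by (intro sum.cong refl) (simp add: val glue_conf[OF \<omega>])
    then show "gq w b T m (t, \<omega>) = (\<Sum>\<zeta>\<in>PiE (lev T (Suc t)) (\<lambda>_. UNIV). gq w b T m (Suc t, glue (tball T t) \<omega> \<zeta>))"
      using t \<omega> cp[OF t] by (simp add: val Zpeel[OF t] peel[OF t] sum_divide_distrib[symmetric])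
  next
    fix t U and \<omega> \<omega>' :: "nat list \<Rightarrow> 'x"
    assume "t \<le> n" "U \<subseteq> tball T t \<and> (\<forall>u\<in>U. nbrs T u \<subseteq> tball T t)" "\<omega> \<in> conf T t" "\<omega>' \<in> conf T t" "\<forall>v. v \<notin> U \<longrightarrow> \<omega> v = \<omega>' v"
    then show "gq w b T m (t, \<omega>) * lw w b T U \<omega>' = gq w b T m (t, \<omega>') * lw w b T U \<omega>"
      using Fm_factor[OF T, of U t \<omega> \<omega>' w b m] by (simp add: val)
  qed
qed

end

section \<open>Gibbs measures from consistent marginals\<close>

lemma dsys_ratio:
  assumes d: "dsys w b T n q" and "t \<le> n" "U \<subseteq> tball T t" "\<And>u. u \<in> U \<Longrightarrow> nbrs T u \<subseteq> tball T t"
    "\<omega> \<in> conf T t" "\<omega>' \<in> conf T t" "\<And>v. v \<notin> U \<Longrightarrow> \<omega> v = \<omega>' v"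
  shows "q (t, \<omega>) * lw w b T U \<omega>' = q (t, \<omega>') * lw w b T U \<omega>"
proof -
  have "\<forall>t\<le>n. \<forall>U. U \<subseteq> tball T t \<and> (\<forall>u\<in>U. nbrs T u \<subseteq> tball T t) \<longrightarrow>
        (\<forall>\<omega>\<in>conf T t. \<forall>\<omega>'\<in>conf T t. (\<forall>v. v \<notin> U \<longrightarrow> \<omega> v = \<omega>' v) \<longrightarrow>
           q (t, \<omega>) * lw w b T U \<omega>' = q (t, \<omega>') * lw w b T U \<omega>)"
    using d unfolding dsys_def by (elim conjE)
  from this[rule_format, OF assms(2) _ assms(5,6)] show ?thesis using assms(3,4,7) by simp
qed

context
  fixes T :: "nat list set" and q :: "nat \<times> (nat list \<Rightarrow> 'x::finite) \<Rightarrow> real" and w :: "'x \<Rightarrow> 'x \<Rightarrow> real" and b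
  assumes T: "utree T" and q: "\<And>n. dsys w b T n q"
begin

private definition Qp :: "nat \<Rightarrow> (nat list \<Rightarrow> 'x) pmf" where
  "Qp t = embed_pmf (\<lambda>\<omega>. if \<omega> \<in> conf T t then q (t, \<omega>) else 0)"

private lemma q_nn: "0 \<le> q c" using q[of 0] by (cases c) (auto simp: dsys_def)

private lemma pmf_Qp: "pmf (Qp t) \<omega> = (if \<omega> \<in> conf T t then q (t, \<omega>) else 0)"
  unfolding Qp_def
proof (rule pmf_embed_pmf)
  let ?f = "\<lambda>\<omega>. if \<omega> \<in> conf T t then q (t, \<omega>) else 0"
  have "(\<integral>\<^sup>+ x. ennreal (?f x) \<partial>count_space UNIV) = (\<Sum>\<omega>\<in>conf T t. ennreal (?f \<omega>))"
    by (rule nn_integral_count_space') (auto simp: finite_conf[OF T])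
  also have "\<dots> = ennreal (\<Sum>\<omega>\<in>conf T t. q (t, \<omega>))" by (simp add: sum_ennreal q_nn)
  also have "\<dots> = 1" using dsys_sum[OF q[of t]] by simp
  finally show "(\<integral>\<^sup>+ x. ennreal (?f x) \<partial>count_space UNIV) = 1" .
qed (auto simp: q_nn)

private lemma prob_Qp: "measure (measure_pmf (Qp t)) A = (\<Sum>\<omega>\<in>conf T t. if \<omega> \<in> A then q (t, \<omega>) else 0)"
proof -
  have s: "set_pmf (Qp t) \<subseteq> conf T t" by (auto simp: set_pmf_iff pmf_Qp split: if_splits)
  have "measure (measure_pmf (Qp t)) A = measure (measure_pmf (Qp t)) (A \<inter> conf T t)"
    by (rule measure_pmf.finite_measure_eq_AE) (use s in \<open>auto intro!: AE_pmfI\<close>)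
  also have "\<dots> = (\<Sum>\<omega>\<in>A \<inter> conf T t. pmf (Qp t) \<omega>)"
    by (rule measure_measure_pmf_finite) (auto simp: finite_conf[OF T])
  also have "\<dots> = (\<Sum>\<omega>\<in>conf T t. if \<omega> \<in> A then q (t, \<omega>) else 0)"
    by (rule sum.mono_neutral_cong_left) (auto simp: finite_conf[OF T] pmf_Qp)
  finally show ?thesis .
qed

private lemma restrict_glue: "\<sigma> \<in> conf T t \<Longrightarrow> restrict (glue (tball T t) \<sigma> \<zeta>) (tball T t) = \<sigma>"
  by (auto simp: conf_def glue_def restrict_def fun_eq_iff PiE_iff extensional_def)

private lemma map_Qp_Suc: "map_pmf (\<lambda>\<omega>. restrict \<omega> (tball T t)) (Qp (Suc t)) = Qp t"
proof (rule pmf_eqI)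
  fix \<omega> :: "nat list \<Rightarrow> 'x"
  let ?r = "\<lambda>\<omega>. restrict \<omega> (tball T t)"
  have "pmf (map_pmf ?r (Qp (Suc t))) \<omega> = (\<Sum>\<sigma>\<in>conf T (Suc t). if ?r \<sigma> = \<omega> then q (Suc t, \<sigma>) else 0)"
    by (simp add: pmf_map prob_Qp)
  also have "\<dots> = (\<Sum>\<sigma>\<in>conf T t. if \<sigma> = \<omega> then (\<Sum>\<zeta>\<in>PiE (lev T (Suc t)) (\<lambda>_. UNIV). q (Suc t, glue (tball T t) \<sigma> \<zeta>)) else 0)"
    unfolding sum_conf_Suc by (intro sum.cong refl) (auto simp: restrict_glue)
  also have "\<dots> = (\<Sum>\<sigma>\<in>conf T t. if \<sigma> = \<omega> then q (t, \<sigma>) else 0)"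
    using q[of "Suc t"] by (intro sum.cong refl) (auto simp: dsys_def)
  also have "\<dots> = pmf (Qp t) \<omega>" by (simp add: pmf_Qp finite_conf[OF T])
  finally show "pmf (map_pmf ?r (Qp (Suc t))) \<omega> = pmf (Qp t) \<omega>" .
qed

private lemma map_Qp: "t \<le> u \<Longrightarrow> map_pmf (\<lambda>\<omega>. restrict \<omega> (tball T t)) (Qp u) = Qp t"
proof (induction u)
  case 0
  then show ?case using map_Qp_Suc[of 0] by (subst map_Qp_Suc[symmetric], subst map_pmf_comp, simp)
next
  case (Suc u)
  show ?case
  proof (cases "t = Suc u")
    case True
    then show ?thesis by (subst (1 2) map_Qp_Suc[symmetric]) (simp add: map_pmf_comp)
  next
    case False
    then have "t \<le> u" using Suc by simp
    moreover have "restrict (restrict \<omega> (tball T u)) (tball T t) = restrict \<omega> (tball T t)" for \<omega> :: "nat list \<Rightarrow> 'x"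
      using tball_mono[OF \<open>t \<le> u\<close>, of T] by (auto simp: restrict_def fun_eq_iff)
    ultimately show ?thesis using Suc.IH map_Qp_Suc[of u, symmetric] by (simp add: map_pmf_comp del: restrict_restrict restrict_apply)
  qed
qed

section \<open>Kolmogorov extension of the ball marginals\<close>

private abbreviation "M \<equiv> (\<lambda>_::nat list. count_space (UNIV :: 'x set))"

text \<open>The sum of the lengths is an explicit radius whose ball contains J; any other such
  radius gives the same law.\<close>

private definition PJ :: "nat list set \<Rightarrow> (nat list \<Rightarrow> 'x) measure" where
  "PJ J = distr (measure_pmf (Qp (\<Sum>v\<in>J. length v))) (PiM J M) (\<lambda>\<omega>. restrict \<omega> J)"

private lemma PJ_eq:
  assumes J: "J \<subseteq> tball T t"
  shows "PJ J = distr (measure_pmf (Qp t)) (PiM J M) (\<lambda>\<omega>. restrict \<omega> J)"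
proof -
  have fin: "finite J" using J finite_tball[OF T] finite_subset by blast
  have m: "(\<lambda>\<omega>. restrict \<omega> J) \<in> measure_pmf p \<rightarrow>\<^sub>M PiM J M" for p :: "(nat list \<Rightarrow> 'x) pmf"
    by (auto simp: measurable_def space_PiM)
  have *: "distr (measure_pmf (Qp u)) (PiM J M) (\<lambda>\<omega>. restrict \<omega> J) = distr (measure_pmf (Qp t)) (PiM J M) (\<lambda>\<omega>. restrict \<omega> J)"
    if "t \<le> u" "J \<subseteq> tball T t" for t u
  proof -
    have r: "restrict (restrict \<omega> (tball T t)) J = restrict \<omega> J" for \<omega> :: "nat list \<Rightarrow> 'x"
      using that by (auto simp: restrict_def fun_eq_iff)
    have "distr (measure_pmf (Qp t)) (PiM J M) (\<lambda>\<omega>. restrict \<omega> J)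
      = distr (distr (measure_pmf (Qp u)) (count_space UNIV) (\<lambda>\<omega>. restrict \<omega> (tball T t))) (PiM J M) (\<lambda>\<omega>. restrict \<omega> J)"
      by (simp add: map_Qp[OF that(1), symmetric] map_pmf_rep_eq)
    also have "\<dots> = distr (measure_pmf (Qp u)) (PiM J M) (\<lambda>\<omega>. restrict \<omega> J)"
      by (subst distr_distr) (auto simp: o_def r space_PiM simp del: restrict_restrict)
    finally show ?thesis by simp
  qed
  have J2: "J \<subseteq> tball T (\<Sum>v\<in>J. length v)"
    using J fin by (auto simp: tball_def intro!: member_le_sum)
  show ?thesis
    unfolding PJ_def using *[of t "\<Sum>v\<in>J. length v"] *[of "\<Sum>v\<in>J. length v" t] J J2
    by (cases "t \<le> (\<Sum>v\<in>J. length v)") auto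
qed

private lemma J_tball: "finite J \<Longrightarrow> J \<subseteq> T \<Longrightarrow> J \<subseteq> tball T (\<Sum>v\<in>J. length v)"
  by (auto simp: tball_def intro!: member_le_sum)

private lemma fam: "projective_family T PJ M"
  unfolding projective_family_def
proof (intro conjI allI impI)
  fix J H :: "nat list set" assume a: "J \<subseteq> H" "finite H" "H \<subseteq> T"
  let ?t = "\<Sum>v\<in>H. length v"
  have H: "H \<subseteq> tball T ?t" using J_tball a by blast
  then have J: "J \<subseteq> tball T ?t" using a by blast
  have r: "restrict (restrict \<omega> H) J = restrict \<omega> J" for \<omega> :: "nat list \<Rightarrow> 'x"
    using a by (auto simp: restrict_def fun_eq_iff)
  show "PJ J = distr (PJ H) (PiM J M) (\<lambda>f. restrict f J)"
    unfolding PJ_eq[OF J] PJ_eq[OF H]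
    by (subst distr_distr) (use a in \<open>auto simp: o_def r space_PiM simp del: restrict_restrict intro!: measurable_restrict_subset\<close>)
next
  fix J :: "nat list set" assume "finite J" "J \<subseteq> T"
  then show "prob_space (PJ J)" unfolding PJ_def
    by (intro measure_pmf.prob_space_distr) (auto simp: space_PiM)
qed

interpretation projective_family T PJ M by (rule fam)

text \<open>A cylinder over finitely many coordinates is a finite union of boxes whose factors are
  singletons or full, and in the discrete topology each such box is closed. This is the input for
  the compactness step of the extension.\<close>

private lemma emb_closed:
  assumes "finite J" "J \<subseteq> T" "X \<subseteq> PiE J (\<lambda>_. UNIV)"
  shows "closedin (product_topology (\<lambda>_. discrete_topology UNIV) T) (emb T J X)"
proof -
  have fX: "finite X" by (rule finite_subset[OF assms(3)]) (intro finite_PiE, use assms in auto)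
  have "emb T J X = (\<Union>\<omega>\<in>X. PiE T (\<lambda>v. if v \<in> J then {\<omega> v} else UNIV))"
  proof (intro equalityI subsetI)
    fix \<eta> assume "\<eta> \<in> emb T J X"
    then have e: "restrict \<eta> J \<in> X" "\<eta> \<in> PiE T (\<lambda>_. UNIV)" by (auto simp: prod_emb_def)
    then have "\<eta> \<in> PiE T (\<lambda>v. if v \<in> J then {restrict \<eta> J v} else UNIV)" by (auto simp: PiE_iff)
    then show "\<eta> \<in> (\<Union>\<omega>\<in>X. PiE T (\<lambda>v. if v \<in> J then {\<omega> v} else UNIV))" using e(1) by blast
  next
    fix \<eta> assume "\<eta> \<in> (\<Union>\<omega>\<in>X. PiE T (\<lambda>v. if v \<in> J then {\<omega> v} else UNIV))"
    then obtain \<omega> where \<omega>: "\<omega> \<in> X" "\<eta> \<in> PiE T (\<lambda>v. if v \<in> J then {\<omega> v} else UNIV)" by blast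
    have "\<eta> v = \<omega> v" if "v \<in> J" for v using \<omega>(2) that assms(2) by (auto simp: PiE_iff split: if_splits)
    then have "restrict \<eta> J = \<omega>"
      using assms(3) \<omega>(1) by (auto simp: fun_eq_iff restrict_def PiE_iff extensional_def)
    then show "\<eta> \<in> emb T J X" using \<omega> by (auto simp: prod_emb_def PiE_iff)
  qed
  then show ?thesis
    using fX by (auto intro!: closedin_Union simp: closedin_product_topology)
qed

private definition \<nu> :: "(nat list \<Rightarrow> 'x) measure" where "\<nu> = lim"

private lemma sets_\<nu>: "sets \<nu> = sets (cfgM T)"
  by (simp add: \<nu>_def cfgM_def)

private lemma emeasure_\<nu>:
  assumes "finite J" "J \<subseteq> T" "X \<subseteq> PiE J (\<lambda>_. UNIV)"
  shows "emeasure \<nu> (emb T J X) = emeasure (PJ J) X"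
proof -
  have S: "sets (PiM J M) = Pow (PiE J (\<lambda>_. UNIV))" if "finite J" for J
    using count_space_PiM_finite[of J "\<lambda>_. UNIV :: 'x set"] that by simp
  show ?thesis unfolding \<nu>_def
  proof (rule emeasure_lim)
    fix J :: "nat \<Rightarrow> nat list set" and X :: "nat \<Rightarrow> (nat list \<Rightarrow> 'x) set"
    assume J: "\<And>i. J i \<subseteq> T" "\<And>i. finite (J i)" and X: "\<And>i. X i \<in> sets (PiM (J i) M)"
      and dec: "decseq (\<lambda>i. emb T (J i) (X i))" and pos: "0 < (INF i. emeasure (PJ (J i)) (X i))"
    \<comment> \<open>Tychonoff: the configuration space is compact because there are finitely many
      spins, so decreasing nonempty closed cylinders have a common point. This is continuity at the
      empty set of the measure on cylinders.\<close>
    show "(\<Inter>i. emb T (J i) (X i)) \<noteq> {}"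
    proof (rule compact_space_imp_nest[of "product_topology (\<lambda>_. discrete_topology UNIV) T"])
      show "compact_space (product_topology (\<lambda>_. discrete_topology (UNIV::'x set)) T)"
        by (simp add: compact_space_product_topology compact_space_discrete_topology)
      show "closedin (product_topology (\<lambda>_. discrete_topology UNIV) T) (emb T (J i) (X i))" for i
        by (rule emb_closed) (use J X S in auto)
      show "emb T (J i) (X i) \<noteq> {}" for i
      proof
        assume e: "emb T (J i) (X i) = {}"
        \<comment> \<open>Any element of the base extends to the whole tree, so an empty cylinder
          has an empty base; its measure would be 0, against \<open>pos\<close>.\<close>
        have "X i = {}"
        proof (rule ccontr)
          assume "X i \<noteq> {}"
          then obtain \<omega> where \<omega>: "\<omega> \<in> X i" by blast
          then have w2: "\<omega> \<in> PiE (J i) (\<lambda>_. UNIV)" using S[OF J(2)] X by blast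
          have "restrict (restrict \<omega> T) (J i) = \<omega>"
            using w2 J(1)[of i] by (auto simp: restrict_def fun_eq_iff PiE_iff extensional_def)
          then have "restrict \<omega> T \<in> emb T (J i) (X i)" using \<omega> by (auto simp: prod_emb_def)
          then show False using e by simp
        qed
        then have "(INF i. emeasure (PJ (J i)) (X i)) \<le> 0" by (intro INF_lower2[of i]) auto
        then show False using pos by simp
      qed
    qed (use dec in simp)
  qed (use assms S in auto)
qed

private lemma prob_\<nu>: "prob_space \<nu>"
proof
  have "emeasure \<nu> (emb T {} {\<lambda>_. undefined}) = emeasure (PJ {}) {\<lambda>_. undefined}"
    by (rule emeasure_\<nu>) auto
  also have "\<dots> = emeasure (PJ {}) (space (PJ {}))" by (simp add: PJ_def space_PiM)
  also have "\<dots> = 1" using prob_space_P[of "{}"] by (simp add: prob_space.emeasure_space_1)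
  also have "emb T {} {\<lambda>_. undefined} = space \<nu>"
    using sets_eq_imp_space_eq[OF sets_\<nu>] by (auto simp: prod_emb_def cfgM_def space_PiM restrict_def)
  finally show "emeasure \<nu> (space \<nu>) = 1" .
qed

interpretation nu: prob_space \<nu> by (rule prob_\<nu>)

private lemma space_\<nu>: "space \<nu> = PiE T (\<lambda>_. UNIV)"
  using sets_eq_imp_space_eq[OF sets_\<nu>] by (simp add: cfgM_def space_PiM)

private lemma coord_\<nu>[measurable]: "v \<in> T \<Longrightarrow> (\<lambda>\<eta>. \<eta> v) \<in> \<nu> \<rightarrow>\<^sub>M count_space UNIV"
  unfolding measurable_cong_sets[OF sets_\<nu> refl] cfgM_def by (rule measurable_component_singleton)

private lemma agree_\<nu>: "finite J \<Longrightarrow> J \<subseteq> T \<Longrightarrow> Measurable.pred \<nu> (\<lambda>\<eta>. \<forall>v\<in>J. \<eta> v = \<omega> v)"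
proof (rule pred_intros_finite(3))
  fix v assume "v \<in> J" "J \<subseteq> T"
  then have [measurable]: "(\<lambda>\<eta>. \<eta> v) \<in> \<nu> \<rightarrow>\<^sub>M count_space UNIV" by (intro coord_\<nu>) auto
  show "Measurable.pred \<nu> (\<lambda>\<eta>. \<eta> v = \<omega> v)" by measurable
qed

private lemma prob_cyl:
  assumes J: "J \<subseteq> tball T t"
  shows "measure \<nu> {\<eta> \<in> space \<nu>. \<forall>v\<in>J. \<eta> v = \<omega> v} = (\<Sum>\<sigma>\<in>conf T t. if \<forall>v\<in>J. \<sigma> v = \<omega> v then q (t, \<sigma>) else 0)"
proof -
  have fin: "finite J" using J finite_tball[OF T] finite_subset by blast
  have JT: "J \<subseteq> T" using J by (auto simp: tball_def)
  have m: "(\<lambda>\<omega>. restrict \<omega> J) \<in> measure_pmf p \<rightarrow>\<^sub>M PiM J M" for p :: "(nat list \<Rightarrow> 'x) pmf"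
    by (auto simp: measurable_def space_PiM)
  have sing: "{restrict \<omega> J} \<in> sets (PiM J M)" 
    using count_space_PiM_finite[of J "\<lambda>_. UNIV :: 'x set"] fin by simp
  have r: "restrict \<sigma> J = restrict \<omega> J \<longleftrightarrow> (\<forall>v\<in>J. \<sigma> v = \<omega> v)" for \<sigma>
    by (metis restrict_apply' restrict_ext)
  have "{\<eta> \<in> space \<nu>. \<forall>v\<in>J. \<eta> v = \<omega> v} = emb T J {restrict \<omega> J}"
    by (auto simp: space_\<nu> prod_emb_def r)
  moreover have "(\<lambda>\<omega>. restrict \<omega> J) -` {restrict \<omega> J} = {\<sigma>. \<forall>v\<in>J. \<sigma> v = \<omega> v}"
    by (auto simp: r)
  ultimately have "emeasure \<nu> {\<eta> \<in> space \<nu>. \<forall>v\<in>J. \<eta> v = \<omega> v} = emeasure (measure_pmf (Qp t)) {\<sigma>. \<forall>v\<in>J. \<sigma> v = \<omega> v}"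
    using emeasure_\<nu>[OF fin JT, of "{restrict \<omega> J}"] by (simp add: PJ_eq[OF J] emeasure_distr[OF m sing])
  then have "measure \<nu> {\<eta> \<in> space \<nu>. \<forall>v\<in>J. \<eta> v = \<omega> v} = measure (measure_pmf (Qp t)) {\<sigma>. \<forall>v\<in>J. \<sigma> v = \<omega> v}"
    by (simp add: measure_def)
  then show ?thesis by (simp add: prob_Qp)
qed

private lemma prob_cyl_glue:
  assumes U: "U \<subseteq> tball T t" and \<tau>: "\<tau> \<in> PiE U (\<lambda>_. UNIV)" and \<omega>: "\<omega> \<in> conf T t"
  shows "measure \<nu> {\<eta> \<in> space \<nu>. (\<forall>v\<in>tball T t - U. \<eta> v = \<omega> v) \<and> (\<forall>v\<in>U. \<eta> v = \<tau> v)} = q (t, glue U \<tau> \<omega>)"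
proof -
  have g: "glue U \<tau> \<omega> \<in> conf T t" using U \<omega> by (auto simp: conf_def glue_def PiE_iff extensional_def)
  have "{\<eta> \<in> space \<nu>. (\<forall>v\<in>tball T t - U. \<eta> v = \<omega> v) \<and> (\<forall>v\<in>U. \<eta> v = \<tau> v)}
    = {\<eta> \<in> space \<nu>. \<forall>v\<in>tball T t. \<eta> v = glue U \<tau> \<omega> v}"
    using U by (auto simp: glue_def)
  moreover have "(\<forall>v\<in>tball T t. \<sigma> v = glue U \<tau> \<omega> v) \<longleftrightarrow> \<sigma> = glue U \<tau> \<omega>" if "\<sigma> \<in> conf T t" for \<sigma>
    using that g by (auto simp: conf_def intro: PiE_ext)
  ultimately show ?thesis
    using g by (simp add: prob_cyl[of "tball T t" t "glue U \<tau> \<omega>"] finite_conf[OF T] cong: if_cong sum.cong)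
qed

private lemma prob_cyl_out:
  assumes U: "U \<subseteq> tball T t" and \<omega>: "\<omega> \<in> conf T t"
  shows "measure \<nu> {\<eta> \<in> space \<nu>. \<forall>v\<in>tball T t - U. \<eta> v = \<omega> v} = (\<Sum>\<tau>\<in>PiE U (\<lambda>_. UNIV). q (t, glue U \<tau> \<omega>))"
proof -
  have eq: "{\<eta> \<in> space \<nu>. \<forall>v\<in>tball T t - U. \<eta> v = \<omega> v} = (\<Union>\<tau>\<in>PiE U (\<lambda>_. UNIV). {\<eta> \<in> space \<nu>. (\<forall>v\<in>tball T t - U. \<eta> v = \<omega> v) \<and> (\<forall>v\<in>U. \<eta> v = \<tau> v)})" (is "_ = (\<Union>\<tau>\<in>_. ?A \<tau>)")
  proof (intro equalityI subsetI)
    fix \<eta> assume "\<eta> \<in> {\<eta> \<in> space \<nu>. \<forall>v\<in>tball T t - U. \<eta> v = \<omega> v}"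
    then have "\<eta> \<in> ?A (restrict \<eta> U)" by auto
    then show "\<eta> \<in> (\<Union>\<tau>\<in>PiE U (\<lambda>_. UNIV). ?A \<tau>)" by (intro UN_I[of "restrict \<eta> U"]) auto
  qed auto
  have fU: "finite U" using U finite_tball[OF T] finite_subset by blast
  have "measure \<nu> (\<Union>\<tau>\<in>PiE U (\<lambda>_. UNIV). ?A \<tau>) = (\<Sum>\<tau>\<in>PiE U (\<lambda>_. UNIV). measure \<nu> (?A \<tau>))"
  proof (rule measure_finite_Union)
    have fin: "finite (tball T t - U)" using finite_tball[OF T] by auto
    have UT: "U \<subseteq> T" using U by (auto simp: tball_def)
    show "?A ` PiE U (\<lambda>_. UNIV) \<subseteq> sets \<nu>"
    proof clarify
      fix \<tau> :: "nat list \<Rightarrow> 'x"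
      have [measurable]: "Measurable.pred \<nu> (\<lambda>\<eta>. \<forall>v\<in>tball T t - U. \<eta> v = \<omega> v)"
        by (rule agree_\<nu>[OF fin]) (auto simp: tball_def)
      have [measurable]: "Measurable.pred \<nu> (\<lambda>\<eta>. \<forall>v\<in>U. \<eta> v = \<tau> v)"
        by (rule agree_\<nu>[OF fU UT])
      show "?A \<tau> \<in> sets \<nu>" by measurable
    qed
    show "disjoint_family_on ?A (PiE U (\<lambda>_. UNIV))"
      unfolding disjoint_family_on_def
    proof (intro ballI impI)
      fix \<tau> \<tau>' :: "nat list \<Rightarrow> 'x" assume "\<tau> \<in> PiE U (\<lambda>_. UNIV)" "\<tau>' \<in> PiE U (\<lambda>_. UNIV)" "\<tau> \<noteq> \<tau>'"
      then obtain v where "v \<in> U" "\<tau> v \<noteq> \<tau>' v" by (metis PiE_ext)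
      then show "?A \<tau> \<inter> ?A \<tau>' = {}" by force
    qed
  qed (use fU in \<open>auto intro!: finite_PiE\<close>)
  then show ?thesis unfolding eq by (simp add: prob_cyl_glue[OF U _ \<omega>])
qed

section \<open>Events outside a finite set and the DLR equations\<close>

private definition Gs :: "nat list set \<Rightarrow> nat \<Rightarrow> (nat list \<Rightarrow> 'x) \<Rightarrow> (nat list \<Rightarrow> 'x) set" where
  "Gs U t \<omega> = {\<eta> \<in> space \<nu>. \<forall>v\<in>tball T t - U. \<eta> v = \<omega> v}"

private lemma space_outside: "space (outsideM T U :: (nat list \<Rightarrow> 'x) measure) = space \<nu>"
  using sets_eq_imp_space_eq[OF sets_\<nu>] by (auto simp: outsideM_def simp: space_measure_of_conv)

private lemma coord_outside[measurable]: 
  "v \<in> T - U \<Longrightarrow> (\<lambda>\<eta>. \<eta> v) \<in> (outsideM T U :: (nat list \<Rightarrow> 'x) measure) \<rightarrow>\<^sub>M count_space UNIV"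
proof (rule measurable_count_space_eq2[THEN iffD2], simp, intro conjI ballI)
  fix a :: 'x assume v: "v \<in> T - U"
  have "{\<eta> \<in> space (cfgM T). \<eta> v = a} \<in> sets (outsideM T U)"
    unfolding outsideM_def using v by (intro in_measure_of) auto
  moreover have "space (outsideM T U :: (nat list \<Rightarrow> 'x) measure) = space (cfgM T)" 
    by (auto simp: outsideM_def simp: space_measure_of_conv)
  ultimately show "(\<lambda>\<eta>. \<eta> v) -` {a} \<inter> space (outsideM T U) \<in> sets (outsideM T U :: (nat list \<Rightarrow> 'x) measure)"
    by (simp add: vimage_def Int_def conj_commute)
qed auto

private lemma Gs_outside: "Gs U t \<omega> \<in> sets (outsideM T U)"
proof -
  have fin: "finite (tball T t - U)" using finite_tball[OF T] by auto
  have "Measurable.pred (outsideM T U) (\<lambda>\<eta>. \<forall>v\<in>tball T t - U. \<eta> v = \<omega> v)"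
  proof (rule pred_intros_finite(3)[OF fin])
    fix v assume "v \<in> tball T t - U"
    then have [measurable]: "(\<lambda>\<eta>. \<eta> v) \<in> (outsideM T U :: (nat list \<Rightarrow> 'x) measure) \<rightarrow>\<^sub>M count_space UNIV"
      by (intro coord_outside) (auto simp: tball_def)
    show "Measurable.pred (outsideM T U) (\<lambda>\<eta>. \<eta> v = \<omega> v)" by measurable
  qed
  then have "{\<eta> \<in> space (outsideM T U). \<forall>v\<in>tball T t - U. \<eta> v = \<omega> v} \<in> sets (outsideM T U)"
    by measurable
  then show ?thesis by (simp add: Gs_def space_outside)
qed

private lemma outside_sub: "sets (outsideM T U) \<subseteq> sets \<nu>"
  unfolding outsideM_def sets_\<nu>
proof (subst sets_measure_of, blast, rule sets.sigma_sets_subset, safe)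
  fix v a assume "v \<in> T"
  then have "Measurable.pred \<nu> (\<lambda>\<eta>. \<eta> v = a)" by measurable
  then show "{\<eta> \<in> space (cfgM T). \<eta> v = a} \<in> sets (cfgM T)"
    using sets_\<nu> sets_eq_imp_space_eq[OF sets_\<nu>] by (simp add: pred_def)
qed

text \<open>Every coordinate outside U is seen by all large balls, so the cylinders over balls of
  radius at least \<open>t0\<close> already generate; the freedom in \<open>t0\<close> leaves room
  for U and its neighbours inside these balls.\<close>

private lemma outside_gen:
  "sets (outsideM T U) = sigma_sets (space \<nu>) {Gs U t \<omega> | t \<omega>. t0 \<le> t \<and> \<omega> \<in> conf T t}"
proof
  let ?G = "{Gs U t \<omega> | t \<omega>. t0 \<le> t \<and> \<omega> \<in> conf T t}"
  have sp: "space \<nu> = space (cfgM T)" using sets_eq_imp_space_eq[OF sets_\<nu>] .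
  show "sigma_sets (space \<nu>) ?G \<subseteq> sets (outsideM T U)"
    using Gs_outside by (subst space_outside[of U, symmetric], intro sets.sigma_sets_subset) auto
  have "{\<eta> \<in> space (cfgM T). \<eta> v = a} \<in> sigma_sets (space \<nu>) ?G" if v: "v \<in> T - U" for v and a :: 'x
  proof -
    let ?t = "max t0 (length v)"
    have vt: "v \<in> tball T ?t" using v by (auto simp: tball_def)
    have "{\<eta> \<in> space (cfgM T). \<eta> v = a} = (\<Union>\<omega>\<in>{\<omega>\<in>conf T ?t. \<omega> v = a}. Gs U ?t \<omega>)"
    proof (intro equalityI subsetI)
      fix \<eta> assume \<eta>: "\<eta> \<in> {\<eta> \<in> space (cfgM T). \<eta> v = a}"
      then have "\<eta> \<in> Gs U ?t (restrict \<eta> (tball T ?t))" by (auto simp: Gs_def sp)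
      then show "\<eta> \<in> (\<Union>\<omega>\<in>{\<omega>\<in>conf T ?t. \<omega> v = a}. Gs U ?t \<omega>)"
        using \<eta> vt by (intro UN_I[of "restrict \<eta> (tball T ?t)"]) (auto simp: conf_def)
    qed (use v vt in \<open>auto simp: Gs_def sp\<close>)
    also have "\<dots> \<in> sigma_sets (space \<nu>) ?G"
      proof (rule sigma_sets_UNION)
      show "A \<in> sigma_sets (space \<nu>) ?G" if "A \<in> Gs U ?t ` {\<omega>\<in>conf T ?t. \<omega> v = a}" for A
        using that max.cobounded1[of t0 "length v"] by (intro sigma_sets.Basic) blast
    qed (auto intro!: countable_finite finite_imageI simp: finite_conf[OF T])
    finally show ?thesis .
  qed
  then show "sets (outsideM T U) \<subseteq> sigma_sets (space \<nu>) ?G"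
    unfolding outsideM_def
    by (subst sets_measure_of, blast, subst sp[symmetric], intro sigma_sets_mono) auto
qed

text \<open>On nested balls two cylinders are disjoint, or the finer one lies in the coarser one.
  Together with the empty set they form a pi-system.\<close>

private lemma Gs_Int:
  assumes "t \<le> t'"
  shows "Gs U t \<omega> \<inter> Gs U t' \<omega>' = {} \<or> Gs U t \<omega> \<inter> Gs U t' \<omega>' = Gs U t' \<omega>'"
proof (cases "\<forall>v\<in>tball T t - U. \<omega> v = \<omega>' v")
  case True
  then have "Gs U t \<omega> \<inter> Gs U t' \<omega>' = Gs U t' \<omega>'" using tball_mono[OF assms, of T] by (auto simp: Gs_def)
  then show ?thesis by blast
next
  case False
  then obtain v where v: "v \<in> tball T t - U" "\<omega> v \<noteq> \<omega>' v" by blast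
  then have "v \<in> tball T t' - U" using tball_mono[OF assms, of T] by auto
  with v have "Gs U t \<omega> \<inter> Gs U t' \<omega>' = {}" unfolding Gs_def by force
  then show ?thesis by blast
qed

text \<open>The conditional laws of the extended measure are identified by testing the candidate
  ratio on cylinders outside U, where the claim reduces to the ratio equations of
  \<open>dsys\<close> on a single ball.\<close>

lemma exists_gibbs:
  assumes w: "\<And>a c. w a c = \<psi> \<beta> a c" and b: "\<And>a. b a = \<psi>b B a" and spin: "spin w b sp"
  shows "\<exists>\<nu>\<in>gibbs \<psi> \<psi>b \<beta> B T. \<forall>t. \<forall>\<omega>\<in>conf T t.
    measure \<nu> {\<eta> \<in> space (cfgM T). \<forall>v\<in>tball T t. \<eta> v = \<omega> v} = q (t, \<omega>)"
proof (intro bexI allI ballI)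
  have sp: "space \<nu> = space (cfgM T)" using sets_eq_imp_space_eq[OF sets_\<nu>] .
  have w': "w = \<psi> \<beta>" and b': "b = \<psi>b B" using w b by auto
  interpret spin w b sp by (rule spin)
  fix t and \<omega> :: "nat list \<Rightarrow> 'x" assume \<omega>: "\<omega> \<in> conf T t"
  have "{\<eta> \<in> space (cfgM T). \<forall>v\<in>tball T t. \<eta> v = \<omega> v} = Gs {} t \<omega>" by (simp add: Gs_def sp)
  then show "measure \<nu> {\<eta> \<in> space (cfgM T). \<forall>v\<in>tball T t. \<eta> v = \<omega> v} = q (t, \<omega>)"
    using prob_cyl_out[of "{}" t \<omega>] \<omega> by (simp add: Gs_def glue_def[abs_def])
next
  have sp: "space \<nu> = space (cfgM T)" using sets_eq_imp_space_eq[OF sets_\<nu>] .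
  have w': "w = \<psi> \<beta>" and b': "b = \<psi>b B" using w b by auto
  interpret spin w b sp by (rule spin)
  show "\<nu> \<in> gibbs \<psi> \<psi>b \<beta> B T"
    unfolding gibbs_def
  proof (intro CollectI conjI allI impI)
    show "sets \<nu> = sets (cfgM T)" "prob_space \<nu>" by (rule sets_\<nu>, rule prob_\<nu>)
    fix U assume U: "finite U \<and> U \<subseteq> T"
    define W where "W = tedges T U"
    \<comment> \<open>Exceeds every length occurring in U, so that the ball contains U together with
      all its neighbours.\<close>
    define t0 where "t0 = Suc (\<Sum>v\<in>U. length v)"
    have Ut: "U \<subseteq> tball T (\<Sum>v\<in>U. length v)" using J_tball U by blast
    have Ut0: "U \<subseteq> tball T t" if "t0 \<le> t" for t
      using Ut tball_mono[of "\<Sum>v\<in>U. length v" t T] that by (auto simp: t0_def)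
    have nb0: "nbrs T u \<subseteq> tball T t" if "t0 \<le> t" "u \<in> U" for t u
    proof -
      have "length u \<le> (\<Sum>v\<in>U. length v)" using Ut that by (auto simp: tball_def)
      then show ?thesis using that(1) by (auto simp: nbrs_def tadj_def tball_def t0_def)
    qed
    have te: "e \<in> W \<Longrightarrow> fst e \<in> tball T t \<and> snd e \<in> tball T t" if "t0 \<le> t" for e t
    proof -
      assume "e \<in> W"
      then obtain p i where e: "e = (p, p @ [i])" "p @ [i] \<in> T" "p \<in> U \<or> p @ [i] \<in> U"
        by (auto simp: W_def tedges_def)
      have p: "p \<in> T" using utreeD(2)[OF T e(2)] .
      show ?thesis using e(3)
      proof
        assume "p \<in> U" then show ?thesis using nb0[OF that, of p] Ut0[OF that] e by (auto simp: nbrs_def tadj_def)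
      next
        assume "p @ [i] \<in> U" then show ?thesis using nb0[OF that, of "p @ [i]"] Ut0[OF that] e p by (auto simp: nbrs_def tadj_def)
      qed
    qed
    \<comment> \<open>Filling U with the permissive spin has positive weight against any surrounding
      configuration.\<close>
    have Zpos: "0 < Zloc \<psi> \<psi>b \<beta> B T U \<sigma>" for \<sigma>
    proof -
      let ?\<tau> = "restrict (\<lambda>_. sp) U"
      have "0 < lw w b T U (glue U ?\<tau> \<sigma>)" unfolding lw_def
      proof (intro mult_pos_pos prod_pos)
        fix e assume "e \<in> tedges T U"
        then have "fst e \<in> U \<or> snd e \<in> U" by (auto simp: tedges_def)
        then show "0 < w (glue U ?\<tau> \<sigma> (fst e)) (glue U ?\<tau> \<sigma> (snd e))"
          using w_sp w_sp' by (auto simp: glue_def)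
      qed (simp add: b_pos)
      then show ?thesis unfolding Zloc_def wloc_lw w'[symmetric] b'[symmetric]
        by (intro sum_pos2[of _ ?\<tau>]) (auto intro!: finite_PiE simp: U lw_def intro!: mult_nonneg_nonneg prod_nonneg w_nn less_imp_le[OF b_pos])
    qed
    have main: "AE \<sigma> in \<nu>. real_cond_exp \<nu> (outsideM T U)
                 (indicator {\<eta> \<in> space (cfgM T). \<forall>v\<in>U. \<eta> v = \<tau> v} :: (nat list \<Rightarrow> 'x) \<Rightarrow> real) \<sigma>
              = wloc \<psi> \<psi>b \<beta> B T U \<tau> \<sigma> / Zloc \<psi> \<psi>b \<beta> B T U \<sigma>" if \<tau>: "\<tau> \<in> PiE U (\<lambda>_. UNIV)" for \<tau>
    proof -
      let ?F = "outsideM T U :: (nat list \<Rightarrow> 'x) measure"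
      let ?C = "{\<eta> \<in> space (cfgM T). \<forall>v\<in>U. \<eta> v = \<tau> v}"
      let ?g = "\<lambda>\<sigma>. wloc \<psi> \<psi>b \<beta> B T U \<tau> \<sigma> / Zloc \<psi> \<psi>b \<beta> B T U \<sigma>"
      have sub: "subalgebra \<nu> ?F" using outside_sub space_outside by (auto simp: subalgebra_def)
      interpret F: finite_measure_subalgebra \<nu> ?F by standard (rule sub)
      have lw_nn: "0 \<le> wloc \<psi> \<psi>b \<beta> B T U \<tau> \<sigma>" for \<tau> \<sigma>
        unfolding wloc_lw w'[symmetric] b'[symmetric] lw_def
        by (intro mult_nonneg_nonneg prod_nonneg ballI w_nn less_imp_le[OF b_pos])
      have g_nn: "0 \<le> ?g \<sigma>" for \<sigma> using lw_nn Zpos[of \<sigma>] by (simp add: less_imp_le)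
      have g_le: "?g \<sigma> \<le> 1" for \<sigma>
      proof -
        have "wloc \<psi> \<psi>b \<beta> B T U \<tau> \<sigma> \<le> Zloc \<psi> \<psi>b \<beta> B T U \<sigma>"
          unfolding Zloc_def by (rule member_le_sum) (auto simp: \<tau> lw_nn U intro!: finite_PiE)
        then show ?thesis using Zpos[of \<sigma>] by simp
      qed
      have C[measurable]: "?C \<in> sets \<nu>"
      proof -
        have "Measurable.pred \<nu> (\<lambda>\<eta>. \<forall>v\<in>U. \<eta> v = \<tau> v)"
          by (rule agree_\<nu>) (use U in auto)
        then show ?thesis by (simp add: pred_def sp)
      qed
      have gl: "(\<lambda>\<eta>. glue U \<tau>' \<eta> v) \<in> ?F \<rightarrow>\<^sub>M count_space UNIV" if "v \<in> T" for v \<tau>'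
      proof (cases "v \<in> U")
        case True then show ?thesis by (simp add: glue_def)
      next
        case False then show ?thesis using that coord_outside[of v U] by (simp add: glue_def)
      qed
      have wm: "(\<lambda>\<sigma>. wloc \<psi> \<psi>b \<beta> B T U \<tau>' \<sigma>) \<in> borel_measurable ?F" for \<tau>'
        unfolding wloc_lw lw_def
      proof (intro borel_measurable_times borel_measurable_prod)
        fix e assume "e \<in> tedges T U"
        then have e: "fst e \<in> T" "snd e \<in> T" using te[OF order_refl, of e] by (auto simp: W_def tball_def)
        note [measurable] = gl[OF e(1), of \<tau>'] gl[OF e(2), of \<tau>']
        show "(\<lambda>\<sigma>. \<psi> \<beta> (glue U \<tau>' \<sigma> (fst e)) (glue U \<tau>' \<sigma> (snd e))) \<in> borel_measurable ?F"
          by measurable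
      next
        fix i assume "i \<in> U"
        then have "i \<in> T" using U by blast
        note [measurable] = gl[OF this, of \<tau>']
        show "(\<lambda>\<sigma>. \<psi>b B (glue U \<tau>' \<sigma> i)) \<in> borel_measurable ?F" by measurable
      qed
      have g_meas: "?g \<in> borel_measurable ?F"
        unfolding Zloc_def by (intro borel_measurable_divide borel_measurable_sum wm)
      have g_meas'[measurable]: "?g \<in> borel_measurable \<nu>"
        using measurable_from_subalg[OF sub g_meas] .
      have int_g: "integrable \<nu> ?g"
      proof (rule nu.integrable_const_bound[of _ 1])
        show "AE \<sigma> in \<nu>. norm (?g \<sigma>) \<le> 1" by (rule AE_I2) (simp only: real_norm_def abs_of_nonneg[OF g_nn] g_le)
      qed (rule g_meas')
      \<comment> \<open>The two sides of the defining property of the conditional expectation,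
        regarded as finite measures on the outside sigma-algebra: they only have to agree on a
        generating pi-system.\<close>
      let ?N1 = "restr_to_subalg (density \<nu> (\<lambda>\<sigma>. ennreal (indicator ?C \<sigma>))) ?F"
      let ?N2 = "restr_to_subalg (density \<nu> (\<lambda>\<sigma>. ennreal (?g \<sigma>))) ?F"
      have subd: "subalgebra (density \<nu> f) ?F" for f using sub by (simp add: subalgebra_def)
      have N1: "emeasure ?N1 A = ennreal (\<integral>\<sigma>\<in>A. indicator ?C \<sigma> \<partial>\<nu>)" if "A \<in> sets ?F" for A
      proof -
        have [measurable]: "A \<in> sets \<nu>" using that outside_sub by blast
        have "emeasure ?N1 A = (\<integral>\<^sup>+\<sigma>. ennreal (indicator A \<sigma> * indicator ?C \<sigma>) \<partial>\<nu>)"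
          by (subst emeasure_restr_to_subalg[OF subd that], subst emeasure_density) 
             (auto intro!: nn_integral_cong split: split_indicator)
        also have "\<dots> = ennreal (\<integral>\<sigma>. indicator A \<sigma> * indicator ?C \<sigma> \<partial>\<nu>)"
          by (rule nn_integral_eq_integral) (auto intro!: nu.integrable_const_bound[of _ 1] split: split_indicator)
        finally show ?thesis by (simp add: set_lebesgue_integral_def)
      qed
      have N2: "emeasure ?N2 A = ennreal (\<integral>\<sigma>\<in>A. ?g \<sigma> \<partial>\<nu>)" if "A \<in> sets ?F" for A
      proof -
        have [measurable]: "A \<in> sets \<nu>" using that outside_sub by blast
        have "emeasure ?N2 A = (\<integral>\<^sup>+\<sigma>. ennreal (indicator A \<sigma> * ?g \<sigma>) \<partial>\<nu>)"
          by (subst emeasure_restr_to_subalg[OF subd that], subst emeasure_density) 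
             (auto intro!: nn_integral_cong split: split_indicator)
        also have "\<dots> = ennreal (\<integral>\<sigma>. indicator A \<sigma> * ?g \<sigma> \<partial>\<nu>)"
        proof (rule nn_integral_eq_integral)
          show "integrable \<nu> (\<lambda>\<sigma>. indicator A \<sigma> * ?g \<sigma>)"
            using integrable_mult_indicator[OF \<open>A \<in> sets \<nu>\<close> int_g] by simp
        qed (use g_nn in \<open>auto simp: indicator_def\<close>)
        finally show ?thesis by (simp add: set_lebesgue_integral_def)
      qed
      let ?G0 = "{Gs U t \<omega> | t \<omega>. t0 \<le> t \<and> \<omega> \<in> conf T t}"
      let ?G = "insert {} ?G0"
      have gen: "sets ?F = sigma_sets (space \<nu>) ?G"
      proof
        show "sets ?F \<subseteq> sigma_sets (space \<nu>) ?G"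
          unfolding outside_gen[of U t0] by (rule sigma_sets_mono') auto
        show "sigma_sets (space \<nu>) ?G \<subseteq> sets ?F"
          using Gs_outside by (subst space_outside[of U, symmetric], intro sets.sigma_sets_subset) auto
      qed
      have N12: "?N1 = ?N2"
      proof (rule measure_eqI_generator_eq_countable)
        show "Int_stable ?G"
          unfolding Int_stable_def
        proof (intro ballI)
          have "Gs U t \<omega> \<inter> Gs U t' \<omega>' \<in> ?G" if "t0 \<le> t" "t0 \<le> t'" "\<omega> \<in> conf T t" "\<omega>' \<in> conf T t'" for t t' \<omega> \<omega>'
          proof (cases "t \<le> t'")
            case True then show ?thesis using Gs_Int[OF True, of U \<omega> \<omega>'] that by auto
          next
            case False then show ?thesis using Gs_Int[of t' t U \<omega>' \<omega>] that by (auto simp: Int_commute)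
          qed
          moreover fix A B assume "A \<in> ?G" "B \<in> ?G"
          ultimately show "A \<inter> B \<in> ?G"
            by (elim insertE CollectE exE conjE) (simp_all only: Int_empty_left Int_empty_right insertI1)
        qed
        show "?G \<subseteq> Pow (space \<nu>)" by (auto simp: Gs_def)
        show "sets ?N1 = sigma_sets (space \<nu>) ?G" "sets ?N2 = sigma_sets (space \<nu>) ?G"
          using gen by (simp_all add: sets_restr_to_subalg[OF subd])
        show "\<Union> (Gs U t0 ` conf T t0) = space \<nu>"
        proof (intro equalityI subsetI)
          fix \<eta> assume "\<eta> \<in> space \<nu>"
          then have "\<eta> \<in> Gs U t0 (restrict \<eta> (tball T t0))" by (auto simp: Gs_def)
          then show "\<eta> \<in> \<Union> (Gs U t0 ` conf T t0)" by (auto simp: conf_def)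
        qed (auto simp: Gs_def)
        show "countable (Gs U t0 ` conf T t0)" by (auto simp: finite_conf[OF T] countable_finite)
        show "Gs U t0 ` conf T t0 \<subseteq> ?G" by auto
        show "emeasure ?N1 A \<noteq> \<infinity>" if "A \<in> Gs U t0 ` conf T t0" for A
          using that N1[of A] Gs_outside by auto
        show "emeasure ?N1 A = emeasure ?N2 A" if "A \<in> ?G" for A
        proof (cases "A = {}")
          case False
          then obtain t \<omega> where A: "A = Gs U t \<omega>" "t0 \<le> t" "\<omega> \<in> conf T t" using that \<open>A \<in> ?G\<close> by auto
          have AF: "A \<in> sets ?F" using A Gs_outside by simp
          then have [measurable]: "A \<in> sets \<nu>" using outside_sub by blast
          have "(\<integral>\<sigma>\<in>A. indicator ?C \<sigma> \<partial>\<nu>) = measure \<nu> (A \<inter> ?C)"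
            by (simp add: set_lebesgue_integral_def indicator_inter_arith[symmetric] del: Int_Collect)
          also have "A \<inter> ?C = {\<eta> \<in> space \<nu>. (\<forall>v\<in>tball T t - U. \<eta> v = \<omega> v) \<and> (\<forall>v\<in>U. \<eta> v = \<tau> v)}"
            by (auto simp: A Gs_def sp)
          also have "measure \<nu> \<dots> = q (t, glue U \<tau> \<omega>)"
            by (rule prob_cyl_glue[OF Ut0[OF A(2)] \<tau> A(3)])
          finally have I1: "(\<integral>\<sigma>\<in>A. indicator ?C \<sigma> \<partial>\<nu>) = q (t, glue U \<tau> \<omega>)" .
          \<comment> \<open>Outside U the local weight reads only neighbours of U, whose spins the
            cylinder fixes; so the candidate is constant on the cylinder.\<close>
          have wl: "wloc \<psi> \<psi>b \<beta> B T U \<tau>' \<sigma> = wloc \<psi> \<psi>b \<beta> B T U \<tau>' \<omega>" if "\<sigma> \<in> A" for \<sigma> \<tau>'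
            unfolding wloc_lw lw_def
            by (intro arg_cong2[where f="(*)"] prod.cong refl)
               (use that te[OF A(2), unfolded W_def] in \<open>auto simp: A Gs_def glue_def\<close>)
          have gl: "?g \<sigma> = ?g \<omega>" if "\<sigma> \<in> A" for \<sigma>
            unfolding Zloc_def by (simp add: wl[OF that])
          have "(\<integral>\<sigma>\<in>A. ?g \<sigma> \<partial>\<nu>) = (\<integral>\<sigma>\<in>A. ?g \<omega> \<partial>\<nu>)"
            unfolding set_lebesgue_integral_def
            by (intro Bochner_Integration.integral_cong refl) (auto simp: gl indicator_def)
          also have "\<dots> = ?g \<omega> * measure \<nu> A" by (simp add: set_lebesgue_integral_def)
          also have "measure \<nu> A = (\<Sum>\<tau>'\<in>PiE U (\<lambda>_. UNIV). q (t, glue U \<tau>' \<omega>))"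
            unfolding A Gs_def by (rule prob_cyl_out[OF Ut0[OF A(2)] A(3)])
          also have "?g \<omega> * \<dots> = q (t, glue U \<tau> \<omega>)"
          proof -
            have gc: "glue U \<tau>' \<omega> \<in> conf T t" if "\<tau>' \<in> PiE U (\<lambda>_. UNIV)" for \<tau>'
              using that Ut0[OF A(2)] A(3) by (auto simp: conf_def glue_def PiE_iff extensional_def)
            have dl: "\<omega> \<in> conf T t \<Longrightarrow> \<omega>' \<in> conf T t \<Longrightarrow> (\<And>v. v \<notin> U \<Longrightarrow> \<omega> v = \<omega>' v) \<Longrightarrow> q (t, \<omega>) * lw w b T U \<omega>' = q (t, \<omega>') * lw w b T U \<omega>" for \<omega> \<omega>'
              by (rule dsys_ratio[OF q[of t] order_refl Ut0[OF A(2)] nb0[OF A(2)]])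
            \<comment> \<open>Summing the cross-multiplied ratio over all fillings of U turns it
              into the normalised form.\<close>
            have "q (t, glue U \<tau> \<omega>) * Zloc \<psi> \<psi>b \<beta> B T U \<omega> = (\<Sum>\<tau>'\<in>PiE U (\<lambda>_. UNIV). q (t, glue U \<tau> \<omega>) * lw w b T U (glue U \<tau>' \<omega>))"
              by (simp add: Zloc_def wloc_lw w' b' sum_distrib_left)
            also have "\<dots> = (\<Sum>\<tau>'\<in>PiE U (\<lambda>_. UNIV). q (t, glue U \<tau>' \<omega>) * lw w b T U (glue U \<tau> \<omega>))"
              by (intro sum.cong refl dl gc \<tau>) (auto simp: glue_def)
            also have "\<dots> = wloc \<psi> \<psi>b \<beta> B T U \<tau> \<omega> * (\<Sum>\<tau>'\<in>PiE U (\<lambda>_. UNIV). q (t, glue U \<tau>' \<omega>))"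
              by (simp add: wloc_lw w' b' sum_distrib_left mult_ac)
            finally show ?thesis using Zpos[of \<omega>] by (simp add: field_simps)
          qed
          finally show ?thesis using N1[OF AF] N2[OF AF] I1 by simp
        qed simp
      qed
      show ?thesis
      proof (rule F.real_cond_exp_charact[OF _ _ int_g g_meas])
        show "integrable \<nu> (indicator ?C :: _ \<Rightarrow> real)" by (auto intro!: nu.integrable_const_bound[of _ 1] split: split_indicator)
        fix A assume A: "A \<in> sets ?F"
        then have [measurable]: "A \<in> sets \<nu>" using outside_sub by blast
        have "ennreal (\<integral>\<sigma>\<in>A. indicator ?C \<sigma> \<partial>\<nu>) = ennreal (\<integral>\<sigma>\<in>A. ?g \<sigma> \<partial>\<nu>)"
          using N1[OF A] N2[OF A] N12 by simp
        moreover have "0 \<le> (\<integral>\<sigma>\<in>A. indicator ?C \<sigma> \<partial>\<nu> :: real)" "0 \<le> (\<integral>\<sigma>\<in>A. ?g \<sigma> \<partial>\<nu>)"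
          unfolding set_lebesgue_integral_def by (rule integral_nonneg_AE, simp, rule integral_nonneg_AE, rule AE_I2)
            (metis (no_types) g_nn indicator_pos_le real_scaleR_def mult_nonneg_nonneg)
        ultimately show "(\<integral>\<sigma>\<in>A. indicator ?C \<sigma> \<partial>\<nu>) = (\<integral>\<sigma>\<in>A. ?g \<sigma> \<partial>\<nu>)" by simp
      qed
    qed
    have "AE \<sigma> in \<nu>. \<forall>\<tau>\<in>PiE U (\<lambda>_. UNIV :: 'x set). real_cond_exp \<nu> (outsideM T U)
                 (indicator {\<eta> \<in> space (cfgM T). \<forall>v\<in>U. \<eta> v = \<tau> v} :: (nat list \<Rightarrow> 'x) \<Rightarrow> real) \<sigma>
              = wloc \<psi> \<psi>b \<beta> B T U \<tau> \<sigma> / Zloc \<psi> \<psi>b \<beta> B T U \<sigma>"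
      by (rule AE_finite_allI) (use U main in \<open>auto intro!: finite_PiE\<close>)
    then show "AE \<sigma> in \<nu>. Zloc \<psi> \<psi>b \<beta> B T U \<sigma> > 0 \<and>
           (\<forall>\<tau>\<in>U \<rightarrow>\<^sub>E (UNIV::'x set).
              real_cond_exp \<nu> (outsideM T U)
                 (indicator {\<eta> \<in> space (cfgM T). \<forall>v\<in>U. \<eta> v = \<tau> v} :: (nat list \<Rightarrow> 'x) \<Rightarrow> real) \<sigma>
              = wloc \<psi> \<psi>b \<beta> B T U \<tau> \<sigma> / Zloc \<psi> \<psi>b \<beta> B T U \<sigma>)"
      using Zpos by simp
  qed
qed

end

section \<open>Uniqueness forces decorrelation from the boundary\<close>

lemma closed_imp: "(A \<Longrightarrow> closed {p. P p}) \<Longrightarrow> closed {p. A \<longrightarrow> P p}"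
  by (cases A) auto

lemma cont_coord: "continuous_on UNIV (\<lambda>q. (q :: 'a \<Rightarrow> 'b::topological_space) c)"
  by (rule continuous_on_product_coordinates)

text \<open>Each clause is an equation or a weak inequality linear in the coordinates of q, hence
  closed in the product topology. Conditional probabilities written as quotients would be
  discontinuous where a denominator vanishes.\<close>

lemma closed_dsys: "closed {q. dsys w b T n q}"
  unfolding dsys_def Ball_def
  by (intro closed_Collect_conj closed_Collect_all closed_imp closed_Collect_le closed_Collect_eq
      continuous_intros cont_coord)

context spin
begin

text \<open>Both tables are the ball marginals of Gibbs measures, and there is only one such
  measure.\<close>

lemma dsys_unique:
  assumes T: "utree T" and u: "\<exists>!\<nu>. \<nu> \<in> gibbs \<psi> \<psi>b \<beta> B T" and w: "w = \<psi> \<beta>" "b = \<psi>b B"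
    and q: "\<And>n. dsys w b T n q" "\<And>n. dsys w b T n q'" and \<omega>: "\<omega> \<in> conf T t"
  shows "q (t, \<omega>) = q' (t, \<omega>)"
proof -
  have s: "spin w b sp" by unfold_locales
  obtain \<nu> where \<nu>: "\<nu> \<in> gibbs \<psi> \<psi>b \<beta> B T" "\<And>t \<omega>. \<omega> \<in> conf T t \<Longrightarrow>
      measure \<nu> {\<eta> \<in> space (cfgM T). \<forall>v\<in>tball T t. \<eta> v = \<omega> v} = q (t, \<omega>)"
    using exists_gibbs[OF T q(1), of \<psi> \<beta> \<psi>b B sp] w s by auto
  obtain \<nu>' where \<nu>': "\<nu>' \<in> gibbs \<psi> \<psi>b \<beta> B T" "\<And>t \<omega>. \<omega> \<in> conf T t \<Longrightarrow>
      measure \<nu>' {\<eta> \<in> space (cfgM T). \<forall>v\<in>tball T t. \<eta> v = \<omega> v} = q' (t, \<omega>)"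
    using exists_gibbs[OF T q(2), of \<psi> \<beta> \<psi>b B sp] w s by auto
  have "\<nu> = \<nu>'" using u \<nu>(1) \<nu>'(1) by blast
  then show ?thesis using \<nu>(2)[OF \<omega>] \<nu>'(2)[OF \<omega>] by simp
qed

text \<open>Compactness: the pairs of systems of level t + n that differ by at least e at the given
  coordinate form a closed set, decreasing in n, inside a compact cube. Were all of them nonempty, a
  common element would be a pair of systems valid at every level that differ, against uniqueness. No
  rate is obtained.\<close>

lemma decorrelation:
  assumes T: "utree T" and u: "\<exists>!\<nu>. \<nu> \<in> gibbs \<psi> \<psi>b \<beta> B T" and w: "w = \<psi> \<beta>" "b = \<psi>b B"
    and \<omega>: "\<omega> \<in> conf T t" and e: "0 < e"
  shows "\<exists>n\<ge>t. \<forall>q q'. dsys w b T n q \<and> dsys w b T n q' \<longrightarrow> \<bar>q (t, \<omega>) - q' (t, \<omega>)\<bar> < e"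
proof (rule ccontr)
  assume neg: "\<not> ?thesis"
  let ?C = "PiE UNIV (\<lambda>_::nat \<times> (nat list \<Rightarrow> 'x). {0..1::real})"
  let ?K = "\<lambda>n. {p. dsys w b T (t + n) (fst p) \<and> dsys w b T (t + n) (snd p) \<and> e \<le> \<bar>fst p (t, \<omega>) - snd p (t, \<omega>)\<bar>}"
  have C: "compact ?C"
    unfolding compactin_euclidean_iff[symmetric] euclidean_product_topology[symmetric]
    by (subst compactin_PiE) auto
  have clos: "closed (?K n)" for n
  proof (intro closed_Collect_conj closed_Collect_le)
    show "closed {p :: (nat \<times> (nat list \<Rightarrow> 'x) \<Rightarrow> real) \<times> (nat \<times> (nat list \<Rightarrow> 'x) \<Rightarrow> real). dsys w b T (t + n) (fst p)}"
      using closed_vimage[OF closed_dsys[of w b T "t + n"] continuous_on_fst[OF continuous_on_id]] by (simp add: vimage_def)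
    show "closed {p :: (nat \<times> (nat list \<Rightarrow> 'x) \<Rightarrow> real) \<times> (nat \<times> (nat list \<Rightarrow> 'x) \<Rightarrow> real). dsys w b T (t + n) (snd p)}"
      using closed_vimage[OF closed_dsys[of w b T "t + n"] continuous_on_snd[OF continuous_on_id]] by (simp add: vimage_def)
  qed (intro continuous_intros continuous_on_compose2[OF cont_coord continuous_on_fst] continuous_on_compose2[OF cont_coord continuous_on_snd] subset_UNIV)+
  have sub: "?K n \<subseteq> ?C \<times> ?C" for n by (auto simp: dsys_def PiE_iff)
  have "(\<Inter>n. ?K n) \<noteq> {}"
  proof (rule compact_space_imp_nest[of "top_of_set (?C \<times> ?C)"])
    show "compact_space (top_of_set (?C \<times> ?C))"
      using compact_Times[OF C C] by (simp add: compact_space_subtopology)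
    show "closedin (top_of_set (?C \<times> ?C)) (?K n)" for n by (rule closed_subset[OF sub clos])
    show "?K n \<noteq> {}" for n
    proof -
      obtain q q' where "dsys w b T (t + n) q" "dsys w b T (t + n) q'" "e \<le> \<bar>q (t, \<omega>) - q' (t, \<omega>)\<bar>"
        using neg by (meson le_add1 not_less)
      then have "(q, q') \<in> ?K n" by simp
      then show ?thesis by blast
    qed
    show "decseq ?K"
      by (rule decseq_SucI) (auto intro: dsys_antimono)
  qed
  then obtain p where p: "\<And>n. p \<in> ?K n" by auto
  have "dsys w b T n (fst p)" "dsys w b T n (snd p)" for n
    using p[of n] dsys_antimono[of w b T "t + n" _ n] by auto
  then have "fst p (t, \<omega>) = snd p (t, \<omega>)" by (rule dsys_unique[OF T u w _ _ \<omega>])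
  then show False using p[of 0] e by simp
qed

text \<open>The sum of the finitely many radii serves as a bound for their maximum; a larger level
  only strengthens the hypothesis on the two systems.\<close>

lemma decorrelation_all:
  assumes T: "utree T" and u: "\<exists>!\<nu>. \<nu> \<in> gibbs \<psi> \<psi>b \<beta> B T" and w: "w = \<psi> \<beta>" "b = \<psi>b B" and e: "0 < e"
  shows "\<exists>n\<ge>t. \<forall>m\<ge>n. \<forall>q q'. \<forall>\<omega>\<in>conf T t. dsys w b T m q \<and> dsys w b T m q' \<longrightarrow> \<bar>q (t, \<omega>) - q' (t, \<omega>)\<bar> < e"
proof -
  obtain N where N: "\<And>\<omega>. \<omega> \<in> conf T t \<Longrightarrow> t \<le> N \<omega>"
    "\<And>\<omega> q q'. \<omega> \<in> conf T t \<Longrightarrow> dsys w b T (N \<omega>) q \<Longrightarrow> dsys w b T (N \<omega>) q' \<Longrightarrow> \<bar>q (t, \<omega>) - q' (t, \<omega>)\<bar> < e"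
    using decorrelation[OF T u w _ e, of _ t] by metis
  have fin: "finite (conf T t :: (nat list \<Rightarrow> 'x) set)" by (rule finite_conf[OF T])
  have le: "N \<omega> \<le> (\<Sum>\<omega>\<in>conf T t. N \<omega>)" if "\<omega> \<in> conf T t" for \<omega> :: "nat list \<Rightarrow> 'x"
    by (rule member_le_sum[OF that]) (auto simp: fin)
  show ?thesis
  proof (intro exI[of _ "t + (\<Sum>\<omega>\<in>conf T t. N \<omega>)"] conjI allI ballI impI)
    fix m q q' and \<omega> :: "nat list \<Rightarrow> 'x" assume a: "t + (\<Sum>\<omega>\<in>conf T t. N \<omega>) \<le> m" "\<omega> \<in> conf T t" "dsys w b T m q \<and> dsys w b T m q'"
    then have "N \<omega> \<le> m" using le[OF a(2)] by simp
    then show "\<bar>q (t, \<omega>) - q' (t, \<omega>)\<bar> < e" using a by (intro N(2)) (auto intro: dsys_antimono)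
  qed simp
qed

end

section \<open>Measurability on the space of trees\<close>

lemma space_treeM: "space treeM = Collect utree"
  unfolding treeM_def by (auto simp: space_measure_of_conv)

lemma mem_treeM[measurable]: "Measurable.pred treeM (\<lambda>T. w \<in> T)"
proof -
  have "{T. utree T \<and> w \<in> T} \<in> sets treeM"
    unfolding treeM_def by (intro in_measure_of) auto
  then show ?thesis by (simp add: pred_def space_treeM)
qed

text \<open>There are only countably many finite sets of words, so it suffices that the preimage of
  each is measurable, and this is a countable conjunction of membership conditions.\<close>

lemma measurable_finset:
  assumes [measurable]: "\<And>w. Measurable.pred treeM (\<lambda>T. w \<in> N T)" and fin: "\<And>T. utree T \<Longrightarrow> finite (N T)"
  shows "N \<in> treeM \<rightarrow>\<^sub>M count_space (Collect (finite :: nat list set \<Rightarrow> bool))"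
proof (subst measurable_count_space_eq_countable)
  show "countable (Collect (finite :: nat list set \<Rightarrow> bool))" by (rule countable_Collect_finite)
  show "N \<in> space treeM \<rightarrow> Collect finite \<and> (\<forall>S\<in>Collect finite. N -` {S} \<inter> space treeM \<in> sets treeM)"
  proof (intro conjI ballI)
    fix S :: "nat list set"
    have "Measurable.pred treeM (\<lambda>T. \<forall>w. w \<in> N T \<longleftrightarrow> w \<in> S)" by measurable
    then show "N -` {S} \<inter> space treeM \<in> sets treeM"
      by (simp add: pred_def set_eq_iff[symmetric] vimage_def Int_def conj_commute)
  qed (use fin in \<open>auto simp: space_treeM\<close>)
qed

text \<open>Freezing the finite set at each of its countably many values lets products and sums over
  a random neighbourhood be treated as if the index set were fixed.\<close>

lemma measurable_via_finset:
  assumes N: "N \<in> treeM \<rightarrow>\<^sub>M count_space (Collect (finite :: nat list set \<Rightarrow> bool))"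
    and f: "\<And>S. finite S \<Longrightarrow> f S \<in> measurable treeM K"
  shows "(\<lambda>T. f (N T) T) \<in> measurable treeM K"
  by (rule measurable_compose_countable'[OF _ N]) (use f in \<open>auto intro: countable_Collect_finite\<close>)

lemma measurable_tball: "(\<lambda>T. tball T t) \<in> treeM \<rightarrow>\<^sub>M count_space (Collect finite)"
  proof (rule measurable_finset)
  show "Measurable.pred treeM (\<lambda>T. w \<in> tball T t)" for w unfolding tball_def by simp
qed (rule finite_tball)

text \<open>The ball takes countably many values, so every function of it is measurable, in
  particular a maximum over boundary conditions or a choice of representatives.\<close>

lemma measurable_via_tball: "g \<in> UNIV \<rightarrow> space K \<Longrightarrow> (\<lambda>T. g (tball T t)) \<in> measurable treeM K"
  by (rule measurable_via_finset[OF measurable_tball, where f="\<lambda>S T. g S"]) (auto intro!: measurable_const)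

lemma finite_nbrs': "utree T \<Longrightarrow> finite (nbrs T x)"
proof (cases "x \<in> T")
  case False
  assume T: "utree T"
  have "nbrs T x \<subseteq> {butlast x}" using utreeD(2)[OF T] False by (auto simp: nbrs_def tadj_def)
  then show ?thesis using finite_subset by blast
qed (rule finite_nbrs)

lemma measurable_nbrs: "(\<lambda>T. nbrs T x) \<in> treeM \<rightarrow>\<^sub>M count_space (Collect finite)"
  proof (rule measurable_finset)
  show "Measurable.pred treeM (\<lambda>T. w \<in> nbrs T x)" for w unfolding nbrs_def by simp
qed (rule finite_nbrs')

lemma measurable_prod_nbrs:
  assumes [measurable]: "\<And>v. (\<lambda>T. f T v) \<in> borel_measurable treeM"
  shows "(\<lambda>T. \<Prod>v\<in>nbrs T x - A. f T v :: real) \<in> borel_measurable treeM"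
  by (rule measurable_via_finset[OF measurable_nbrs, where f="\<lambda>S T. \<Prod>v\<in>S - A. f T v"]) measurable

lemma measurable_sum_nbrs:
  assumes [measurable]: "\<And>v. (\<lambda>T. f T v) \<in> borel_measurable treeM"
  shows "(\<lambda>T. \<Sum>v\<in>nbrs T x - A. f T v :: real) \<in> borel_measurable treeM"
  by (rule measurable_via_finset[OF measurable_nbrs, where f="\<lambda>S T. \<Sum>v\<in>S - A. f T v"]) measurable

lemma measurable_deg[measurable]: "(\<lambda>T. deg T x) \<in> treeM \<rightarrow>\<^sub>M count_space UNIV"
  unfolding deg_def by (rule measurable_via_finset[OF measurable_nbrs, where f="\<lambda>S T. card S"]) auto

text \<open>The random index set is traded for an indicator over the countable set of all
  words.\<close>

lemma measurable_count_tree: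
  fixes F :: "nat list set \<Rightarrow> nat list \<Rightarrow> ennreal"
  assumes [measurable]: "\<And>x. (\<lambda>T. F T x) \<in> borel_measurable treeM"
  shows "(\<lambda>T. \<integral>\<^sup>+x. F T x \<partial>count_space T) \<in> borel_measurable treeM"
proof -
  interpret C: sigma_finite_measure "count_space (UNIV :: nat list set)"
    by (rule sigma_finite_measure_count_space_countable) auto
  have "(\<lambda>(x, T). F T x * indicator T x) \<in> borel_measurable (count_space UNIV \<Otimes>\<^sub>M treeM)"
    by (rule measurable_pair_measure_countable1) (auto simp: indicator_def)
  then have "(\<lambda>(T, x). F T x * indicator T x) \<in> borel_measurable (treeM \<Otimes>\<^sub>M count_space UNIV)"
    by (subst measurable_pair_swap_iff) simp
  from C.borel_measurable_nn_integral[OF this]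
  show ?thesis by (simp add: nn_integral_count_space_indicator)
qed

section \<open>Isomorphism invariance and mass transport\<close>

text \<open>Isomorphism with its map exposed and the roots left out: one and the same map has to
  transport neighbourhoods, balls and boundary configurations.\<close>

definition giso :: "('a \<Rightarrow> 'b) \<Rightarrow> 'a set \<Rightarrow> ('a \<Rightarrow> 'a \<Rightarrow> bool) \<Rightarrow> 'b set \<Rightarrow> ('b \<Rightarrow> 'b \<Rightarrow> bool) \<Rightarrow> bool" where
  "giso f A adjA B adjB \<longleftrightarrow> bij_betw f A B \<and> (\<forall>u\<in>A. \<forall>v\<in>A. adjA u v = adjB (f u) (f v))"

lemma riso2_giso: "riso2 A adjA a1 a2 B adjB b1 b2 \<longleftrightarrow> (\<exists>f. giso f A adjA B adjB \<and> f a1 = b1 \<and> f a2 = b2)"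
  unfolding riso2_def giso_def by blast

lemma giso_inv: "giso f A adjA B adjB \<Longrightarrow> giso (inv_into A f) B adjB A adjA"
proof -
  assume a: "giso f A adjA B adjB"
  then have b: "bij_betw f A B" by (simp add: giso_def)
  have i: "u \<in> B \<Longrightarrow> inv_into A f u \<in> A \<and> f (inv_into A f u) = u" for u
    using b by (auto simp: bij_betw_def inv_into_into f_inv_into_f)
  show ?thesis unfolding giso_def
  proof (intro conjI ballI)
    show "bij_betw (inv_into A f) B A" by (rule bij_betw_inv_into[OF b])
    fix u v assume "u \<in> B" "v \<in> B"
    then show "adjB u v = adjA (inv_into A f u) (inv_into A f v)"
      using a i[of u] i[of v] by (auto simp: giso_def)
  qed
qed

lemma giso_trans: "giso f A adjA B adjB \<Longrightarrow> giso g B adjB C adjC \<Longrightarrow> giso (g \<circ> f) A adjA C adjC"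
  unfolding giso_def by (auto intro: bij_betw_trans simp: bij_betw_apply)

lemma riso2_refl: "riso2 A adjA a1 a2 A adjA a1 a2"
  unfolding riso2_giso giso_def by (rule exI[of _ id]) auto

lemma riso2_sym: "riso2 A adjA a1 a2 B adjB b1 b2 \<Longrightarrow> a1 \<in> A \<Longrightarrow> a2 \<in> A \<Longrightarrow> riso2 B adjB b1 b2 A adjA a1 a2"
  unfolding riso2_giso
  by (elim exE conjE, rule exI, rule conjI, erule giso_inv) (auto simp: giso_def bij_betw_def)

lemma riso2_trans: "riso2 A adjA a1 a2 B adjB b1 b2 \<Longrightarrow> riso2 B adjB b1 b2 C adjC c1 c2 \<Longrightarrow> riso2 A adjA a1 a2 C adjC c1 c2"
  unfolding riso2_giso
  by (elim exE conjE, rule exI, rule conjI, erule (1) giso_trans) auto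

lemma giso_nbrs:
  assumes f: "giso f T tadj T' tadj" and u: "u \<in> T"
  shows "nbrs T' (f u) = f ` nbrs T u"
proof (intro equalityI subsetI)
  fix v assume v: "v \<in> nbrs T' (f u)"
  then obtain v0 where v0: "v0 \<in> T" "v = f v0" using f by (auto simp: nbrs_def giso_def bij_betw_def)
  then show "v \<in> f ` nbrs T u" using v f u by (auto simp: nbrs_def giso_def)
next
  fix v assume "v \<in> f ` nbrs T u"
  then show "v \<in> nbrs T' (f u)" using f u by (auto simp: nbrs_def giso_def bij_betw_def)
qed

lemma giso_mem: "giso f T a T' a' \<Longrightarrow> u \<in> T \<Longrightarrow> f u \<in> T'"
  by (auto simp: giso_def bij_betw_def)

lemma giso_inj: "giso f T a T' a' \<Longrightarrow> inj_on f T"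
  by (auto simp: giso_def bij_betw_def)

locale tree_law = prob_space \<mu> for \<mu> :: "nat list set measure" +
  assumes sets_\<mu>: "sets \<mu> = sets treeM" and unim: "unimodular \<mu>"
begin

lemma space_\<mu>: "space \<mu> = Collect utree"
  using sets_eq_imp_space_eq[OF sets_\<mu>] space_treeM by simp

lemma measurable_\<mu>: "f \<in> measurable treeM K \<Longrightarrow> f \<in> measurable \<mu> K"
  by (simp add: measurable_cong_sets[OF sets_\<mu> refl])

lemma AE_utree: "AE T in \<mu>. utree T"
  by (rule AE_I2) (simp add: space_\<mu>)

text \<open>Everything shows at the root: by mass transport, an exceptional edge anywhere in the tree
  would with positive probability be an exceptional edge at the root.\<close>

lemma AE_up_all_edges:
  assumes meas[measurable]: "\<And>x y. Measurable.pred treeM (\<lambda>T. P T x y)"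
    and inv: "\<And>T T' x y x' y'. \<lbrakk>utree T; utree T'; x \<in> T; y \<in> T; x' \<in> T'; y' \<in> T'; tadj x y; tadj x' y';
       riso2 T tadj x y T' tadj x' y'; P T x y\<rbrakk> \<Longrightarrow> P T' x' y'"
    and up: "AE_up \<mu> P"
  shows "AE T in \<mu>. \<forall>x\<in>T. \<forall>y\<in>T. tadj x y \<longrightarrow> P T x y"
proof -
  \<comment> \<open>A vertex is exceptional when some edge into it violates P, and every vertex
    sends mass 1 to each exceptional vertex. The root receives no mass by hypothesis, so in the mean
    it sends none; but it sends to all exceptional vertices of the tree, hence there are
    none.\<close>
  define Q where "Q = (\<lambda>T y. \<exists>z. z \<in> T \<and> tadj z y \<and> \<not> P T z y)"
  define f where "f = (\<lambda>T (x :: nat list) y. if Q T y then 1 else 0 :: ennreal)"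
  have Q[measurable]: "Measurable.pred treeM (\<lambda>T. Q T y)" for y unfolding Q_def by measurable
  have fm: "(\<lambda>T. f T x y) \<in> borel_measurable treeM" for x y unfolding f_def by measurable
  have Qinv: "Q T' y'" if T: "utree T" "utree T'" "y \<in> T" "y' \<in> T'" and g: "giso g T tadj T' tadj" "g y = y'" and q: "Q T y" for T T' y y' g
  proof -
    obtain z where z: "z \<in> T" "tadj z y" "\<not> P T z y" using q by (auto simp: Q_def)
    have gz: "g z \<in> T'" "tadj (g z) y'" using giso_mem[OF g(1)] z g T by (auto simp: giso_def)
    have r: "riso2 T tadj z y T' tadj (g z) y'" unfolding riso2_giso using g by blast
    have "\<not> P T' (g z) y'"
      using inv[of T' T "g z" y' z y] riso2_sym[OF r z(1) T(3)] T z gz by blast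
    then show ?thesis using gz by (auto simp: Q_def)
  qed
  have finv: "f T x y = f T' x' y'" if a: "utree T" "utree T'" "x \<in> T" "y \<in> T" "x' \<in> T'" "y' \<in> T'" and r: "riso2 T tadj x y T' tadj x' y'" for T T' x y x' y'
  proof -
    obtain g where g: "giso g T tadj T' tadj" "g x = x'" "g y = y'" using r by (auto simp: riso2_giso)
    obtain g' where g': "giso g' T' tadj T tadj" "g' y' = y"
      using riso2_sym[OF r a(3,4)] by (auto simp: riso2_giso)
    have "Q T y \<longleftrightarrow> Q T' y'" using Qinv[OF _ _ _ _ g(1,3)] Qinv[OF _ _ _ _ g'] a by blast
    then show ?thesis by (simp add: f_def)
  qed
  have eq: "(\<integral>\<^sup>+T. (\<integral>\<^sup>+x. f T [] x \<partial>count_space T) \<partial>\<mu>) = (\<integral>\<^sup>+T. (\<integral>\<^sup>+x. f T x [] \<partial>count_space T) \<partial>\<mu>)"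
    using unim[unfolded unimodular_def, rule_format, of f] fm finv by blast
  have "AE T in \<mu>. \<not> Q T []"
    using up unfolding AE_up_def by eventually_elim (auto simp: Q_def tadj_def)
  then have "AE T in \<mu>. (\<integral>\<^sup>+x. f T x [] \<partial>count_space T) = 0"
    by eventually_elim (simp add: f_def)
  then have "(\<integral>\<^sup>+T. (\<integral>\<^sup>+x. f T x [] \<partial>count_space T) \<partial>\<mu>) = 0"
    by (subst nn_integral_cong_AE[where v="\<lambda>_. 0"]) auto
  then have "(\<integral>\<^sup>+T. (\<integral>\<^sup>+x. f T [] x \<partial>count_space T) \<partial>\<mu>) = 0" using eq by simp
  moreover have "(\<lambda>T. \<integral>\<^sup>+x. f T [] x \<partial>count_space T) \<in> borel_measurable \<mu>"
    by (rule measurable_\<mu>, rule measurable_count_tree, rule fm)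
  ultimately have "AE T in \<mu>. (\<integral>\<^sup>+x. f T [] x \<partial>count_space T) = 0"
    by (simp add: nn_integral_0_iff_AE)
  then show ?thesis
  proof eventually_elim
    case (elim T)
    then have "\<forall>y\<in>T. f T [] y = 0" by (simp add: nn_integral_0_iff_AE AE_count_space)
    then show ?case by (auto simp: f_def Q_def split: if_splits)
  qed
qed

text \<open>Unimodularity for a transport supported on pairs of neighbours, where the sums over the
  tree reduce to sums over the neighbours of the root.\<close>

lemma mass_transport_nn:
  fixes F :: "nat list set \<Rightarrow> nat list \<Rightarrow> nat list \<Rightarrow> ennreal"
  assumes meas: "\<And>x y. (\<lambda>T. F T x y) \<in> borel_measurable treeM"
    and inv: "\<And>T T' x y x' y'. \<lbrakk>utree T; utree T'; x \<in> T; y \<in> T; x' \<in> T'; y' \<in> T'; tadj x y; tadj x' y';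
       riso2 T tadj x y T' tadj x' y'\<rbrakk> \<Longrightarrow> F T x y = F T' x' y'"
  shows "(\<integral>\<^sup>+T. (\<Sum>j\<in>nbrs T []. F T [] j) \<partial>\<mu>) = (\<integral>\<^sup>+T. (\<Sum>j\<in>nbrs T []. F T j []) \<partial>\<mu>)"
proof -
  define f where "f = (\<lambda>T x y. if tadj x y then F T x y else 0)"
  have fm: "(\<lambda>T. f T x y) \<in> borel_measurable treeM" for x y using meas by (auto simp: f_def)
  have finv: "f T x y = f T' x' y'" if "utree T" "utree T'" "x \<in> T" "y \<in> T" "x' \<in> T'" "y' \<in> T'" and r: "riso2 T tadj x y T' tadj x' y'" for T T' x y x' y'
  proof -
    have "tadj x y = tadj x' y'" using r that by (auto simp: riso2_def)
    then show ?thesis using inv[OF that(1-6) _ _ r] by (auto simp: f_def)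
  qed
  have eq: "(\<integral>\<^sup>+T. (\<integral>\<^sup>+x. f T [] x \<partial>count_space T) \<partial>\<mu>) = (\<integral>\<^sup>+T. (\<integral>\<^sup>+x. f T x [] \<partial>count_space T) \<partial>\<mu>)"
    using unim[unfolded unimodular_def, rule_format, of f] fm finv by blast
  have 1: "(\<integral>\<^sup>+x. f T [] x \<partial>count_space T) = (\<Sum>j\<in>nbrs T []. F T [] j)" if "utree T" for T
  proof -
    have "(\<integral>\<^sup>+x. f T [] x \<partial>count_space T) = (\<Sum>j\<in>nbrs T []. f T [] j)"
      by (rule nn_integral_count_space'[OF finite_nbrs'[OF that]]) (auto simp: nbrs_def f_def)
    then show ?thesis by (simp add: f_def nbrs_def)
  qed
  have 2: "(\<integral>\<^sup>+x. f T x [] \<partial>count_space T) = (\<Sum>j\<in>nbrs T []. F T j [])" if "utree T" for T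
  proof -
    have "(\<integral>\<^sup>+x. f T x [] \<partial>count_space T) = (\<Sum>j\<in>nbrs T []. f T j [])"
      by (rule nn_integral_count_space'[OF finite_nbrs'[OF that]]) (auto simp: nbrs_def f_def tadj_sym[of _ "[]"])
    then show ?thesis by (simp add: f_def nbrs_def tadj_sym[of _ "[]"])
  qed
  have "(\<integral>\<^sup>+T. (\<Sum>j\<in>nbrs T []. F T [] j) \<partial>\<mu>) = (\<integral>\<^sup>+T. (\<integral>\<^sup>+x. f T [] x \<partial>count_space T) \<partial>\<mu>)"
    by (rule nn_integral_cong) (simp add: 1 space_\<mu>)
  also have "\<dots> = (\<integral>\<^sup>+T. (\<Sum>j\<in>nbrs T []. F T j []) \<partial>\<mu>)"
    unfolding eq by (rule nn_integral_cong) (simp add: 2 space_\<mu>)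
  finally show ?thesis .
qed

text \<open>Integrability of the outgoing mass is enough: the nonnegative version applied to
  absolute values gives it for the incoming mass, and the positive and negative parts are then
  transported separately.\<close>

lemma mass_transport:
  fixes F :: "nat list set \<Rightarrow> nat list \<Rightarrow> nat list \<Rightarrow> real"
  assumes meas[measurable]: "\<And>x y. (\<lambda>T. F T x y) \<in> borel_measurable treeM"
    and inv: "\<And>T T' x y x' y'. \<lbrakk>utree T; utree T'; x \<in> T; y \<in> T; x' \<in> T'; y' \<in> T'; tadj x y; tadj x' y';
       riso2 T tadj x y T' tadj x' y'\<rbrakk> \<Longrightarrow> F T x y = F T' x' y'"
    and int: "integrable \<mu> (\<lambda>T. \<Sum>j\<in>nbrs T []. \<bar>F T [] j\<bar>)"
  shows "integrable \<mu> (\<lambda>T. \<Sum>j\<in>nbrs T []. F T [] j)" "integrable \<mu> (\<lambda>T. \<Sum>j\<in>nbrs T []. F T j [])"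
    "(\<integral>T. (\<Sum>j\<in>nbrs T []. F T [] j) \<partial>\<mu>) = (\<integral>T. (\<Sum>j\<in>nbrs T []. F T j []) \<partial>\<mu>)"
proof -
  have sm: "(\<lambda>T. \<Sum>j\<in>nbrs T []. f T j :: real) \<in> borel_measurable \<mu>" if "\<And>v. (\<lambda>T. f T v) \<in> borel_measurable treeM" for f
    using measurable_\<mu>[OF measurable_sum_nbrs[where A="{}" and x="[]", OF that]] by simp
  let ?p = "\<lambda>T x y. max 0 (F T x y)" and ?m = "\<lambda>T x y. max 0 (- F T x y)"
  \<comment> \<open>The function h is kept general because the identity is used for the absolute
    value and for both parts.\<close>
  have nnF: "(\<integral>\<^sup>+T. ennreal (\<Sum>j\<in>nbrs T []. h (F T [] j)) \<partial>\<mu>) = (\<integral>\<^sup>+T. ennreal (\<Sum>j\<in>nbrs T []. h (F T j [])) \<partial>\<mu>)"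
    if h: "\<And>r. 0 \<le> h r" "h \<in> borel_measurable borel" for h :: "real \<Rightarrow> real"
  proof -
    note [measurable] = h(2)
    have "(\<integral>\<^sup>+T. (\<Sum>j\<in>nbrs T []. ennreal (h (F T [] j))) \<partial>\<mu>) = (\<integral>\<^sup>+T. (\<Sum>j\<in>nbrs T []. ennreal (h (F T j []))) \<partial>\<mu>)"
    proof (rule mass_transport_nn)
      show "ennreal (h (F T x y)) = ennreal (h (F T' x' y'))"
        if "utree T" "utree T'" "x \<in> T" "y \<in> T" "x' \<in> T'" "y' \<in> T'" "tadj x y" "tadj x' y'" "riso2 T tadj x y T' tadj x' y'"
        for T T' x y x' y' using inv[OF that] by simp
    qed measurable
    then show ?thesis by (simp add: sum_ennreal h)
  qed
  have int1: "integrable \<mu> (\<lambda>T. \<Sum>j\<in>nbrs T []. h (F T [] j))"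
    if h: "\<And>r. \<bar>h r\<bar> \<le> \<bar>r\<bar>" "h \<in> borel_measurable borel" for h :: "real \<Rightarrow> real"
  proof (rule Bochner_Integration.integrable_bound[OF int sm])
    note [measurable] = h(2)
    show "(\<lambda>T. h (F T [] v)) \<in> borel_measurable treeM" for v by measurable
    show "AE T in \<mu>. norm (\<Sum>j\<in>nbrs T []. h (F T [] j)) \<le> norm (\<Sum>j\<in>nbrs T []. \<bar>F T [] j\<bar>)"
    proof (rule AE_I2)
      fix T
      have "\<bar>\<Sum>j\<in>nbrs T []. h (F T [] j)\<bar> \<le> (\<Sum>j\<in>nbrs T []. \<bar>h (F T [] j)\<bar>)" by (rule sum_abs)
      also have "\<dots> \<le> (\<Sum>j\<in>nbrs T []. \<bar>F T [] j\<bar>)" by (rule sum_mono) (rule h)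
      finally show "norm (\<Sum>j\<in>nbrs T []. h (F T [] j)) \<le> norm (\<Sum>j\<in>nbrs T []. \<bar>F T [] j\<bar>)" by simp
    qed
  qed
  have int2: "integrable \<mu> (\<lambda>T. \<Sum>j\<in>nbrs T []. \<bar>F T j []\<bar>)"
  proof (rule integrableI_bounded[OF sm])
    have "(\<integral>\<^sup>+T. ennreal (\<Sum>j\<in>nbrs T []. \<bar>F T [] j\<bar>) \<partial>\<mu>) < \<infinity>"
      using int by (auto simp: integrable_iff_bounded sum_nonneg)
    then show "(\<integral>\<^sup>+T. ennreal (norm (\<Sum>j\<in>nbrs T []. \<bar>F T j []\<bar>)) \<partial>\<mu>) < \<infinity>"
      using nnF[of abs] by (simp add: sum_nonneg)
  qed measurable
  have int3: "integrable \<mu> (\<lambda>T. \<Sum>j\<in>nbrs T []. h (F T j []))"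
    if h: "\<And>r. \<bar>h r\<bar> \<le> \<bar>r\<bar>" "h \<in> borel_measurable borel" for h :: "real \<Rightarrow> real"
  proof (rule Bochner_Integration.integrable_bound[OF int2 sm])
    note [measurable] = h(2)
    show "(\<lambda>T. h (F T v [])) \<in> borel_measurable treeM" for v by measurable
    show "AE T in \<mu>. norm (\<Sum>j\<in>nbrs T []. h (F T j [])) \<le> norm (\<Sum>j\<in>nbrs T []. \<bar>F T j []\<bar>)"
    proof (rule AE_I2)
      fix T
      have "\<bar>\<Sum>j\<in>nbrs T []. h (F T j [])\<bar> \<le> (\<Sum>j\<in>nbrs T []. \<bar>h (F T j [])\<bar>)" by (rule sum_abs)
      also have "\<dots> \<le> (\<Sum>j\<in>nbrs T []. \<bar>F T j []\<bar>)" by (rule sum_mono) (rule h)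
      finally show "norm (\<Sum>j\<in>nbrs T []. h (F T j [])) \<le> norm (\<Sum>j\<in>nbrs T []. \<bar>F T j []\<bar>)" by simp
    qed
  qed
  show "integrable \<mu> (\<lambda>T. \<Sum>j\<in>nbrs T []. F T [] j)" "integrable \<mu> (\<lambda>T. \<Sum>j\<in>nbrs T []. F T j [])"
    using int1[of "\<lambda>r. r"] int3[of "\<lambda>r. r"] by auto
  have I: "(\<integral>T. (\<Sum>j\<in>nbrs T []. h (F T [] j)) \<partial>\<mu>) = (\<integral>T. (\<Sum>j\<in>nbrs T []. h (F T j [])) \<partial>\<mu>)"
    if h: "\<And>r. \<bar>h r\<bar> \<le> \<bar>r\<bar>" "\<And>r. 0 \<le> h r" "h \<in> borel_measurable borel" for h :: "real \<Rightarrow> real"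
  proof -
    have "ennreal (\<integral>T. (\<Sum>j\<in>nbrs T []. h (F T [] j)) \<partial>\<mu>) = ennreal (\<integral>T. (\<Sum>j\<in>nbrs T []. h (F T j [])) \<partial>\<mu>)"
      using nnF[OF h(2,3)] by (subst (1 2) nn_integral_eq_integral[symmetric]) (auto intro!: int1 int3 sum_nonneg h)
    then show ?thesis by (subst (asm) ennreal_inj) (auto intro!: integral_nonneg_AE sum_nonneg h)
  qed
  have s: "(\<Sum>j\<in>A. f j) = (\<Sum>j\<in>A. max 0 (f j)) - (\<Sum>j\<in>A. max 0 (- f j))" for A and f :: "nat list \<Rightarrow> real"
    unfolding sum_subtractf[symmetric] by (rule sum.cong) auto
  have i: "integrable \<mu> (\<lambda>T. \<Sum>j\<in>nbrs T []. max 0 (F T [] j))" "integrable \<mu> (\<lambda>T. \<Sum>j\<in>nbrs T []. max 0 (- F T [] j))"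
    "integrable \<mu> (\<lambda>T. \<Sum>j\<in>nbrs T []. max 0 (F T j []))" "integrable \<mu> (\<lambda>T. \<Sum>j\<in>nbrs T []. max 0 (- F T j []))"
    using int1[of "max 0"] int1[of "\<lambda>r. max 0 (- r)"] int3[of "max 0"] int3[of "\<lambda>r. max 0 (- r)"] by auto
  show "(\<integral>T. (\<Sum>j\<in>nbrs T []. F T [] j) \<partial>\<mu>) = (\<integral>T. (\<Sum>j\<in>nbrs T []. F T j []) \<partial>\<mu>)"
    unfolding s[of "\<lambda>j. F _ [] j"] s[of "\<lambda>j. F _ j []"]
    using I[of "max 0"] I[of "\<lambda>r. max 0 (- r)"] i by (simp add: Bochner_Integration.integral_diff)
qed

end

section \<open>Messages\<close>

definition Br :: "('x::finite \<Rightarrow> 'x \<Rightarrow> real) \<Rightarrow> ('x \<Rightarrow> real) \<Rightarrow> (nat list set \<Rightarrow> nat list \<Rightarrow> nat list \<Rightarrow> 'x \<Rightarrow> real)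
    \<Rightarrow> nat list set \<Rightarrow> nat list \<Rightarrow> nat list \<Rightarrow> 'x \<Rightarrow> real" where
  "Br w b h T x y s = b s * (\<Prod>v\<in>nbrs T x - {y}. \<Sum>r\<in>UNIV. w s r * h T v x r)"

text \<open>Iterates of belief propagation from uniform messages. Being defined by the same rule on
  every tree, they are measurable and invariant under isomorphism, and pass both properties on to
  their limit.\<close>

fun hmsg :: "('x::finite \<Rightarrow> 'x \<Rightarrow> real) \<Rightarrow> ('x \<Rightarrow> real) \<Rightarrow> nat \<Rightarrow> nat list set \<Rightarrow> nat list \<Rightarrow> nat list \<Rightarrow> 'x \<Rightarrow> real" where
  "hmsg w b 0 T x y s = 1 / real CARD('x)"
| "hmsg w b (Suc n) T x y s = Br w b (hmsg w b n) T x y s / (\<Sum>r\<in>UNIV. Br w b (hmsg w b n) T x y r)"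

text \<open>The uniform default off the convergence set, taken for all spins at once, keeps the
  value a probability vector.\<close>

definition hlim :: "('x::finite \<Rightarrow> 'x \<Rightarrow> real) \<Rightarrow> ('x \<Rightarrow> real) \<Rightarrow> nat list set \<Rightarrow> nat list \<Rightarrow> nat list \<Rightarrow> 'x \<Rightarrow> real" where
  "hlim w b T x y s = (if \<forall>s. convergent (\<lambda>n. hmsg w b n T x y s) then lim (\<lambda>n. hmsg w b n T x y s) else 1 / real CARD('x))"

lemma bp_rhs_Br: "bp_rhs \<psi> \<psi>b \<beta> B = Br (\<psi> \<beta>) (\<psi>b B)"
  by (intro ext) (simp add: bp_rhs_def Br_def)

lemma is_messageD:
  assumes "is_message h"
  shows "(\<lambda>T. h T x y s) \<in> borel_measurable treeM"
    "utree T \<Longrightarrow> x \<in> T \<Longrightarrow> y \<in> T \<Longrightarrow> tadj x y \<Longrightarrow> 0 \<le> h T x y s"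
    "utree T \<Longrightarrow> x \<in> T \<Longrightarrow> y \<in> T \<Longrightarrow> tadj x y \<Longrightarrow> (\<Sum>s\<in>UNIV. h T x y s) = 1"
    "\<lbrakk>utree T; utree T'; x \<in> T; y \<in> T; x' \<in> T'; y' \<in> T'; tadj x y; riso2 T tadj x y T' tadj x' y'\<rbrakk> \<Longrightarrow> h T x y s = h T' x' y' s"
proof -
  note m = assms[unfolded is_message_def]
  show "(\<lambda>T. h T x y s) \<in> borel_measurable treeM" by (rule m[THEN conjunct1, rule_format])
  show "utree T \<Longrightarrow> x \<in> T \<Longrightarrow> y \<in> T \<Longrightarrow> tadj x y \<Longrightarrow> 0 \<le> h T x y s"
    by (rule m[THEN conjunct2, THEN conjunct1, rule_format, THEN conjunct1, rule_format]) simp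
  show "utree T \<Longrightarrow> x \<in> T \<Longrightarrow> y \<in> T \<Longrightarrow> tadj x y \<Longrightarrow> (\<Sum>s\<in>UNIV. h T x y s) = 1"
    by (rule m[THEN conjunct2, THEN conjunct1, rule_format, THEN conjunct2]) simp
  show "\<lbrakk>utree T; utree T'; x \<in> T; y \<in> T; x' \<in> T'; y' \<in> T'; tadj x y; riso2 T tadj x y T' tadj x' y'\<rbrakk> \<Longrightarrow> h T x y s = h T' x' y' s"
    by (rule m[THEN conjunct2, THEN conjunct2, rule_format, THEN fun_cong]) simp
qed

lemma Br_measurable: "(\<And>x y s. (\<lambda>T. h T x y s) \<in> borel_measurable treeM) \<Longrightarrow> (\<lambda>T. Br w b h T x y s) \<in> borel_measurable treeM"
  unfolding Br_def by (intro borel_measurable_times borel_measurable_const measurable_prod_nbrs borel_measurable_sum)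

lemma Br_iso:
  assumes T: "utree T" "utree T'" and xy: "x \<in> T" "y \<in> T" "tadj x y" and f: "giso f T tadj T' tadj"
    and h: "\<And>u v. u \<in> T \<Longrightarrow> v \<in> T \<Longrightarrow> tadj u v \<Longrightarrow> h T u v = h T' (f u) (f v)"
  shows "Br w b h T x y s = Br w b h T' (f x) (f y) s"
proof -
  have inj: "inj_on f T" using giso_inj[OF f] .
  have "nbrs T' (f x) - {f y} = f ` (nbrs T x - {y})"
    unfolding giso_nbrs[OF f xy(1)] using inj xy by (auto simp: nbrs_def inj_on_def)
  moreover have "inj_on f (nbrs T x - {y})" using inj by (auto simp: inj_on_def nbrs_def)
  moreover have "h T' (f v) (f x) = h T v x" if "v \<in> nbrs T x - {y}" for v
    using h[of v x] that xy by (auto simp: nbrs_def tadj_sym)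
  ultimately show ?thesis unfolding Br_def by (simp add: prod.reindex)
qed

lemma is_message_iso: "is_message h \<Longrightarrow> utree T \<Longrightarrow> utree T' \<Longrightarrow> giso f T tadj T' tadj \<Longrightarrow> u \<in> T \<Longrightarrow> v \<in> T \<Longrightarrow> tadj u v
    \<Longrightarrow> h T u v = h T' (f u) (f v)"
  by (rule ext, rule is_messageD(4)) (auto simp: riso2_giso giso_mem)

text \<open>Messages towards the root, indexed by the emitting vertex in the form that
  \<open>BP\<close> and \<open>Fm\<close> expect.\<close>

definition upm :: "(nat list set \<Rightarrow> nat list \<Rightarrow> nat list \<Rightarrow> 'x \<Rightarrow> real) \<Rightarrow> nat list set \<Rightarrow> nat list \<Rightarrow> 'x \<Rightarrow> real" where
  "upm h T v = h T v (butlast v)"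

lemma Br_up:
  assumes "utree T" "v \<in> T" "v \<noteq> []"
  shows "Br w b h T v (butlast v) s = BP w b T (upm h T) v s"
proof -
  have "butlast v \<notin> kids T v" proof
    assume "butlast v \<in> kids T v"
    then obtain i where "butlast v = v @ [i]" by (auto simp: kids_def)
    then have "length (butlast v) = Suc (length v)" by simp
    then show False by simp
  qed
  then have "nbrs T v - {butlast v} = kids T v" using assms by (simp add: nbrs_eq)
  moreover have "(\<Prod>x\<in>kids T v. \<Sum>r\<in>UNIV. w s r * h T x v r) = (\<Prod>x\<in>kids T v. \<Sum>r\<in>UNIV. w s r * h T x (butlast x) r)"
    by (rule prod.cong) (auto simp: kids_def)
  ultimately show ?thesis unfolding Br_def BP_def upm_def by simp
qed

lemma tadj_butlast: "v \<noteq> [] \<Longrightarrow> tadj v (butlast v)"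
  unfolding tadj_def by (metis append_butlast_last_id)

section \<open>The star at the root\<close>

text \<open>Weight of the star at the root with complete messages on its leaves: unlike in
  \<open>Fm\<close> at radius 1, the vertex weights of the leaves and all that lies beyond them are
  absorbed in x.\<close>

definition St :: "('x::finite \<Rightarrow> 'x \<Rightarrow> real) \<Rightarrow> ('x \<Rightarrow> real) \<Rightarrow> nat list set \<Rightarrow> (nat list \<Rightarrow> 'x \<Rightarrow> real) \<Rightarrow> (nat list \<Rightarrow> 'x) \<Rightarrow> real" where
  "St w b T x \<omega> = b (\<omega> []) * (\<Prod>j\<in>nbrs T []. w (\<omega> []) (\<omega> j) * x j (\<omega> j))"

definition Zst :: "('x::finite \<Rightarrow> 'x \<Rightarrow> real) \<Rightarrow> ('x \<Rightarrow> real) \<Rightarrow> nat list set \<Rightarrow> (nat list \<Rightarrow> 'x \<Rightarrow> real) \<Rightarrow> real" where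
  "Zst w b T x = (\<Sum>a\<in>UNIV. b a * (\<Prod>j\<in>nbrs T []. \<Sum>s\<in>UNIV. w a s * x j s))"

lemma sum_conf1:
  fixes f :: "(nat list \<Rightarrow> 'x::finite) \<Rightarrow> real"
  assumes T: "utree T"
  shows "(\<Sum>\<omega>\<in>conf T (Suc 0). f \<omega>) = (\<Sum>a\<in>UNIV. \<Sum>\<zeta>\<in>PiE (nbrs T []) (\<lambda>_. UNIV). f (fun_upd \<zeta> [] a))"
proof -
  have nN: "[] \<notin> nbrs T []" by (auto simp: nbrs_def tadj_def)
  have c: "tball T (Suc 0) = insert [] (nbrs T [])" using tball_Suc[of T 0] T by (simp add: tball_0 nbrs_root)
  show ?thesis unfolding sum.cartesian_product
  proof (rule sum.reindex_bij_witness[where i="\<lambda>(a, \<zeta>). fun_upd \<zeta> [] a" and j="\<lambda>\<omega>. (\<omega> [], fun_upd \<omega> [] undefined)"])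
    fix \<omega> assume "\<omega> \<in> conf T (Suc 0)"
    then show "(\<omega> [], fun_upd \<omega> [] undefined) \<in> UNIV \<times> PiE (nbrs T []) (\<lambda>_. UNIV)"
      using nN by (auto simp: conf_def c PiE_iff extensional_def)
  next
    fix p :: "'x \<times> (nat list \<Rightarrow> 'x)" assume "p \<in> UNIV \<times> PiE (nbrs T []) (\<lambda>_. UNIV)"
    then show "(case p of (a, \<zeta>) \<Rightarrow> fun_upd \<zeta> [] a) \<in> conf T (Suc 0)"
      by (auto simp: conf_def c PiE_iff extensional_def)
    show "((case p of (a, \<zeta>) \<Rightarrow> fun_upd \<zeta> [] a) [], fun_upd (case p of (a, \<zeta>) \<Rightarrow> fun_upd \<zeta> [] a) [] undefined) = p"
      using \<open>p \<in> _\<close> nN by (auto simp: PiE_iff extensional_def fun_eq_iff)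
  qed auto
qed

text \<open>Given the root spin the leaves are independent; the second identity marks one leaf by
  inserting g into its factor.\<close>

lemma sum_St:
  assumes T: "utree T"
  shows "(\<Sum>\<omega>\<in>conf T (Suc 0). St w b T x \<omega> * f (\<omega> [])) = (\<Sum>a\<in>UNIV. b a * f a * (\<Prod>j\<in>nbrs T []. \<Sum>s\<in>UNIV. w a s * x j s))"
    and "i \<in> nbrs T [] \<Longrightarrow> (\<Sum>\<omega>\<in>conf T (Suc 0). St w b T x \<omega> * g (\<omega> []) (\<omega> i)) =
      (\<Sum>a\<in>UNIV. b a * (\<Sum>s\<in>UNIV. w a s * x i s * g a s) * (\<Prod>j\<in>nbrs T [] - {i}. \<Sum>s\<in>UNIV. w a s * x j s))"
proof -
  have fin: "finite (nbrs T [])" using finite_nbrs'[OF T] .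
  have nN: "[] \<notin> nbrs T []" by (auto simp: nbrs_def tadj_def)
  then have nj: "j \<in> nbrs T [] \<Longrightarrow> j \<noteq> []" for j by auto
  have St: "St w b T x (fun_upd \<zeta> [] a) = b a * (\<Prod>j\<in>nbrs T []. w a (\<zeta> j) * x j (\<zeta> j))" for \<zeta> a
    unfolding St_def using nj by (auto intro!: arg_cong2[where f="(*)"] prod.cong)
  show "(\<Sum>\<omega>\<in>conf T (Suc 0). St w b T x \<omega> * f (\<omega> [])) = (\<Sum>a\<in>UNIV. b a * f a * (\<Prod>j\<in>nbrs T []. \<Sum>s\<in>UNIV. w a s * x j s))"
    unfolding sum_conf1[OF T] St prod_sum_PiE[OF fin finite]
    by (simp add: sum_distrib_left mult_ac)
  assume i: "i \<in> nbrs T []"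
  \<comment> \<open>The function of leaf i is written as a factor at every leaf, equal to 1
    elsewhere, so that the product form survives.\<close>
  have p: "(\<Prod>j\<in>nbrs T []. w a (\<zeta> j) * x j (\<zeta> j)) * g a (\<zeta> i) = (\<Prod>j\<in>nbrs T []. w a (\<zeta> j) * x j (\<zeta> j) * (if j = i then g a (\<zeta> j) else 1))" for a \<zeta>
    using fin i by (simp add: prod.distrib prod.remove[of _ i])
  have "(\<Sum>\<omega>\<in>conf T (Suc 0). St w b T x \<omega> * g (\<omega> []) (\<omega> i)) = (\<Sum>a\<in>UNIV. b a * (\<Sum>\<zeta>\<in>PiE (nbrs T []) (\<lambda>_. UNIV). \<Prod>j\<in>nbrs T []. w a (\<zeta> j) * x j (\<zeta> j) * (if j = i then g a (\<zeta> j) else 1)))"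
    unfolding sum_conf1[OF T] St using nj[OF i] by (simp add: sum_distrib_left mult.assoc p)
  also have "\<dots> = (\<Sum>a\<in>UNIV. b a * (\<Prod>j\<in>nbrs T []. \<Sum>s\<in>UNIV. w a s * x j s * (if j = i then g a s else 1)))"
    by (subst prod_sum_PiE[OF fin finite]) (rule refl)
  also have "\<dots> = (\<Sum>a\<in>UNIV. b a * (\<Sum>s\<in>UNIV. w a s * x i s * g a s) * (\<Prod>j\<in>nbrs T [] - {i}. \<Sum>s\<in>UNIV. w a s * x j s))"
    using fin i by (simp add: prod.remove[of _ i] mult.assoc)
  finally show "(\<Sum>\<omega>\<in>conf T (Suc 0). St w b T x \<omega> * g (\<omega> []) (\<omega> i)) =
      (\<Sum>a\<in>UNIV. b a * (\<Sum>s\<in>UNIV. w a s * x i s * g a s) * (\<Prod>j\<in>nbrs T [] - {i}. \<Sum>s\<in>UNIV. w a s * x j s))" .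
qed

lemma sum_St_Zst: "utree T \<Longrightarrow> (\<Sum>\<omega>\<in>conf T (Suc 0). St w b T x \<omega>) = Zst w b T x"
  using sum_St(1)[of T w b x "\<lambda>_. 1"] by (simp add: Zst_def)

text \<open>By the recursion at a leaf, its vertex weight and the messages of its children multiply
  to its own message up to \<open>c j\<close>; the constants cancel after normalisation.\<close>

lemma Fm_star:
  assumes T: "utree T" and c: "\<And>j s. j \<in> nbrs T [] \<Longrightarrow> m j s = c j * BP w b T m j s" and c0: "\<And>j. j \<in> nbrs T [] \<Longrightarrow> c j \<noteq> 0"
  shows "St w b T m \<omega> = (\<Prod>j\<in>nbrs T []. c j) * Fm w b T (Suc 0) m \<omega>"
proof -
  let ?J = "nbrs T []"
  have fin: "finite ?J" using finite_nbrs'[OF T] .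
  have J: "?J = lev T (Suc 0)" using nbrs_root[OF T] .
  have nN: "[] \<notin> ?J" by (auto simp: nbrs_def tadj_def)
  have c1: "tball T (Suc 0) = insert [] ?J" using tball_Suc[of T 0] T by (simp add: tball_0 nbrs_root)
  have bl: "j \<in> ?J \<Longrightarrow> butlast j = []" for j by (auto simp: nbrs_def tadj_def)
  have "(\<Prod>v\<in>lev T (Suc (Suc 0)). \<Sum>s\<in>UNIV. w (\<omega> (butlast v)) s * m v s)
      = (\<Prod>j\<in>?J. \<Prod>v\<in>kids T j. \<Sum>s\<in>UNIV. w (\<omega> (butlast v)) s * m v s)"
    unfolding lev_Suc[OF T, of "Suc 0"] J
    by (rule prod.UNION_disjoint) (auto simp: finite_lev[OF T] kids_def, auto simp: lev_def finite_kids[OF T, unfolded kids_def])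
  also have "\<dots> = (\<Prod>j\<in>?J. \<Prod>v\<in>kids T j. \<Sum>s\<in>UNIV. w (\<omega> j) s * m v s)"
    by (intro prod.cong refl) (auto simp: kids_def)
  finally have 1: "(\<Prod>v\<in>lev T (Suc (Suc 0)). \<Sum>s\<in>UNIV. w (\<omega> (butlast v)) s * m v s) = (\<Prod>j\<in>?J. \<Prod>v\<in>kids T j. \<Sum>s\<in>UNIV. w (\<omega> j) s * m v s)" .
  have 2: "(\<Prod>v\<in>tball T (Suc 0) - {[]}. w (\<omega> (butlast v)) (\<omega> v)) = (\<Prod>j\<in>?J. w (\<omega> []) (\<omega> j))"
    using nN by (intro prod.cong) (auto simp: c1 bl)
  have 3: "(\<Prod>v\<in>tball T (Suc 0). b (\<omega> v)) = b (\<omega> []) * (\<Prod>j\<in>?J. b (\<omega> j))"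
    unfolding c1 using fin nN by simp
  have F: "Fm w b T (Suc 0) m \<omega> = b (\<omega> []) * (\<Prod>j\<in>?J. w (\<omega> []) (\<omega> j) * BP w b T m j (\<omega> j))"
    unfolding Fm_def 1 2 3 BP_def by (simp add: prod.distrib mult_ac)
  have "St w b T m \<omega> = b (\<omega> []) * (\<Prod>j\<in>?J. c j * (w (\<omega> []) (\<omega> j) * BP w b T m j (\<omega> j)))"
    unfolding St_def by (intro arg_cong2[where f="(*)" and a="b (\<omega> [])"] prod.cong refl) (simp add: c)
  then show ?thesis unfolding F prod.distrib[of c] by simp
qed

section \<open>Positivity and bounds from the permissive spin\<close>

context spin
begin

abbreviation wmax where "wmax \<equiv> Max (range (case_prod w))"
abbreviation wmin where "wmin \<equiv> Min (range (w sp))"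

lemma w_le: "w a c \<le> wmax" by (rule Max_ge) (auto intro!: image_eqI[of _ _ "(a, c)"])
lemma wmin_pos: "0 < wmin" using w_sp' by (subst Min_gr_iff) auto
lemma wmin_le: "wmin \<le> w sp s" by (rule Min_le) auto

lemma usum_le:
  assumes "\<And>s. 0 \<le> x s" "(\<Sum>s\<in>UNIV. x s) = 1"
  shows "(\<Sum>s\<in>UNIV. w a s * x s) \<le> wmax" "0 \<le> (\<Sum>s\<in>UNIV. w a s * x s)" "wmin \<le> (\<Sum>s\<in>UNIV. w sp s * x s)"
proof -
  have "(\<Sum>s\<in>UNIV. w a s * x s) \<le> (\<Sum>s\<in>UNIV. wmax * x s)"
    by (intro sum_mono mult_right_mono w_le assms)
  then show "(\<Sum>s\<in>UNIV. w a s * x s) \<le> wmax" by (simp add: sum_distrib_left[symmetric] assms)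
  show "0 \<le> (\<Sum>s\<in>UNIV. w a s * x s)" by (intro sum_nonneg mult_nonneg_nonneg w_nn assms)
  have "(\<Sum>s\<in>UNIV. wmin * x s) \<le> (\<Sum>s\<in>UNIV. w sp s * x s)"
    by (intro sum_mono mult_right_mono wmin_le assms)
  then show "wmin \<le> (\<Sum>s\<in>UNIV. w sp s * x s)" by (simp add: sum_distrib_left[symmetric] assms)
qed

lemma prob_ex_pos: "(\<And>s. 0 \<le> x s) \<Longrightarrow> (\<Sum>s\<in>UNIV. x s) = (1::real) \<Longrightarrow> \<exists>s::'x. 0 < x s"
proof (rule ccontr)
  assume "\<And>s. 0 \<le> x s" "(\<Sum>s\<in>UNIV. x s) = 1" "\<not> (\<exists>s::'x. 0 < x s)"
  then have "x s = 0" for s by (meson not_less order.antisym)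
  then show False using \<open>(\<Sum>s\<in>UNIV. x s) = 1\<close> by simp
qed

lemma Br_nn:
  assumes "\<And>v r. v \<in> nbrs T x - {y} \<Longrightarrow> 0 \<le> h T v x r"
  shows "0 \<le> Br w b h T x y s"
  unfolding Br_def by (intro mult_nonneg_nonneg prod_nonneg ballI sum_nonneg w_nn assms less_imp_le[OF b_pos])

lemma Br_sp_pos:
  assumes h: "\<And>v r. v \<in> nbrs T x - {y} \<Longrightarrow> 0 \<le> h T v x r" "\<And>v. v \<in> nbrs T x - {y} \<Longrightarrow> (\<Sum>r\<in>UNIV. h T v x r) = 1"
  shows "0 < Br w b h T x y sp" "0 < (\<Sum>s\<in>UNIV. Br w b h T x y s)"
proof -
  show *: "0 < Br w b h T x y sp" unfolding Br_def
    by (intro mult_pos_pos b_pos prod_pos sum_w_sp_pos prob_ex_pos h)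
  show "0 < (\<Sum>s\<in>UNIV. Br w b h T x y s)"
    by (rule sum_pos2[of _ sp]) (auto intro!: Br_nn h *)
qed

lemma prob_normalise:
  assumes "\<And>s. 0 \<le> f s" "0 < (\<Sum>s\<in>UNIV. f (s::'x))"
  shows "0 \<le> f s / (\<Sum>s\<in>UNIV. f s)" "(\<Sum>s\<in>UNIV. f s / (\<Sum>s\<in>UNIV. f s)) = (1::real)"
  using assms by (auto simp: sum_divide_distrib[symmetric])

lemma nbrs_mem: "v \<in> nbrs T x \<Longrightarrow> v \<in> T \<and> tadj v x" by (auto simp: nbrs_def tadj_sym)

lemma hmsg_prob:
  assumes "utree T" 
  shows "x \<in> T \<Longrightarrow> y \<in> T \<Longrightarrow> tadj x y \<Longrightarrow> (\<forall>s. 0 \<le> hmsg w b n T x y s) \<and> (\<Sum>s\<in>UNIV. hmsg w b n T x y s) = 1"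
proof (induction n arbitrary: x y)
  case (Suc n)
  have h: "0 \<le> hmsg w b n T v x r" "(\<Sum>r\<in>UNIV. hmsg w b n T v x r) = 1" if "v \<in> nbrs T x - {y}" for v r
    using Suc.IH[of v x] nbrs_mem[of v T x] that Suc.prems by auto
  show ?case using prob_normalise[of "Br w b (hmsg w b n) T x y"] Br_sp_pos(2)[of T x y "hmsg w b n"] Br_nn[of T x y "hmsg w b n"] h by auto
qed simp

lemma is_message_hmsg: "is_message (hmsg w b n)"
  unfolding is_message_def
proof (intro conjI allI impI)
  show "(\<lambda>T. hmsg w b n T x y s) \<in> borel_measurable treeM" for x y s
  proof (induction n arbitrary: x y s)
    case (Suc n)
    show ?case unfolding hmsg.simps
      by (intro borel_measurable_divide borel_measurable_sum Br_measurable Suc)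
  qed simp
  show "0 \<le> hmsg w b n T x y s" "(\<Sum>s\<in>UNIV. hmsg w b n T x y s) = 1"
    if "utree T \<and> x \<in> T \<and> y \<in> T \<and> tadj x y" for T x y s using hmsg_prob[of T x y n] that by auto
  have iso: "utree T \<Longrightarrow> utree T' \<Longrightarrow> giso f T tadj T' tadj \<Longrightarrow> x \<in> T \<Longrightarrow> y \<in> T \<Longrightarrow> tadj x y \<Longrightarrow> hmsg w b n T x y = hmsg w b n T' (f x) (f y)"
    for T T' f x y
  proof (induction n arbitrary: x y)
    case (Suc n)
    have "Br w b (hmsg w b n) T x y s = Br w b (hmsg w b n) T' (f x) (f y) s" for s
      by (rule Br_iso) (use Suc in auto)
    then show ?case by (intro ext) simp
  qed (auto simp: fun_eq_iff)
  fix T T' x y x' y'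
  assume "utree T \<and> utree T' \<and> x \<in> T \<and> y \<in> T \<and> tadj x y \<and> x' \<in> T' \<and> y' \<in> T' \<and> riso2 T tadj x y T' tadj x' y'"
  then show "hmsg w b n T x y = hmsg w b n T' x' y'" using iso unfolding riso2_giso by blast
qed

text \<open>The reciprocal of the normaliser of the recursion is the positive constant that
  \<open>dsys_gq\<close> asks for. With n positive the recursion holds at the neighbours of the
  root, which turns the marginal of radius 1 into the star with incoming messages.\<close>

lemma dsys_messages:
  assumes T: "utree T"
    and pr: "\<And>v s. v \<in> T \<Longrightarrow> v \<noteq> [] \<Longrightarrow> length v \<le> Suc n \<Longrightarrow> 0 \<le> m v s" "\<And>v. v \<in> T \<Longrightarrow> v \<noteq> [] \<Longrightarrow> length v \<le> Suc n \<Longrightarrow> (\<Sum>s\<in>UNIV. m v s) = 1"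
    and bp: "\<And>v s. v \<in> T \<Longrightarrow> v \<noteq> [] \<Longrightarrow> length v \<le> n \<Longrightarrow> m v s = BP w b T m v s / (\<Sum>r\<in>UNIV. BP w b T m v r)"
    and n: "0 < n"
  shows "dsys w b T n (gq w b T m)" 
    "0 < Zst w b T m" "\<omega> \<in> conf T (Suc 0) \<Longrightarrow> gq w b T m (Suc 0, \<omega>) = St w b T m \<omega> / Zst w b T m"
proof -
  have ex: "\<exists>s. 0 < m v s" if "v \<in> T" "v \<noteq> []" "length v \<le> Suc n" for v using prob_ex_pos pr that by blast
  have cp: "0 < (\<Sum>r\<in>UNIV. BP w b T m v r)" if v: "v \<in> T" "v \<noteq> []" "length v \<le> n" for v
  proof -
    have kid: "x \<in> T \<and> x \<noteq> [] \<and> length x \<le> Suc n" if "x \<in> kids T v" for x using that v by (auto simp: kids_def)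
    have *: "0 < BP w b T m v sp" unfolding BP_def
      by (intro mult_pos_pos b_pos prod_pos sum_w_sp_pos) (use kid pr(1) ex in auto)
    show ?thesis
      by (rule sum_pos2[of _ sp]) (use kid pr(1) * in \<open>auto simp: BP_def intro!: mult_nonneg_nonneg prod_nonneg sum_nonneg w_nn less_imp_le[OF b_pos]\<close>)
  qed
  have bp': "\<exists>c>0. \<forall>s. m v s = c * BP w b T m v s" if v: "v \<in> T" "v \<noteq> []" "length v \<le> n" for v
    using cp[OF v] by (intro exI[of _ "1 / (\<Sum>r\<in>UNIV. BP w b T m v r)"] conjI allI) (simp, subst bp[OF v], simp)
  show "dsys w b T n (gq w b T m)" by (rule dsys_gq(1)[OF T pr(1) ex bp'])
  have J: "v \<in> nbrs T [] \<Longrightarrow> v \<in> T \<and> v \<noteq> [] \<and> length v \<le> n" for v using n by (auto simp: nbrs_def tadj_def)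
  let ?c = "\<lambda>v. 1 / (\<Sum>r\<in>UNIV. BP w b T m v r)"
  have c0: "0 < (\<Prod>j\<in>nbrs T []. ?c j)" by (rule prod_pos) (use cp J in auto)
  have St: "St w b T m \<omega> = (\<Prod>j\<in>nbrs T []. ?c j) * Fm w b T (Suc 0) m \<omega>" for \<omega>
  proof (rule Fm_star[OF T])
    show "m j s = ?c j * BP w b T m j s" "?c j \<noteq> 0" if "j \<in> nbrs T []" for j s
      using bp[of j s] cp[of j] J[OF that] by (simp_all only: times_divide_eq_left mult_1_left) auto
  qed
  have Z: "Zst w b T m = (\<Prod>j\<in>nbrs T []. ?c j) * Zm w b T (Suc 0) m"
    unfolding sum_St_Zst[OF T, symmetric] St Zm_def sum_distrib_left ..
  have "0 < Zm w b T (Suc 0) m"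
  proof (rule Zm_pos[OF T])
    fix v assume "v \<in> lev T (Suc (Suc 0))"
    then have v: "v \<in> T" "v \<noteq> []" "length v \<le> Suc n" using n by (auto simp: lev_def)
    show "0 \<le> m v s" for s using pr(1)[OF v] .
    show "\<exists>s. 0 < m v s" using ex[OF v] .
  qed
  then show "0 < Zst w b T m" using Z c0 by simp
  assume "\<omega> \<in> conf T (Suc 0)"
  then have "gq w b T m (Suc 0, \<omega>) = Fm w b T (Suc 0) m \<omega> / Zm w b T (Suc 0) m"
    by (intro dsys_gq(2)[OF T pr(1) ex bp']) (use n in auto)
  then show "gq w b T m (Suc 0, \<omega>) = St w b T m \<omega> / Zst w b T m" using c0 by (simp add: Z St)
qed

text \<open>Given a permissive spin at the root the star factorises, so the root marginals
  determine the message along every edge into the root.\<close>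

definition edgeA :: "nat list set \<Rightarrow> (nat \<times> (nat list \<Rightarrow> 'x) \<Rightarrow> real) \<Rightarrow> nat list \<Rightarrow> 'x \<Rightarrow> real" where
  "edgeA T q i s = (\<Sum>\<omega>\<in>conf T (Suc 0). q (Suc 0, \<omega>) * (if \<omega> [] = sp \<and> \<omega> i = s then 1 else 0)) / w sp s"

text \<open>For root spin \<open>sp\<close> the joint law with leaf i is proportional to
  \<open>w sp s * x i s\<close>, with a factor free of s, and \<open>w sp s\<close> is positive.
  Besides the specification, the lower bound for the normaliser involves only the root degree; this
  keeps the quotient stable along sequences of messages on one tree.\<close>

lemma edgeA_messages:
  assumes T: "utree T" and i: "i \<in> nbrs T []"
    and x: "\<And>j s. j \<in> nbrs T [] \<Longrightarrow> 0 \<le> x j s" "\<And>j. j \<in> nbrs T [] \<Longrightarrow> (\<Sum>s\<in>UNIV. x j s) = 1"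
    and q: "\<And>\<omega>. \<omega> \<in> conf T (Suc 0) \<Longrightarrow> q (Suc 0, \<omega>) = St w b T x \<omega> / Zst w b T x"
    and Z: "0 < Zst w b T x"
  shows "x i s = edgeA T q i s / (\<Sum>r\<in>UNIV. edgeA T q i r)"
    "b sp * wmin ^ (card (nbrs T []) - 1) / ((\<Sum>a\<in>UNIV. b a) * wmax ^ card (nbrs T [])) \<le> (\<Sum>r\<in>UNIV. edgeA T q i r)"
proof -
  have fin: "finite (nbrs T [])" using finite_nbrs'[OF T] .
  let ?u = "\<lambda>a j. \<Sum>s\<in>UNIV. w a s * x j s"
  define K where "K = b sp * (\<Prod>j\<in>nbrs T [] - {i}. ?u sp j) / Zst w b T x"
  have A: "edgeA T q i s = K * x i s" for s
  proof -
    have "(\<Sum>\<omega>\<in>conf T (Suc 0). q (Suc 0, \<omega>) * (if \<omega> [] = sp \<and> \<omega> i = s then 1 else 0))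
       = (\<Sum>\<omega>\<in>conf T (Suc 0). St w b T x \<omega> * (if \<omega> [] = sp \<and> \<omega> i = s then 1 else 0)) / Zst w b T x"
      by (simp add: q sum_divide_distrib)
    also have "(\<Sum>\<omega>\<in>conf T (Suc 0). St w b T x \<omega> * (if \<omega> [] = sp \<and> \<omega> i = s then 1 else 0))
       = (\<Sum>a\<in>UNIV. b a * (\<Sum>r\<in>UNIV. w a r * x i r * (if a = sp \<and> r = s then 1 else 0)) * (\<Prod>j\<in>nbrs T [] - {i}. ?u a j))"
      by (rule sum_St(2)[OF T i])
    also have "\<dots> = (\<Sum>a\<in>UNIV. if a = sp then b sp * (w sp s * x i s) * (\<Prod>j\<in>nbrs T [] - {i}. ?u sp j) else 0)"
      by (rule sum.cong) (auto simp: if_distrib[where f="\<lambda>z. _ * z"] cong: if_cong)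
    also have "\<dots> = b sp * (w sp s * x i s) * (\<Prod>j\<in>nbrs T [] - {i}. ?u sp j)" by simp
    finally show ?thesis unfolding edgeA_def K_def using w_sp'[of s] by (simp add: field_simps)
  qed
  have S: "(\<Sum>r\<in>UNIV. edgeA T q i r) = K" unfolding A sum_distrib_left[symmetric] using x(2)[OF i] by simp
  have u: "?u a j \<le> wmax" "0 \<le> ?u a j" "wmin \<le> ?u sp j" if "j \<in> nbrs T []" for a j
    using usum_le[of "x j"] x[OF that] by auto
  have p1: "wmin ^ (card (nbrs T []) - 1) \<le> (\<Prod>j\<in>nbrs T [] - {i}. ?u sp j)"
    using prod_mono[of "nbrs T [] - {i}" "\<lambda>_. wmin" "?u sp"] u(3) i fin wmin_pos by (simp add: less_imp_le)
  have p2: "Zst w b T x \<le> (\<Sum>a\<in>UNIV. b a) * wmax ^ card (nbrs T [])"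
  proof -
    have "(\<Prod>j\<in>nbrs T []. ?u a j) \<le> wmax ^ card (nbrs T [])" for a
      using prod_mono[of "nbrs T []" "?u a" "\<lambda>_. wmax"] u by simp
    then show ?thesis unfolding Zst_def sum_distrib_right
      by (intro sum_mono mult_left_mono less_imp_le[OF b_pos])
  qed
  have p0: "0 < wmin ^ (card (nbrs T []) - 1)" using wmin_pos by simp
  have K: "b sp * wmin ^ (card (nbrs T []) - 1) / ((\<Sum>a\<in>UNIV. b a) * wmax ^ card (nbrs T [])) \<le> K"
    unfolding K_def by (intro frac_le mult_left_mono p1 p2 Z mult_nonneg_nonneg less_imp_le[OF b_pos] less_imp_le[OF less_le_trans[OF p0 p1]])
  then show "b sp * wmin ^ (card (nbrs T []) - 1) / ((\<Sum>a\<in>UNIV. b a) * wmax ^ card (nbrs T [])) \<le> (\<Sum>r\<in>UNIV. edgeA T q i r)"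
    by (simp add: S)
  have "0 < K" unfolding K_def by (intro divide_pos_pos mult_pos_pos b_pos Z less_le_trans[OF p0 p1])
  then show "x i s = edgeA T q i s / (\<Sum>r\<in>UNIV. edgeA T q i r)" by (subst S, subst A) simp
qed

end

section \<open>The fixed point of belief propagation\<close>

lemma bp_fixed_at_measurable:
  assumes "is_message h"
  shows "Measurable.pred treeM (\<lambda>T. bp_fixed_at \<psi> \<psi>b \<beta> B h T x y)"
proof -
  have [measurable]: "(\<lambda>T. bp_rhs \<psi> \<psi>b \<beta> B h T x y s) \<in> borel_measurable treeM" for x y s
    unfolding bp_rhs_Br by (rule Br_measurable) (rule is_messageD(1)[OF assms])
  have [measurable]: "(\<lambda>T. h T x y s) \<in> borel_measurable treeM" for x y s by (rule is_messageD(1)[OF assms])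
  show ?thesis unfolding bp_fixed_at_def by measurable
qed

lemma bp_fixed_at_inv:
  assumes h: "is_message h" and a: "utree T" "utree T'" "x \<in> T" "y \<in> T" "tadj x y"
    and r: "riso2 T tadj x y T' tadj x' y'" and bp: "bp_fixed_at \<psi> \<psi>b \<beta> B h T x y"
  shows "bp_fixed_at \<psi> \<psi>b \<beta> B h T' x' y'"
proof -
  obtain f where f: "giso f T tadj T' tadj" "f x = x'" "f y = y'" using r by (auto simp: riso2_giso)
  have "bp_rhs \<psi> \<psi>b \<beta> B h T x y s = bp_rhs \<psi> \<psi>b \<beta> B h T' x' y' s" for s
    unfolding bp_rhs_Br f(2,3)[symmetric]
    by (rule Br_iso[OF a f(1)]) (rule is_message_iso[OF h a(1,2) f(1)])
  moreover have "h T x y = h T' x' y'" using is_message_iso[OF h a(1,2) f(1) a(3,4,5)] f by simp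
  ultimately show ?thesis using bp by (simp add: bp_fixed_at_def)
qed

text \<open>Membership in \<open>Hstar\<close> controls only edges into the root; systems on the
  whole tree need the recursion at deeper edges, and the Bethe functional needs it at edges out of
  the root.\<close>

lemma (in tree_law) Hstar_all_edges:
  assumes "h \<in> Hstar \<psi> \<psi>b \<mu> \<beta> B"
  shows "AE T in \<mu>. \<forall>x\<in>T. \<forall>y\<in>T. tadj x y \<longrightarrow> bp_fixed_at \<psi> \<psi>b \<beta> B h T x y"
proof (rule AE_up_all_edges)
  have h: "is_message h" using assms by (simp add: Hstar_def)
  show "Measurable.pred treeM (\<lambda>T. bp_fixed_at \<psi> \<psi>b \<beta> B h T x y)" for x y
    by (rule bp_fixed_at_measurable[OF h])
  show "AE_up \<mu> (bp_fixed_at \<psi> \<psi>b \<beta> B h)" using assms by (simp add: Hstar_def)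
  fix T T' x y x' y'
  assume "utree T" "utree T'" "x \<in> T" "y \<in> T" "tadj x y" "riso2 T tadj x y T' tadj x' y'" "bp_fixed_at \<psi> \<psi>b \<beta> B h T x y"
  then show "bp_fixed_at \<psi> \<psi>b \<beta> B h T' x' y'" by (rule bp_fixed_at_inv[OF h])
qed

section \<open>Convergence of the iteration and uniqueness of its limit\<close>

lemma convergent_finite_sum:
  fixes f :: "nat \<Rightarrow> 'a \<Rightarrow> real"
  assumes "\<And>i. i \<in> A \<Longrightarrow> convergent (\<lambda>n. f n i)"
  shows "convergent (\<lambda>n. \<Sum>i\<in>A. f n i)"
proof -
  obtain l where "\<And>i. i \<in> A \<Longrightarrow> (\<lambda>n. f n i) \<longlonglongrightarrow> l i" using assms unfolding convergent_def by metis
  then have "(\<lambda>n. \<Sum>i\<in>A. f n i) \<longlonglongrightarrow> (\<Sum>i\<in>A. l i)" by (intro tendsto_sum)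
  then show ?thesis by (auto simp: convergent_def)
qed

text \<open>The Cauchy criterion with tolerances 1 / (k + 1) involves only countably many
  comparisons.\<close>

lemma measurable_convergent:
  fixes f :: "nat \<Rightarrow> 'a \<Rightarrow> real"
  assumes [measurable]: "\<And>n. f n \<in> borel_measurable M"
  shows "Measurable.pred M (\<lambda>x. convergent (\<lambda>n. f n x))"
proof -
  have "convergent (\<lambda>n. f n x) \<longleftrightarrow> (\<forall>k::nat. \<exists>N. \<forall>m\<ge>N. \<forall>n\<ge>N. \<bar>f m x - f n x\<bar> < 1 / real (Suc k))" for x
    unfolding Cauchy_convergent_iff[symmetric] Cauchy_iff2 by (simp add: inverse_eq_divide)
  then show ?thesis by simp
qed

context spin
begin

lemma messages_upm:
  assumes T: "utree T" and h: "is_message h"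
    and bp: "\<And>x y. x \<in> T \<Longrightarrow> y \<in> T \<Longrightarrow> tadj x y \<Longrightarrow> bp_fixed_at \<psi> \<psi>b \<beta> B h T x y" and w: "w = \<psi> \<beta>" "b = \<psi>b B"
  shows "v \<in> T \<Longrightarrow> v \<noteq> [] \<Longrightarrow> 0 \<le> upm h T v s" "v \<in> T \<Longrightarrow> v \<noteq> [] \<Longrightarrow> (\<Sum>s\<in>UNIV. upm h T v s) = 1"
    "v \<in> T \<Longrightarrow> v \<noteq> [] \<Longrightarrow> upm h T v s = BP w b T (upm h T) v s / (\<Sum>r\<in>UNIV. BP w b T (upm h T) v r)"
proof -
  assume v: "v \<in> T" "v \<noteq> []"
  have e: "butlast v \<in> T" "tadj v (butlast v)" using utree_butlast[OF T v(1)] tadj_butlast[OF v(2)] by auto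
  show "0 \<le> upm h T v s" "(\<Sum>s\<in>UNIV. upm h T v s) = 1"
    using is_messageD(2,3)[OF h T v(1) e] by (auto simp: upm_def)
  show "upm h T v s = BP w b T (upm h T) v s / (\<Sum>r\<in>UNIV. BP w b T (upm h T) v r)"
    using bp[OF v(1) e] unfolding bp_fixed_at_def bp_rhs_Br w[symmetric] Br_up[OF T v] by (simp add: upm_def)
qed

text \<open>Depth l carries the iterate of index n + 1 - l: each level is then the update of the
  next one, and depth n + 1 carries the uniform message. This makes the iterates one solution of the
  recursion up to depth n.\<close>

lemma messages_hmsg:
  assumes T: "utree T" and v: "v \<in> T" "v \<noteq> []" "length v \<le> Suc n"
  defines "m \<equiv> \<lambda>v. hmsg w b (Suc n - length v) T v (butlast v)"
  shows "0 \<le> m v s" "(\<Sum>s\<in>UNIV. m v s) = 1"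
    "length v \<le> n \<Longrightarrow> m v s = BP w b T m v s / (\<Sum>r\<in>UNIV. BP w b T m v r)"
proof -
  have e: "butlast v \<in> T" "tadj v (butlast v)" using utree_butlast[OF T v(1)] tadj_butlast[OF v(2)] by auto
  show "0 \<le> m v s" "(\<Sum>s\<in>UNIV. m v s) = 1"
    using hmsg_prob[OF T v(1) e] by (auto simp: m_def)
  assume "length v \<le> n"
  then have n: "Suc n - length v = Suc (n - length v)" by simp
  have "BP w b T (upm (hmsg w b (n - length v)) T) v s = BP w b T m v s" for s
    unfolding BP_def upm_def m_def by (intro arg_cong2[where f="(*)" and a="b s"] prod.cong refl) (auto simp: kids_def)
  then show "m v s = BP w b T m v s / (\<Sum>r\<in>UNIV. BP w b T m v r)"
    by (simp add: m_def n Br_up[OF T v(1,2)])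
qed

lemma root_nbr: "i \<in> nbrs T [] \<Longrightarrow> i \<in> T \<and> i \<noteq> [] \<and> length i = 1 \<and> butlast i = []"
  by (auto simp: nbrs_def tadj_def)

text \<open>The iterate of index n + 1 at the root edges belongs to a system of level n + 1.
  Decorrelation makes the star marginals of these systems a Cauchy sequence, and
  \<open>edgeA\<close> recovers the message from them with denominators bounded below.\<close>

lemma hmsg_convergent:
  assumes T: "utree T" and u: "\<exists>!\<nu>. \<nu> \<in> gibbs \<psi> \<psi>b \<beta> B T" and w: "w = \<psi> \<beta>" "b = \<psi>b B" and i: "i \<in> nbrs T []"
  shows "convergent (\<lambda>n. hmsg w b n T i [] s)"
proof -
  define m where "m = (\<lambda>n v. hmsg w b (Suc (Suc n) - length v) T v (butlast v))"
  define q where "q = (\<lambda>n. gq w b T (m n))"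
  have mv: "0 \<le> m n v s" "(\<Sum>s\<in>UNIV. m n v s) = 1" if "v \<in> T" "v \<noteq> []" "length v \<le> Suc (Suc n)" for n v s
    using messages_hmsg[OF T that] by (auto simp: m_def)
  have mb: "m n v s = BP w b T (m n) v s / (\<Sum>r\<in>UNIV. BP w b T (m n) v r)" if "v \<in> T" "v \<noteq> []" "length v \<le> Suc n" for n v s
    using messages_hmsg(3)[OF T that(1,2), of "Suc n"] that by (simp add: m_def)
  have d: "dsys w b T (Suc n) (q n)" "0 < Zst w b T (m n)"
    "\<omega> \<in> conf T (Suc 0) \<Longrightarrow> q n (Suc 0, \<omega>) = St w b T (m n) \<omega> / Zst w b T (m n)" for n \<omega>
    unfolding q_def using dsys_messages[of T "Suc n" "m n", OF T mv mb] by auto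
  have cq: "convergent (\<lambda>n. q n (Suc 0, \<omega>))" if \<omega>: "\<omega> \<in> conf T (Suc 0)" for \<omega>
    unfolding Cauchy_convergent_iff[symmetric] Cauchy_iff
  proof (intro allI impI)
    fix e :: real assume "0 < e"
    from decorrelation_all[OF T u w this, of "Suc 0"] obtain N where
      N: "\<And>m q q'. N \<le> m \<Longrightarrow> dsys w b T m q \<Longrightarrow> dsys w b T m q' \<Longrightarrow> \<bar>q (Suc 0, \<omega>) - q' (Suc 0, \<omega>)\<bar> < e"
      using \<omega> by blast
    \<comment> \<open>All later systems are also systems of the one level N, and there decorrelation
      compares them.\<close>
    have dN: "dsys w b T N (q n)" if "N \<le> n" for n using dsys_antimono[OF d(1)[of n], of N] that by simp
    show "\<exists>M. \<forall>m\<ge>M. \<forall>n\<ge>M. norm (q m (Suc 0, \<omega>) - q n (Suc 0, \<omega>)) < e"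
      using N[OF order_refl dN dN] by auto
  qed
  let ?A = "\<lambda>n s. edgeA T (q n) i s"
  have cA: "convergent (\<lambda>n. ?A n s)" for s
  proof -
    have "convergent (\<lambda>n. \<Sum>\<omega>\<in>conf T (Suc 0). q n (Suc 0, \<omega>) * (if \<omega> [] = sp \<and> \<omega> i = s then 1 else 0))"
      by (rule convergent_finite_sum) (rule convergent_mult[OF cq convergent_const])
    then obtain L where "(\<lambda>n. \<Sum>\<omega>\<in>conf T (Suc 0). q n (Suc 0, \<omega>) * (if \<omega> [] = sp \<and> \<omega> i = s then 1 else 0)) \<longlonglongrightarrow> L"
      unfolding convergent_def by blast
    moreover have "w sp s \<noteq> 0" using w_sp'[of s] by simp
    ultimately show ?thesis
      unfolding edgeA_def convergent_def by (intro exI[of _ "L / w sp s"] tendsto_divide tendsto_const)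
  qed
  have ix: "i \<in> T" "i \<noteq> []" "length i = 1" "butlast i = []" using root_nbr[OF i] by auto
  have E: "m n i s = ?A n s / (\<Sum>r\<in>UNIV. ?A n r)"
    "b sp * wmin ^ (card (nbrs T []) - 1) / ((\<Sum>a\<in>UNIV. b a) * wmax ^ card (nbrs T [])) \<le> (\<Sum>r\<in>UNIV. ?A n r)" for n s
    using edgeA_messages[OF T i, of "m n" "q n"] d mv root_nbr by auto
  let ?k = "b sp * wmin ^ (card (nbrs T []) - 1) / ((\<Sum>a\<in>UNIV. b a) * wmax ^ card (nbrs T []))"
  have "0 < wmax" using w_sp[of sp] w_le[of sp sp] by linarith
  then have k: "0 < ?k" using wmin_pos b_pos by (auto intro!: divide_pos_pos mult_pos_pos sum_pos)
  have "convergent (\<lambda>n. \<Sum>r\<in>UNIV. ?A n r)" by (rule convergent_finite_sum) (rule cA)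
  then obtain K where K: "(\<lambda>n. \<Sum>r\<in>UNIV. ?A n r) \<longlonglongrightarrow> K" by (auto simp: convergent_def)
  have "?k \<le> K" by (rule LIMSEQ_le_const[OF K]) (use E(2) in auto)
  then have "K \<noteq> 0" using k by linarith
  obtain L where "(\<lambda>n. ?A n s) \<longlonglongrightarrow> L" using cA by (auto simp: convergent_def)
  from tendsto_divide[OF this K \<open>K \<noteq> 0\<close>] have "convergent (\<lambda>n. m n i s)" unfolding E(1) by (auto simp: convergent_def)
  then have "convergent (\<lambda>n. hmsg w b (n + 1) T i [] s)" using ix by (simp add: m_def)
  then show ?thesis using convergent_ignore_initial_segment[of "\<lambda>n. hmsg w b n T i [] s" 1] by simp
qed

text \<open>Each solution yields a system valid at all levels; these coincide on the star, and the
  edge message is a function of the star marginal.\<close>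

lemma fixed_point_unique:
  assumes T: "utree T" and u: "\<exists>!\<nu>. \<nu> \<in> gibbs \<psi> \<psi>b \<beta> B T" and w: "w = \<psi> \<beta>" "b = \<psi>b B" and i: "i \<in> nbrs T []"
    and h: "is_message h" "\<And>x y. x \<in> T \<Longrightarrow> y \<in> T \<Longrightarrow> tadj x y \<Longrightarrow> bp_fixed_at \<psi> \<psi>b \<beta> B h T x y"
    and h': "is_message h'" "\<And>x y. x \<in> T \<Longrightarrow> y \<in> T \<Longrightarrow> tadj x y \<Longrightarrow> bp_fixed_at \<psi> \<psi>b \<beta> B h' T x y"
  shows "h T i [] s = h' T i [] s"
proof -
  have ix: "butlast i = []" using root_nbr[OF i] by auto
  note m = messages_upm[OF T h w] and m' = messages_upm[OF T h' w]
  let ?q = "gq w b T (upm h T)" and ?q' = "gq w b T (upm h' T)"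
  have d: "dsys w b T (Suc n) ?q" "0 < Zst w b T (upm h T)"
    "\<omega> \<in> conf T (Suc 0) \<Longrightarrow> ?q (Suc 0, \<omega>) = St w b T (upm h T) \<omega> / Zst w b T (upm h T)" for n \<omega>
    using dsys_messages[of T "Suc n" "upm h T", OF T m(1,2,3)] by auto
  have d': "dsys w b T (Suc n) ?q'" "0 < Zst w b T (upm h' T)"
    "\<omega> \<in> conf T (Suc 0) \<Longrightarrow> ?q' (Suc 0, \<omega>) = St w b T (upm h' T) \<omega> / Zst w b T (upm h' T)" for n \<omega>
    using dsys_messages[of T "Suc n" "upm h' T", OF T m'(1,2,3)] by auto
  have "?q (Suc 0, \<omega>) = ?q' (Suc 0, \<omega>)" if "\<omega> \<in> conf T (Suc 0)" for \<omega>
    by (rule dsys_unique[OF T u w _ _ that]) (rule dsys_antimono[OF d(1) le_SucI[OF order_refl]], rule dsys_antimono[OF d'(1) le_SucI[OF order_refl]])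
  then have A: "edgeA T ?q i s = edgeA T ?q' i s" for s unfolding edgeA_def by simp
  have "upm h T i s = edgeA T ?q i s / (\<Sum>r\<in>UNIV. edgeA T ?q i r)"
    by (rule edgeA_messages(1)[OF T i _ _ d(3) d(2)]) (use m root_nbr in auto)
  moreover have "upm h' T i s = edgeA T ?q' i s / (\<Sum>r\<in>UNIV. edgeA T ?q' i r)"
    by (rule edgeA_messages(1)[OF T i _ _ d'(3) d'(2)]) (use m' root_nbr in auto)
  ultimately show ?thesis unfolding A by (simp add: upm_def ix)
qed

lemma is_message_hlim: "is_message (hlim w b)"
  unfolding is_message_def
proof (intro conjI allI impI)
  show "(\<lambda>T. hlim w b T x y s) \<in> borel_measurable treeM" for x y s
  proof -
    have [measurable]: "(\<lambda>T. hmsg w b n T x y s) \<in> borel_measurable treeM" for n s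
      by (rule is_messageD(1)[OF is_message_hmsg])
    have [measurable]: "Measurable.pred treeM (\<lambda>T. convergent (\<lambda>n. hmsg w b n T x y s))" for s
      by (rule measurable_convergent) measurable
    have [measurable]: "(\<lambda>T. lim (\<lambda>n. hmsg w b n T x y s)) \<in> borel_measurable treeM"
      by (rule borel_measurable_lim_metric) measurable
    show ?thesis unfolding hlim_def by measurable
  qed
  fix T x y assume a: "utree T \<and> x \<in> T \<and> y \<in> T \<and> tadj x y"
  then have p: "0 \<le> hmsg w b n T x y s" "(\<Sum>s\<in>UNIV. hmsg w b n T x y s) = 1" for n s using hmsg_prob[of T x y n] by auto
  have "(\<forall>s. 0 \<le> hlim w b T x y s) \<and> (\<Sum>s\<in>UNIV. hlim w b T x y s) = 1"
  proof (cases "\<forall>s. convergent (\<lambda>n. hmsg w b n T x y s)")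
    case True
    then have L: "(\<lambda>n. hmsg w b n T x y s) \<longlonglongrightarrow> hlim w b T x y s" for s
      by (simp add: hlim_def convergent_LIMSEQ_iff)
    have "0 \<le> hlim w b T x y s" for s by (rule LIMSEQ_le_const[OF L]) (use p in auto)
    moreover have "(\<lambda>n. \<Sum>s\<in>UNIV. hmsg w b n T x y s) \<longlonglongrightarrow> (\<Sum>s\<in>UNIV. hlim w b T x y s)"
      by (intro tendsto_sum L)
    then have "(\<Sum>s\<in>UNIV. hlim w b T x y s) = 1" by (simp add: p LIMSEQ_const_iff)
    ultimately show ?thesis by simp
  next
    case False
    then show ?thesis unfolding hlim_def by (subst (1 2) if_not_P[OF False]) simp
  qed
  then show "0 \<le> hlim w b T x y s" "(\<Sum>s\<in>UNIV. hlim w b T x y s) = 1" for s by auto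
next
  fix T T' x y x' y'
  assume a: "utree T \<and> utree T' \<and> x \<in> T \<and> y \<in> T \<and> tadj x y \<and> x' \<in> T' \<and> y' \<in> T' \<and> riso2 T tadj x y T' tadj x' y'"
  then have "hmsg w b n T x y s = hmsg w b n T' x' y' s" for n s
    by (intro is_messageD(4)[OF is_message_hmsg]) auto
  then show "hlim w b T x y = hlim w b T' x' y'" by (intro ext) (simp add: hlim_def)
qed

text \<open>Convergence is obtained at edges into the root and has to be spread to all edges, since
  the recursion at such an edge reads messages from one step further out. The limit then solves the
  recursion, and any competitor agrees with it tree by tree.\<close>

lemma singleton_fixed_point:
  assumes "tree_law \<mu>" and w: "w = \<psi> \<beta>" "b = \<psi>b B" and u: "uniq \<psi> \<psi>b \<mu> \<beta> B"
  shows "singleton_mod_null \<mu> (Hstar \<psi> \<psi>b \<mu> \<beta> B)"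
proof -
  interpret tree_law \<mu> by fact
  let ?c = "\<lambda>T x y. \<forall>s. convergent (\<lambda>n. hmsg w b n T x y s)"
  have up: "AE_up \<mu> ?c"
    using u AE_utree unfolding AE_up_def uniq_def
  proof eventually_elim
    case (elim T)
    have "[i] \<in> T \<Longrightarrow> [i] \<in> nbrs T []" for i by (simp add: nbrs_def tadj_def)
    then show ?case using hmsg_convergent[OF elim(2,1) w] by blast
  qed
  have "AE T in \<mu>. \<forall>x\<in>T. \<forall>y\<in>T. tadj x y \<longrightarrow> ?c T x y"
  proof (rule AE_up_all_edges[OF _ _ up])
    have [measurable]: "(\<lambda>T. hmsg w b n T x y s) \<in> borel_measurable treeM" for n x y s
      by (rule is_messageD(1)[OF is_message_hmsg])
    have [measurable]: "Measurable.pred treeM (\<lambda>T. convergent (\<lambda>n. hmsg w b n T x y s))" for x y s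
      by (rule measurable_convergent) measurable
    show "Measurable.pred treeM (\<lambda>T. ?c T x y)" for x y by measurable
    fix T T' x y x' y'
    assume a: "utree T" "utree T'" "x \<in> T" "y \<in> T" "x' \<in> T'" "y' \<in> T'" "tadj x y" "riso2 T tadj x y T' tadj x' y'" "?c T x y"
    have "hmsg w b n T x y s = hmsg w b n T' x' y' s" for n s
      by (rule is_messageD(4)[OF is_message_hmsg]) (use a in auto)
    then show "?c T' x' y'" using a by simp
  qed
  then have bp: "AE_up \<mu> (bp_fixed_at \<psi> \<psi>b \<beta> B (hlim w b))"
    using AE_utree unfolding AE_up_def
  proof eventually_elim
    case (elim T)
    show ?case
    proof (intro allI impI)
      fix i assume "[i] \<in> T"
      have L: "(\<lambda>n. hmsg w b n T x y s) \<longlonglongrightarrow> hlim w b T x y s" if "x \<in> T" "y \<in> T" "tadj x y" for x y s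
        using elim(1) that by (simp add: hlim_def convergent_LIMSEQ_iff)
      have Br: "(\<lambda>n. Br w b (hmsg w b n) T [i] [] s) \<longlonglongrightarrow> Br w b (hlim w b) T [i] [] s" for s
        unfolding Br_def by (intro tendsto_mult tendsto_const tendsto_prod tendsto_sum L) (auto simp: nbrs_mem \<open>[i] \<in> T\<close>)
      \<comment> \<open>The limiting messages are probability vectors, so the permissive spin keeps
        the limiting normaliser positive and the quotients converge.\<close>
      have pos: "0 < (\<Sum>s\<in>UNIV. Br w b (hlim w b) T [i] [] s)"
        by (rule Br_sp_pos(2)) (use is_messageD(2,3)[OF is_message_hlim elim(2)] nbrs_mem \<open>[i] \<in> T\<close> in auto)
      have t: "[] \<in> T" "tadj [i] []" using utreeD(1)[OF elim(2)] by (auto simp: tadj_def)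
      have "(\<lambda>n. hmsg w b (Suc n) T [i] [] s) \<longlonglongrightarrow> Br w b (hlim w b) T [i] [] s / (\<Sum>s\<in>UNIV. Br w b (hlim w b) T [i] [] s)" for s
        unfolding hmsg.simps by (intro tendsto_divide tendsto_sum Br) (use pos in auto)
      then have "hlim w b T [i] [] s = Br w b (hlim w b) T [i] [] s / (\<Sum>s\<in>UNIV. Br w b (hlim w b) T [i] [] s)" for s
        using LIMSEQ_Suc[OF L[OF \<open>[i] \<in> T\<close> t]] LIMSEQ_unique by blast
      then show "bp_fixed_at \<psi> \<psi>b \<beta> B (hlim w b) T [i] []"
        using pos unfolding bp_fixed_at_def bp_rhs_Br w[symmetric] by blast
    qed
  qed
  have H: "hlim w b \<in> Hstar \<psi> \<psi>b \<mu> \<beta> B" using bp is_message_hlim by (simp add: Hstar_def)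
  show ?thesis unfolding singleton_mod_null_def
  proof (intro bexI[OF _ H] ballI)
    fix h' assume h': "h' \<in> Hstar \<psi> \<psi>b \<mu> \<beta> B"
    show "AE_up \<mu> (\<lambda>T x y. \<forall>s. h' T x y s = hlim w b T x y s)"
      using Hstar_all_edges[OF H] Hstar_all_edges[OF h'] u AE_utree unfolding AE_up_def uniq_def
    proof eventually_elim
      case (elim T)
      have "[i] \<in> T \<Longrightarrow> [i] \<in> nbrs T []" for i by (simp add: nbrs_def tadj_def)
      then show ?case
        using fixed_point_unique[OF elim(4,3) w, where h=h' and h'="hlim w b"] elim(1,2) h' is_message_hlim
        by (auto simp: Hstar_def)
    qed
  qed
qed

end

section \<open>Local weights on finite graphs\<close>

text \<open>Balls grown inside a given vertex set, over an arbitrary vertex type: balls of graphs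
  and of trees are both of this form, so one isomorphism lemma covers them.\<close>

fun gb :: "('v \<Rightarrow> 'v \<Rightarrow> bool) \<Rightarrow> 'v set \<Rightarrow> 'v \<Rightarrow> nat \<Rightarrow> 'v set" where
  "gb adj V r 0 = {r}"
| "gb adj V r (Suc k) = gb adj V r k \<union> {v \<in> V. \<exists>u\<in>gb adj V r k. adj u v}"

lemma gb_subset: "r \<in> V \<Longrightarrow> gb adj V r k \<subseteq> V"
  by (induction k) auto

lemma giso_gb:
  assumes f: "giso f V adj V' adj'" and r: "r \<in> V"
  shows "f ` gb adj V r k = gb adj' V' (f r) k"
proof (induction k)
  case (Suc k)
  have s: "gb adj V r k \<subseteq> V" by (rule gb_subset[OF r])
  have "f ` {v \<in> V. \<exists>u\<in>gb adj V r k. adj u v} = {v \<in> V'. \<exists>u\<in>f ` gb adj V r k. adj' u v}"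
  proof (intro equalityI subsetI)
    fix v assume "v \<in> f ` {v \<in> V. \<exists>u\<in>gb adj V r k. adj u v}"
    then obtain v0 u where v: "v0 \<in> V" "v = f v0" "u \<in> gb adj V r k" "adj u v0" by auto
    then have "adj' (f u) v" using s f by (auto simp: giso_def)
    then show "v \<in> {v \<in> V'. \<exists>u\<in>f ` gb adj V r k. adj' u v}" using v giso_mem[OF f] by auto
  next
    fix v assume "v \<in> {v \<in> V'. \<exists>u\<in>f ` gb adj V r k. adj' u v}"
    then obtain u where u: "v \<in> V'" "u \<in> gb adj V r k" "adj' (f u) v" by auto
    then obtain v0 where v0: "v0 \<in> V" "v = f v0" using f by (auto simp: giso_def bij_betw_def)
    then have "adj u v0" using u s f by (auto simp: giso_def)
    then show "v \<in> f ` {v \<in> V. \<exists>u\<in>gb adj V r k. adj u v}" using v0 u by auto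
  qed
  then show ?case by (simp add: Suc.IH image_Un)
qed simp

lemma gball_mono: "k \<le> t \<Longrightarrow> gball G i k \<subseteq> gball G i t"
  by (induction t) (auto simp: le_Suc_eq)

lemma gball_gb: "k \<le> t \<Longrightarrow> gball G i k = gb G (gball G i t) i k"
proof (induction k)
  case (Suc k)
  have "{v. \<exists>u\<in>gball G i k. G u v} \<subseteq> gball G i t" using gball_mono[OF Suc.prems, of G i] by auto
  then show ?case using Suc by auto
qed simp

lemma tball_gb: "utree T \<Longrightarrow> tball T k = gb tadj T [] k"
proof (induction k)
  case 0
  then show ?case by (simp add: tball_0)
next
  case (Suc k)
  have "{v \<in> T. \<exists>u\<in>tball T k. tadj u v} \<subseteq> tball T (Suc k)" by (auto simp: tball_def tadj_def)
  moreover have "lev T (Suc k) \<subseteq> {v \<in> T. \<exists>u\<in>tball T k. tadj u v}"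
    unfolding lev_Suc[OF Suc.prems] by (auto simp: lev_def kids_def tball_def tadj_def)
  ultimately show ?case using Suc by (auto simp: tball_Suc)
qed

lemma graph_gball_subset: "graph_on n G \<Longrightarrow> i < n \<Longrightarrow> gball G i k \<subseteq> {..<n}"
  by (induction k) (auto simp: graph_on_def)

lemma utree_tball: "utree T \<Longrightarrow> utree (tball T t)"
proof -
  assume T: "utree T"
  have "finite {i. u @ [i] \<in> tball T t}" if "u \<in> tball T t" for u
    by (rule finite_subset[OF _ utreeD(4)[OF T, of u]]) (use that in \<open>auto simp: tball_def\<close>)
  moreover have "u @ [j] \<in> tball T t" if "u @ [i] \<in> tball T t" "j < i" for u i j
    using utreeD(3)[OF T, of u i j] that by (auto simp: tball_def)
  moreover have "u \<in> tball T t" if "u @ [i] \<in> tball T t" for u i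
    using utreeD(2)[OF T, of u i] that by (auto simp: tball_def)
  moreover have "[] \<in> tball T t" by (rule Nil_in_tball[OF T])
  ultimately show ?thesis unfolding utree_def by blast
qed

text \<open>Each undirected edge is counted in both directions with the weight sqrt w, which avoids
  choosing an orientation.\<close>

definition epairs :: "'v set \<Rightarrow> ('v \<Rightarrow> 'v \<Rightarrow> bool) \<Rightarrow> 'v set \<Rightarrow> ('v \<times> 'v) set" where
  "epairs V adj I = {(u, v). u \<in> V \<and> v \<in> V \<and> adj u v \<and> (u \<in> I \<or> v \<in> I)}"

definition glw :: "('x \<Rightarrow> 'x \<Rightarrow> real) \<Rightarrow> ('x \<Rightarrow> real) \<Rightarrow> 'v set \<Rightarrow> ('v \<Rightarrow> 'v \<Rightarrow> bool) \<Rightarrow> 'v set \<Rightarrow> ('v \<Rightarrow> 'x) \<Rightarrow> real" where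
  "glw w b V adj I \<sigma> = (\<Prod>(u, v)\<in>epairs V adj I. sqrt (w (\<sigma> u) (\<sigma> v))) * (\<Prod>i\<in>I. b (\<sigma> i))"

text \<open>c and d are the vertex and edge parts of a logarithmic derivative. Each endpoint takes
  half of an edge, so the sum over all vertices of a graph counts every edge once.\<close>

definition obs :: "('x \<Rightarrow> real) \<Rightarrow> ('x \<Rightarrow> 'x \<Rightarrow> real) \<Rightarrow> 'v set \<Rightarrow> ('v \<Rightarrow> 'v \<Rightarrow> bool) \<Rightarrow> 'v \<Rightarrow> ('v \<Rightarrow> 'x) \<Rightarrow> real" where
  "obs c d V adj r \<sigma> = c (\<sigma> r) + 1/2 * (\<Sum>j\<in>{j\<in>V. adj r j}. d (\<sigma> r) (\<sigma> j))"

definition gnum where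
  "gnum w b c d V adj I r \<eta> = (\<Sum>\<sigma>\<in>PiE I (\<lambda>_. UNIV). glw w b V adj I (glue I \<sigma> \<eta>) * obs c d V adj r (glue I \<sigma> \<eta>))"

definition gden where
  "gden w b V adj I \<eta> = (\<Sum>\<sigma>\<in>PiE I (\<lambda>_. UNIV). glw w b V adj I (glue I \<sigma> \<eta>))"

lemma glw_cong: "I \<subseteq> V \<Longrightarrow> (\<And>v. v \<in> V \<Longrightarrow> \<sigma> v = \<sigma>' v) \<Longrightarrow> glw w b V adj I \<sigma> = glw w b V adj I \<sigma>'"
  unfolding glw_def by (intro arg_cong2[where f="(*)"] prod.cong refl) (auto simp: epairs_def)

lemma obs_cong: "r \<in> V \<Longrightarrow> (\<And>v. v \<in> V \<Longrightarrow> \<sigma> v = \<sigma>' v) \<Longrightarrow> obs c d V adj r \<sigma> = obs c d V adj r \<sigma>'"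
  unfolding obs_def by (auto intro!: sum.cong)

lemma glw_iso:
  assumes f: "giso f V adj V' adj'" and I: "I \<subseteq> V"
  shows "glw w b V adj I (\<omega> \<circ> f) = glw w b V' adj' (f ` I) \<omega>"
proof -
  have inj: "inj_on f V" using giso_inj[OF f] .
  have fI: "f u \<in> f ` I \<longleftrightarrow> u \<in> I" if "u \<in> V" for u using inj that I by (auto simp: inj_on_def)
  have "bij_betw (map_prod f f) (epairs V adj I) (epairs V' adj' (f ` I))"
  proof (rule bij_betw_imageI)
    show "inj_on (map_prod f f) (epairs V adj I)"
      using inj by (auto simp: inj_on_def epairs_def)
    show "map_prod f f ` epairs V adj I = epairs V' adj' (f ` I)"
    proof (intro equalityI subsetI)
      fix p assume "p \<in> map_prod f f ` epairs V adj I"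
      then show "p \<in> epairs V' adj' (f ` I)" using f giso_mem[OF f] by (auto simp: epairs_def giso_def)
    next
      fix p assume "p \<in> epairs V' adj' (f ` I)"
      then obtain u v where p: "p = (u, v)" "u \<in> V'" "v \<in> V'" "adj' u v" "u \<in> f ` I \<or> v \<in> f ` I" by (auto simp: epairs_def)
      then obtain u0 v0 where uv: "u0 \<in> V" "v0 \<in> V" "u = f u0" "v = f v0" using f by (auto simp: giso_def bij_betw_def)
      then have "(u0, v0) \<in> epairs V adj I" using p f fI by (auto simp: epairs_def giso_def)
      then show "p \<in> map_prod f f ` epairs V adj I" using p uv by force
    qed
  qed
  then have "(\<Prod>(u, v)\<in>epairs V' adj' (f ` I). sqrt (w (\<omega> u) (\<omega> v))) = (\<Prod>(u, v)\<in>epairs V adj I. sqrt (w (\<omega> (f u)) (\<omega> (f v))))"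
    by (subst prod.reindex_bij_betw[symmetric]) (auto simp: case_prod_beta)
  moreover have "(\<Prod>i\<in>f ` I. b (\<omega> i)) = (\<Prod>i\<in>I. b (\<omega> (f i)))"
    using inj_on_subset[OF inj I] by (simp add: prod.reindex)
  ultimately show ?thesis by (simp add: glw_def)
qed

lemma obs_iso:
  assumes f: "giso f V adj V' adj'" and r: "r \<in> V"
  shows "obs c d V adj r (\<omega> \<circ> f) = obs c d V' adj' (f r) \<omega>"
proof -
  have "{j\<in>V'. adj' (f r) j} = f ` {j\<in>V. adj r j}"
  proof (intro equalityI subsetI)
    fix j assume "j \<in> {j\<in>V'. adj' (f r) j}"
    then obtain j0 where "j0 \<in> V" "j = f j0" "adj' (f r) (f j0)" using f by (auto simp: giso_def bij_betw_def)
    then show "j \<in> f ` {j\<in>V. adj r j}" using f r by (auto simp: giso_def)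
  qed (use f r giso_mem[OF f] in \<open>auto simp: giso_def\<close>)
  moreover have "inj_on f {j\<in>V. adj r j}" using giso_inj[OF f] by (auto simp: inj_on_def)
  ultimately show ?thesis by (simp add: obs_def sum.reindex)
qed

lemma g_iso:
  assumes f: "giso f V adj V' adj'" and I: "I \<subseteq> V" and r: "r \<in> V"
  shows "gnum w b c d V adj I r (\<eta> \<circ> f) = gnum w b c d V' adj' (f ` I) (f r) \<eta>"
    "gden w b V adj I (\<eta> \<circ> f) = gden w b V' adj' (f ` I) \<eta>"
proof -
  have inj: "inj_on f V" using giso_inj[OF f] .
  then have injI: "inj_on f I" using I by (rule inj_on_subset)
  have fI: "f u \<in> f ` I \<longleftrightarrow> u \<in> I" if "u \<in> V" for u using inj that I by (auto simp: inj_on_def)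
  have key: "glue I (restrict (\<sigma> \<circ> f) I) (\<eta> \<circ> f) v = (glue (f ` I) \<sigma> \<eta> \<circ> f) v" if "v \<in> V" for \<sigma> :: "'b \<Rightarrow> 'x" and \<eta> v
    using fI[OF that] by (auto simp: glue_def)
  have R: "(\<Sum>\<sigma>\<in>PiE I (\<lambda>_. UNIV :: 'x set). F \<sigma>) = (\<Sum>\<sigma>\<in>PiE (f ` I) (\<lambda>_. UNIV). F (restrict (\<sigma> \<circ> f) I))" for F :: "('a \<Rightarrow> 'x) \<Rightarrow> real"
  proof (rule sum.reindex_bij_witness[where i="\<lambda>\<sigma>. restrict (\<sigma> \<circ> f) I" and j="\<lambda>\<sigma>. restrict (\<sigma> \<circ> inv_into I f) (f ` I)"])
    fix \<sigma> :: "'a \<Rightarrow> 'x" assume s: "\<sigma> \<in> PiE I (\<lambda>_. UNIV)"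
    show e: "restrict (restrict (\<sigma> \<circ> inv_into I f) (f ` I) \<circ> f) I = \<sigma>"
      using s injI by (auto simp: fun_eq_iff PiE_iff extensional_def restrict_def)
    then show "F (restrict (restrict (\<sigma> \<circ> inv_into I f) (f ` I) \<circ> f) I) = F \<sigma>" by simp
  qed (use injI in \<open>auto simp: fun_eq_iff PiE_iff extensional_def restrict_def\<close>)
  show "gnum w b c d V adj I r (\<eta> \<circ> f) = gnum w b c d V' adj' (f ` I) (f r) \<eta>"
    unfolding gnum_def R
    by (intro sum.cong refl arg_cong2[where f="(*)"]; subst glw_iso[OF f I, symmetric] obs_iso[OF f r, symmetric])
       (auto intro!: glw_cong[OF I] obs_cong[OF r] key)
  show "gden w b V adj I (\<eta> \<circ> f) = gden w b V' adj' (f ` I) \<eta>"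
    unfolding gden_def R
    by (intro sum.cong refl; subst glw_iso[OF f I, symmetric]) (auto intro!: glw_cong[OF I] key)
qed

lemma g_cong:
  assumes I: "I \<subseteq> V" and r: "r \<in> V" and e: "\<And>v. v \<in> V - I \<Longrightarrow> \<eta> v = \<eta>' v"
  shows "gnum w b c d V adj I r \<eta> = gnum w b c d V adj I r \<eta>'" "gden w b V adj I \<eta> = gden w b V adj I \<eta>'"
proof -
  have "glue I \<sigma> \<eta> v = glue I \<sigma> \<eta>' v" if "v \<in> V" for v \<sigma> using e that by (auto simp: glue_def)
  then show "gnum w b c d V adj I r \<eta> = gnum w b c d V adj I r \<eta>'" "gden w b V adj I \<eta> = gden w b V adj I \<eta>'"
    unfolding gnum_def gden_def by (auto intro!: sum.cong arg_cong2[where f="(*)"] glw_cong[OF I] obs_cong[OF r])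
qed

text \<open>Extreme values of the root observable over all boundary conditions outside the ball of
  radius n.\<close>

definition hiv where
  "hiv w b c d \<tau> n = Max ((\<lambda>\<eta>. gnum w b c d \<tau> tadj (tball \<tau> n) [] \<eta> / gden w b \<tau> tadj (tball \<tau> n) \<eta>) ` PiE (\<tau> - tball \<tau> n) (\<lambda>_. UNIV))"

lemma hiv_ge:
  fixes \<eta> :: "nat list \<Rightarrow> 'x::finite"
  assumes T: "utree \<tau>" and fin: "finite \<tau>"
  shows "gnum w b c d \<tau> tadj (tball \<tau> n) [] \<eta> / gden w b \<tau> tadj (tball \<tau> n) \<eta> \<le> hiv w b c d \<tau> n"
proof -
  have s: "tball \<tau> n \<subseteq> \<tau>" "[] \<in> \<tau>" using utreeD(1)[OF T] by (auto simp: tball_def)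
  let ?\<eta> = "restrict \<eta> (\<tau> - tball \<tau> n)"
  have "gnum w b c d \<tau> tadj (tball \<tau> n) [] \<eta> = gnum w b c d \<tau> tadj (tball \<tau> n) [] ?\<eta>" "gden w b \<tau> tadj (tball \<tau> n) \<eta> = gden w b \<tau> tadj (tball \<tau> n) ?\<eta>"
    by (rule g_cong[OF s]; simp)+
  then show ?thesis unfolding hiv_def
    by (intro Max_ge) (auto intro!: finite_imageI finite_PiE fin)
qed

lemma hiv_attained:
  fixes w :: "'x::finite \<Rightarrow> 'x \<Rightarrow> real"
  assumes fin: "finite \<tau>"
  obtains \<eta> where "hiv w b c d \<tau> n = gnum w b c d \<tau> tadj (tball \<tau> n) [] \<eta> / gden w b \<tau> tadj (tball \<tau> n) \<eta>"
proof -
  have "hiv w b c d \<tau> n \<in> (\<lambda>\<eta>. gnum w b c d \<tau> tadj (tball \<tau> n) [] \<eta> / gden w b \<tau> tadj (tball \<tau> n) \<eta>) ` PiE (\<tau> - tball \<tau> n) (\<lambda>_. UNIV :: 'x set)"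
    unfolding hiv_def by (rule Max_in) (auto intro!: finite_imageI finite_PiE fin simp: PiE_eq_empty_iff)
  then show ?thesis using that by blast
qed

text \<open>The extremal boundary condition of one tree, transported along the isomorphism, competes
  in the maximum of the other.\<close>

lemma hiv_iso_le:
  fixes w :: "'x::finite \<Rightarrow> 'x \<Rightarrow> real"
  assumes T: "utree \<tau>" "finite \<tau>" "utree \<tau>'" "finite \<tau>'" and r: "riso2 \<tau> tadj [] [] \<tau>' tadj [] []"
  shows "hiv w b c d \<tau> n \<le> (hiv w b c d \<tau>' n :: real)"
proof -
  obtain f where f: "giso f \<tau> tadj \<tau>' tadj" "f [] = []" using r by (auto simp: riso2_giso)
  have s: "tball \<tau> n \<subseteq> \<tau>" "[] \<in> \<tau>" using utreeD(1)[OF T(1)] by (auto simp: tball_def)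
  have fI: "f ` tball \<tau> n = tball \<tau>' n" unfolding tball_gb[OF T(1)] tball_gb[OF T(3)] giso_gb[OF f(1) s(2)] f ..
  obtain \<eta> where \<eta>: "hiv w b c d \<tau> n = gnum w b c d \<tau> tadj (tball \<tau> n) [] \<eta> / gden w b \<tau> tadj (tball \<tau> n) \<eta>"
    by (rule hiv_attained[OF T(2)])
  let ?\<eta> = "\<eta> \<circ> inv_into \<tau> f"
  have e: "\<eta> v = (?\<eta> \<circ> f) v" if "v \<in> \<tau>" for v using giso_inj[OF f(1)] that by simp
  have "gnum w b c d \<tau> tadj (tball \<tau> n) [] \<eta> = gnum w b c d \<tau>' tadj (tball \<tau>' n) [] ?\<eta>"
    using g_cong(1)[OF s, of \<eta> "?\<eta> \<circ> f"] e g_iso(1)[OF f(1) s, of w b c d ?\<eta>] by (simp add: fI f)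
  moreover have "gden w b \<tau> tadj (tball \<tau> n) \<eta> = gden w b \<tau>' tadj (tball \<tau>' n) ?\<eta>"
    using g_cong(2)[OF s, of \<eta> "?\<eta> \<circ> f"] e g_iso(2)[OF f(1) s, of w b ?\<eta>] by (simp add: fI f)
  ultimately show ?thesis using hiv_ge[OF T(3,4), of w b c d n ?\<eta>] \<eta> by simp
qed

lemma hiv_iso:
  fixes w :: "'x::finite \<Rightarrow> 'x \<Rightarrow> real"
  assumes T: "utree \<tau>" "finite \<tau>" "utree \<tau>'" "finite \<tau>'" and r: "riso2 \<tau> tadj [] [] \<tau>' tadj [] []"
  shows "hiv w b c d \<tau> n = (hiv w b c d \<tau>' n :: real)"
  using hiv_iso_le[OF T r] hiv_iso_le[OF T(3,4,1,2) riso2_sym[OF r]] utreeD(1)[OF T(1)] by (intro antisym) auto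

section \<open>Bounds for local averages under boundary conditions\<close>

context spin
begin

lemma glw_nn: "0 \<le> glw w b V adj I \<sigma>"
  unfolding glw_def by (intro mult_nonneg_nonneg prod_nonneg) (auto simp: w_nn less_imp_le[OF b_pos])

lemma gden_pos:
  assumes "finite I"
  shows "0 < gden w b V adj I \<eta>"
proof -
  let ?\<sigma> = "restrict (\<lambda>_. sp) I"
  have "0 < glw w b V adj I (glue I ?\<sigma> \<eta>)" unfolding glw_def
    by (intro mult_pos_pos prod_pos) (auto simp: epairs_def glue_def b_pos w_sp w_sp')
  then show ?thesis unfolding gden_def
    by (intro sum_pos2[of _ ?\<sigma>]) (auto intro!: finite_PiE assms glw_nn)
qed

lemma obs_bound:
  assumes "\<And>a. \<bar>c a\<bar> \<le> K" "\<And>a a'. \<bar>d a a'\<bar> \<le> K"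
  shows "\<bar>obs c d V adj r \<sigma>\<bar> \<le> K * (1 + real (card {j\<in>V. adj r j}))"
proof -
  have K: "0 \<le> K" using assms(1)[of undefined] by linarith
  have "\<bar>\<Sum>j\<in>{j\<in>V. adj r j}. d (\<sigma> r) (\<sigma> j)\<bar> \<le> (\<Sum>j\<in>{j\<in>V. adj r j}. \<bar>d (\<sigma> r) (\<sigma> j)\<bar>)" by (rule sum_abs)
  also have "\<dots> \<le> real (card {j\<in>V. adj r j}) * K" by (rule sum_bounded_above) (use assms in auto)
  finally have "\<bar>\<Sum>j\<in>{j\<in>V. adj r j}. d (\<sigma> r) (\<sigma> j)\<bar> \<le> real (card {j\<in>V. adj r j}) * K" .
  moreover have "0 \<le> real (card {j\<in>V. adj r j}) * K" using K by simp
  ultimately show ?thesis unfolding obs_def using assms(1)[of "\<sigma> r"] by (simp add: algebra_simps) 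
qed

lemma ratio_bound:
  assumes "finite I" and cd: "\<And>a. \<bar>c a\<bar> \<le> K" "\<And>a a'. \<bar>d a a'\<bar> \<le> K"
  shows "\<bar>gnum w b c d V adj I r \<eta> / gden w b V adj I \<eta>\<bar> \<le> K * (1 + real (card {j\<in>V. adj r j}))"
proof -
  have "\<bar>gnum w b c d V adj I r \<eta>\<bar> \<le> (\<Sum>\<sigma>\<in>PiE I (\<lambda>_. UNIV). \<bar>glw w b V adj I (glue I \<sigma> \<eta>) * obs c d V adj r (glue I \<sigma> \<eta>)\<bar>)"
    unfolding gnum_def by (rule sum_abs)
  also have "\<dots> \<le> (\<Sum>\<sigma>\<in>PiE I (\<lambda>_. UNIV). glw w b V adj I (glue I \<sigma> \<eta>) * (K * (1 + real (card {j\<in>V. adj r j}))))"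
    unfolding abs_mult using glw_nn by (intro sum_mono mult_mono obs_bound cd) auto
  also have "\<dots> = gden w b V adj I \<eta> * (K * (1 + real (card {j\<in>V. adj r j})))" by (simp add: gden_def sum_distrib_right)
  finally show ?thesis using gden_pos[OF assms(1), of V adj \<eta>] by (simp add: field_simps)
qed

text \<open>In any Gibbs weight on a larger vertex set the root observable is an average over boundary
  conditions of the ball, hence at most the extreme value on an isomorphic tree.\<close>

lemma ball_average:
  assumes A: "finite A" "V \<subseteq> A" and T: "utree \<tau>" "finite \<tau>" and r: "r \<in> V"
    and f: "giso f V adj \<tau> tadj" "f r = []" and I: "I = gb adj V r n"
    and R: "\<And>\<sigma>. 0 \<le> R \<sigma>" "\<And>\<sigma> \<sigma>'. (\<And>v. v \<in> A - I \<Longrightarrow> \<sigma> v = \<sigma>' v) \<Longrightarrow> R \<sigma> = R \<sigma>'"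
  shows "(\<Sum>\<sigma>\<in>PiE A (\<lambda>_. UNIV). glw w b V adj I \<sigma> * R \<sigma> * obs c d V adj r \<sigma>)
    \<le> hiv w b c d \<tau> n * (\<Sum>\<sigma>\<in>PiE A (\<lambda>_. UNIV). glw w b V adj I \<sigma> * R \<sigma>)"
proof -
  have IV: "I \<subseteq> V" unfolding I by (rule gb_subset[OF r])
  have fI: "f ` I = tball \<tau> n" unfolding I giso_gb[OF f(1) r] tball_gb[OF T(1)] f ..
  have AI: "A = I \<union> (A - I)" using IV A by auto
  have fin: "finite I" by (rule finite_subset[OF order_trans[OF IV A(2)] A(1)])
  have split: "(\<Sum>\<sigma>\<in>PiE A (\<lambda>_. UNIV). glw w b V adj I \<sigma> * R \<sigma> * F \<sigma>)
     = (\<Sum>\<zeta>\<in>PiE (A - I) (\<lambda>_. UNIV). R \<zeta> * (\<Sum>\<sigma>\<in>PiE I (\<lambda>_. UNIV). glw w b V adj I (glue I \<sigma> \<zeta>) * F (glue I \<sigma> \<zeta>)))" for F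
  proof -
    have "(\<Sum>\<sigma>\<in>PiE A (\<lambda>_. UNIV). glw w b V adj I \<sigma> * R \<sigma> * F \<sigma>)
      = (\<Sum>\<sigma>\<in>PiE I (\<lambda>_. UNIV). \<Sum>\<zeta>\<in>PiE (A - I) (\<lambda>_. UNIV). glw w b V adj I (glue I \<sigma> \<zeta>) * R (glue I \<sigma> \<zeta>) * F (glue I \<sigma> \<zeta>))"
      using sum_PiE_glue[of I "A - I" "\<lambda>\<sigma>. glw w b V adj I \<sigma> * R \<sigma> * F \<sigma>"] AI by auto
    also have "\<dots> = (\<Sum>\<zeta>\<in>PiE (A - I) (\<lambda>_. UNIV). \<Sum>\<sigma>\<in>PiE I (\<lambda>_. UNIV). glw w b V adj I (glue I \<sigma> \<zeta>) * R (glue I \<sigma> \<zeta>) * F (glue I \<sigma> \<zeta>))"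
      by (rule sum.swap)
    also have "\<dots> = (\<Sum>\<zeta>\<in>PiE (A - I) (\<lambda>_. UNIV). R \<zeta> * (\<Sum>\<sigma>\<in>PiE I (\<lambda>_. UNIV). glw w b V adj I (glue I \<sigma> \<zeta>) * F (glue I \<sigma> \<zeta>)))"
    proof (intro sum.cong refl)
      fix \<zeta>
      have "R (glue I \<sigma> \<zeta>) = R \<zeta>" for \<sigma> by (rule R(2)) (auto simp: glue_def)
      then show "(\<Sum>\<sigma>\<in>PiE I (\<lambda>_. UNIV). glw w b V adj I (glue I \<sigma> \<zeta>) * R (glue I \<sigma> \<zeta>) * F (glue I \<sigma> \<zeta>))
        = R \<zeta> * (\<Sum>\<sigma>\<in>PiE I (\<lambda>_. UNIV). glw w b V adj I (glue I \<sigma> \<zeta>) * F (glue I \<sigma> \<zeta>))"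
        by (simp add: sum_distrib_left mult_ac)
    qed
    finally show ?thesis .
  qed
  \<comment> \<open>For each outside configuration the interior average is, after transport along f,
    bounded by the maximum over boundary conditions of the tree.\<close>
  have le: "gnum w b c d V adj I r \<zeta> \<le> hiv w b c d \<tau> n * gden w b V adj I \<zeta>" for \<zeta>
  proof -
    let ?\<eta> = "\<zeta> \<circ> inv_into V f"
    have e: "\<zeta> v = (?\<eta> \<circ> f) v" if "v \<in> V" for v using giso_inj[OF f(1)] that by simp
    have "gnum w b c d V adj I r \<zeta> = gnum w b c d \<tau> tadj (tball \<tau> n) [] ?\<eta>"
      using g_cong(1)[OF IV r, of \<zeta> "?\<eta> \<circ> f"] e g_iso(1)[OF f(1) IV r, of w b c d ?\<eta>] by (simp add: fI f)
    moreover have "gden w b V adj I \<zeta> = gden w b \<tau> tadj (tball \<tau> n) ?\<eta>"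
      using g_cong(2)[OF IV r, of \<zeta> "?\<eta> \<circ> f"] e g_iso(2)[OF f(1) IV r, of w b ?\<eta>] by (simp add: fI f)
    ultimately show ?thesis using hiv_ge[OF T, of w b c d n ?\<eta>] gden_pos[OF fin, of V adj \<zeta>] by (simp add: field_simps)
  qed
  have "(\<Sum>\<sigma>\<in>PiE A (\<lambda>_. UNIV). glw w b V adj I \<sigma> * R \<sigma> * obs c d V adj r \<sigma>) = (\<Sum>\<zeta>\<in>PiE (A - I) (\<lambda>_. UNIV). R \<zeta> * gnum w b c d V adj I r \<zeta>)"
    unfolding split gnum_def ..
  also have "\<dots> \<le> (\<Sum>\<zeta>\<in>PiE (A - I) (\<lambda>_. UNIV). R \<zeta> * (hiv w b c d \<tau> n * gden w b V adj I \<zeta>))"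
    by (intro sum_mono mult_left_mono le R)
  also have "\<dots> = hiv w b c d \<tau> n * (\<Sum>\<sigma>\<in>PiE A (\<lambda>_. UNIV). glw w b V adj I \<sigma> * R \<sigma>)"
    using split[of "\<lambda>_. 1"] by (simp add: gden_def sum_distrib_left mult_ac)
  finally show ?thesis .
qed

end

section \<open>Averages over locally convergent graphs\<close>

text \<open>Expectations over the random graph are therefore finite sums: integrability is automatic
  and derivatives pass inside.\<close>

lemma finite_graph_on: "finite {G. graph_on n G}"
proof (rule finite_imageD)
  have "(\<lambda>G. {(i, j). G i j}) ` {G. graph_on n G} \<subseteq> Pow ({..<n} \<times> {..<n})" by (auto simp: graph_on_def)
  then show "finite ((\<lambda>G. {(i, j). G i j}) ` {G. graph_on n G})" by (rule finite_subset) auto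
  show "inj_on (\<lambda>G. {(i, j). G i j}) {G. graph_on n G}" by (auto simp: inj_on_def fun_eq_iff)
qed

locale lwc_graphs =
  fixes Gn :: "nat \<Rightarrow> (nat \<Rightarrow> nat \<Rightarrow> bool) pmf" and \<mu> :: "nat list set measure"
  assumes lwc: "lwc Gn \<mu>" and deg_int: "integrable \<mu> (\<lambda>T. real (deg T []))"

sublocale lwc_graphs \<subseteq> tree_law \<mu>
  using lwc unfolding lwc_def by (auto simp: tree_law_def tree_law_axioms_def)

lemma deg_tball: "1 \<le> t \<Longrightarrow> deg (tball T t) [] = deg T []"
  unfolding deg_def by (rule arg_cong[where f=card]) (auto simp: nbrs_def tball_def tadj_def)

context lwc_graphs
begin

lemma Gn_graph: "G \<in> set_pmf (Gn n) \<Longrightarrow> graph_on n G"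
  using lwc unfolding lwc_def by blast

lemma finite_Gn: "finite (set_pmf (Gn n))"
  by (rule finite_subset[OF _ finite_graph_on[of n]]) (auto dest: Gn_graph)

lemma integrable_Gn[simp]: "integrable (measure_pmf (Gn n)) (f :: _ \<Rightarrow> real)"
  by (rule integrable_measure_pmf_finite[OF finite_Gn])

abbreviation EG where "EG n f \<equiv> measure_pmf.expectation (Gn n) (f :: (nat \<Rightarrow> nat \<Rightarrow> bool) \<Rightarrow> real)"

lemma EG_mono: "(\<And>G. graph_on n G \<Longrightarrow> f G \<le> g G) \<Longrightarrow> EG n f \<le> EG n g"
  by (intro integral_mono_AE) (auto intro!: AE_pmfI dest: Gn_graph)

lemma sparse:
  assumes "0 < e"
  shows "\<exists>L. eventually (\<lambda>n. EG n (\<lambda>G. (\<Sum>i<n. real (gdeg G n i) * (if gdeg G n i \<ge> L then 1 else 0)) / real n) < e) sequentially"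
proof -
  have "((\<lambda>L::nat. limsup (\<lambda>n. ereal (EG n (\<lambda>G. (\<Sum>i<n. real (gdeg G n i) * (if gdeg G n i \<ge> L then 1 else 0)) / real n)))) \<longlongrightarrow> 0) sequentially"
    using lwc unfolding lwc_def unif_sparse_def by blast
  then have "eventually (\<lambda>L. limsup (\<lambda>n. ereal (EG n (\<lambda>G. (\<Sum>i<n. real (gdeg G n i) * (if gdeg G n i \<ge> L then 1 else 0)) / real n))) < ereal e) sequentially"
    by (rule order_tendstoD) (use assms in simp)
  then obtain L where "limsup (\<lambda>n. ereal (EG n (\<lambda>G. (\<Sum>i<n. real (gdeg G n i) * (if gdeg G n i \<ge> L then 1 else 0)) / real n))) < ereal e"
    by (auto simp: eventually_sequentially)
  from Limsup_lessD[OF this] show ?thesis by auto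
qed

text \<open>Vertices whose neighbourhood falls into finitely many isomorphism classes are handled by
  local convergence. The others contribute at most K times one plus the degree, which uniform
  sparsity controls on the graphs and dominated convergence on the tree. X itself need not be local,
  only dominated by the local function hi.\<close>

lemma lwc_upper:
  assumes t: "1 \<le> t" and K: "0 \<le> K"
    and hi: "\<And>\<tau>. utree \<tau> \<Longrightarrow> finite \<tau> \<Longrightarrow> \<bar>hi \<tau>\<bar> \<le> K * (1 + real (deg \<tau> []))"
    and inv: "\<And>\<tau> \<tau>'. utree \<tau> \<Longrightarrow> finite \<tau> \<Longrightarrow> utree \<tau>' \<Longrightarrow> finite \<tau>' \<Longrightarrow> riso2 \<tau> tadj [] [] \<tau>' tadj [] [] \<Longrightarrow> hi \<tau> = hi \<tau>'"
    and X: "\<And>n G i. graph_on n G \<Longrightarrow> i < n \<Longrightarrow> \<bar>X n G i\<bar> \<le> K * (1 + real (gdeg G n i))"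
    and Xhi: "\<And>n G i \<tau>. graph_on n G \<Longrightarrow> i < n \<Longrightarrow> utree \<tau> \<Longrightarrow> finite \<tau> \<Longrightarrow> riso2 (gball G i t) G i i \<tau> tadj [] [] \<Longrightarrow> X n G i \<le> hi \<tau>"
    and e: "0 < e"
  shows "eventually (\<lambda>n. EG n (\<lambda>G. (\<Sum>i<n. X n G i) / real n) \<le> (\<integral>T. hi (tball T t) \<partial>\<mu>) + e) sequentially"
proof -
  define TT where "TT = {\<tau>. utree \<tau> \<and> finite \<tau>}"
  let ?iso = "\<lambda>\<tau> \<tau>'. riso2 \<tau> tadj ([]::nat list) ([]::nat list) \<tau>' tadj ([]::nat list) ([]::nat list)"
  \<comment> \<open>One chosen representative per isomorphism class of finite rooted trees turns the
    classes into a countable set that finite sets exhaust.\<close>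
  define rep where "rep = (\<lambda>\<tau>. SOME \<tau>'. \<tau>' \<in> TT \<and> ?iso \<tau> \<tau>')"
  have rep: "rep \<tau> \<in> TT" "?iso \<tau> (rep \<tau>)" if "\<tau> \<in> TT" for \<tau>
  proof -
    have "rep \<tau> \<in> TT \<and> ?iso \<tau> (rep \<tau>)" unfolding rep_def
      by (rule someI[of _ \<tau>]) (use that riso2_refl in auto)
    then show "rep \<tau> \<in> TT" "?iso \<tau> (rep \<tau>)" by auto
  qed
  have nil: "[] \<in> \<tau>" if "\<tau> \<in> TT" for \<tau> using that utreeD(1) by (auto simp: TT_def)
  have rep_eq: "rep \<tau> = rep \<tau>'" if "\<tau> \<in> TT" "\<tau>' \<in> TT" "?iso \<tau> \<tau>'" for \<tau> \<tau>'
  proof -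
    have "?iso \<tau> \<sigma> \<longleftrightarrow> ?iso \<tau>' \<sigma>" for \<sigma>
      using riso2_trans[OF that(3), of \<sigma> tadj "[]" "[]"] riso2_trans[OF riso2_sym[OF that(3)], of \<sigma> tadj "[]" "[]"] nil[OF that(1)] by blast
    then show ?thesis by (simp add: rep_def)
  qed
  have rep_rep: "rep (rep \<tau>) = rep \<tau>" if "\<tau> \<in> TT" for \<tau>
    using rep_eq[OF that rep(1)[OF that] rep(2)[OF that]] by simp
  define R where "R = rep ` TT"
  have R: "\<tau> \<in> TT" "rep \<tau> = \<tau>" if "\<tau> \<in> R" for \<tau> using that rep rep_rep by (auto simp: R_def)
  have tT: "tball T s \<in> TT" if "utree T" for T s using utree_tball[OF that] finite_tball[OF that] by (simp add: TT_def)
  have "{[]} \<in> TT" by (auto simp: TT_def utree_def)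
  then have Rne: "R \<noteq> {}" by (auto simp: R_def)
  have cR: "countable R"
    by (rule countable_subset[OF _ countable_Collect_finite]) (use R in \<open>auto simp: TT_def\<close>)
  define F where "F = (\<lambda>m. from_nat_into R ` {..<m::nat})"
  have F: "finite (F m)" "F m \<subseteq> R" for m using from_nat_into[OF Rne] by (auto simp: F_def)
  have Fev: "\<exists>m0. \<forall>m\<ge>m0. \<tau> \<in> F m" if "\<tau> \<in> R" for \<tau>
  proof -
    have "\<tau> \<in> range (from_nat_into R)" using range_from_nat_into[OF Rne cR] that by simp
    then obtain k where "from_nat_into R k = \<tau>" by auto
    then show ?thesis by (intro exI[of _ "Suc k"]) (auto simp: F_def)
  qed
  define Y where "Y = (\<lambda>T. rep (tball T t))"
  have YR: "Y T \<in> R" if "utree T" for T using tT[OF that] by (auto simp: Y_def R_def)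
  have iso_Y: "?iso (tball T t) \<tau> \<longleftrightarrow> Y T = \<tau>" if "utree T" "\<tau> \<in> R" for T \<tau>
    using rep_eq[OF tT[OF that(1)] R(1)[OF that(2)]] R(2)[OF that(2)] rep(2)[OF tT[OF that(1)]] by (auto simp: Y_def)
  have Ym: "Measurable.pred \<mu> (\<lambda>T. P (Y T))" for P
    unfolding Y_def by (rule measurable_\<mu>, rule measurable_via_tball[where g="\<lambda>S. P (rep S)"]) simp
  have Ym'[measurable]: "(\<lambda>T. if P (Y T) then 1 else 0 :: real) \<in> borel_measurable \<mu>" for P
    using Ym[of P] by measurable
  have Dm[measurable]: "(\<lambda>T. real (deg T [])) \<in> borel_measurable \<mu>"
    using deg_int by simp
  have him: "(\<lambda>T. hi (tball T t)) \<in> borel_measurable \<mu>"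
    by (rule measurable_\<mu>, rule measurable_via_tball) simp
  have hi_int: "integrable \<mu> (\<lambda>T. hi (tball T t))"
  proof (rule Bochner_Integration.integrable_bound[of _ "\<lambda>T. K * (1 + real (deg T []))"])
    show "AE T in \<mu>. norm (hi (tball T t)) \<le> norm (K * (1 + real (deg T [])))"
      using AE_utree
    proof eventually_elim
      case (elim T)
      then show ?case using hi[of "tball T t"] tT[OF elim, of t] K deg_tball[OF t] by (simp add: TT_def)
    qed
  qed (use deg_int him in auto)
  define p where "p = (\<lambda>n \<tau>. EG n (\<lambda>G. real (card {i \<in> {0..<n}. riso2 (gball G i t) G i i \<tau> tadj [] []}) / real n))"
  define P where "P = (\<lambda>\<tau>. measure \<mu> {T \<in> space \<mu>. Y T = \<tau>})"
  have pP: "(\<lambda>n. p n \<tau>) \<longlonglongrightarrow> P \<tau>" if "\<tau> \<in> R" for \<tau>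
  proof -
    have ev: "{T \<in> space \<mu>. ?iso (tball T t) \<tau>} = {T \<in> space \<mu>. Y T = \<tau>}" using iso_Y[OF _ that] by (auto simp: space_\<mu>)
    have \<tau>: "utree \<tau> \<and> finite \<tau>" using R(1)[OF that] by (simp add: TT_def)
    have "\<forall>t \<tau>. utree \<tau> \<and> finite \<tau> \<longrightarrow>
        (\<lambda>n. EG n (\<lambda>G. real (card {i \<in> {0..<n}. riso2 (gball G i t) G i i \<tau> tadj [] []}) / real n))
        \<longlonglongrightarrow> measure \<mu> {T \<in> space \<mu>. riso2 (tball T t) tadj [] [] \<tau> tadj [] []}"
      using lwc unfolding lwc_def by (elim conjE)
    from this[rule_format, OF \<tau>, of t] show ?thesis unfolding p_def P_def ev .
  qed
  \<comment> \<open>The tolerance e is spent in quarters; dividing by K + 1 rather than K admits K =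
    0.\<close>
  obtain L :: nat where L: "eventually (\<lambda>n. EG n (\<lambda>G. (\<Sum>i<n. real (gdeg G n i) * (if gdeg G n i \<ge> L then 1 else 0)) / real n) < e / (4 * (K + 1))) sequentially"
    using sparse[of "e / (4 * (K + 1))"] e K by auto
  \<comment> \<open>On classes outside \<open>F m\<close> the function hi is replaced by the cap K *
    (1 + L). The first summand bounds hi from below, the second is the cap.\<close>
  define bad where "bad = (\<lambda>m T. (K * (1 + real (deg T [])) + K * (1 + real L)) * (if Y T \<notin> F m then 1 else 0))"
  have badm: "bad m \<in> borel_measurable \<mu>" for m unfolding bad_def by measurable
  have bad_int: "integrable \<mu> (bad m)" for m
  proof (rule Bochner_Integration.integrable_bound[OF _ badm])
    show "integrable \<mu> (\<lambda>T. K * (1 + real (deg T [])) + K * (1 + real L))" using deg_int by simp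
  qed (use K in \<open>auto simp: bad_def\<close>)
  have "(\<lambda>m. \<integral>T. bad m T \<partial>\<mu>) \<longlonglongrightarrow> (\<integral>T. 0 \<partial>\<mu>)"
  proof (rule integral_dominated_convergence[where w="\<lambda>T. K * (1 + real (deg T [])) + K * (1 + real L)"])
    show "AE T in \<mu>. (\<lambda>m. bad m T) \<longlonglongrightarrow> 0"
      using AE_utree
    proof eventually_elim
      case (elim T)
      obtain m0 where "\<forall>m\<ge>m0. Y T \<in> F m" using Fev[OF YR[OF elim]] by blast
      then have "eventually (\<lambda>m. bad m T = 0) sequentially" unfolding eventually_sequentially by (auto simp: bad_def)
      then show ?case by (rule tendsto_eventually)
    qed
    show "AE T in \<mu>. norm (bad m T) \<le> K * (1 + real (deg T [])) + K * (1 + real L)" for m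
      using K by (auto simp: bad_def)
  qed (use deg_int badm in auto)
  then have "eventually (\<lambda>m. (\<integral>T. bad m T \<partial>\<mu>) < e / 4) sequentially"
    using e by (intro order_tendstoD(2)) auto
  then obtain m where m: "(\<integral>T. bad m T \<partial>\<mu>) < e / 4" by (auto simp: eventually_sequentially)
  let ?F = "F m"
  define S where "S = (\<lambda>n G. (\<Sum>i<n. real (gdeg G n i) * (if gdeg G n i \<ge> L then 1 else 0)) / real n)"
  \<comment> \<open>For a neighbourhood outside the chosen classes, a degree below L is capped by L
    and a degree from L on enters the sparse sum; the proportion of such vertices is one minus the
    proportions of the chosen classes.\<close>
  have up: "EG n (\<lambda>G. (\<Sum>i<n. X n G i) / real n) \<le> (\<Sum>\<tau>\<in>?F. hi \<tau> * p n \<tau>) + K * (1 + real L) * (1 - (\<Sum>\<tau>\<in>?F. p n \<tau>)) + K * EG n (S n)"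
    if n: "0 < n" for n
  proof -
    let ?ind = "\<lambda>G i \<tau>. if riso2 (gball G i t) G i i \<tau> tadj ([]::nat list) [] then 1 else 0 :: real"
    have pt: "X n G i \<le> (\<Sum>\<tau>\<in>?F. hi \<tau> * ?ind G i \<tau>) + K * (1 + real L) * (1 - (\<Sum>\<tau>\<in>?F. ?ind G i \<tau>)) + K * (real (gdeg G n i) * (if gdeg G n i \<ge> L then 1 else 0))"
      if G: "graph_on n G" "i < n" for G i
    proof (cases "\<exists>\<tau>\<in>?F. riso2 (gball G i t) G i i \<tau> tadj [] []")
      case True
      then obtain \<tau>0 where \<tau>0: "\<tau>0 \<in> ?F" "riso2 (gball G i t) G i i \<tau>0 tadj [] []" by blast
      have ii: "i \<in> gball G i t" using gball_mono[of 0 t G i] by simp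
      have ind: "?ind G i \<tau> = (if \<tau> = \<tau>0 then 1 else 0)" if "\<tau> \<in> ?F" for \<tau>
      proof (cases "riso2 (gball G i t) G i i \<tau> tadj [] []")
        case True
        have "?iso \<tau>0 \<tau>" by (rule riso2_trans[OF riso2_sym[OF \<tau>0(2) ii ii] True])
        moreover have "\<tau>0 \<in> R" "\<tau> \<in> R" using F(2) \<tau>0(1) that by auto
        ultimately have "\<tau>0 = \<tau>" using rep_eq[of \<tau>0 \<tau>] R by simp
        then show ?thesis using True by simp
      qed (use \<tau>0(2) in auto)
      have "(\<Sum>\<tau>\<in>?F. hi \<tau> * ?ind G i \<tau>) = (\<Sum>\<tau>\<in>?F. if \<tau> = \<tau>0 then hi \<tau>0 else 0)"
        by (rule sum.cong) (auto simp: ind)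
      moreover have "(\<Sum>\<tau>\<in>?F. ?ind G i \<tau>) = (\<Sum>\<tau>\<in>?F. if \<tau> = \<tau>0 then 1 else 0)"
        by (rule sum.cong) (auto simp: ind)
      moreover have "X n G i \<le> hi \<tau>0" using Xhi[OF G _ _ \<tau>0(2)] R(1) F(2) \<tau>0(1) by (auto simp: TT_def)
      moreover have "0 \<le> K * (real (gdeg G n i) * (if gdeg G n i \<ge> L then 1 else 0))" using K by simp
      ultimately show ?thesis using \<tau>0(1) F(1)
        by (simp only: sum.delta if_True diff_self mult_zero_right add_0_right)
    next
      case False
      then have z: "(\<Sum>\<tau>\<in>?F. hi \<tau> * ?ind G i \<tau>) = 0" "(\<Sum>\<tau>\<in>?F. ?ind G i \<tau>) = 0"
        by (auto intro!: sum.neutral)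
      have "K * real (gdeg G n i) \<le> K * real L" if "\<not> L \<le> gdeg G n i" using K that by (intro mult_left_mono) auto
      then have "K * (1 + real (gdeg G n i)) \<le> K * (1 + real L) + K * (real (gdeg G n i) * (if gdeg G n i \<ge> L then 1 else 0))"
        using K by (cases "L \<le> gdeg G n i") (auto simp: algebra_simps)
      then show ?thesis unfolding z using X[OF G] by (simp add: abs_le_iff)
    qed
    have cnt: "(\<Sum>i<n. ?ind G i \<tau>) = real (card {i \<in> {0..<n}. riso2 (gball G i t) G i i \<tau> tadj [] []})" for G \<tau>
      by (simp add: sum.If_cases Int_def lessThan_atLeast0 conj_commute)
    have "EG n (\<lambda>G. (\<Sum>i<n. X n G i) / real n) \<le> EG n (\<lambda>G. (\<Sum>\<tau>\<in>?F. hi \<tau> * (real (card {i \<in> {0..<n}. riso2 (gball G i t) G i i \<tau> tadj [] []}) / real n))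
       + K * (1 + real L) * (1 - (\<Sum>\<tau>\<in>?F. real (card {i \<in> {0..<n}. riso2 (gball G i t) G i i \<tau> tadj [] []}) / real n)) + K * S n G)"
    proof (rule EG_mono)
      fix G assume G: "graph_on n G"
      let ?c = "\<lambda>\<tau>. real (card {i \<in> {0..<n}. riso2 (gball G i t) G i i \<tau> tadj ([]::nat list) []})"
      have alg: "(A + k * (real n - B) + K * C) / real n = A / real n + k * (1 - B / real n) + K * (C / real n)" for A B C k
        using n by (simp add: field_simps)
      have sw: "(\<Sum>i<n. \<Sum>\<tau>\<in>?F. hi \<tau> * ?ind G i \<tau>) = (\<Sum>\<tau>\<in>?F. hi \<tau> * ?c \<tau>)"
        by (subst sum.swap) (simp only: sum_distrib_left[symmetric] cnt)
      have "(\<Sum>i<n. X n G i) \<le> (\<Sum>i<n. (\<Sum>\<tau>\<in>?F. hi \<tau> * ?ind G i \<tau>) + K * (1 + real L) * (1 - (\<Sum>\<tau>\<in>?F. ?ind G i \<tau>)) + K * (real (gdeg G n i) * (if gdeg G n i \<ge> L then 1 else 0)))"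
        by (intro sum_mono pt G) simp
      also have "\<dots> = (\<Sum>\<tau>\<in>?F. hi \<tau> * ?c \<tau>) + K * (1 + real L) * (real n - (\<Sum>\<tau>\<in>?F. ?c \<tau>)) + K * (\<Sum>i<n. real (gdeg G n i) * (if gdeg G n i \<ge> L then 1 else 0))"
      proof -
        have sw1: "(\<Sum>i<n. \<Sum>\<tau>\<in>?F. ?ind G i \<tau>) = (\<Sum>\<tau>\<in>?F. ?c \<tau>)"
          by (subst sum.swap) (simp only: cnt)
        show ?thesis unfolding sum.distrib sw sum_distrib_left[symmetric] sum_subtractf sw1 by simp
      qed
      finally have "(\<Sum>i<n. X n G i) / real n \<le> ((\<Sum>\<tau>\<in>?F. hi \<tau> * ?c \<tau>) + K * (1 + real L) * (real n - (\<Sum>\<tau>\<in>?F. ?c \<tau>)) + K * (\<Sum>i<n. real (gdeg G n i) * (if gdeg G n i \<ge> L then 1 else 0))) / real n"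
        by (rule divide_right_mono) simp
      then show "(\<Sum>i<n. X n G i) / real n \<le> (\<Sum>\<tau>\<in>?F. hi \<tau> * (?c \<tau> / real n)) + K * (1 + real L) * (1 - (\<Sum>\<tau>\<in>?F. ?c \<tau> / real n)) + K * S n G"
        unfolding alg S_def by (simp add: sum_divide_distrib)
    qed
    also have "\<dots> = (\<Sum>\<tau>\<in>?F. hi \<tau> * p n \<tau>) + K * (1 + real L) * (1 - (\<Sum>\<tau>\<in>?F. p n \<tau>)) + K * EG n (S n)"
      unfolding p_def by (simp add: Bochner_Integration.integral_add Bochner_Integration.integral_diff Bochner_Integration.integral_sum)
    finally show ?thesis .
  qed
  define a where "a = (\<Sum>\<tau>\<in>?F. hi \<tau> * P \<tau>) + K * (1 + real L) * (1 - (\<Sum>\<tau>\<in>?F. P \<tau>))"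
  have "(\<lambda>n. (\<Sum>\<tau>\<in>?F. hi \<tau> * p n \<tau>) + K * (1 + real L) * (1 - (\<Sum>\<tau>\<in>?F. p n \<tau>))) \<longlonglongrightarrow> a"
    unfolding a_def by (intro tendsto_intros pP) (use F(2) in auto)
  then have ev: "eventually (\<lambda>n. (\<Sum>\<tau>\<in>?F. hi \<tau> * p n \<tau>) + K * (1 + real L) * (1 - (\<Sum>\<tau>\<in>?F. p n \<tau>)) < a + e / 4) sequentially"
    using e by (intro order_tendstoD(2)) auto
  have PI: "P \<tau> = (\<integral>T. (if Y T = \<tau> then 1 else 0) \<partial>\<mu>)" for \<tau>
  proof -
    have "(\<integral>T. (if Y T = \<tau> then 1 else 0 :: real) \<partial>\<mu>) = (\<integral>T. indicator {T \<in> space \<mu>. Y T = \<tau>} T \<partial>\<mu>)"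
      by (rule Bochner_Integration.integral_cong) (auto simp: indicator_def)
    also have "\<dots> = P \<tau>" using Ym[of "\<lambda>y. y = \<tau>"] by (simp add: P_def pred_def)
    finally show ?thesis by simp
  qed
  have iY: "integrable \<mu> (\<lambda>T. if Y T = \<tau> then 1 else 0 :: real)" for \<tau>
    by (rule integrable_const_bound[of _ 1]) auto
  have "a = (\<integral>T. (\<Sum>\<tau>\<in>?F. hi \<tau> * (if Y T = \<tau> then 1 else 0)) + K * (1 + real L) * (1 - (\<Sum>\<tau>\<in>?F. if Y T = \<tau> then 1 else 0)) \<partial>\<mu>)"
    unfolding a_def PI using iY by (simp add: Bochner_Integration.integral_add Bochner_Integration.integral_diff Bochner_Integration.integral_sum prob_space)
  also have "\<dots> \<le> (\<integral>T. hi (tball T t) + bad m T \<partial>\<mu>)"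
  proof (rule integral_mono_AE)
    show "AE T in \<mu>. (\<Sum>\<tau>\<in>?F. hi \<tau> * (if Y T = \<tau> then 1 else 0)) + K * (1 + real L) * (1 - (\<Sum>\<tau>\<in>?F. if Y T = \<tau> then 1 else 0)) \<le> hi (tball T t) + bad m T"
      using AE_utree
    proof eventually_elim
      case (elim T)
      have TT: "utree (tball T t)" "finite (tball T t)" using tT[OF elim] by (auto simp: TT_def)
      show ?case
      proof (cases "Y T \<in> ?F")
        case True
        have "hi (Y T) = hi (tball T t)"
          using inv[OF TT, of "Y T"] rep[OF tT[OF elim]] by (auto simp: Y_def TT_def)
        then show ?thesis using True F(1) by (simp add: bad_def if_distrib[where f="\<lambda>z. _ * z"] cong: if_cong)
      next
        case False
        then have z: "(\<Sum>\<tau>\<in>?F. hi \<tau> * (if Y T = \<tau> then 1 else 0)) = 0" "(\<Sum>\<tau>\<in>?F. if Y T = \<tau> then 1 else 0) = (0::real)"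
          by (auto intro!: sum.neutral)
        show ?thesis unfolding z using hi[OF TT] deg_tball[OF t, of T] False by (simp add: bad_def abs_le_iff)
      qed
    qed
  qed (use iY hi_int bad_int in auto)
  also have "\<dots> = (\<integral>T. hi (tball T t) \<partial>\<mu>) + (\<integral>T. bad m T \<partial>\<mu>)" using hi_int bad_int by simp
  finally have a: "a < (\<integral>T. hi (tball T t) \<partial>\<mu>) + e / 4" using m by linarith
  show ?thesis using ev L eventually_gt_at_top[of 0]
  proof eventually_elim
    case (elim n)
    have "EG n (S n) < e / (4 * (K + 1))" using elim(2) by (simp add: S_def)
    then have "K * EG n (S n) \<le> K * (e / (4 * (K + 1)))" using K by (intro mult_left_mono) auto
    also have "\<dots> \<le> e / 4" using K e by (simp add: field_simps)
    finally show ?case using up[OF elim(3)] elim(1) a e by linarith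
  qed
qed

end

section \<open>Gibbs expectations on graphs and on trees\<close>

definition GE :: "('x::finite \<Rightarrow> 'x \<Rightarrow> real) \<Rightarrow> ('x \<Rightarrow> real) \<Rightarrow> ('x \<Rightarrow> real) \<Rightarrow> ('x \<Rightarrow> 'x \<Rightarrow> real) \<Rightarrow> nat \<Rightarrow>
    (nat \<Rightarrow> nat \<Rightarrow> bool) \<Rightarrow> nat \<Rightarrow> real" where
  "GE w b c d n G i = (\<Sum>\<sigma>\<in>PiE {..<n} (\<lambda>_. UNIV). glw w b {..<n} G {..<n} \<sigma> * obs c d {..<n} G i \<sigma>)
     / (\<Sum>\<sigma>\<in>PiE {..<n} (\<lambda>_. UNIV). glw w b {..<n} G {..<n} \<sigma>)"

text \<open>Expectation of the root observable in the star with incoming messages x.\<close>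

definition Gst :: "('x::finite \<Rightarrow> 'x \<Rightarrow> real) \<Rightarrow> ('x \<Rightarrow> real) \<Rightarrow> ('x \<Rightarrow> real) \<Rightarrow> ('x \<Rightarrow> 'x \<Rightarrow> real) \<Rightarrow> 'v set
    \<Rightarrow> ('v \<Rightarrow> 'x \<Rightarrow> real) \<Rightarrow> real" where
  "Gst w b c d J x = (\<Sum>a\<in>UNIV. b a * (c a * (\<Prod>j\<in>J. \<Sum>s\<in>UNIV. w a s * x j s)
      + 1/2 * (\<Sum>j\<in>J. (\<Sum>s\<in>UNIV. w a s * x j s * d a s) * (\<Prod>i\<in>J - {j}. \<Sum>s\<in>UNIV. w a s * x i s))))
     / (\<Sum>a\<in>UNIV. b a * (\<Prod>j\<in>J. \<Sum>s\<in>UNIV. w a s * x j s))"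

lemma Gst_cong:
  assumes "\<And>j. j \<in> J \<Longrightarrow> x j = x' j"
  shows "Gst w b c d J x = Gst w b c d J x'"
proof -
  have "(\<Prod>j\<in>A. \<Sum>s\<in>UNIV. w a s * x j s) = (\<Prod>j\<in>A. \<Sum>s\<in>UNIV. w a s * x' j s)" if "A \<subseteq> J" for a A
    by (rule prod.cong) (use that assms in auto)
  note P = this[OF order_refl] this[OF Diff_subset]
  have "(\<Sum>j\<in>J. (\<Sum>s\<in>UNIV. w a s * x j s * d a s) * (\<Prod>i\<in>J - {j}. \<Sum>s\<in>UNIV. w a s * x' i s))
     = (\<Sum>j\<in>J. (\<Sum>s\<in>UNIV. w a s * x' j s * d a s) * (\<Prod>i\<in>J - {j}. \<Sum>s\<in>UNIV. w a s * x' i s))" for a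
    by (rule sum.cong) (simp_all add: assms)
  then show ?thesis unfolding Gst_def P by simp
qed

text \<open>The product form of \<open>Gst\<close> shows its dependence on the messages, which
  serves measurability and continuity; here it is recognised as an expectation in the star.\<close>

lemma sum_St_obs:
  assumes T: "utree T"
  shows "(\<Sum>\<omega>\<in>conf T (Suc 0). St w b T x \<omega> * obs c d T tadj [] \<omega>) / Zst w b T x = Gst w b c d (nbrs T []) x"
proof -
  let ?J = "nbrs T []"
  have J: "{j\<in>T. tadj [] j} = ?J" by (simp add: nbrs_def)
  define X where "X = (\<lambda>a j. \<Sum>s\<in>UNIV. w a s * x j s * d a s)"
  define P where "P = (\<lambda>a A. \<Prod>j\<in>A. \<Sum>s\<in>UNIV. w a s * x j s)"
  have "(\<Sum>\<omega>\<in>conf T (Suc 0). St w b T x \<omega> * obs c d T tadj [] \<omega>)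
     = (\<Sum>\<omega>\<in>conf T (Suc 0). St w b T x \<omega> * c (\<omega> []) + 1/2 * (\<Sum>j\<in>?J. St w b T x \<omega> * d (\<omega> []) (\<omega> j)))"
    unfolding sum_distrib_left[symmetric] by (intro sum.cong refl) (simp add: obs_def J algebra_simps)
  also have "\<dots> = (\<Sum>\<omega>\<in>conf T (Suc 0). St w b T x \<omega> * c (\<omega> [])) + 1/2 * (\<Sum>j\<in>?J. \<Sum>\<omega>\<in>conf T (Suc 0). St w b T x \<omega> * d (\<omega> []) (\<omega> j))"
    by (simp only: sum.distrib sum_distrib_left[symmetric] sum.swap[where A="nbrs T []"])
  also have "\<dots> = (\<Sum>a\<in>UNIV. b a * c a * P a ?J) + 1/2 * (\<Sum>j\<in>?J. \<Sum>a\<in>UNIV. b a * X a j * P a (?J - {j}))"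
    using sum_St(1)[OF T, of w b x c] sum_St(2)[OF T, of _ w b x d] by (simp add: X_def P_def)
  also have "\<dots> = (\<Sum>a\<in>UNIV. b a * (c a * P a ?J + 1/2 * (\<Sum>j\<in>?J. X a j * P a (?J - {j}))))"
    by (subst sum.swap) (simp add: sum_distrib_left sum.distrib algebra_simps)
  also have "\<dots> = (\<Sum>a\<in>UNIV. b a * (c a * (\<Prod>j\<in>?J. \<Sum>s\<in>UNIV. w a s * x j s)
      + 1/2 * (\<Sum>j\<in>?J. (\<Sum>s\<in>UNIV. w a s * x j s * d a s) * (\<Prod>i\<in>?J - {j}. \<Sum>s\<in>UNIV. w a s * x i s))))"
    by (simp add: X_def P_def)
  finally show ?thesis by (simp add: Gst_def Zst_def)
qed

text \<open>By consistency an observable of the star may be averaged at any radius: the boundary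
  condition sits beyond radius n, the comparison of systems happens at radius 1.\<close>

lemma dsys_marginal:
  assumes d: "dsys w b T n q" and T: "utree T"
    and f: "\<And>\<omega> \<omega>'. (\<And>v. v \<in> tball T (Suc 0) \<Longrightarrow> \<omega> v = \<omega>' v) \<Longrightarrow> f \<omega> = (f \<omega>' :: real)"
  shows "Suc t \<le> n \<Longrightarrow> (\<Sum>\<omega>\<in>conf T (Suc t). q (Suc t, \<omega>) * f \<omega>) = (\<Sum>\<omega>\<in>conf T (Suc 0). q (Suc 0, \<omega>) * f \<omega>)"
proof (induction t)
  case (Suc t)
  have sub: "tball T (Suc 0) \<subseteq> tball T (Suc t)" by (rule tball_mono) simp
  have c: "q (Suc t, \<omega>) = (\<Sum>\<zeta>\<in>PiE (lev T (Suc (Suc t))) (\<lambda>_. UNIV). q (Suc (Suc t), glue (tball T (Suc t)) \<omega> \<zeta>))"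
    if "\<omega> \<in> conf T (Suc t)" for \<omega> using d that Suc.prems by (auto simp: dsys_def)
  have "(\<Sum>\<omega>\<in>conf T (Suc (Suc t)). q (Suc (Suc t), \<omega>) * f \<omega>)
    = (\<Sum>\<omega>\<in>conf T (Suc t). \<Sum>\<zeta>\<in>PiE (lev T (Suc (Suc t))) (\<lambda>_. UNIV). q (Suc (Suc t), glue (tball T (Suc t)) \<omega> \<zeta>) * f \<omega>)"
    unfolding sum_conf_Suc[of _ T "Suc t"]
    by (intro sum.cong refl arg_cong2[where f="(*)"] f) (use sub in \<open>auto simp: glue_def\<close>)
  also have "\<dots> = (\<Sum>\<omega>\<in>conf T (Suc t). q (Suc t, \<omega>) * f \<omega>)"
    by (intro sum.cong refl) (simp add: c sum_distrib_right)
  finally show ?case using Suc by simp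
qed simp

lemma obs_root_cong:
  assumes "utree T" "V \<subseteq> T" "tball T (Suc 0) \<subseteq> V" "\<And>v. v \<in> tball T (Suc 0) \<Longrightarrow> \<omega> v = \<omega>' v"
  shows "obs c d V tadj [] \<omega> = obs c d T tadj [] \<omega>'"
proof -
  have s: "{j\<in>V. tadj [] j} = {j\<in>T. tadj [] j}" using assms(2,3) by (auto simp: tball_def tadj_def)
  have "j \<in> T \<Longrightarrow> tadj [] j \<Longrightarrow> \<omega> j = \<omega>' j" for j by (rule assms(4)) (auto simp: tball_def tadj_def)
  moreover have "\<omega> [] = \<omega>' []" by (rule assms(4)) (rule Nil_in_tball[OF assms(1)])
  ultimately show ?thesis unfolding obs_def s by (auto intro!: sum.cong)
qed

text \<open>Messages generated by a boundary configuration: point masses at the boundary and k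
  updates above it. Boundary conditions thereby fall under \<open>dsys_gq\<close>.\<close>

fun bm :: "('x::finite \<Rightarrow> 'x \<Rightarrow> real) \<Rightarrow> ('x \<Rightarrow> real) \<Rightarrow> nat list set \<Rightarrow> (nat list \<Rightarrow> 'x) \<Rightarrow> nat \<Rightarrow> nat list \<Rightarrow> 'x \<Rightarrow> real" where
  "bm w b T \<eta> 0 v s = (if s = \<eta> v then 1 else 0)"
| "bm w b T \<eta> (Suc k) v s = BP w b T (bm w b T \<eta> k) v s / (\<Sum>r\<in>UNIV. BP w b T (bm w b T \<eta> k) v r)"

context spin
begin

lemma BP_sp_pos:
  assumes "\<And>x r. x \<in> kids T v \<Longrightarrow> 0 \<le> m x r" "\<And>x. x \<in> kids T v \<Longrightarrow> (\<Sum>r\<in>UNIV. m x r) = 1"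
  shows "0 \<le> BP w b T m v s" "0 < (\<Sum>r\<in>UNIV. BP w b T m v r)"
proof -
  show *: "0 \<le> BP w b T m v s" for s unfolding BP_def
    by (intro mult_nonneg_nonneg prod_nonneg sum_nonneg ballI w_nn assms less_imp_le[OF b_pos])
  have "0 < BP w b T m v sp" unfolding BP_def
    by (intro mult_pos_pos b_pos prod_pos sum_w_sp_pos prob_ex_pos assms)
  then show "0 < (\<Sum>r\<in>UNIV. BP w b T m v r)" by (intro sum_pos2[of _ sp]) (auto intro: *)
qed

lemma bm_prob: "(\<forall>s. 0 \<le> bm w b T \<eta> k v s) \<and> (\<Sum>s\<in>UNIV. bm w b T \<eta> k v s) = 1"
proof (induction k arbitrary: v)
  case (Suc k)
  have "0 \<le> BP w b T (bm w b T \<eta> k) v s" "0 < (\<Sum>r\<in>UNIV. BP w b T (bm w b T \<eta> k) v r)" for s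
    by (rule BP_sp_pos; use Suc in simp)+
  then show ?case using prob_normalise[of "BP w b T (bm w b T \<eta> k) v"] by auto
qed simp

text \<open>A tree edge occurs once, as parent and child, in the recursion, and in both orientations
  with square roots in \<open>glw\<close>. Point masses at depth n + 1 insert the boundary
  configuration into the outermost edge factors.\<close>

lemma Fm_glw:
  assumes T: "utree T" and m: "\<And>v s. v \<in> lev T (Suc n) \<Longrightarrow> m v s = (if s = \<eta> v then 1 else 0)"
  shows "Fm w b T n m \<omega> = glw w b (tball T (Suc n)) tadj (tball T n) (glue (tball T n) \<omega> \<eta>)"
proof -
  let ?I = "tball T n" and ?V = "tball T (Suc n)" and ?L = "lev T (Suc n)"
  let ?g = "glue ?I \<omega> \<eta>"
  have fin: "finite ?I" "finite ?L" "finite ?V" using finite_tball[OF T] finite_lev[OF T] by auto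
  have bl: "v \<in> ?V - {[]} \<Longrightarrow> butlast v \<in> ?I" for v using utree_butlast[OF T] by (auto simp: tball_def)
  have adj: "u = butlast v \<and> v \<noteq> [] \<or> v = butlast u \<and> u \<noteq> [] \<longleftrightarrow> tadj u v" for u v
    unfolding tadj_def by (metis append_butlast_last_id butlast_snoc snoc_eq_iff_butlast)
  let ?E1 = "(\<lambda>v. (butlast v, v)) ` (?V - {[]})" and ?E2 = "(\<lambda>v. (v, butlast v)) ` (?V - {[]})"
  have IV: "?I \<subseteq> ?V" by (rule tball_mono) simp
  have E: "epairs ?V tadj ?I = ?E1 \<union> ?E2"
  proof (intro equalityI subsetI)
    fix p assume "p \<in> epairs ?V tadj ?I"
    then obtain u v where p: "p = (u, v)" "u \<in> ?V" "v \<in> ?V" "tadj u v" by (auto simp: epairs_def)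
    then show "p \<in> ?E1 \<union> ?E2" using adj[of u v] by auto
  next
    fix p assume "p \<in> ?E1 \<union> ?E2"
    then obtain v where v: "v \<in> ?V - {[]}" "p = (butlast v, v) \<or> p = (v, butlast v)" by auto
    then show "p \<in> epairs ?V tadj ?I" using bl[OF v(1)] IV adj[of "butlast v" v] adj[of v "butlast v"] by (auto simp: epairs_def)
  qed
  have len: "v \<noteq> [] \<Longrightarrow> length (butlast v) < length v" for v :: "nat list" by simp
  \<comment> \<open>A vertex is never its own grandparent, by length; so the two orientations give
    disjoint sets of pairs.\<close>
  have disj: "?E1 \<inter> ?E2 = {}"
  proof -
    have "v \<noteq> butlast (butlast v)" if "v \<noteq> []" for v :: "nat list"
    proof
      assume "v = butlast (butlast v)"
      then have "length v = length (butlast (butlast v))" by (rule arg_cong)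
      then have "length v = length v - 1 - 1" unfolding length_butlast .
      moreover have "0 < length v" using that by simp
      ultimately show False by arith
    qed
    then show ?thesis by (auto simp: image_iff)
  qed
  have "(\<Prod>(u, v)\<in>epairs ?V tadj ?I. sqrt (w (?g u) (?g v))) = (\<Prod>v\<in>?V - {[]}. sqrt (w (?g (butlast v)) (?g v))) * (\<Prod>v\<in>?V - {[]}. sqrt (w (?g v) (?g (butlast v))))"
    unfolding E using fin disj
    by (subst prod.union_disjoint) (auto simp: prod.reindex inj_on_def)
  also have "\<dots> = (\<Prod>v\<in>?V - {[]}. w (?g (butlast v)) (?g v))"
    unfolding prod.distrib[symmetric] by (intro prod.cong refl) (subst w_sym, simp add: w_nn)
  also have "?V - {[]} = (?I - {[]}) \<union> ?L" by (auto simp: tball_Suc lev_def)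
  also have "(\<Prod>v\<in>(?I - {[]}) \<union> ?L. w (?g (butlast v)) (?g v)) = (\<Prod>v\<in>?I - {[]}. w (?g (butlast v)) (?g v)) * (\<Prod>v\<in>?L. w (?g (butlast v)) (?g v))"
    by (rule prod.union_disjoint) (use fin tball_lev_disj in auto)
  also have "(\<Prod>v\<in>?I - {[]}. w (?g (butlast v)) (?g v)) = (\<Prod>v\<in>?I - {[]}. w (\<omega> (butlast v)) (\<omega> v))"
    by (intro prod.cong refl) (use bl IV in \<open>auto simp: glue_def\<close>)
  also have "(\<Prod>v\<in>?L. w (?g (butlast v)) (?g v)) = (\<Prod>v\<in>?L. \<Sum>s\<in>UNIV. w (\<omega> (butlast v)) s * m v s)"
  proof (intro prod.cong refl)
    fix v assume v: "v \<in> ?L"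
    then have v': "v \<in> ?V - {[]}" "v \<notin> ?I" using tball_lev_disj[of T n] by (auto simp: tball_Suc lev_def)
    show "w (?g (butlast v)) (?g v) = (\<Sum>s\<in>UNIV. w (\<omega> (butlast v)) s * m v s)"
      using bl[OF v'(1)] v'(2) by (simp add: m[OF v] glue_def if_distrib[where f="\<lambda>z. _ * z"] cong: if_cong)
  qed
  finally have 1: "(\<Prod>(u, v)\<in>epairs ?V tadj ?I. sqrt (w (?g u) (?g v))) = (\<Prod>v\<in>?I - {[]}. w (\<omega> (butlast v)) (\<omega> v)) * (\<Prod>v\<in>?L. \<Sum>s\<in>UNIV. w (\<omega> (butlast v)) s * m v s)" .
  have 2: "(\<Prod>v\<in>?I. b (?g v)) = (\<Prod>v\<in>?I. b (\<omega> v))" by (intro prod.cong refl) (simp add: glue_def)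
  show ?thesis unfolding glw_def 1 2 Fm_def by simp
qed

text \<open>Every boundary condition beyond radius n defines a system of level n, so the extreme
  values over boundary conditions are expectations in such systems.\<close>

lemma tree_boundary:
  assumes T: "utree T" and n: "0 < n"
  shows "\<exists>q. dsys w b T n q \<and> gnum w b c d (tball T (Suc n)) tadj (tball T n) [] \<eta> / gden w b (tball T (Suc n)) tadj (tball T n) \<eta>
    = (\<Sum>\<omega>\<in>conf T (Suc 0). q (Suc 0, \<omega>) * obs c d T tadj [] \<omega>)"
proof -
  define m where "m = (\<lambda>v. bm w b T \<eta> (Suc n - length v) v)"
  have pr: "0 \<le> m v s" "(\<Sum>s\<in>UNIV. m v s) = 1" for v s using bm_prob[of T \<eta> _ v] by (auto simp: m_def)
  have cp: "0 < (\<Sum>r\<in>UNIV. BP w b T m v r)" for v by (rule BP_sp_pos(2)) (use pr in auto)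
  have bp: "m v s = BP w b T m v s / (\<Sum>r\<in>UNIV. BP w b T m v r)" if "length v \<le> n" for v s
  proof -
    have k: "Suc n - length v = Suc (n - length v)" using that by simp
    have "BP w b T (bm w b T \<eta> (n - length v)) v s = BP w b T m v s" for s
      unfolding BP_def m_def by (intro arg_cong2[where f="(*)" and a="b s"] prod.cong refl) (auto simp: kids_def)
    then show ?thesis by (simp add: m_def k)
  qed
  have bp': "\<exists>c>0. \<forall>s. m v s = c * BP w b T m v s" if v: "v \<in> T" "v \<noteq> []" "length v \<le> n" for v
    using cp by (intro exI[of _ "1 / (\<Sum>r\<in>UNIV. BP w b T m v r)"] conjI allI) (simp, subst bp[OF v(3)], simp)
  let ?q = "gq w b T m"
  have d: "dsys w b T n ?q" by (rule dsys_gq(1)[OF T pr(1) prob_ex_pos[OF pr] bp'])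
  have q: "?q (n, \<omega>) = Fm w b T n m \<omega> / Zm w b T n m" if "\<omega> \<in> conf T n" for \<omega>
    by (rule dsys_gq(2)[OF T pr(1) prob_ex_pos[OF pr] bp' order_refl that])
  have F: "Fm w b T n m \<omega> = glw w b (tball T (Suc n)) tadj (tball T n) (glue (tball T n) \<omega> \<eta>)" for \<omega>
    by (rule Fm_glw[OF T]) (simp add: m_def lev_def)
  have sub: "tball T (Suc 0) \<subseteq> tball T n" "tball T (Suc 0) \<subseteq> tball T (Suc n)" using n by (auto intro!: tball_mono)
  have o: "obs c d (tball T (Suc n)) tadj [] (glue (tball T n) \<omega> \<eta>) = obs c d T tadj [] \<omega>" for \<omega>
    by (rule obs_root_cong[OF T _ sub(2)]) (use sub in \<open>auto simp: tball_def glue_def\<close>)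
  have den: "gden w b (tball T (Suc n)) tadj (tball T n) \<eta> = Zm w b T n m"
    by (simp add: gden_def Zm_def conf_def F)
  have num: "gnum w b c d (tball T (Suc n)) tadj (tball T n) [] \<eta> = (\<Sum>\<omega>\<in>conf T n. Fm w b T n m \<omega> * obs c d T tadj [] \<omega>)"
    by (simp add: gnum_def conf_def F o)
  have TT: "tball T (Suc 0) \<subseteq> T" by (auto simp: tball_def)
  have f: "obs c d T tadj [] \<omega> = obs c d T tadj [] \<omega>'" if "\<And>v. v \<in> tball T (Suc 0) \<Longrightarrow> \<omega> v = \<omega>' v" for \<omega> \<omega>'
    by (rule obs_root_cong[OF T order_refl TT that])
  obtain k where k: "n = Suc k" using n by (cases n) auto
  have "gnum w b c d (tball T (Suc n)) tadj (tball T n) [] \<eta> / gden w b (tball T (Suc n)) tadj (tball T n) \<eta>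
    = (\<Sum>\<omega>\<in>conf T n. ?q (n, \<omega>) * obs c d T tadj [] \<omega>)"
    unfolding den num by (simp add: q sum_divide_distrib)
  also have "\<dots> = (\<Sum>\<omega>\<in>conf T (Suc 0). ?q (Suc 0, \<omega>) * obs c d T tadj [] \<omega>)"
    unfolding k by (rule dsys_marginal[OF d T f]) (simp_all add: k)
  finally show ?thesis using d by blast
qed

text \<open>The maximising boundary condition is one more system of level n, and decorrelation
  compares it with q on the star.\<close>

lemma tree_hiv:
  assumes T: "utree T" and u: "\<exists>!\<nu>. \<nu> \<in> gibbs \<psi> \<psi>b \<beta> B T" and w: "w = \<psi> \<beta>" "b = \<psi>b B" and e: "0 < e"
  shows "\<exists>N>0. \<forall>n\<ge>N. \<forall>q. dsys w b T n q \<longrightarrow> hiv w b c d (tball T (Suc n)) n \<le> (\<Sum>\<omega>\<in>conf T (Suc 0). q (Suc 0, \<omega>) * obs c d T tadj [] \<omega>) + e"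
proof -
  define S where "S = (\<Sum>\<omega>\<in>conf T (Suc 0). \<bar>obs c d T tadj [] (\<omega> :: nat list \<Rightarrow> 'x)\<bar>)"
  have S: "0 \<le> S" unfolding S_def by (rule sum_nonneg) simp
  \<comment> \<open>S is the total of the absolute observable over star configurations, so marginals
    that are e / (S + 1) close change the expectation by at most e; the added 1 covers S =
    0.\<close>
  then have "0 < e / (S + 1)" using e by simp
  from decorrelation_all[OF T u w this, of "Suc 0"] obtain N where N: "Suc 0 \<le> N"
    "\<And>n q q' \<omega>. N \<le> n \<Longrightarrow> \<omega> \<in> conf T (Suc 0) \<Longrightarrow> dsys w b T n q \<Longrightarrow> dsys w b T n q' \<Longrightarrow> \<bar>q (Suc 0, \<omega>) - q' (Suc 0, \<omega>)\<bar> < e / (S + 1)"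
    by blast
  show ?thesis
  proof (intro exI[of _ N] conjI allI impI)
    show "0 < N" using N(1) by simp
    fix n q assume n: "N \<le> n" and q: "dsys w b T n q"
    have tt: "tball (tball T (Suc n)) n = tball T n" by (auto simp: tball_def)
    obtain \<eta> where \<eta>: "hiv w b c d (tball T (Suc n)) n = gnum w b c d (tball T (Suc n)) tadj (tball T n) [] \<eta> / gden w b (tball T (Suc n)) tadj (tball T n) \<eta>"
      using hiv_attained[OF finite_tball[OF T], of w b c d "Suc n" n] unfolding tt by blast
    have "0 < n" using n N(1) by simp
    then obtain q' where q': "dsys w b T n q'" "hiv w b c d (tball T (Suc n)) n = (\<Sum>\<omega>\<in>conf T (Suc 0). q' (Suc 0, \<omega>) * obs c d T tadj [] \<omega>)"
      using tree_boundary[OF T, of n c d \<eta>] \<eta> by auto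
    have "(\<Sum>\<omega>\<in>conf T (Suc 0). q' (Suc 0, \<omega>) * obs c d T tadj [] \<omega>) - (\<Sum>\<omega>\<in>conf T (Suc 0). q (Suc 0, \<omega>) * obs c d T tadj [] \<omega>)
      = (\<Sum>\<omega>\<in>conf T (Suc 0). (q' (Suc 0, \<omega>) - q (Suc 0, \<omega>)) * obs c d T tadj [] \<omega>)"
      by (simp add: sum_subtractf left_diff_distrib)
    also have "\<dots> \<le> (\<Sum>\<omega>\<in>conf T (Suc 0). e / (S + 1) * \<bar>obs c d T tadj [] \<omega>\<bar>)"
    proof (rule sum_mono)
      fix \<omega> :: "nat list \<Rightarrow> 'x" assume "\<omega> \<in> conf T (Suc 0)"
      then have "\<bar>q' (Suc 0, \<omega>) - q (Suc 0, \<omega>)\<bar> * \<bar>obs c d T tadj [] \<omega>\<bar> \<le> e / (S + 1) * \<bar>obs c d T tadj [] \<omega>\<bar>"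
        by (intro mult_right_mono less_imp_le[OF N(2)[OF n _ q'(1) q]]) auto
      then show "(q' (Suc 0, \<omega>) - q (Suc 0, \<omega>)) * obs c d T tadj [] \<omega> \<le> e / (S + 1) * \<bar>obs c d T tadj [] \<omega>\<bar>"
        unfolding abs_mult[symmetric] by (rule order_trans[OF abs_ge_self])
    qed
    also have "\<dots> = e / (S + 1) * S" by (simp add: S_def sum_distrib_left)
    also have "\<dots> \<le> e" using S e by (simp add: field_simps)
    finally show "hiv w b c d (tball T (Suc n)) n \<le> (\<Sum>\<omega>\<in>conf T (Suc 0). q (Suc 0, \<omega>) * obs c d T tadj [] \<omega>) + e"
      unfolding q'(2) by simp
  qed
qed

lemma hiv_bound:
  assumes "utree \<tau>" "finite \<tau>" and cd: "\<And>a. \<bar>c a\<bar> \<le> K" "\<And>a a'. \<bar>d a a'\<bar> \<le> K"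
  shows "\<bar>hiv w b c d \<tau> n\<bar> \<le> K * (1 + real (deg \<tau> []))"
proof -
  obtain \<eta> where \<eta>: "hiv w b c d \<tau> n = gnum w b c d \<tau> tadj (tball \<tau> n) [] \<eta> / gden w b \<tau> tadj (tball \<tau> n) \<eta>"
    using hiv_attained[OF assms(2), of w b c d n] by blast
  have "deg \<tau> [] = card {j\<in>\<tau>. tadj [] j}" by (simp add: deg_def nbrs_def)
  then show ?thesis unfolding \<eta> using ratio_bound[OF finite_tball[OF assms(1)] cd] by simp
qed

lemma graph_weight_pos: fixes n :: nat shows "0 < (\<Sum>\<sigma>\<in>PiE {..<n} (\<lambda>_. UNIV). glw w b {..<n} G {..<n} \<sigma>)"
proof -
  have "(\<Sum>\<sigma>\<in>PiE {..<n} (\<lambda>_. UNIV). glw w b {..<n} G {..<n} \<sigma>) = gden w b {..<n} G {..<n} \<eta>" for \<eta>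
    unfolding gden_def by (intro sum.cong refl glw_cong) (auto simp: glue_def)
  from this[of undefined] show ?thesis using gden_pos[of "{..<n}" "{..<n}" G undefined] by simp
qed

lemma GE_bound:
  assumes cd: "\<And>a. \<bar>c a\<bar> \<le> K" "\<And>a a'. \<bar>d a a'\<bar> \<le> K"
  shows "\<bar>GE w b c d n G i\<bar> \<le> K * (1 + real (gdeg G n i))"
proof -
  have g: "gdeg G n i = card {j\<in>{..<n}. G i j}" by (simp add: gdeg_def lessThan_atLeast0)
  have "\<bar>\<Sum>\<sigma>\<in>PiE {..<n} (\<lambda>_. UNIV). glw w b {..<n} G {..<n} \<sigma> * obs c d {..<n} G i \<sigma>\<bar>
     \<le> (\<Sum>\<sigma>\<in>PiE {..<n} (\<lambda>_. UNIV). \<bar>glw w b {..<n} G {..<n} \<sigma> * obs c d {..<n} G i \<sigma>\<bar>)" by (rule sum_abs)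
  also have "\<dots> \<le> (\<Sum>\<sigma>\<in>PiE {..<n} (\<lambda>_. UNIV). glw w b {..<n} G {..<n} \<sigma> * (K * (1 + real (gdeg G n i))))"
    unfolding abs_mult g using glw_nn by (intro sum_mono mult_mono obs_bound cd) auto
  also have "\<dots> = K * (1 + real (gdeg G n i)) * (\<Sum>\<sigma>\<in>PiE {..<n} (\<lambda>_. UNIV). glw w b {..<n} G {..<n} \<sigma>)"
    by (simp add: sum_distrib_left mult_ac)
  finally show ?thesis unfolding GE_def abs_divide
    using graph_weight_pos[of n G] by (simp add: divide_le_eq)
qed

text \<open>The Gibbs weight of the whole graph is the weight touching the ball of radius k times a
  factor that does not read this ball. The isomorphism is assumed at radius k + 1 so that all edges
  leaving the ball are included.\<close>

lemma GE_le_hiv: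
  assumes G: "graph_on n G" and i: "i < n" and T: "utree \<tau>" "finite \<tau>"
    and r: "riso2 (gball G i (Suc k)) G i i \<tau> tadj [] []"
  shows "GE w b c d n G i \<le> hiv w b c d \<tau> k"
proof -
  let ?N = "{..<n}" and ?V = "gball G i (Suc k)" and ?I = "gball G i k"
  obtain f where f: "giso f ?V G \<tau> tadj" "f i = []" using r by (auto simp: riso2_giso)
  have VN: "?V \<subseteq> ?N" by (rule graph_gball_subset[OF G i])
  have IV: "?I \<subseteq> ?V" by (rule gball_mono) simp
  have iI: "i \<in> ?I" using gball_mono[of 0 k G i] by simp
  have nb: "v \<in> ?V" if "u \<in> ?I" "G u v" for u v using that by auto
  have I: "?I = gb G ?V i k" by (rule gball_gb) simp
  let ?E = "epairs ?N G ?N - epairs ?V G ?I"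
  define R where "R = (\<lambda>\<sigma>. (\<Prod>(u, v)\<in>?E. sqrt (w (\<sigma> u) (\<sigma> v))) * (\<Prod>v\<in>?N - ?I. b (\<sigma> v)))"
  have fe: "finite (epairs ?N G ?N)" by (rule finite_subset[of _ "?N \<times> ?N"]) (auto simp: epairs_def)
  have sub: "epairs ?V G ?I \<subseteq> epairs ?N G ?N" using VN by (auto simp: epairs_def)
  \<comment> \<open>An edge with an endpoint in the ball of radius k lies entirely in the ball of
    radius k + 1 and has been split off.\<close>
  have out: "u \<notin> ?I \<and> v \<notin> ?I \<and> u \<in> ?N \<and> v \<in> ?N" if "(u, v) \<in> ?E" for u v
  proof -
    have e: "u < n" "v < n" "G u v" "G v u" using that G by (auto simp: epairs_def graph_on_def)
    have "\<not> (u \<in> ?V \<and> v \<in> ?V \<and> (u \<in> ?I \<or> v \<in> ?I))" using that e by (auto simp: epairs_def)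
    then show ?thesis using nb[OF _ e(3)] nb[OF _ e(4)] IV e by blast
  qed
  have W: "glw w b ?N G ?N \<sigma> = glw w b ?V G ?I \<sigma> * R \<sigma>" for \<sigma>
  proof -
    have "(\<Prod>(u, v)\<in>epairs ?N G ?N. sqrt (w (\<sigma> u) (\<sigma> v))) = (\<Prod>(u, v)\<in>?E. sqrt (w (\<sigma> u) (\<sigma> v))) * (\<Prod>(u, v)\<in>epairs ?V G ?I. sqrt (w (\<sigma> u) (\<sigma> v)))"
      by (rule prod.subset_diff[OF sub fe])
    moreover have "(\<Prod>v\<in>?N. b (\<sigma> v)) = (\<Prod>v\<in>?N - ?I. b (\<sigma> v)) * (\<Prod>v\<in>?I. b (\<sigma> v))"
      by (rule prod.subset_diff) (use IV VN in auto)
    ultimately show ?thesis by (simp add: glw_def R_def)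
  qed
  have o: "obs c d ?N G i \<sigma> = obs c d ?V G i \<sigma>" for \<sigma>
  proof -
    have "{j\<in>?N. G i j} = {j\<in>?V. G i j}" using VN nb[OF iI] by auto
    then show ?thesis by (simp add: obs_def)
  qed
  have "(\<Sum>\<sigma>\<in>PiE ?N (\<lambda>_. UNIV). glw w b ?V G ?I \<sigma> * R \<sigma> * obs c d ?V G i \<sigma>) \<le> hiv w b c d \<tau> k * (\<Sum>\<sigma>\<in>PiE ?N (\<lambda>_. UNIV). glw w b ?V G ?I \<sigma> * R \<sigma>)"
  proof (rule ball_average[OF _ VN T _ f I])
    show "0 \<le> R \<sigma>" for \<sigma> unfolding R_def
      by (intro mult_nonneg_nonneg prod_nonneg) (auto simp: w_nn less_imp_le[OF b_pos])
    show "R \<sigma> = R \<sigma>'" if "\<And>v. v \<in> ?N - ?I \<Longrightarrow> \<sigma> v = \<sigma>' v" for \<sigma> \<sigma>'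
    proof -
      have "(\<Prod>(u, v)\<in>?E. sqrt (w (\<sigma> u) (\<sigma> v))) = (\<Prod>(u, v)\<in>?E. sqrt (w (\<sigma>' u) (\<sigma>' v)))"
      proof (rule prod.cong[OF refl])
        fix p assume "p \<in> ?E"
        moreover obtain u v where p: "p = (u, v)" by (cases p)
        ultimately have "u \<in> ?N - ?I" "v \<in> ?N - ?I" using out[of u v] by auto
        then show "(case p of (u, v) \<Rightarrow> sqrt (w (\<sigma> u) (\<sigma> v))) = (case p of (u, v) \<Rightarrow> sqrt (w (\<sigma>' u) (\<sigma>' v)))"
          unfolding p by (simp only: that prod.case)
      qed
      moreover have "(\<Prod>v\<in>?N - ?I. b (\<sigma> v)) = (\<Prod>v\<in>?N - ?I. b (\<sigma>' v))" by (intro prod.cong refl) (simp add: that)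
      ultimately show ?thesis by (simp add: R_def)
    qed
  qed (use iI IV in auto)
  then show ?thesis unfolding GE_def o W[symmetric]
    using graph_weight_pos[of n G] by (simp add: divide_le_eq)
qed

text \<open>The closed expression in the fixed point messages is an expectation in a system of all
  levels, so the estimates for systems apply to it.\<close>

lemma fixed_point_dsys:
  assumes T: "utree T" and h: "is_message h"
    and bp: "\<And>x y. x \<in> T \<Longrightarrow> y \<in> T \<Longrightarrow> tadj x y \<Longrightarrow> bp_fixed_at \<psi> \<psi>b \<beta> B h T x y" and w: "w = \<psi> \<beta>" "b = \<psi>b B"
  shows "\<exists>q. (\<forall>n. dsys w b T n q) \<and> (\<Sum>\<omega>\<in>conf T (Suc 0). q (Suc 0, \<omega>) * obs c d T tadj [] \<omega>) = Gst w b c d (nbrs T []) (\<lambda>j. h T j [])"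
proof -
  note m = messages_upm[OF T h bp w]
  let ?q = "gq w b T (upm h T)"
  have d: "dsys w b T (Suc n) ?q"
    "\<omega> \<in> conf T (Suc 0) \<Longrightarrow> ?q (Suc 0, \<omega>) = St w b T (upm h T) \<omega> / Zst w b T (upm h T)" for n \<omega>
    using dsys_messages[of T "Suc n" "upm h T", OF T m(1,2,3)] by auto
  have "(\<Sum>\<omega>\<in>conf T (Suc 0). ?q (Suc 0, \<omega>) * obs c d T tadj [] \<omega>) = Gst w b c d (nbrs T []) (upm h T)"
    unfolding sum_St_obs[OF T, symmetric] by (simp add: d(2) sum_divide_distrib)
  also have "\<dots> = Gst w b c d (nbrs T []) (\<lambda>j. h T j [])"
  proof -
    have "upm h T j = h T j []" if "j \<in> nbrs T []" for j using root_nbr[OF that] by (simp add: upm_def)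
    then show ?thesis by (rule Gst_cong)
  qed
  finally show ?thesis using dsys_antimono[OF d(1) le_SucI[OF order_refl]] by blast
qed

lemma Gst_bound:
  assumes q: "dsys w b T 1 q" and cd: "\<And>a. \<bar>c a\<bar> \<le> K" "\<And>a a'. \<bar>d a a'\<bar> \<le> K"
  shows "\<bar>\<Sum>\<omega>\<in>conf T (Suc 0). q (Suc 0, \<omega>) * obs c d T tadj [] \<omega>\<bar> \<le> K * (1 + real (deg T []))"
proof -
  have q0: "0 \<le> q x" for x using q by (cases x) (auto simp: dsys_def)
  have "\<bar>\<Sum>\<omega>\<in>conf T (Suc 0). q (Suc 0, \<omega>) * obs c d T tadj [] \<omega>\<bar> \<le> (\<Sum>\<omega>\<in>conf T (Suc 0). \<bar>q (Suc 0, \<omega>) * obs c d T tadj [] \<omega>\<bar>)" by (rule sum_abs)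
  also have "\<dots> \<le> (\<Sum>\<omega>\<in>conf T (Suc 0). q (Suc 0, \<omega>) * (K * (1 + real (card {j\<in>T. tadj [] j}))))"
    unfolding abs_mult using q0 by (intro sum_mono mult_mono obs_bound cd) auto
  also have "\<dots> = K * (1 + real (card {j\<in>T. tadj [] j}))"
    using dsys_sum[OF q, of "Suc 0"] by (simp add: sum_distrib_right[symmetric])
  finally show ?thesis by (simp add: deg_def nbrs_def)
qed

end

lemma Gst_measurable:
  assumes [measurable]: "\<And>j s. (\<lambda>T. h T j s) \<in> borel_measurable treeM"
  shows "(\<lambda>T. Gst w b c d (nbrs T []) (h T)) \<in> borel_measurable treeM"
  by (rule measurable_via_finset[OF measurable_nbrs, where f="\<lambda>S T. Gst w b c d S (h T)"]) (unfold Gst_def, measurable)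

text \<open>Averages are odd in the observable: an upper bound for the negated pair c, d is a lower
  bound for the original pair.\<close>

lemma glw_neg_obs: "obs (\<lambda>a. - c a) (\<lambda>a a'. - d a a') V adj r \<sigma> = - obs c d V adj r \<sigma>"
  by (simp add: obs_def sum_negf)

lemma GE_neg: "GE w b (\<lambda>a. - c a) (\<lambda>a a'. - d a a') n G i = - GE w b c d n G i"
  unfolding GE_def glw_neg_obs by (simp add: sum_negf)

lemma Gst_neg: "Gst w b (\<lambda>a. - c a) (\<lambda>a a'. - d a a') J x = - Gst w b c d J x"
proof -
  have "(\<Sum>a\<in>UNIV. b a * (- c a * (\<Prod>j\<in>J. \<Sum>s\<in>UNIV. w a s * x j s)
      + 1/2 * (\<Sum>j\<in>J. (\<Sum>s\<in>UNIV. w a s * x j s * - d a s) * (\<Prod>i\<in>J - {j}. \<Sum>s\<in>UNIV. w a s * x i s))))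
    = - (\<Sum>a\<in>UNIV. b a * (c a * (\<Prod>j\<in>J. \<Sum>s\<in>UNIV. w a s * x j s)
      + 1/2 * (\<Sum>j\<in>J. (\<Sum>s\<in>UNIV. w a s * x j s * d a s) * (\<Prod>i\<in>J - {j}. \<Sum>s\<in>UNIV. w a s * x i s))))"
    unfolding sum_negf[symmetric] by (intro sum.cong refl) (simp add: sum_negf algebra_simps)
  then show ?thesis unfolding Gst_def by simp
qed

section \<open>Limits of vertex averages at a fixed parameter\<close>

locale lwc_spin = spin w b sp + lwc_graphs Gn \<mu>
  for w :: "'x::finite \<Rightarrow> 'x \<Rightarrow> real" and b sp Gn \<mu>
begin

context
  fixes \<psi> :: "real \<Rightarrow> 'x \<Rightarrow> 'x \<Rightarrow> real" and \<psi>b :: "real \<Rightarrow> 'x \<Rightarrow> real" and \<beta> B h and c :: "'x \<Rightarrow> real" and d :: "'x \<Rightarrow> 'x \<Rightarrow> real" and K :: real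
  assumes w: "w = \<psi> \<beta>" "b = \<psi>b B" and u: "uniq \<psi> \<psi>b \<mu> \<beta> B" and h: "h \<in> Hstar \<psi> \<psi>b \<mu> \<beta> B"
 and cd: "\<And>a. \<bar>c a\<bar> \<le> K" "\<And>a a'. \<bar>d a a'\<bar> \<le> K"
begin

lemma Gst_AE: "AE T in \<mu>. \<bar>Gst w b c d (nbrs T []) (\<lambda>j. h T j [])\<bar> \<le> K * (1 + real (deg T []))"
  using Hstar_all_edges[OF h] AE_utree
proof eventually_elim
  case (elim T)
  have hm: "is_message h" using h by (simp add: Hstar_def)
  have bp: "bp_fixed_at \<psi> \<psi>b \<beta> B h T x y" if "x \<in> T" "y \<in> T" "tadj x y" for x y using elim(1) that by simp
  have "\<exists>q. (\<forall>n. dsys w b T n q) \<and> (\<Sum>\<omega>\<in>conf T (Suc 0). q (Suc 0, \<omega>) * obs c d T tadj [] \<omega>) = Gst w b c d (nbrs T []) (\<lambda>j. h T j [])"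
    by (rule fixed_point_dsys[where \<psi>=\<psi> and \<beta>=\<beta> and \<psi>b=\<psi>b and B=B and h=h, OF elim(2) hm _ w]) (rule bp)
  then
  obtain q where q: "\<forall>n. dsys w b T n q" "(\<Sum>\<omega>\<in>conf T (Suc 0). q (Suc 0, \<omega>) * obs c d T tadj [] \<omega>) = Gst w b c d (nbrs T []) (\<lambda>j. h T j [])"
    by (elim exE conjE)
  show ?case using Gst_bound[where c=c and d=d and K=K, OF q(1)[rule_format] cd] unfolding q(2) .
qed

lemma Gst_m: "(\<lambda>T. Gst w b c d (nbrs T []) (\<lambda>j. h T j [])) \<in> borel_measurable \<mu>"
  using h by (intro measurable_\<mu> Gst_measurable) (auto simp: Hstar_def intro: is_messageD)

lemma K_deg_int: "integrable \<mu> (\<lambda>T. K * (1 + real (deg T [])))"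
  using deg_int by simp

lemma Gst_int: "integrable \<mu> (\<lambda>T. Gst w b c d (nbrs T []) (\<lambda>j. h T j []))"
  by (rule Bochner_Integration.integrable_bound[OF K_deg_int Gst_m])
     (use Gst_AE in \<open>eventually_elim, auto\<close>)

text \<open>For a fixed radius, local convergence bounds the graph average by the mean of the
  extreme value on the tree; the radius is chosen so that this mean exceeds that of the fixed point
  observable by little.\<close>

lemma graph_average_upper:
  assumes e: "0 < e"
  shows "eventually (\<lambda>n. EG n (\<lambda>G. (\<Sum>i<n. GE w b c d n G i) / real n) \<le> (\<integral>T. Gst w b c d (nbrs T []) (\<lambda>j. h T j []) \<partial>\<mu>) + e) sequentially"
proof -
  let ?g = "\<lambda>T. Gst w b c d (nbrs T []) (\<lambda>j. h T j [])"
  let ?f = "\<lambda>n T. hiv w b c d (tball T (Suc n)) n"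
  have K: "0 \<le> K" using cd(1)[of undefined] by linarith
  have fm: "?f n \<in> borel_measurable \<mu>" for n
    by (rule measurable_\<mu>, rule measurable_via_tball[where g="\<lambda>S. hiv w b c d S n"]) simp
  have fb: "AE T in \<mu>. \<bar>?f n T\<bar> \<le> K * (1 + real (deg T []))" for n
    using AE_utree
  proof eventually_elim
    case (elim T)
    show ?case using hiv_bound[where c=c and d=d and K=K, OF utree_tball[OF elim] finite_tball[OF elim] cd, of "Suc n" n] deg_tball[of "Suc n" T] by simp
  qed
  have fi: "integrable \<mu> (?f n)" for n
    by (rule Bochner_Integration.integrable_bound[OF K_deg_int fm]) (use fb[of n] in \<open>eventually_elim, auto\<close>)
  \<comment> \<open>Decorrelation is used to bound the extreme value from above only; its maximum
    with the intended limit is a sequence that does converge.\<close>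
  have "(\<lambda>n. \<integral>T. max (?f n T) (?g T) \<partial>\<mu>) \<longlonglongrightarrow> (\<integral>T. ?g T \<partial>\<mu>)"
  proof (rule integral_dominated_convergence[where w="\<lambda>T. K * (1 + real (deg T []))"])
    show "AE T in \<mu>. (\<lambda>n. max (?f n T) (?g T)) \<longlonglongrightarrow> ?g T"
      using Hstar_all_edges[OF h] AE_utree u unfolding uniq_def
    proof eventually_elim
      case (elim T)
      have hm: "is_message h" using h by (simp add: Hstar_def)
      have bp: "bp_fixed_at \<psi> \<psi>b \<beta> B h T x y" if "x \<in> T" "y \<in> T" "tadj x y" for x y using elim(1) that by simp
      have "\<exists>q. (\<forall>n. dsys w b T n q) \<and> (\<Sum>\<omega>\<in>conf T (Suc 0). q (Suc 0, \<omega>) * obs c d T tadj [] \<omega>) = Gst w b c d (nbrs T []) (\<lambda>j. h T j [])"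
    by (rule fixed_point_dsys[where \<psi>=\<psi> and \<beta>=\<beta> and \<psi>b=\<psi>b and B=B and h=h, OF elim(2) hm _ w]) (rule bp)
  then
      obtain q where q: "\<forall>n. dsys w b T n q" "(\<Sum>\<omega>\<in>conf T (Suc 0). q (Suc 0, \<omega>) * obs c d T tadj [] \<omega>) = ?g T"
        by (elim exE conjE)
      show ?case
      proof (rule LIMSEQ_I)
        fix r :: real assume "0 < r"
        then have "0 < r / 2" by simp
        from tree_hiv[OF elim(2,3) w this, of c d] obtain N where
          N: "\<And>n. N \<le> n \<Longrightarrow> ?f n T \<le> ?g T + r / 2" using q by metis
        show "\<exists>no. \<forall>n\<ge>no. norm (max (?f n T) (?g T) - ?g T) < r"
        proof (intro exI[of _ N] allI impI)
          fix n assume "N \<le> n"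
          from N[OF this] show "norm (max (?f n T) (?g T) - ?g T) < r" using \<open>0 < r\<close> by (auto simp: max_def)
        qed
      qed
    qed
    show "AE T in \<mu>. norm (max (?f n T) (?g T)) \<le> K * (1 + real (deg T []))" for n
      using fb[of n] Gst_AE by eventually_elim (auto simp: max_def)
  qed (use K_deg_int fm Gst_m in auto)
  then have "eventually (\<lambda>n. (\<integral>T. max (?f n T) (?g T) \<partial>\<mu>) < (\<integral>T. ?g T \<partial>\<mu>) + e / 2) sequentially"
    using e by (intro order_tendstoD(2)) auto
  then obtain k where k: "(\<integral>T. max (?f k T) (?g T) \<partial>\<mu>) < (\<integral>T. ?g T \<partial>\<mu>) + e / 2" by (auto simp: eventually_sequentially)
  have "(\<integral>T. ?f k T \<partial>\<mu>) \<le> (\<integral>T. max (?f k T) (?g T) \<partial>\<mu>)"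
    by (rule integral_mono_AE) (use fi Gst_int in auto)
  moreover have "eventually (\<lambda>n. EG n (\<lambda>G. (\<Sum>i<n. GE w b c d n G i) / real n) \<le> (\<integral>T. ?f k T \<partial>\<mu>) + e / 2) sequentially"
  proof (rule lwc_upper[where K=K and hi="\<lambda>\<tau>. hiv w b c d \<tau> k" and t="Suc k"])
    show "\<bar>hiv w b c d \<tau> k\<bar> \<le> K * (1 + real (deg \<tau> []))" if "utree \<tau>" "finite \<tau>" for \<tau>
      by (rule hiv_bound[OF that cd])
    show "hiv w b c d \<tau> k = hiv w b c d \<tau>' k"
      if "utree \<tau>" "finite \<tau>" "utree \<tau>'" "finite \<tau>'" "riso2 \<tau> tadj [] [] \<tau>' tadj [] []" for \<tau> \<tau>'
      by (rule hiv_iso[OF that])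
    show "\<bar>GE w b c d n G i\<bar> \<le> K * (1 + real (gdeg G n i))" for n G i by (rule GE_bound[OF cd])
    show "GE w b c d n G i \<le> hiv w b c d \<tau> k"
      if "graph_on n G" "i < n" "utree \<tau>" "finite \<tau>" "riso2 (gball G i (Suc k)) G i i \<tau> tadj [] []" for n G i \<tau>
      by (rule GE_le_hiv[OF that])
  qed (use e K in auto)
  ultimately show ?thesis using k by (elim eventually_mono) linarith
qed

end

lemma graph_average:
  fixes c :: "'x \<Rightarrow> real" and d :: "'x \<Rightarrow> 'x \<Rightarrow> real"
  assumes w: "w = \<psi> \<beta>" "b = \<psi>b B" and u: "uniq \<psi> \<psi>b \<mu> \<beta> B" and h: "h \<in> Hstar \<psi> \<psi>b \<mu> \<beta> B"
 and cd: "\<And>a. \<bar>c a\<bar> \<le> K" "\<And>a a'. \<bar>d a a'\<bar> \<le> K"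
  shows "(\<lambda>n. EG n (\<lambda>G. (\<Sum>i<n. GE w b c d n G i) / real n)) \<longlonglongrightarrow> (\<integral>T. Gst w b c d (nbrs T []) (\<lambda>j. h T j []) \<partial>\<mu>)"
    (is "?a \<longlonglongrightarrow> ?l")
proof (rule LIMSEQ_I)
  fix e :: real assume e: "0 < e"
  have 1: "eventually (\<lambda>n. ?a n \<le> ?l + e / 2) sequentially"
    by (rule graph_average_upper[OF w u h cd]) (use e in auto)
  have "eventually (\<lambda>n. EG n (\<lambda>G. (\<Sum>i<n. GE w b (\<lambda>a. - c a) (\<lambda>a a'. - d a a') n G i) / real n)
     \<le> (\<integral>T. Gst w b (\<lambda>a. - c a) (\<lambda>a a'. - d a a') (nbrs T []) (\<lambda>j. h T j []) \<partial>\<mu>) + e / 2) sequentially"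
    by (rule graph_average_upper[OF w u h, of _ K]) (use e cd in auto)
  then have 2: "eventually (\<lambda>n. - ?a n \<le> - ?l + e / 2) sequentially"
    unfolding GE_neg Gst_neg by (simp add: sum_negf)
  show "\<exists>no. \<forall>n\<ge>no. norm (?a n - ?l) < e"
    using eventually_conj[OF 1 2] e unfolding eventually_sequentially by (fastforce simp: abs_less_iff)
qed

end

section \<open>The derivative of the free energy\<close>

lemma DERIV_prod_log:
  fixes f :: "'i \<Rightarrow> real \<Rightarrow> real"
  assumes "finite A" "\<And>i. i \<in> A \<Longrightarrow> ((\<lambda>p. f i p) has_real_derivative f i p * l i) (at p)"
  shows "((\<lambda>p. \<Prod>i\<in>A. f i p) has_real_derivative (\<Prod>i\<in>A. f i p) * (\<Sum>i\<in>A. l i)) (at p)"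
  using assms
proof (induction A rule: finite_induct)
  case (insert i A)
  have "((\<lambda>p. f i p * (\<Prod>i\<in>A. f i p)) has_real_derivative f i p * l i * (\<Prod>i\<in>A. f i p) + (\<Prod>i\<in>A. f i p) * (\<Sum>i\<in>A. l i) * f i p) (at p)"
    by (rule DERIV_mult) (use insert in auto)
  then show ?case using insert(1,2) by (simp add: algebra_simps)
qed simp

definition PE :: "nat \<Rightarrow> (nat \<Rightarrow> nat \<Rightarrow> bool) \<Rightarrow> (nat \<times> nat) set" where
  "PE n G = {(i, j). i < j \<and> j < n \<and> G i j}"

lemma finite_PE: "finite (PE n G)"
  by (rule finite_subset[of _ "{..<n} \<times> {..<n}"]) (auto simp: PE_def)

lemma epairs_PE:
  assumes "graph_on n G"
  shows "epairs {..<n} G {..<n} = PE n G \<union> prod.swap ` PE n G" "PE n G \<inter> prod.swap ` PE n G = {}"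
proof -
  show "epairs {..<n} G {..<n} = PE n G \<union> prod.swap ` PE n G"
  proof (intro equalityI subsetI)
    fix e assume "e \<in> epairs {..<n} G {..<n}"
    then obtain i j where e: "e = (i, j)" "i < n" "j < n" "G i j" by (auto simp: epairs_def)
    then have "i \<noteq> j" "G j i" using assms by (auto simp: graph_on_def)
    then have "(i, j) \<in> PE n G \<or> (j, i) \<in> PE n G" using e by (auto simp: PE_def)
    then show "e \<in> PE n G \<union> prod.swap ` PE n G" using e by force
  next
    fix e assume "e \<in> PE n G \<union> prod.swap ` PE n G"
    then show "e \<in> epairs {..<n} G {..<n}" using assms by (auto simp: PE_def epairs_def graph_on_def)
  qed
  show "PE n G \<inter> prod.swap ` PE n G = {}" by (auto simp: PE_def)
qed

lemma (in spin) glw_PE: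
  assumes "graph_on n G"
  shows "glw w b {..<n} G {..<n} \<sigma> = (\<Prod>e\<in>PE n G. w (\<sigma> (fst e)) (\<sigma> (snd e))) * (\<Prod>i<n. b (\<sigma> i))"
proof -
  have "(\<Prod>(u, v)\<in>epairs {..<n} G {..<n}. sqrt (w (\<sigma> u) (\<sigma> v))) = (\<Prod>(u, v)\<in>PE n G. sqrt (w (\<sigma> u) (\<sigma> v))) * (\<Prod>(u, v)\<in>PE n G. sqrt (w (\<sigma> v) (\<sigma> u)))"
    unfolding epairs_PE(1)[OF assms] using epairs_PE(2)[OF assms] finite_PE[of n G]
    by (subst prod.union_disjoint) (auto simp: prod.reindex case_prod_beta)
  also have "\<dots> = (\<Prod>e\<in>PE n G. w (\<sigma> (fst e)) (\<sigma> (snd e)))"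
    unfolding prod.distrib[symmetric] case_prod_beta by (intro prod.cong refl) (subst (2) w_sym, simp add: w_nn)
  finally show ?thesis by (simp add: glw_def)
qed

lemma sum_obs_PE:
  assumes G: "graph_on n G" and d: "\<And>a a'. d a a' = d a' a"
  shows "(\<Sum>i<n. obs c d {..<n} G i \<sigma>) = (\<Sum>e\<in>PE n G. d (\<sigma> (fst e)) (\<sigma> (snd e))) + (\<Sum>i<n. c (\<sigma> i))"
proof -
  have "(\<Sum>i<n. \<Sum>j\<in>{j\<in>{..<n}. G i j}. d (\<sigma> i) (\<sigma> j)) = (\<Sum>(i, j)\<in>epairs {..<n} G {..<n}. d (\<sigma> i) (\<sigma> j))"
    by (subst sum.Sigma) (auto intro!: sum.cong simp: epairs_def)
  also have "\<dots> = (\<Sum>(u, v)\<in>PE n G. d (\<sigma> u) (\<sigma> v)) + (\<Sum>(u, v)\<in>PE n G. d (\<sigma> v) (\<sigma> u))"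
    unfolding epairs_PE(1)[OF G] using epairs_PE(2)[OF G] finite_PE[of n G]
    by (subst sum.union_disjoint) (auto simp: sum.reindex case_prod_beta)
  also have "\<dots> = 2 * (\<Sum>e\<in>PE n G. d (\<sigma> (fst e)) (\<sigma> (snd e)))"
    by (simp add: case_prod_beta d[of "\<sigma> (snd _)"])
  finally show ?thesis unfolding obs_def by (simp add: sum.distrib sum_distrib_left[symmetric] sum_divide_distrib[symmetric])
qed

lemma (in spin) Zg_eq:
  assumes "graph_on n G" "w = \<psi> \<beta>" "b = \<psi>b B"
  shows "Zg \<psi> \<psi>b \<beta> B n G = (\<Sum>\<sigma>\<in>PiE {..<n} (\<lambda>_. UNIV). glw w b {..<n} G {..<n} \<sigma>)"
  unfolding Zg_def glw_PE[OF assms(1)] by (simp add: assms(2,3) PE_def lessThan_atLeast0)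

text \<open>A one-parameter family of specifications with logarithmic derivatives c (vertices) and
  d (edges); forbidden pairs have weight identically 0 and any d.\<close>

locale spin_family =
  fixes \<psi> :: "real \<Rightarrow> 'x::finite \<Rightarrow> 'x \<Rightarrow> real" and \<psi>b :: "real \<Rightarrow> 'x \<Rightarrow> real" and sp :: 'x
    and c :: "real \<Rightarrow> 'x \<Rightarrow> real" and d :: "real \<Rightarrow> 'x \<Rightarrow> 'x \<Rightarrow> real"
  assumes spin: "spin (\<psi> p) (\<psi>b p) sp"
    and d_sym: "d p s t = d p t s"
    and psi_deriv: "((\<lambda>p. \<psi> p s t) has_real_derivative \<psi> p s t * d p s t) (at p)"
    and psib_deriv: "((\<lambda>p. \<psi>b p s) has_real_derivative \<psi>b p s * c p s) (at p)"
    and c_cont: "continuous_on UNIV (\<lambda>p. c p s)" and d_cont: "continuous_on UNIV (\<lambda>p. d p s t)"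

text \<open>c and d are the derivatives of the logarithms. For a forbidden pair the logarithm is
  that of the constant 0, so d is again continuous, and the weight satisfies its derivative rule
  trivially.\<close>

lemma H1_family:
  assumes H: "H1 \<psi> \<psi>b"
  shows "\<exists>sp c d. spin_family \<psi> \<psi>b sp c d"
proof -
  obtain sp where sp: "\<And>\<beta> s. \<psi> \<beta> s sp > 0" using H unfolding H1_def by blast
  have sym: "\<psi> p s t = \<psi> p t s" and nn: "0 \<le> \<psi> p s t" and bpos: "0 < \<psi>b p s"
    and bC: "(\<lambda>B. ln (\<psi>b B s)) C1_differentiable_on UNIV"
    and pC: "(\<forall>\<beta>. \<psi> \<beta> s t = 0) \<or> ((\<forall>\<beta>. \<psi> \<beta> s t > 0) \<and> (\<lambda>\<beta>. ln (\<psi> \<beta> s t)) C1_differentiable_on UNIV)" for p s t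
    using H unfolding H1_def by simp_all
  have C1: "(f has_real_derivative deriv f p) (at p) \<and> continuous_on UNIV (deriv f)" if C: "f C1_differentiable_on UNIV" for f :: "real \<Rightarrow> real" and p
  proof -
    obtain D where D: "\<And>x. (f has_vector_derivative D x) (at x)" "continuous_on UNIV D"
      using C unfolding C1_differentiable_on_def by auto
    then have "(f has_real_derivative D x) (at x)" for x by (simp add: has_real_derivative_iff_has_vector_derivative)
    moreover from this have "deriv f = D" by (intro ext DERIV_imp_deriv)
    ultimately show ?thesis using D by simp
  qed
  have ln_pos: "(f has_real_derivative f p * deriv (\<lambda>p. ln (f p)) p) (at p)"
    if C: "(\<lambda>p. ln (f p)) C1_differentiable_on UNIV" and pos: "\<And>p. 0 < f p" for f :: "real \<Rightarrow> real" and p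
  proof -
    have "((\<lambda>p. exp (ln (f p))) has_real_derivative exp (ln (f p)) * deriv (\<lambda>p. ln (f p)) p) (at p)"
      by (rule DERIV_chain2[OF DERIV_exp]) (use C1[OF C] in blast)
    then show ?thesis by (simp add: pos)
  qed
  let ?c = "\<lambda>p s. deriv (\<lambda>p. ln (\<psi>b p s)) p" and ?d = "\<lambda>p s t. deriv (\<lambda>p. ln (\<psi> p s t)) p"
  have "spin_family \<psi> \<psi>b sp ?c ?d"
  proof
    fix p s t
    show "\<psi> p s t = \<psi> p t s" "0 \<le> \<psi> p s t" "0 < \<psi>b p s" "0 < \<psi> p s sp" using sym nn bpos sp by auto
    show "?d p s t = ?d p t s" by (subst sym) (rule refl)
    show "((\<lambda>p. \<psi> p s t) has_real_derivative \<psi> p s t * ?d p s t) (at p)"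
      using pC[of s t]
    proof
      assume z: "\<forall>\<beta>. \<psi> \<beta> s t = 0"
      then show ?thesis by simp
    next
      assume z: "(\<forall>\<beta>. \<psi> \<beta> s t > 0) \<and> (\<lambda>\<beta>. ln (\<psi> \<beta> s t)) C1_differentiable_on UNIV"
      show ?thesis by (rule ln_pos) (use z in auto)
    qed
    show "((\<lambda>p. \<psi>b p s) has_real_derivative \<psi>b p s * ?c p s) (at p)" by (rule ln_pos[OF bC bpos])
    show "continuous_on UNIV (\<lambda>p. ?c p s)" using C1[OF bC[of s]] by simp
    show "continuous_on UNIV (\<lambda>p. ?d p s t)"
      using pC[of s t]
    proof
      assume "\<forall>\<beta>. \<psi> \<beta> s t = 0"
      then show ?thesis by simp
    next
      assume "(\<forall>\<beta>. \<psi> \<beta> s t > 0) \<and> (\<lambda>\<beta>. ln (\<psi> \<beta> s t)) C1_differentiable_on UNIV"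
      then show ?thesis using C1 by blast
    qed
  qed
  then show ?thesis by blast
qed

context spin_family
begin

text \<open>The logarithmic derivative of a configuration weight is the sum of \<open>obs\<close>
  over the vertices, so the log partition function has as derivative a sum of Gibbs means at single
  vertices, the form to which local convergence applies.\<close>

lemma lnZ_deriv:
  fixes p :: real
  assumes G: "graph_on n G"
  shows "((\<lambda>p. ln (Zg \<psi> \<psi>b p p n G)) has_real_derivative (\<Sum>i<n. GE (\<psi> p) (\<psi>b p) (c p) (d p) n G i)) (at p)"
proof -
  interpret S: spin "\<psi> u" "\<psi>b u" sp for u by (rule spin)
  let ?C = "PiE {..<n} (\<lambda>_. UNIV :: 'x set)"
  let ?W = "\<lambda>p \<sigma>. glw (\<psi> p) (\<psi>b p) {..<n} G {..<n} \<sigma>"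
  have Z: "Zg \<psi> \<psi>b p p n G = (\<Sum>\<sigma>\<in>?C. ?W p \<sigma>)" for p by (rule S.Zg_eq[OF G refl refl])
  have pos: "0 < (\<Sum>\<sigma>\<in>?C. ?W p \<sigma>)" for p by (rule S.graph_weight_pos)
  have W: "((\<lambda>p. ?W p \<sigma>) has_real_derivative ?W p \<sigma> * (\<Sum>i<n. obs (c p) (d p) {..<n} G i \<sigma>)) (at p)" for \<sigma>
  proof -
    have "((\<lambda>p. (\<Prod>e\<in>PE n G. \<psi> p (\<sigma> (fst e)) (\<sigma> (snd e))) * (\<Prod>i<n. \<psi>b p (\<sigma> i))) has_real_derivative
       (\<Prod>e\<in>PE n G. \<psi> p (\<sigma> (fst e)) (\<sigma> (snd e))) * (\<Sum>e\<in>PE n G. d p (\<sigma> (fst e)) (\<sigma> (snd e))) * (\<Prod>i<n. \<psi>b p (\<sigma> i))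
       + (\<Prod>i<n. \<psi>b p (\<sigma> i)) * (\<Sum>i<n. c p (\<sigma> i)) * (\<Prod>e\<in>PE n G. \<psi> p (\<sigma> (fst e)) (\<sigma> (snd e)))) (at p)"
      by (intro DERIV_mult DERIV_prod_log finite_PE finite_lessThan psi_deriv psib_deriv)
    then show ?thesis unfolding S.glw_PE[OF G] sum_obs_PE[OF G d_sym] by (simp add: algebra_simps)
  qed
  have S: "((\<lambda>p. \<Sum>\<sigma>\<in>?C. ?W p \<sigma>) has_real_derivative (\<Sum>\<sigma>\<in>?C. ?W p \<sigma> * (\<Sum>i<n. obs (c p) (d p) {..<n} G i \<sigma>))) (at p)"
    by (rule DERIV_sum[OF W])
  have "((\<lambda>p. ln (\<Sum>\<sigma>\<in>?C. ?W p \<sigma>)) has_real_derivative 1 / (\<Sum>\<sigma>\<in>?C. ?W p \<sigma>) * (\<Sum>\<sigma>\<in>?C. ?W p \<sigma> * (\<Sum>i<n. obs (c p) (d p) {..<n} G i \<sigma>))) (at p)"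
    by (rule DERIV_chain2[OF DERIV_ln_divide[OF pos] S])
  moreover have "(\<Sum>\<sigma>\<in>?C. ?W p \<sigma> * (\<Sum>i<n. obs (c p) (d p) {..<n} G i \<sigma>)) = (\<Sum>i<n. \<Sum>\<sigma>\<in>?C. ?W p \<sigma> * obs (c p) (d p) {..<n} G i \<sigma>)"
    unfolding sum_distrib_left by (rule sum.swap)
  ultimately have D: "((\<lambda>p. ln (\<Sum>\<sigma>\<in>?C. ?W p \<sigma>)) has_real_derivative 1 / (\<Sum>\<sigma>\<in>?C. ?W p \<sigma>) * (\<Sum>i<n. \<Sum>\<sigma>\<in>?C. ?W p \<sigma> * obs (c p) (d p) {..<n} G i \<sigma>)) (at p)"
    by (simp only:)
  have E: "(\<Sum>i<n. GE (\<psi> p) (\<psi>b p) (c p) (d p) n G i) = 1 / (\<Sum>\<sigma>\<in>?C. ?W p \<sigma>) * (\<Sum>i<n. \<Sum>\<sigma>\<in>?C. ?W p \<sigma> * obs (c p) (d p) {..<n} G i \<sigma>)"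
    unfolding GE_def sum_divide_distrib[symmetric] by simp
  show ?thesis unfolding Z by (rule DERIV_cong[OF D E[symmetric]])
qed

lemma cd_bound: "\<exists>K\<ge>0. \<forall>p\<in>{lo..hi}. (\<forall>s. \<bar>c p s\<bar> \<le> K) \<and> (\<forall>s t. \<bar>d p s t\<bar> \<le> K)"
proof -
  have bd: "\<exists>K\<ge>0. \<forall>p\<in>{lo..hi}. \<bar>f p\<bar> \<le> K" if "continuous_on UNIV f" for f :: "real \<Rightarrow> real"
  proof -
    have "compact (f ` {lo..hi})" by (rule compact_continuous_image[OF continuous_on_subset[OF that]]) auto
    then obtain K where "\<forall>x\<in>f ` {lo..hi}. norm x \<le> K" using compact_imp_bounded bounded_iff by blast
    then have "\<forall>p\<in>{lo..hi}. \<bar>f p\<bar> \<le> max 0 K" by (auto simp: max_def)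
    then show ?thesis by (intro exI[of _ "max 0 K"]) auto
  qed
  obtain Kc where Kc: "\<And>s. 0 \<le> Kc s" "\<And>s p. p \<in> {lo..hi} \<Longrightarrow> \<bar>c p s\<bar> \<le> Kc s"
    using bd[OF c_cont] by metis
  obtain Kd where Kd: "\<And>s t. 0 \<le> Kd s t" "\<And>s t p. p \<in> {lo..hi} \<Longrightarrow> \<bar>d p s t\<bar> \<le> Kd s t"
    using bd[OF d_cont] by metis
  let ?A = "\<Sum>s\<in>UNIV. Kc s" and ?B = "\<Sum>(s, t)\<in>UNIV. Kd s t"
  have A: "Kc s \<le> ?A" for s by (rule member_le_sum) (auto simp: Kc)
  have B: "Kd s t \<le> ?B" for s t using member_le_sum[of "(s, t)" UNIV "case_prod Kd"] Kd(1) by auto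
  have nn: "0 \<le> ?A" "0 \<le> ?B" using Kc(1) Kd(1) by (auto intro!: sum_nonneg)
  show ?thesis
  proof (intro exI[of _ "?A + ?B"] conjI ballI allI)
    fix p s t assume p: "p \<in> {lo..hi}"
    show "\<bar>c p s\<bar> \<le> ?A + ?B" using Kc(2)[OF p, of s] A[of s] nn by linarith
    show "\<bar>d p s t\<bar> \<le> ?A + ?B" using Kd(2)[OF p, of s t] B[of s t] nn by linarith
  qed (use nn in auto)
qed

end

section \<open>Integration of the derivative over the parameter\<close>

locale lwc_family = spin_family \<psi> \<psi>b sp c d + lwc_graphs Gn \<mu>
  for \<psi> :: "real \<Rightarrow> 'x::finite \<Rightarrow> 'x \<Rightarrow> real" and \<psi>b sp c d Gn \<mu> +
  fixes lo hi :: real and h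
  assumes lohi: "lo \<le> hi"
    and uniq: "p \<in> {lo..hi} \<Longrightarrow> uniq \<psi> \<psi>b \<mu> p p"
    and Hstar: "p \<in> {lo..hi} \<Longrightarrow> h p \<in> Hstar \<psi> \<psi>b \<mu> p p"
begin

definition g :: "real \<Rightarrow> real" where
  "g p = (\<integral>T. Gst (\<psi> p) (\<psi>b p) (c p) (d p) (nbrs T []) (\<lambda>j. h p T j []) \<partial>\<mu>)"

definition dphi :: "nat \<Rightarrow> real \<Rightarrow> real" where
  "dphi n p = EG n (\<lambda>G. (\<Sum>i<n. GE (\<psi> p) (\<psi>b p) (c p) (d p) n G i) / real n)"

lemma phin_deriv: "((\<lambda>p. phin \<psi> \<psi>b Gn n p p) has_real_derivative dphi n p) (at p)"
proof -
  have E: "EG n f = (\<Sum>G\<in>set_pmf (Gn n). f G * pmf (Gn n) G)" for f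
    by (rule integral_measure_pmf_real[OF finite_Gn]) auto
  have eq: "(\<Sum>G\<in>set_pmf (Gn n). S G * pmf (Gn n) G) / real n = (\<Sum>G\<in>set_pmf (Gn n). S G / real n * pmf (Gn n) G)" for S
    by (simp add: sum_divide_distrib)
  have "((\<lambda>p. (\<Sum>G\<in>set_pmf (Gn n). ln (Zg \<psi> \<psi>b p p n G) * pmf (Gn n) G) / real n) has_real_derivative
     (\<Sum>G\<in>set_pmf (Gn n). (\<Sum>i<n. GE (\<psi> p) (\<psi>b p) (c p) (d p) n G i) * pmf (Gn n) G) / real n) (at p)"
    by (intro DERIV_sum DERIV_cdivide DERIV_cmult_right lnZ_deriv Gn_graph)
  then show ?thesis unfolding phin_def dphi_def E eq .
qed

text \<open>Degrees below a fixed L contribute at most L, the others are controlled by uniform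
  sparsity. This supplies the dominating constant for the integration over the parameter.\<close>

lemma avg_deg: "\<exists>C. eventually (\<lambda>n. EG n (\<lambda>G. (\<Sum>i<n. 1 + real (gdeg G n i)) / real n) \<le> C) sequentially"
proof -
  obtain L where L: "eventually (\<lambda>n. EG n (\<lambda>G. (\<Sum>i<n. real (gdeg G n i) * (if gdeg G n i \<ge> L then 1 else 0)) / real n) < 1) sequentially"
    using sparse[of 1] by auto
  show ?thesis
  proof (intro exI[of _ "1 + real L + 1"] eventually_mono[OF eventually_conj[OF L eventually_gt_at_top[of 0]]])
    fix n :: nat
    let ?S = "\<lambda>G. (\<Sum>i<n. real (gdeg G n i) * (if gdeg G n i \<ge> L then 1 else 0)) / real n"
    assume n: "EG n ?S < 1 \<and> 0 < n"
    have "EG n (\<lambda>G. (\<Sum>i<n. 1 + real (gdeg G n i)) / real n) \<le> EG n (\<lambda>G. (1 + real L) + ?S G)"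
    proof (rule EG_mono)
      fix G
      have "(\<Sum>i<n. 1 + real (gdeg G n i)) \<le> (\<Sum>i<n. (1 + real L) + real (gdeg G n i) * (if gdeg G n i \<ge> L then 1 else 0))"
        by (rule sum_mono) auto
      also have "\<dots> = real n * (1 + real L) + (\<Sum>i<n. real (gdeg G n i) * (if gdeg G n i \<ge> L then 1 else 0))"
        by (simp add: sum.distrib algebra_simps)
      finally show "(\<Sum>i<n. 1 + real (gdeg G n i)) / real n \<le> (1 + real L) + ?S G"
        using n by (simp add: divide_le_eq algebra_simps)
    qed
    also have "\<dots> = (1 + real L) + EG n ?S" by simp
    finally show "EG n (\<lambda>G. (\<Sum>i<n. 1 + real (gdeg G n i)) / real n) \<le> 1 + real L + 1" using n by linarith
  qed
qed

lemma dphi_limit: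
  assumes p: "p \<in> {lo..hi}"
  shows "(\<lambda>n. dphi n p) \<longlonglongrightarrow> g p"
proof -
  obtain K where K: "\<And>s. \<bar>c p s\<bar> \<le> K" "\<And>s t. \<bar>d p s t\<bar> \<le> K" using cd_bound[of lo hi] p by blast
  interpret S: spin "\<psi> p" "\<psi>b p" sp by (rule spin)
  interpret L: lwc_spin "\<psi> p" "\<psi>b p" sp Gn \<mu> ..
  show ?thesis unfolding dphi_def g_def
    by (rule L.graph_average[OF refl refl uniq[OF p] Hstar[OF p] K])
qed

text \<open>The derivative is known to converge pointwise in p only; bounded mean degree and the
  bounds for c and d on the interval allow dominated convergence.\<close>

lemma phin_integral:
  shows "g integrable_on {lo..hi}"
    "(\<lambda>n. phin \<psi> \<psi>b Gn n hi hi - phin \<psi> \<psi>b Gn n lo lo) \<longlonglongrightarrow> integral {lo..hi} g"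
proof -
  obtain C where C: "eventually (\<lambda>n. EG n (\<lambda>G. (\<Sum>i<n. 1 + real (gdeg G n i)) / real n) \<le> C) sequentially"
    using avg_deg by blast
  then obtain N where N: "\<And>n. N \<le> n \<Longrightarrow> EG n (\<lambda>G. (\<Sum>i<n. 1 + real (gdeg G n i)) / real n) \<le> C"
    by (auto simp: eventually_sequentially)
  obtain K where K: "0 \<le> K" "\<And>p s. p \<in> {lo..hi} \<Longrightarrow> \<bar>c p s\<bar> \<le> K" "\<And>p s t. p \<in> {lo..hi} \<Longrightarrow> \<bar>d p s t\<bar> \<le> K"
    using cd_bound[of lo hi] by blast
  have bd: "\<bar>dphi n p\<bar> \<le> K * C" if n: "N \<le> n" and p: "p \<in> {lo..hi}" for n p
  proof -
    interpret S: spin "\<psi> p" "\<psi>b p" sp by (rule spin)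
    have "\<bar>dphi n p\<bar> \<le> EG n (\<lambda>G. \<bar>(\<Sum>i<n. GE (\<psi> p) (\<psi>b p) (c p) (d p) n G i) / real n\<bar>)"
      unfolding dphi_def by (rule integral_abs_bound)
    also have "\<dots> \<le> EG n (\<lambda>G. K * ((\<Sum>i<n. 1 + real (gdeg G n i)) / real n))"
    proof (rule EG_mono)
      fix G
      have "\<bar>\<Sum>i<n. GE (\<psi> p) (\<psi>b p) (c p) (d p) n G i\<bar> \<le> (\<Sum>i<n. \<bar>GE (\<psi> p) (\<psi>b p) (c p) (d p) n G i\<bar>)" by (rule sum_abs)
      also have "\<dots> \<le> (\<Sum>i<n. K * (1 + real (gdeg G n i)))" by (intro sum_mono S.GE_bound K p)
      finally have "\<bar>\<Sum>i<n. GE (\<psi> p) (\<psi>b p) (c p) (d p) n G i\<bar> / real n \<le> K * (\<Sum>i<n. 1 + real (gdeg G n i)) / real n"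
        by (intro divide_right_mono) (auto simp: sum_distrib_left)
      then show "\<bar>(\<Sum>i<n. GE (\<psi> p) (\<psi>b p) (c p) (d p) n G i) / real n\<bar> \<le> K * ((\<Sum>i<n. 1 + real (gdeg G n i)) / real n)"
        by simp
    qed
    also have "\<dots> \<le> K * C"
      unfolding Bochner_Integration.integral_mult_right_zero by (rule mult_left_mono[OF N[OF n] K(1)])
    finally show ?thesis .
  qed
  have int: "(dphi n has_integral (phin \<psi> \<psi>b Gn n hi hi - phin \<psi> \<psi>b Gn n lo lo)) {lo..hi}" for n
    by (rule fundamental_theorem_of_calculus[OF lohi])
       (use phin_deriv in \<open>auto simp: has_real_derivative_iff_has_vector_derivative[symmetric] intro: has_field_derivative_at_within\<close>)
  \<comment> \<open>The bound holds from index N on, so the sequence is shifted by N before the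
    limit is taken.\<close>
  have d1: "dphi (k + N) integrable_on {lo..hi}" for k using int by blast
  have d2: "(\<lambda>_. K * C) integrable_on {lo..hi}" by (rule integrable_const_ivl)
  have d3: "norm (dphi (k + N) p) \<le> K * C" if "p \<in> {lo..hi}" for k p using bd[OF _ that] by simp
  have d4: "(\<lambda>k. dphi (k + N) p) \<longlonglongrightarrow> g p" if "p \<in> {lo..hi}" for p
    by (rule LIMSEQ_ignore_initial_segment[OF dphi_limit[OF that]])
  note dc = dominated_convergence[where f="\<lambda>k. dphi (k + N)" and h="\<lambda>_. K * C" and S="{lo..hi}" and g=g, OF d1 d2 d3 d4]
  show "g integrable_on {lo..hi}" by (rule dc(1))
  have "(\<lambda>k. phin \<psi> \<psi>b Gn (k + N) hi hi - phin \<psi> \<psi>b Gn (k + N) lo lo) \<longlonglongrightarrow> integral {lo..hi} g"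
    using dc(2) integral_unique[OF int] by simp
  then show "(\<lambda>n. phin \<psi> \<psi>b Gn n hi hi - phin \<psi> \<psi>b Gn n lo lo) \<longlonglongrightarrow> integral {lo..hi} g"
    by (rule LIMSEQ_offset)
qed

end

section \<open>Increments along a sequence of partitions\<close>

text \<open>Row m of F lists the values of a function of bounded variation at the m + 1 points of the
  m-th partition, and omega its increments to first order: the errors sum to o(1), so that the sums
  of omega approximate the total increment although F need not be differentiable.\<close>

definition gd :: "(nat \<Rightarrow> nat \<Rightarrow> real) \<Rightarrow> (nat \<Rightarrow> nat \<Rightarrow> real) \<Rightarrow> bool" where
  "gd F \<omega> \<longleftrightarrow> (\<exists>C\<ge>0. \<forall>m. (\<forall>k\<le>m. \<bar>F m k\<bar> \<le> C) \<and> (\<Sum>k<m. \<bar>F m (Suc k) - F m k\<bar>) \<le> C)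
     \<and> (\<forall>e>0. \<forall>\<^sub>F m in sequentially. \<forall>k<m. \<bar>F m (Suc k) - F m k\<bar> \<le> e)
     \<and> (\<lambda>m. \<Sum>k<m. \<bar>F m (Suc k) - F m k - \<omega> m k\<bar>) \<longlonglongrightarrow> 0"

lemma gdD:
  "gd F \<omega> \<Longrightarrow> \<exists>C. 0 \<le> C \<and> (\<forall>m k. k \<le> m \<longrightarrow> \<bar>F m k\<bar> \<le> C) \<and> (\<forall>m. (\<Sum>k<m. \<bar>F m (Suc k) - F m k\<bar>) \<le> C)"
  unfolding gd_def by blast

lemma gd_osc: "gd F \<omega> \<Longrightarrow> 0 < e \<Longrightarrow> \<forall>\<^sub>F m in sequentially. \<forall>k<m. \<bar>F m (Suc k) - F m k\<bar> \<le> e"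
  and gd_err: "gd F \<omega> \<Longrightarrow> (\<lambda>m. \<Sum>k<m. \<bar>F m (Suc k) - F m k - \<omega> m k\<bar>) \<longlonglongrightarrow> 0"
  by (auto simp: gd_def)

lemma gd_cong: "gd F \<omega> \<Longrightarrow> (\<And>m k. k < m \<Longrightarrow> \<omega> m k = \<omega>' m k) \<Longrightarrow> gd F \<omega>'"
proof -
  assume g: "gd F \<omega>" and e: "\<And>m k. k < m \<Longrightarrow> \<omega> m k = \<omega>' m k"
  have "(\<lambda>m. \<Sum>k<m. \<bar>F m (Suc k) - F m k - \<omega> m k\<bar>) = (\<lambda>m. \<Sum>k<m. \<bar>F m (Suc k) - F m k - \<omega>' m k\<bar>)"
    by (intro ext sum.cong refl) (simp add: e)
  then show "gd F \<omega>'" using g unfolding gd_def by simp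
qed

lemma sandwich0:
  fixes f :: "nat \<Rightarrow> real"
  assumes "\<And>m. 0 \<le> f m" "\<And>m. f m \<le> g m" "g \<longlonglongrightarrow> 0"
  shows "f \<longlonglongrightarrow> 0"
  by (rule tendsto_sandwich[OF _ _ tendsto_const assms(3)]) (use assms in auto)

lemma gd_telescope:
  assumes "gd F \<omega>"
  shows "(\<lambda>m. F m m - F m 0 - (\<Sum>k<m. \<omega> m k)) \<longlonglongrightarrow> 0"
proof -
  have e: "F m m - F m 0 - (\<Sum>k<m. \<omega> m k) = (\<Sum>k<m. F m (Suc k) - F m k - \<omega> m k)" for m
    using sum_lessThan_telescope[of "F m" m] by (simp add: sum_subtractf)
  have "(\<lambda>m. \<bar>F m m - F m 0 - (\<Sum>k<m. \<omega> m k)\<bar>) \<longlonglongrightarrow> 0"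
    by (rule sandwich0[OF _ _ gd_err[OF assms]]) (auto simp: e sum_abs)
  then show ?thesis by (rule tendsto_rabs_zero_cancel)
qed

lemma gd_const: "gd (\<lambda>m k. c) (\<lambda>m k. 0)"
  unfolding gd_def by (auto intro!: exI[of _ "\<bar>c\<bar>"])

text \<open>Messages enter with their exact increments, so no differentiability is asked of them;
  only expressions built from them are expanded.\<close>

lemma gd_raw:
  assumes "\<And>m k. k \<le> m \<Longrightarrow> \<bar>F m k\<bar> \<le> C" "\<And>m. (\<Sum>k<m. \<bar>F m (Suc k) - F m k\<bar>) \<le> C"
    and "\<And>e. 0 < e \<Longrightarrow> \<forall>\<^sub>F m in sequentially. \<forall>k<m. \<bar>F m (Suc k) - F m k\<bar> \<le> e"
  shows "gd F (\<lambda>m k. F m (Suc k) - F m k)"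
proof -
  have "0 \<le> C" using assms(1)[of 0 0] by linarith
  then show ?thesis unfolding gd_def using assms by auto
qed

lemma gd_add:
  assumes F: "gd F \<omega>" and G: "gd G \<eta>"
  shows "gd (\<lambda>m k. F m k + G m k) (\<lambda>m k. \<omega> m k + \<eta> m k)"
  unfolding gd_def
proof (intro conjI allI impI)
  obtain C where C: "0 \<le> C" "\<And>m k. k \<le> m \<Longrightarrow> \<bar>F m k\<bar> \<le> C" "\<And>m. (\<Sum>k<m. \<bar>F m (Suc k) - F m k\<bar>) \<le> C" using gdD[OF F] by blast
  obtain D where D: "0 \<le> D" "\<And>m k. k \<le> m \<Longrightarrow> \<bar>G m k\<bar> \<le> D" "\<And>m. (\<Sum>k<m. \<bar>G m (Suc k) - G m k\<bar>) \<le> D" using gdD[OF G] by blast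
  have tri: "\<bar>(a + b) - (a' + b')\<bar> \<le> \<bar>a - a'\<bar> + \<bar>b - b'\<bar>" for a b a' b' :: real by linarith
  show "\<exists>C\<ge>0. \<forall>m. (\<forall>k\<le>m. \<bar>F m k + G m k\<bar> \<le> C) \<and> (\<Sum>k<m. \<bar>F m (Suc k) + G m (Suc k) - (F m k + G m k)\<bar>) \<le> C"
  proof (intro exI[of _ "C + D"] conjI allI impI)
    fix m
    have "(\<Sum>k<m. \<bar>F m (Suc k) + G m (Suc k) - (F m k + G m k)\<bar>) \<le> (\<Sum>k<m. \<bar>F m (Suc k) - F m k\<bar> + \<bar>G m (Suc k) - G m k\<bar>)"
      by (rule sum_mono) (rule tri)
    then show "(\<Sum>k<m. \<bar>F m (Suc k) + G m (Suc k) - (F m k + G m k)\<bar>) \<le> C + D"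
      using C(3)[of m] D(3)[of m] by (simp add: sum.distrib)
    fix k assume "k \<le> m"
    then show "\<bar>F m k + G m k\<bar> \<le> C + D" using C(2) D(2) by (intro order_trans[OF abs_triangle_ineq] add_mono)
  qed (use C D in auto)
  fix e :: real assume "0 < e"
  then have "0 < e / 2" by simp
  show "\<forall>\<^sub>F m in sequentially. \<forall>k<m. \<bar>F m (Suc k) + G m (Suc k) - (F m k + G m k)\<bar> \<le> e"
    using gd_osc[OF F \<open>0 < e/2\<close>] gd_osc[OF G \<open>0 < e/2\<close>]
  proof eventually_elim
    case (elim m)
    show ?case
    proof (intro allI impI)
      fix k assume "k < m"
      then show "\<bar>F m (Suc k) + G m (Suc k) - (F m k + G m k)\<bar> \<le> e"
        using elim(1)[rule_format, of k] elim(2)[rule_format, of k] by linarith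
    qed
  qed
next
  show "(\<lambda>m. \<Sum>k<m. \<bar>F m (Suc k) + G m (Suc k) - (F m k + G m k) - (\<omega> m k + \<eta> m k)\<bar>) \<longlonglongrightarrow> 0"
  proof (rule sandwich0)
    show "(\<Sum>k<m. \<bar>F m (Suc k) + G m (Suc k) - (F m k + G m k) - (\<omega> m k + \<eta> m k)\<bar>)
      \<le> (\<Sum>k<m. \<bar>F m (Suc k) - F m k - \<omega> m k\<bar>) + (\<Sum>k<m. \<bar>G m (Suc k) - G m k - \<eta> m k\<bar>)" for m
      unfolding sum.distrib[symmetric] by (rule sum_mono) linarith
    show "(\<lambda>m. (\<Sum>k<m. \<bar>F m (Suc k) - F m k - \<omega> m k\<bar>) + (\<Sum>k<m. \<bar>G m (Suc k) - G m k - \<eta> m k\<bar>)) \<longlonglongrightarrow> 0"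
      using tendsto_add[OF gd_err[OF F] gd_err[OF G]] by simp
  qed (auto intro: sum_nonneg)
qed

text \<open>Leibniz rule to first order. Beyond the two given errors there is the sum of products of
  increments: one factor is uniformly small and the other summable, so it vanishes.\<close>

lemma gd_mult:
  assumes F: "gd F \<omega>" and G: "gd G \<eta>"
  shows "gd (\<lambda>m k. F m k * G m k) (\<lambda>m k. F m k * \<eta> m k + G m k * \<omega> m k)"
  unfolding gd_def
proof (intro conjI allI impI)
  obtain C where C: "0 \<le> C" "\<And>m k. k \<le> m \<Longrightarrow> \<bar>F m k\<bar> \<le> C" "\<And>m. (\<Sum>k<m. \<bar>F m (Suc k) - F m k\<bar>) \<le> C" using gdD[OF F] by blast
  obtain D where D: "0 \<le> D" "\<And>m k. k \<le> m \<Longrightarrow> \<bar>G m k\<bar> \<le> D" "\<And>m. (\<Sum>k<m. \<bar>G m (Suc k) - G m k\<bar>) \<le> D" using gdD[OF G] by blast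
  have inc: "\<bar>F m (Suc k) * G m (Suc k) - F m k * G m k\<bar> \<le> C * \<bar>G m (Suc k) - G m k\<bar> + D * \<bar>F m (Suc k) - F m k\<bar>" if "k < m" for m k
  proof -
    have "F m (Suc k) * G m (Suc k) - F m k * G m k = F m k * (G m (Suc k) - G m k) + G m (Suc k) * (F m (Suc k) - F m k)"
      by (simp add: algebra_simps)
    then have "\<bar>F m (Suc k) * G m (Suc k) - F m k * G m k\<bar> \<le> \<bar>F m k\<bar> * \<bar>G m (Suc k) - G m k\<bar> + \<bar>G m (Suc k)\<bar> * \<bar>F m (Suc k) - F m k\<bar>"
      using abs_triangle_ineq[of "F m k * (G m (Suc k) - G m k)" "G m (Suc k) * (F m (Suc k) - F m k)"] by (simp add: abs_mult)
    also have "\<dots> \<le> C * \<bar>G m (Suc k) - G m k\<bar> + D * \<bar>F m (Suc k) - F m k\<bar>"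
      using C(2)[of k m] D(2)[of "Suc k" m] that by (intro add_mono mult_right_mono) auto
    finally show ?thesis .
  qed
  show "\<exists>C\<ge>0. \<forall>m. (\<forall>k\<le>m. \<bar>F m k * G m k\<bar> \<le> C) \<and> (\<Sum>k<m. \<bar>F m (Suc k) * G m (Suc k) - F m k * G m k\<bar>) \<le> C"
  proof (intro exI[of _ "2 * (C * D)"] conjI allI impI)
    fix m
    have "(\<Sum>k<m. \<bar>F m (Suc k) * G m (Suc k) - F m k * G m k\<bar>) \<le> (\<Sum>k<m. C * \<bar>G m (Suc k) - G m k\<bar> + D * \<bar>F m (Suc k) - F m k\<bar>)"
      by (rule sum_mono) (rule inc, simp)
    also have "\<dots> = C * (\<Sum>k<m. \<bar>G m (Suc k) - G m k\<bar>) + D * (\<Sum>k<m. \<bar>F m (Suc k) - F m k\<bar>)"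
      by (simp add: sum.distrib sum_distrib_left)
    also have "\<dots> \<le> C * D + D * C" by (intro add_mono mult_left_mono C D)
    finally show "(\<Sum>k<m. \<bar>F m (Suc k) * G m (Suc k) - F m k * G m k\<bar>) \<le> 2 * (C * D)" by simp
    fix k assume "k \<le> m"
    then have "\<bar>F m k * G m k\<bar> \<le> C * D" unfolding abs_mult using C D by (intro mult_mono) auto
    moreover have "0 \<le> C * D" using C D by simp
    ultimately show "\<bar>F m k * G m k\<bar> \<le> 2 * (C * D)" by linarith
  qed (use C D in auto)
  fix e :: real assume e: "0 < e"
  define e' where "e' = e / (C + D + 1)"
  have e': "0 < e'" "(C + D) * e' \<le> e" using e C(1) D(1) by (auto simp: e'_def field_simps)
  show "\<forall>\<^sub>F m in sequentially. \<forall>k<m. \<bar>F m (Suc k) * G m (Suc k) - F m k * G m k\<bar> \<le> e"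
    using gd_osc[OF F e'(1)] gd_osc[OF G e'(1)]
  proof eventually_elim
    case (elim m)
    show ?case
    proof (intro allI impI)
      fix k assume k: "k < m"
      have "\<bar>F m (Suc k) * G m (Suc k) - F m k * G m k\<bar> \<le> C * \<bar>G m (Suc k) - G m k\<bar> + D * \<bar>F m (Suc k) - F m k\<bar>" by (rule inc[OF k])
      also have "\<dots> \<le> C * e' + D * e'" using elim k C D by (intro add_mono mult_left_mono) auto
      also have "\<dots> \<le> e" using e'(2) by (simp add: algebra_simps)
      finally show "\<bar>F m (Suc k) * G m (Suc k) - F m k * G m k\<bar> \<le> e" .
    qed
  qed
next
  obtain C where C: "0 \<le> C" "\<And>m k. k \<le> m \<Longrightarrow> \<bar>F m k\<bar> \<le> C" "\<And>m. (\<Sum>k<m. \<bar>F m (Suc k) - F m k\<bar>) \<le> C" using gdD[OF F] by blast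
  obtain D where D: "0 \<le> D" "\<And>m k. k \<le> m \<Longrightarrow> \<bar>G m k\<bar> \<le> D" "\<And>m. (\<Sum>k<m. \<bar>G m (Suc k) - G m k\<bar>) \<le> D" using gdD[OF G] by blast
  let ?P = "\<lambda>m. \<Sum>k<m. \<bar>F m (Suc k) - F m k\<bar> * \<bar>G m (Suc k) - G m k\<bar>"
  have P: "?P \<longlonglongrightarrow> 0"
  proof (rule LIMSEQ_I)
    fix r :: real assume r: "0 < r"
    define e where "e = r / (2 * (C + 1))"
    have e: "0 < e" "e * C < r"
      using r C(1) mult_nonneg_nonneg[OF C(1) less_imp_le[OF r]] by (auto simp: e_def field_simps intro: add_nonneg_pos)
    obtain M where M: "\<And>m k. M \<le> m \<Longrightarrow> k < m \<Longrightarrow> \<bar>G m (Suc k) - G m k\<bar> \<le> e"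
      using gd_osc[OF G e(1)] by (auto simp: eventually_sequentially)
    show "\<exists>no. \<forall>n\<ge>no. norm (?P n - 0) < r"
    proof (intro exI[of _ M] allI impI)
      fix m assume m: "M \<le> m"
      have "?P m \<le> (\<Sum>k<m. \<bar>F m (Suc k) - F m k\<bar> * e)" by (rule sum_mono, rule mult_left_mono) (use M[OF m] in auto)
      also have "\<dots> = e * (\<Sum>k<m. \<bar>F m (Suc k) - F m k\<bar>)" by (simp add: sum_distrib_left mult.commute)
      also have "\<dots> \<le> e * C" using e C(3)[of m] by (intro mult_left_mono) auto
      finally have "?P m < r" using e by linarith
      moreover have "0 \<le> ?P m" by (intro sum_nonneg) simp
      ultimately show "norm (?P m - 0) < r" by simp
    qed
  qed
  show "(\<lambda>m. \<Sum>k<m. \<bar>F m (Suc k) * G m (Suc k) - F m k * G m k - (F m k * \<eta> m k + G m k * \<omega> m k)\<bar>) \<longlonglongrightarrow> 0"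
  proof (rule sandwich0)
    fix m
    have "\<bar>F m (Suc k) * G m (Suc k) - F m k * G m k - (F m k * \<eta> m k + G m k * \<omega> m k)\<bar>
      \<le> C * \<bar>G m (Suc k) - G m k - \<eta> m k\<bar> + D * \<bar>F m (Suc k) - F m k - \<omega> m k\<bar> + \<bar>F m (Suc k) - F m k\<bar> * \<bar>G m (Suc k) - G m k\<bar>" if k: "k < m" for k
    proof -
      have "F m (Suc k) * G m (Suc k) - F m k * G m k - (F m k * \<eta> m k + G m k * \<omega> m k)
        = F m k * (G m (Suc k) - G m k - \<eta> m k) + G m k * (F m (Suc k) - F m k - \<omega> m k) + (F m (Suc k) - F m k) * (G m (Suc k) - G m k)"
        by (simp add: algebra_simps)
      moreover have "\<bar>a + b + c\<bar> \<le> \<bar>a\<bar> + \<bar>b\<bar> + \<bar>c\<bar>" for a b c :: real by linarith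
      ultimately have "\<bar>F m (Suc k) * G m (Suc k) - F m k * G m k - (F m k * \<eta> m k + G m k * \<omega> m k)\<bar>
        \<le> \<bar>F m k\<bar> * \<bar>G m (Suc k) - G m k - \<eta> m k\<bar> + \<bar>G m k\<bar> * \<bar>F m (Suc k) - F m k - \<omega> m k\<bar> + \<bar>F m (Suc k) - F m k\<bar> * \<bar>G m (Suc k) - G m k\<bar>"
        unfolding abs_mult[symmetric] by simp
      also have "\<dots> \<le> C * \<bar>G m (Suc k) - G m k - \<eta> m k\<bar> + D * \<bar>F m (Suc k) - F m k - \<omega> m k\<bar> + \<bar>F m (Suc k) - F m k\<bar> * \<bar>G m (Suc k) - G m k\<bar>"
        using C(2)[of k m] D(2)[of k m] k by (intro add_mono mult_right_mono order_refl) auto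
      finally show ?thesis .
    qed
    then have "(\<Sum>k<m. \<bar>F m (Suc k) * G m (Suc k) - F m k * G m k - (F m k * \<eta> m k + G m k * \<omega> m k)\<bar>)
      \<le> (\<Sum>k<m. C * \<bar>G m (Suc k) - G m k - \<eta> m k\<bar> + D * \<bar>F m (Suc k) - F m k - \<omega> m k\<bar> + \<bar>F m (Suc k) - F m k\<bar> * \<bar>G m (Suc k) - G m k\<bar>)"
      by (intro sum_mono) auto
    then show "(\<Sum>k<m. \<bar>F m (Suc k) * G m (Suc k) - F m k * G m k - (F m k * \<eta> m k + G m k * \<omega> m k)\<bar>)
      \<le> C * (\<Sum>k<m. \<bar>G m (Suc k) - G m k - \<eta> m k\<bar>) + D * (\<Sum>k<m. \<bar>F m (Suc k) - F m k - \<omega> m k\<bar>) + ?P m"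
      by (simp add: sum.distrib sum_distrib_left)
  next
    show "(\<lambda>m. C * (\<Sum>k<m. \<bar>G m (Suc k) - G m k - \<eta> m k\<bar>) + D * (\<Sum>k<m. \<bar>F m (Suc k) - F m k - \<omega> m k\<bar>) + ?P m) \<longlonglongrightarrow> 0"
      using tendsto_add[OF tendsto_add[OF tendsto_mult_left[OF gd_err[OF G], of C] tendsto_mult_left[OF gd_err[OF F], of D]] P] by simp
  qed (auto intro: sum_nonneg)
qed

lemma gd_cmult: "gd F \<omega> \<Longrightarrow> gd (\<lambda>m k. c * F m k) (\<lambda>m k. c * \<omega> m k)"
  using gd_mult[OF gd_const[of c], of F \<omega>] by simp

lemma gd_sum:
  assumes "finite A" "\<And>i. i \<in> A \<Longrightarrow> gd (F i) (\<omega> i)"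
  shows "gd (\<lambda>m k. \<Sum>i\<in>A. F i m k) (\<lambda>m k. \<Sum>i\<in>A. \<omega> i m k)"
  using assms
proof (induction A rule: finite_induct)
  case empty then show ?case using gd_const[of 0] by simp
next
  case (insert i A)
  then show ?case using gd_add[of "F i" "\<omega> i"] by simp
qed

text \<open>Each term omits one factor instead of dividing by it, since factors may vanish under
  hard constraints.\<close>

lemma gd_prod:
  assumes "finite A" "\<And>i. i \<in> A \<Longrightarrow> gd (F i) (\<omega> i)"
  shows "gd (\<lambda>m k. \<Prod>i\<in>A. F i m k) (\<lambda>m k. \<Sum>i\<in>A. \<omega> i m k * (\<Prod>j\<in>A - {i}. F j m k))"
  using assms
proof (induction A rule: finite_induct)
  case empty then show ?case using gd_const[of 1] by simp
next
  case (insert i A)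
  have "gd (\<lambda>m k. F i m k * (\<Prod>i\<in>A. F i m k)) (\<lambda>m k. F i m k * (\<Sum>i\<in>A. \<omega> i m k * (\<Prod>j\<in>A - {i}. F j m k)) + (\<Prod>i\<in>A. F i m k) * \<omega> i m k)"
    using insert by (intro gd_mult) auto
  then have "gd (\<lambda>m k. \<Prod>i\<in>insert i A. F i m k) (\<lambda>m k. F i m k * (\<Sum>i\<in>A. \<omega> i m k * (\<Prod>j\<in>A - {i}. F j m k)) + (\<Prod>i\<in>A. F i m k) * \<omega> i m k)"
    using insert(1,2) by simp
  then show ?case
  proof (rule gd_cong)
    fix m k
    have "(\<Prod>j\<in>insert i A - {i'}. F j m k) = F i m k * (\<Prod>j\<in>A - {i'}. F j m k)" if "i' \<in> A" for i'
    proof -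
      have "insert i A - {i'} = insert i (A - {i'})" using insert(2) that by auto
      then show ?thesis using insert(1,2) by simp
    qed
    moreover have "insert i A - {i} = A" using insert(2) by auto
    ultimately show "F i m k * (\<Sum>i\<in>A. \<omega> i m k * (\<Prod>j\<in>A - {i}. F j m k)) + (\<Prod>i\<in>A. F i m k) * \<omega> i m k
      = (\<Sum>i'\<in>insert i A. \<omega> i' m k * (\<Prod>j\<in>insert i A - {i'}. F j m k))"
      using insert(1,2) by (simp add: sum_distrib_left algebra_simps)
  qed
qed

text \<open>The inequality ln t \<le> t - 1 for t = y / x and for t = x / y encloses the increment
  between (y - x) / y and (y - x) / x.\<close>

lemma ln_increment:
  assumes "0 < c" "c \<le> x" "c \<le> (y :: real)"
  shows "\<bar>ln y - ln x - (y - x) / x\<bar> \<le> (y - x)\<^sup>2 / c\<^sup>2" "\<bar>ln y - ln x\<bar> \<le> \<bar>y - x\<bar> / c"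
proof -
  have xy: "0 < x" "0 < y" using assms by auto
  have u: "ln y - ln x \<le> (y - x) / x"
    using ln_le_minus_one[of "y / x"] xy by (simp add: ln_div diff_divide_distrib)
  have l: "(y - x) / y \<le> ln y - ln x"
    using ln_le_minus_one[of "x / y"] xy by (simp add: ln_div diff_divide_distrib)
  have "\<bar>ln y - ln x - (y - x) / x\<bar> \<le> (y - x) / x - (y - x) / y" using u l by linarith
  also have "\<dots> = (y - x)\<^sup>2 / (x * y)" using xy by (simp add: field_simps power2_eq_square)
  also have "\<dots> \<le> (y - x)\<^sup>2 / c\<^sup>2"
    unfolding power2_eq_square[of c] using assms by (intro divide_left_mono mult_mono) auto
  finally show "\<bar>ln y - ln x - (y - x) / x\<bar> \<le> (y - x)\<^sup>2 / c\<^sup>2" .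
  have "\<bar>(y - x) / x\<bar> \<le> \<bar>y - x\<bar> / c" "\<bar>(y - x) / y\<bar> \<le> \<bar>y - x\<bar> / c"
    unfolding abs_divide using assms by (auto intro!: divide_left_mono)
  then show "\<bar>ln y - ln x\<bar> \<le> \<bar>y - x\<bar> / c" using u l by linarith
qed

text \<open>With values bounded away from 0 along all partitions, the second order error is a
  multiple of the squared increments, again small times summable.\<close>

lemma gd_ln:
  assumes F: "gd F \<omega>" and c: "0 < c" "\<And>m k. k \<le> m \<Longrightarrow> c \<le> F m k"
  shows "gd (\<lambda>m k. ln (F m k)) (\<lambda>m k. \<omega> m k / F m k)"
  unfolding gd_def
proof (intro conjI allI impI)
  obtain C where C: "0 \<le> C" "\<And>m k. k \<le> m \<Longrightarrow> \<bar>F m k\<bar> \<le> C" "\<And>m. (\<Sum>k<m. \<bar>F m (Suc k) - F m k\<bar>) \<le> C" using gdD[OF F] by blast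
  have lip: "\<bar>ln (F m (Suc k)) - ln (F m k)\<bar> \<le> \<bar>F m (Suc k) - F m k\<bar> / c" if "k < m" for m k
    by (rule ln_increment(2)[OF c(1)]) (use c that in auto)
  have cC: "c \<le> C" using c(2)[of 0 0] C(2)[of 0 0] by auto
  define B where "B = \<bar>ln c\<bar> + \<bar>ln C\<bar> + C / c"
  show "\<exists>C\<ge>0. \<forall>m. (\<forall>k\<le>m. \<bar>ln (F m k)\<bar> \<le> C) \<and> (\<Sum>k<m. \<bar>ln (F m (Suc k)) - ln (F m k)\<bar>) \<le> C"
  proof (intro exI[of _ B] conjI allI impI)
    have "0 \<le> C / c" using C c by simp
    then show "0 \<le> B" by (simp add: B_def)
    fix m
    have "(\<Sum>k<m. \<bar>ln (F m (Suc k)) - ln (F m k)\<bar>) \<le> (\<Sum>k<m. \<bar>F m (Suc k) - F m k\<bar> / c)" by (rule sum_mono) (rule lip, simp)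
    also have "\<dots> \<le> C / c" unfolding sum_divide_distrib[symmetric] using C(3) c by (intro divide_right_mono) auto
    finally show "(\<Sum>k<m. \<bar>ln (F m (Suc k)) - ln (F m k)\<bar>) \<le> B" by (simp add: B_def)
    fix k assume k: "k \<le> m"
    have "c \<le> F m k" "F m k \<le> C" using c(2)[OF k] C(2)[OF k] by auto
    then have "ln c \<le> ln (F m k)" "ln (F m k) \<le> ln C" using c by auto
    then show "\<bar>ln (F m k)\<bar> \<le> B" using \<open>0 \<le> C / c\<close> by (simp add: B_def)
  qed
  have fin: "\<forall>\<^sub>F m in sequentially. \<forall>k<m. \<bar>F m (Suc k) - F m k\<bar> / c \<le> e" if "0 < e" for e
    using gd_osc[OF F, of "e * c"] that c by (auto simp: divide_le_eq)
  fix e :: real assume "0 < e"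
  from fin[OF this] show "\<forall>\<^sub>F m in sequentially. \<forall>k<m. \<bar>ln (F m (Suc k)) - ln (F m k)\<bar> \<le> e"
    by eventually_elim (use lip order_trans in blast)
next
  obtain C where C: "0 \<le> C" "\<And>m k. k \<le> m \<Longrightarrow> \<bar>F m k\<bar> \<le> C" "\<And>m. (\<Sum>k<m. \<bar>F m (Suc k) - F m k\<bar>) \<le> C" using gdD[OF F] by blast
  have "gd (\<lambda>m k. F m k * F m k) (\<lambda>m k. F m k * \<omega> m k + F m k * \<omega> m k)" by (rule gd_mult[OF F F])
  let ?Q = "\<lambda>m. \<Sum>k<m. (F m (Suc k) - F m k)\<^sup>2"
  have Q: "?Q \<longlonglongrightarrow> 0"
  proof (rule LIMSEQ_I)
    fix r :: real assume r: "0 < r"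
    define e where "e = r / (2 * (C + 1))"
    have e: "0 < e" "e * C < r"
      using r C(1) mult_nonneg_nonneg[OF C(1) less_imp_le[OF r]] by (auto simp: e_def field_simps intro: add_nonneg_pos)
    obtain M where M: "\<And>m k. M \<le> m \<Longrightarrow> k < m \<Longrightarrow> \<bar>F m (Suc k) - F m k\<bar> \<le> e"
      using gd_osc[OF F e(1)] by (auto simp: eventually_sequentially)
    show "\<exists>no. \<forall>n\<ge>no. norm (?Q n - 0) < r"
    proof (intro exI[of _ M] allI impI)
      fix m assume m: "M \<le> m"
      have "?Q m \<le> (\<Sum>k<m. e * \<bar>F m (Suc k) - F m k\<bar>)"
      proof (rule sum_mono)
        fix k assume "k \<in> {..<m}"
        then have "\<bar>F m (Suc k) - F m k\<bar> * \<bar>F m (Suc k) - F m k\<bar> \<le> e * \<bar>F m (Suc k) - F m k\<bar>"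
          using M[OF m, of k] by (intro mult_right_mono) auto
        then show "(F m (Suc k) - F m k)\<^sup>2 \<le> e * \<bar>F m (Suc k) - F m k\<bar>" by (simp add: power2_eq_square)
      qed
      also have "\<dots> \<le> e * C" unfolding sum_distrib_left[symmetric] using e C(3)[of m] by (intro mult_left_mono) auto
      finally have "?Q m < r" using e by linarith
      moreover have "0 \<le> ?Q m" by (intro sum_nonneg) simp
      ultimately show "norm (?Q m - 0) < r" by simp
    qed
  qed
  show "(\<lambda>m. \<Sum>k<m. \<bar>ln (F m (Suc k)) - ln (F m k) - \<omega> m k / F m k\<bar>) \<longlonglongrightarrow> 0"
  proof (rule sandwich0)
    fix m
    have "\<bar>ln (F m (Suc k)) - ln (F m k) - \<omega> m k / F m k\<bar> \<le> (F m (Suc k) - F m k)\<^sup>2 / c\<^sup>2 + \<bar>F m (Suc k) - F m k - \<omega> m k\<bar> / c" if k: "k < m" for k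
    proof -
      have cF: "c \<le> F m k" "c \<le> F m (Suc k)" using c(2) k by auto
      have "\<bar>(F m (Suc k) - F m k - \<omega> m k) / F m k\<bar> \<le> \<bar>F m (Suc k) - F m k - \<omega> m k\<bar> / c"
        unfolding abs_divide using cF c(1) by (intro divide_left_mono) auto
      moreover have "(F m (Suc k) - F m k - \<omega> m k) / F m k = (F m (Suc k) - F m k) / F m k - \<omega> m k / F m k"
        by (simp add: diff_divide_distrib)
      ultimately show ?thesis using ln_increment(1)[OF c(1) cF] by linarith
    qed
    then have "(\<Sum>k<m. \<bar>ln (F m (Suc k)) - ln (F m k) - \<omega> m k / F m k\<bar>) \<le> (\<Sum>k<m. (F m (Suc k) - F m k)\<^sup>2 / c\<^sup>2 + \<bar>F m (Suc k) - F m k - \<omega> m k\<bar> / c)"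
      by (intro sum_mono) auto
    then show "(\<Sum>k<m. \<bar>ln (F m (Suc k)) - ln (F m k) - \<omega> m k / F m k\<bar>) \<le> ?Q m / c\<^sup>2 + (\<Sum>k<m. \<bar>F m (Suc k) - F m k - \<omega> m k\<bar>) / c"
      by (simp add: sum.distrib sum_divide_distrib)
  next
    show "(\<lambda>m. ?Q m / c\<^sup>2 + (\<Sum>k<m. \<bar>F m (Suc k) - F m k - \<omega> m k\<bar>) / c) \<longlonglongrightarrow> 0"
      using tendsto_add[OF tendsto_divide[OF Q tendsto_const, of "c\<^sup>2"] tendsto_divide[OF gd_err[OF F] tendsto_const, of c]] c by simp
  qed (auto intro: sum_nonneg)
qed

section \<open>Equidistant partitions of the parameter interval\<close>

definition gp :: "real \<Rightarrow> real \<Rightarrow> nat \<Rightarrow> nat \<Rightarrow> real" where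
  "gp lo hi m k = lo + (hi - lo) * real k / real m"

lemma gp_in: "lo \<le> hi \<Longrightarrow> k \<le> m \<Longrightarrow> gp lo hi m k \<in> {lo..hi}"
proof -
  assume a: "lo \<le> hi" "k \<le> m"
  have "real k / real m \<le> 1" using a by (cases "m = 0") (auto simp: divide_le_eq)
  then have "(hi - lo) * (real k / real m) \<le> (hi - lo) * 1" using a by (intro mult_left_mono) auto
  then show ?thesis using a by (auto simp: gp_def)
qed

lemma gp_0: "gp lo hi m 0 = lo" and gp_m: "0 < m \<Longrightarrow> gp lo hi m m = hi"
  by (auto simp: gp_def)

lemma gp_Suc: "gp lo hi m (Suc k) - gp lo hi m k = (hi - lo) / real m"
  by (simp add: gp_def add_divide_distrib ring_distribs)

lemma gp_mono: "lo \<le> hi \<Longrightarrow> i \<le> j \<Longrightarrow> gp lo hi m i \<le> gp lo hi m j"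
  unfolding gp_def by (intro add_left_mono divide_right_mono mult_left_mono) auto

lemma mesh_small:
  assumes "0 < (e :: real)"
  shows "\<forall>\<^sub>F m in sequentially. 0 < m \<and> (hi - lo) / real m < e"
proof -
  have "(\<lambda>m. (hi - lo) / real m) \<longlonglongrightarrow> 0" by (rule lim_const_over_n)
  then have "\<forall>\<^sub>F m in sequentially. (hi - lo) / real m < e" by (rule order_tendstoD) (rule assms)
  then show ?thesis using eventually_gt_at_top[of 0] by eventually_elim auto
qed

lemma osc_continuous:
  assumes lh: "lo \<le> hi" and f: "continuous_on {lo..hi} f" and e: "0 < (e :: real)"
  shows "\<forall>\<^sub>F m in sequentially. \<forall>k<m. \<bar>f (gp lo hi m (Suc k)) - f (gp lo hi m k)\<bar> \<le> e"
proof -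
  have "uniformly_continuous_on {lo..hi} f" by (rule compact_uniformly_continuous[OF f]) simp
  then obtain r where r: "0 < r" "\<And>x y. x \<in> {lo..hi} \<Longrightarrow> y \<in> {lo..hi} \<Longrightarrow> dist y x < r \<Longrightarrow> dist (f y) (f x) < e"
    unfolding uniformly_continuous_on_def using e by metis
  show ?thesis using mesh_small[OF r(1), of hi lo]
  proof eventually_elim
    case (elim m)
    show ?case
    proof (intro allI impI)
      fix k assume k: "k < m"
      have "0 \<le> (hi - lo) / real m" using lh by simp
      then have "dist (gp lo hi m (Suc k)) (gp lo hi m k) < r" using elim unfolding dist_real_def gp_Suc by (simp only: abs_of_nonneg)
      then have "dist (f (gp lo hi m (Suc k))) (f (gp lo hi m k)) < e"
        using k by (intro r(2) gp_in[OF lh]) auto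
      then show "\<bar>f (gp lo hi m (Suc k)) - f (gp lo hi m k)\<bar> \<le> e" by (simp add: dist_real_def)
    qed
  qed
qed

text \<open>By the mean value theorem the error on a cell is its length times an oscillation of f',
  and uniform continuity makes the sum of these small.\<close>

lemma gd_C1:
  assumes lh: "lo \<le> hi" and f: "\<And>x. x \<in> {lo..hi} \<Longrightarrow> (f has_real_derivative f' x) (at x within {lo..hi})"
    and f': "continuous_on {lo..hi} f'"
  shows "gd (\<lambda>m k. f (gp lo hi m k)) (\<lambda>m k. f' (gp lo hi m k) * ((hi - lo) / real m))"
proof -
  have cf: "continuous_on {lo..hi} f"
    using f DERIV_continuous continuous_on_eq_continuous_within by blast
  obtain K where K: "\<And>x. x \<in> {lo..hi} \<Longrightarrow> \<bar>f' x\<bar> \<le> K" "\<And>x. x \<in> {lo..hi} \<Longrightarrow> \<bar>f x\<bar> \<le> K"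
  proof -
    have "bounded (f' ` {lo..hi})" "bounded (f ` {lo..hi})"
      by (intro compact_imp_bounded compact_continuous_image f' cf, simp)+
    then obtain K1 K2 where "\<forall>y\<in>f' ` {lo..hi}. norm y \<le> K1" "\<forall>y\<in>f ` {lo..hi}. norm y \<le> K2"
      unfolding bounded_iff by blast
    then show ?thesis by (intro that[of "max K1 K2"]) (auto simp: le_max_iff_disj)
  qed
  have K0: "0 \<le> K" using K(1)[of lo] lh by auto
  have mv: "\<exists>z\<in>{gp lo hi m k..gp lo hi m (Suc k)}. f (gp lo hi m (Suc k)) - f (gp lo hi m k) = f' z * ((hi - lo) / real m)" if k: "k < m" for m k
  proof -
    let ?p = "gp lo hi m k" and ?q = "gp lo hi m (Suc k)"
    have pq: "?p \<le> ?q" by (rule gp_mono[OF lh]) simp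
    have sub: "{?p..?q} \<subseteq> {lo..hi}" using gp_in[OF lh, of k m] gp_in[OF lh, of "Suc k" m] k by auto
    have "\<exists>z\<in>{?p..?q}. f ?q - f ?p = f' z * (?q - ?p)"
    proof (rule mvt_very_simple[OF pq, where f'="\<lambda>x y. f' x * y"])
      fix x assume "?p \<le> x" "x \<le> ?q"
      then have "x \<in> {lo..hi}" using sub by auto
      from f[OF this] show "(f has_derivative (*) (f' x)) (at x within {?p..?q})"
        unfolding has_field_derivative_def by (rule has_derivative_subset[OF _ sub])
    qed
    then show ?thesis unfolding gp_Suc .
  qed
  have d0: "0 \<le> (hi - lo) / real m" for m using lh by simp
  have md: "real m * ((hi - lo) / real m) \<le> hi - lo" for m using lh by (cases "m = 0") auto
  show ?thesis
    unfolding gd_def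
  proof (intro conjI allI impI)
    show "\<exists>C\<ge>0. \<forall>m. (\<forall>k\<le>m. \<bar>f (gp lo hi m k)\<bar> \<le> C) \<and> (\<Sum>k<m. \<bar>f (gp lo hi m (Suc k)) - f (gp lo hi m k)\<bar>) \<le> C"
    proof (intro exI[of _ "K + K * (hi - lo)"] conjI allI impI)
      have n: "0 \<le> K * (hi - lo)" using K0 lh by simp
      then show "0 \<le> K + K * (hi - lo)" using K0 by simp
      show "\<bar>f (gp lo hi m k)\<bar> \<le> K + K * (hi - lo)" if "k \<le> m" for m k using K(2)[OF gp_in[OF lh that]] n by linarith
      fix m
      have "(\<Sum>k<m. \<bar>f (gp lo hi m (Suc k)) - f (gp lo hi m k)\<bar>) \<le> (\<Sum>k<m. K * ((hi - lo) / real m))"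
      proof (rule sum_mono)
        fix k assume "k \<in> {..<m}"
        then have k: "k < m" by simp
        obtain z where z: "z \<in> {gp lo hi m k..gp lo hi m (Suc k)}" "f (gp lo hi m (Suc k)) - f (gp lo hi m k) = f' z * ((hi - lo) / real m)"
          using mv[OF k] by blast
        have "z \<in> {lo..hi}" using z(1) gp_in[OF lh, of k m] gp_in[OF lh, of "Suc k" m] k by auto
        then show "\<bar>f (gp lo hi m (Suc k)) - f (gp lo hi m k)\<bar> \<le> K * ((hi - lo) / real m)"
          unfolding z(2) abs_mult abs_of_nonneg[OF d0] by (intro mult_right_mono K d0)
      qed
      also have "\<dots> = K * (real m * ((hi - lo) / real m))" by simp
      also have "\<dots> \<le> K * (hi - lo)" by (rule mult_left_mono[OF md K0])
      finally show "(\<Sum>k<m. \<bar>f (gp lo hi m (Suc k)) - f (gp lo hi m k)\<bar>) \<le> K + K * (hi - lo)" using K0 by simp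
    qed
    show "\<forall>\<^sub>F m in sequentially. \<forall>k<m. \<bar>f (gp lo hi m (Suc k)) - f (gp lo hi m k)\<bar> \<le> e" if "0 < e" for e
      by (rule osc_continuous[OF lh cf that])
    show "(\<lambda>m. \<Sum>k<m. \<bar>f (gp lo hi m (Suc k)) - f (gp lo hi m k) - f' (gp lo hi m k) * ((hi - lo) / real m)\<bar>) \<longlonglongrightarrow> 0"
    proof (rule LIMSEQ_I)
      fix r :: real assume r: "0 < r"
      define e where "e = r / (2 * (hi - lo + 1))"
      have "r * (hi - lo) < r * (2 * (hi - lo + 1))" using r lh by (intro mult_strict_left_mono) auto
      then have e: "0 < e" "e * (hi - lo) < r" using r lh by (simp_all add: e_def pos_divide_less_eq)
      have "uniformly_continuous_on {lo..hi} f'" by (rule compact_uniformly_continuous[OF f']) simp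
      then obtain s where s: "0 < s" "\<And>x y. x \<in> {lo..hi} \<Longrightarrow> y \<in> {lo..hi} \<Longrightarrow> dist y x < s \<Longrightarrow> dist (f' y) (f' x) < e"
        unfolding uniformly_continuous_on_def using e(1) by metis
      obtain M where M: "\<And>m. M \<le> m \<Longrightarrow> (hi - lo) / real m < s"
        using mesh_small[OF s(1), of hi lo] by (auto simp: eventually_sequentially)
      show "\<exists>no. \<forall>n\<ge>no. norm ((\<Sum>k<n. \<bar>f (gp lo hi n (Suc k)) - f (gp lo hi n k) - f' (gp lo hi n k) * ((hi - lo) / real n)\<bar>) - 0) < r"
      proof (intro exI[of _ M] allI impI)
        fix m assume m: "M \<le> m"
        let ?S = "\<Sum>k<m. \<bar>f (gp lo hi m (Suc k)) - f (gp lo hi m k) - f' (gp lo hi m k) * ((hi - lo) / real m)\<bar>"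
        have "?S \<le> (\<Sum>k<m. e * ((hi - lo) / real m))"
        proof (rule sum_mono)
          fix k assume "k \<in> {..<m}"
          then have k: "k < m" by simp
          obtain z where z: "z \<in> {gp lo hi m k..gp lo hi m (Suc k)}" "f (gp lo hi m (Suc k)) - f (gp lo hi m k) = f' z * ((hi - lo) / real m)"
            using mv[OF k] by blast
          have zi: "z \<in> {lo..hi}" using z(1) gp_in[OF lh, of k m] gp_in[OF lh, of "Suc k" m] k by auto
          have "dist z (gp lo hi m k) < s" using z(1) M[OF m] gp_Suc[of lo hi m k] by (auto simp: dist_real_def)
          then have "\<bar>f' z - f' (gp lo hi m k)\<bar> \<le> e"
            using s(2)[OF gp_in[OF lh, of k m] zi] k by (auto simp: dist_real_def)
          then have "\<bar>f' z - f' (gp lo hi m k)\<bar> * ((hi - lo) / real m) \<le> e * ((hi - lo) / real m)" by (rule mult_right_mono[OF _ d0])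
          moreover have "f' z * ((hi - lo) / real m) - f' (gp lo hi m k) * ((hi - lo) / real m) = (f' z - f' (gp lo hi m k)) * ((hi - lo) / real m)"
            by (simp only: left_diff_distrib)
          ultimately show "\<bar>f (gp lo hi m (Suc k)) - f (gp lo hi m k) - f' (gp lo hi m k) * ((hi - lo) / real m)\<bar> \<le> e * ((hi - lo) / real m)"
            unfolding z(2) by (simp only: abs_mult abs_of_nonneg[OF d0])
        qed
        also have "\<dots> = e * (real m * ((hi - lo) / real m))" by simp
        also have "\<dots> \<le> e * (hi - lo)" using md e(1) by (intro mult_left_mono) auto
        finally have "?S < r" using e(2) by linarith
        moreover have "0 \<le> ?S" by (intro sum_nonneg) simp
        ultimately show "norm (?S - 0) < r" by simp
      qed
    qed
  qed
qed

text \<open>Telescoping applied to the antiderivative.\<close>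

lemma riemann_sums:
  assumes lh: "lo \<le> hi" and g: "continuous_on {lo..hi} g"
  shows "(\<lambda>m. \<Sum>k<m. g (gp lo hi m k) * ((hi - lo) / real m)) \<longlonglongrightarrow> integral {lo..hi} g"
proof -
  let ?f = "\<lambda>x. integral {lo..x} g"
  have "gd (\<lambda>m k. ?f (gp lo hi m k)) (\<lambda>m k. g (gp lo hi m k) * ((hi - lo) / real m))"
    by (rule gd_C1[OF lh _ g]) (rule integral_has_real_derivative[OF g])
  from gd_telescope[OF this]
  have "(\<lambda>m. ?f (gp lo hi m m) - ?f (gp lo hi m 0) - (\<Sum>k<m. g (gp lo hi m k) * ((hi - lo) / real m))) \<longlonglongrightarrow> 0" .
  moreover have "\<forall>\<^sub>F m in sequentially. ?f (gp lo hi m m) - ?f (gp lo hi m 0) - (\<Sum>k<m. g (gp lo hi m k) * ((hi - lo) / real m))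
     = integral {lo..hi} g - (\<Sum>k<m. g (gp lo hi m k) * ((hi - lo) / real m))"
    using eventually_gt_at_top[of 0] by eventually_elim (simp add: gp_0 gp_m)
  ultimately have "(\<lambda>m. integral {lo..hi} g - (\<Sum>k<m. g (gp lo hi m k) * ((hi - lo) / real m))) \<longlonglongrightarrow> 0"
    by (rule Lim_transform_eventually)
  from tendsto_diff[OF tendsto_const this, of "integral {lo..hi} g"] show ?thesis by simp
qed

section \<open>The Bethe functional along a path of fixed points\<close>

text \<open>The outgoing message \<open>y j\<close> is proportional to the star weight without leaf
  j, hence Z = z j * E j. A change \<open>dx j\<close> then enters the increment of ln Z as R j / E
  j; the edge term removes half of it and also half of S j / E j. What remains is antisymmetric in
  incoming and outgoing changes, while the explicit edge derivatives keep the factor 1/2 and combine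
  with the vertex derivatives to \<open>Gst\<close>.\<close>

lemma bethe_increment_algebra:
  fixes w d :: "'x::finite \<Rightarrow> 'x \<Rightarrow> real" and b c :: "'x \<Rightarrow> real" and x y dx dy :: "'v \<Rightarrow> 'x \<Rightarrow> real"
  assumes fin: "finite J"
    and bp: "\<And>j a. j \<in> J \<Longrightarrow> y j a = b a * (\<Prod>i\<in>J - {j}. \<Sum>s\<in>UNIV. w a s * x i s) / z j" and z: "\<And>j. j \<in> J \<Longrightarrow> 0 < z j"
    and Z: "Z = (\<Sum>a\<in>UNIV. b a * (\<Prod>i\<in>J. \<Sum>s\<in>UNIV. w a s * x i s))" "0 < Z"
    and E: "\<And>j. E j = (\<Sum>a\<in>UNIV. \<Sum>s\<in>UNIV. w a s * x j s * y j a)"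
  shows "(\<Sum>a\<in>UNIV. b a * (\<Sum>j\<in>J. (\<Sum>s\<in>UNIV. w a s * dx j s + x j s * (w a s * d a s * \<delta>)) * (\<Prod>i\<in>J - {j}. \<Sum>s\<in>UNIV. w a s * x i s))
        + (\<Prod>i\<in>J. \<Sum>s\<in>UNIV. w a s * x i s) * (b a * c a * \<delta>)) / Z
      - 1/2 * (\<Sum>j\<in>J. (\<Sum>a\<in>UNIV. \<Sum>s\<in>UNIV. w a s * x j s * dy j a + y j a * (w a s * dx j s + x j s * (w a s * d a s * \<delta>))) / E j)
    = \<delta> * Gst w b c d J x + 1/2 * (\<Sum>j\<in>J. (\<Sum>a\<in>UNIV. \<Sum>s\<in>UNIV. w a s * dx j s * y j a) / E j - (\<Sum>a\<in>UNIV. \<Sum>s\<in>UNIV. w a s * x j s * dy j a) / E j)"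
proof -
  define u where "u = (\<lambda>j a. \<Sum>s\<in>UNIV. w a s * x j s)"
  define Q where "Q = (\<lambda>j a. b a * (\<Prod>i\<in>J - {j}. u i a))"
  define P where "P = (\<lambda>j. \<Sum>a\<in>UNIV. \<Sum>s\<in>UNIV. w a s * x j s * d a s * y j a)"
  define R where "R = (\<lambda>j. \<Sum>a\<in>UNIV. \<Sum>s\<in>UNIV. w a s * dx j s * y j a)"
  define S where "S = (\<lambda>j. \<Sum>a\<in>UNIV. \<Sum>s\<in>UNIV. w a s * x j s * dy j a)"
  define A where "A = (\<Sum>a\<in>UNIV. b a * c a * (\<Prod>i\<in>J. u i a))"
  \<comment> \<open>The fixed point equation: the star weight without leaf j is the outgoing message
    up to the factor \<open>z j\<close>.\<close>
  have Q: "Q j a = z j * y j a" if "j \<in> J" for j a using bp[OF that] z[OF that] by (simp add: Q_def u_def)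
  have ZE: "Z = z j * E j" if "j \<in> J" for j
  proof -
    have "Z = (\<Sum>a\<in>UNIV. Q j a * u j a)" unfolding Z(1) Q_def u_def
      by (intro sum.cong refl) (simp add: prod.remove[OF fin that] mult_ac)
    also have "\<dots> = z j * E j" unfolding E Q[OF that] u_def by (simp add: sum_distrib_left sum_distrib_right mult_ac)
    finally show ?thesis .
  qed
  have Ej: "E j \<noteq> 0" if "j \<in> J" for j using ZE[OF that] Z(2) by auto
  have zE: "z j = Z / E j" if "j \<in> J" for j using ZE[OF that] Ej[OF that] by simp
  have 1: "(\<Sum>a\<in>UNIV. Q j a * (\<Sum>s\<in>UNIV. w a s * dx j s + x j s * (w a s * d a s * \<delta>))) = Z / E j * (R j + \<delta> * P j)" if "j \<in> J" for j
    unfolding Q[OF that] zE[OF that] R_def P_def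
    by (simp add: sum_distrib_left sum.distrib[symmetric] algebra_simps)
  have num1: "(\<Sum>a\<in>UNIV. b a * (\<Sum>j\<in>J. (\<Sum>s\<in>UNIV. w a s * dx j s + x j s * (w a s * d a s * \<delta>)) * (\<Prod>i\<in>J - {j}. u i a)) + (\<Prod>i\<in>J. u i a) * (b a * c a * \<delta>))
    = (\<Sum>j\<in>J. Z / E j * (R j + \<delta> * P j)) + \<delta> * A"
  proof -
    have "(\<Sum>j\<in>J. Z / E j * (R j + \<delta> * P j)) = (\<Sum>j\<in>J. \<Sum>a\<in>UNIV. Q j a * (\<Sum>s\<in>UNIV. w a s * dx j s + x j s * (w a s * d a s * \<delta>)))"
      by (intro sum.cong refl) (simp add: 1)
    also have "\<dots> = (\<Sum>a\<in>UNIV. \<Sum>j\<in>J. Q j a * (\<Sum>s\<in>UNIV. w a s * dx j s + x j s * (w a s * d a s * \<delta>)))" by (rule sum.swap)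
    also have "\<dots> = (\<Sum>a\<in>UNIV. b a * (\<Sum>j\<in>J. (\<Sum>s\<in>UNIV. w a s * dx j s + x j s * (w a s * d a s * \<delta>)) * (\<Prod>i\<in>J - {j}. u i a)))"
      by (intro sum.cong refl) (simp add: Q_def sum_distrib_left[of "b _"] mult_ac)
    finally show ?thesis by (simp add: A_def sum.distrib sum_distrib_left mult_ac)
  qed
  have num2: "(\<Sum>a\<in>UNIV. \<Sum>s\<in>UNIV. w a s * x j s * dy j a + y j a * (w a s * dx j s + x j s * (w a s * d a s * \<delta>))) = S j + R j + \<delta> * P j" for j
    unfolding S_def R_def P_def by (simp add: sum_distrib_left sum.distrib[symmetric] algebra_simps)
  have G: "Gst w b c d J x = (A + 1/2 * (\<Sum>j\<in>J. Z / E j * P j)) / Z"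
  proof -
    have "(\<Sum>j\<in>J. Z / E j * P j) = (\<Sum>j\<in>J. \<Sum>a\<in>UNIV. Q j a * (\<Sum>s\<in>UNIV. w a s * x j s * d a s))"
    proof (intro sum.cong refl)
      fix j assume j: "j \<in> J"
      show "Z / E j * P j = (\<Sum>a\<in>UNIV. Q j a * (\<Sum>s\<in>UNIV. w a s * x j s * d a s))"
        unfolding Q[OF j] zE[OF j] P_def by (simp add: sum_distrib_left mult_ac)
    qed
    also have "\<dots> = (\<Sum>a\<in>UNIV. \<Sum>j\<in>J. Q j a * (\<Sum>s\<in>UNIV. w a s * x j s * d a s))" by (rule sum.swap)
    also have "\<dots> = (\<Sum>a\<in>UNIV. b a * (\<Sum>j\<in>J. (\<Sum>s\<in>UNIV. w a s * x j s * d a s) * (\<Prod>i\<in>J - {j}. u i a)))"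
      by (intro sum.cong refl) (simp add: Q_def sum_distrib_left[of "b _"] mult_ac)
    finally have e: "(\<Sum>j\<in>J. Z / E j * P j) = (\<Sum>a\<in>UNIV. b a * (\<Sum>j\<in>J. (\<Sum>s\<in>UNIV. w a s * x j s * d a s) * (\<Prod>i\<in>J - {j}. u i a)))" .
    have gen: "(\<Sum>a\<in>UNIV. b a * (c a * q a + 1/2 * y a)) = (\<Sum>a\<in>UNIV. b a * c a * q a) + 1/2 * (\<Sum>a\<in>UNIV. b a * y a)" for q y :: "'x \<Rightarrow> real"
      by (simp add: sum.distrib[symmetric] sum_distrib_left algebra_simps)
    have "(\<Sum>a\<in>UNIV. b a * (c a * (\<Prod>j\<in>J. u j a) + 1/2 * (\<Sum>j\<in>J. (\<Sum>s\<in>UNIV. w a s * x j s * d a s) * (\<Prod>i\<in>J - {j}. u i a)))) = A + 1/2 * (\<Sum>j\<in>J. Z / E j * P j)"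
      unfolding gen e A_def ..  
    then show ?thesis unfolding Gst_def Z(1) u_def by simp
  qed
  have "((\<Sum>j\<in>J. Z / E j * (R j + \<delta> * P j)) + \<delta> * A) / Z - 1/2 * (\<Sum>j\<in>J. (S j + R j + \<delta> * P j) / E j)
    = \<delta> * ((A + 1/2 * (\<Sum>j\<in>J. Z / E j * P j)) / Z) + 1/2 * (\<Sum>j\<in>J. R j / E j - S j / E j)"
  proof -
    have a: "(\<Sum>j\<in>J. Z / E j * (R j + \<delta> * P j)) = Z * (\<Sum>j\<in>J. R j / E j) + Z * \<delta> * (\<Sum>j\<in>J. P j / E j)"
      by (simp add: sum_distrib_left sum.distrib[symmetric] algebra_simps add_divide_distrib)
    have b: "(\<Sum>j\<in>J. (S j + R j + \<delta> * P j) / E j) = (\<Sum>j\<in>J. S j / E j) + (\<Sum>j\<in>J. R j / E j) + \<delta> * (\<Sum>j\<in>J. P j / E j)"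
      by (simp add: sum_distrib_left sum.distrib[symmetric] add_divide_distrib)
    have c: "(\<Sum>j\<in>J. Z / E j * P j) = Z * (\<Sum>j\<in>J. P j / E j)" by (simp add: sum_distrib_left)
    have d: "(\<Sum>j\<in>J. R j / E j - S j / E j) = (\<Sum>j\<in>J. R j / E j) - (\<Sum>j\<in>J. S j / E j)" by (rule sum_subtractf)
    show ?thesis unfolding a b c d using Z(2) by (simp add: field_simps)
  qed
  moreover have "(\<Sum>a\<in>UNIV. \<Sum>s\<in>UNIV. w a s * dx j s * y j a) = R j" "(\<Sum>a\<in>UNIV. \<Sum>s\<in>UNIV. w a s * x j s * dy j a) = S j" for j
    by (simp_all add: R_def S_def)
  ultimately show ?thesis unfolding num1[unfolded u_def] num2 G by simp
qed

section \<open>Uniform bounds at the root along the path\<close>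

locale bethe_path = lwc_family \<psi> \<psi>b sp c d Gn \<mu> lo hi h
  for \<psi> :: "real \<Rightarrow> 'x::finite \<Rightarrow> 'x \<Rightarrow> real" and \<psi>b sp c d Gn \<mu> lo hi h +
  assumes H3: "H3 \<mu> h lo hi"
    and H2: "(\<forall>p s t. 0 < \<psi> p s t) \<or> (\<forall>k. integrable \<mu> (\<lambda>T. exp (k * real (deg T []))))"
begin

abbreviation gr where "gr m k \<equiv> gp lo hi m k"

lemma psi_cont: "continuous_on A (\<lambda>p. \<psi> p s t)" and psib_cont: "continuous_on A (\<lambda>p. \<psi>b p s)"
  using psi_deriv psib_deriv by (auto intro!: continuous_at_imp_continuous_on DERIV_isCont)

lemma psi_consts: "\<exists>M m. 1 \<le> M \<and> 0 < m \<and> m \<le> 1 \<and> (\<forall>p\<in>{lo..hi}. \<forall>s t. \<psi> p s t \<le> M \<and> \<psi>b p s \<le> M \<and> m \<le> \<psi>b p s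
    \<and> ((\<forall>p. 0 < \<psi> p s t) \<longrightarrow> m \<le> \<psi> p s t))"
proof -
  have S: "spin (\<psi> p) (\<psi>b p) sp" for p by (rule spin)
  have ub: "\<exists>K\<ge>1. \<forall>p\<in>{lo..hi}. f p \<le> K" if f: "continuous_on {lo..hi} f" for f :: "real \<Rightarrow> real"
  proof -
    have "bounded (f ` {lo..hi})" by (intro compact_imp_bounded compact_continuous_image f) simp
    then obtain K where "\<forall>y\<in>f ` {lo..hi}. norm y \<le> K" unfolding bounded_iff by blast
    then have "\<forall>p\<in>{lo..hi}. f p \<le> max 1 K" by (auto simp: le_max_iff_disj abs_le_iff)
    then show ?thesis by (intro exI[of _ "max 1 K"]) auto
  qed
  have lb: "\<exists>k>0. k \<le> 1 \<and> (\<forall>p\<in>{lo..hi}. k \<le> f p)" if f: "continuous_on {lo..hi} f" and pos: "\<And>p. 0 < f p" for f :: "real \<Rightarrow> real"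
  proof -
    obtain q where q: "q \<in> {lo..hi}" "\<forall>p\<in>{lo..hi}. f q \<le> f p"
      using continuous_attains_inf[of "{lo..hi}" f] f lohi by auto
    then show ?thesis using pos[of q] by (intro exI[of _ "min 1 (f q)"]) (auto simp: min_le_iff_disj)
  qed
  obtain M1 where M1: "\<And>s t. 1 \<le> M1 s t" "\<And>s t p. p \<in> {lo..hi} \<Longrightarrow> \<psi> p s t \<le> M1 s t"
    using ub[OF psi_cont] by metis
  obtain M2 where M2: "\<And>s. 1 \<le> M2 s" "\<And>s p. p \<in> {lo..hi} \<Longrightarrow> \<psi>b p s \<le> M2 s"
    using ub[OF psib_cont] by metis
  have bp: "0 < \<psi>b p s" for p s using spin.b_pos[OF S] .
  obtain m2 where m2: "\<And>s. 0 < m2 s" "\<And>s. m2 s \<le> 1" "\<And>s p. p \<in> {lo..hi} \<Longrightarrow> m2 s \<le> \<psi>b p s"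
    using lb[OF psib_cont bp] by metis
  have "\<exists>k>0. k \<le> 1 \<and> (\<forall>p\<in>{lo..hi}. (\<forall>p. 0 < \<psi> p s t) \<longrightarrow> k \<le> \<psi> p s t)" for s t
  proof (cases "\<forall>p. 0 < \<psi> p s t")
    case True
    then have "\<exists>k>0. k \<le> 1 \<and> (\<forall>p\<in>{lo..hi}. k \<le> \<psi> p s t)" by (intro lb[OF psi_cont]) auto
    then show ?thesis by blast
  next
    case False
    then show ?thesis by (intro exI[of _ 1]) auto
  qed
  then obtain m1 where m1: "\<And>s t. 0 < m1 s t" "\<And>s t. m1 s t \<le> 1" "\<And>s t p. p \<in> {lo..hi} \<Longrightarrow> (\<forall>p. 0 < \<psi> p s t) \<Longrightarrow> m1 s t \<le> \<psi> p s t"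
    by metis
  define M where "M = (\<Sum>(s, t)\<in>UNIV. M1 s t) + (\<Sum>s\<in>UNIV. M2 s)"
  have nn: "0 \<le> (\<Sum>(s, t)\<in>UNIV. M1 s t)" "0 \<le> (\<Sum>s\<in>UNIV. M2 s)"
    by (rule sum_nonneg; use M1(1) M2(1) order_trans[OF zero_le_one] in auto)+
  have MM: "M1 s t \<le> M" "M2 s \<le> M" for s t
  proof -
    have "M1 s t \<le> (\<Sum>(s, t)\<in>UNIV. M1 s t)"
      using member_le_sum[of "(s, t)" UNIV "case_prod M1"] order_trans[OF zero_le_one M1(1)] by auto
    moreover have "M2 s \<le> (\<Sum>s\<in>UNIV. M2 s)" by (rule member_le_sum) (auto intro: order_trans[OF zero_le_one M2(1)])
    ultimately show "M1 s t \<le> M" "M2 s \<le> M" using nn by (auto simp: M_def)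
  qed
  define m where "m = min (Min (range (case_prod m1))) (Min (range m2))"
  have mm: "m \<le> m1 s t" "m \<le> m2 s" for s t
  proof -
    have "Min (range (case_prod m1)) \<le> m1 s t" by (rule Min_le) (auto intro!: image_eqI[of _ _ "(s, t)"])
    moreover have "Min (range m2) \<le> m2 s" by (rule Min_le) auto
    ultimately show "m \<le> m1 s t" "m \<le> m2 s" by (auto simp: m_def min_le_iff_disj)
  qed
  have m0: "0 < m" unfolding m_def using m1(1) m2(1) by (simp add: split_paired_all)
  show ?thesis
  proof (rule exI[of _ M], rule exI[of _ m], intro conjI ballI allI impI)
    show "1 \<le> M" using MM(1) M1(1) order_trans by blast
    show "m \<le> 1" using mm(2) m2(2) order_trans by blast
    fix p s t assume p: "p \<in> {lo..hi}"
    show "\<psi> p s t \<le> M" "\<psi>b p s \<le> M" "m \<le> \<psi>b p s"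
      using M1(2)[OF p, of s t] M2(2)[OF p, of s] m2(3)[OF p, of s] MM(1)[of s t] MM(2)[of s] mm(2)[of s] by auto
    show "m \<le> \<psi> p s t" if "\<forall>p. 0 < \<psi> p s t" using m1(3)[OF p that] mm(1)[of s t] by linarith
  qed (rule m0)
qed

text \<open>Packages the bounds so that one pair of constants can be chosen for the whole
  development along the path.\<close>

definition admissible :: "real \<Rightarrow> real \<Rightarrow> bool" where
  "admissible M m \<longleftrightarrow> 1 \<le> M \<and> 0 < m \<and> m \<le> 1 \<and> (\<forall>p\<in>{lo..hi}. \<forall>s t. \<psi> p s t \<le> M \<and> \<psi>b p s \<le> M \<and> m \<le> \<psi>b p s
    \<and> ((\<forall>p. 0 < \<psi> p s t) \<longrightarrow> m \<le> \<psi> p s t))"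

definition "M = (SOME M. \<exists>m. admissible M m)"
definition "m0 = (SOME m. admissible M m)"

lemma Mm: "1 \<le> M" "0 < m0" "m0 \<le> 1"
  "p \<in> {lo..hi} \<Longrightarrow> \<psi> p s t \<le> M" "p \<in> {lo..hi} \<Longrightarrow> \<psi>b p s \<le> M" "p \<in> {lo..hi} \<Longrightarrow> m0 \<le> \<psi>b p s"
  "p \<in> {lo..hi} \<Longrightarrow> (\<forall>p. 0 < \<psi> p s t) \<Longrightarrow> m0 \<le> \<psi> p s t"
proof -
  have "\<exists>m. admissible M m" unfolding M_def by (rule someI_ex) (use psi_consts in \<open>simp add: admissible_def\<close>)
  then have "admissible M m0" unfolding m0_def by (rule someI_ex)
  then show "1 \<le> M" "0 < m0" "m0 \<le> 1"
  "p \<in> {lo..hi} \<Longrightarrow> \<psi> p s t \<le> M" "p \<in> {lo..hi} \<Longrightarrow> \<psi>b p s \<le> M" "p \<in> {lo..hi} \<Longrightarrow> m0 \<le> \<psi>b p s"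
  "p \<in> {lo..hi} \<Longrightarrow> (\<forall>p. 0 < \<psi> p s t) \<Longrightarrow> m0 \<le> \<psi> p s t" unfolding admissible_def by blast+
qed

lemma m0_sp: "p \<in> {lo..hi} \<Longrightarrow> m0 \<le> \<psi> p sp t"
  using Mm(7)[of p sp t] spin.w_sp'[OF spin] by blast

text \<open>Lower bound for the edge normalisation in terms of the root degree; it degenerates with the
  degree only when hard constraints are present.\<close>

definition lb :: "nat \<Rightarrow> real" where
  "lb D = (if \<forall>p s t. 0 < \<psi> p s t then m0 else m0 * (m0 * m0 ^ D / (real CARD('x) * M * M ^ D)))"

lemma lb_pos: "0 < lb D" using Mm(1,2) by (auto simp: lb_def)

text \<open>Dominating function for the Bethe functional and its increments: it absorbs terms linear
  in the root degree as well as the sum over root edges of reciprocals of the edge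
  normalisation.\<close>

definition dom where "dom T = (1 + real (deg T [])) * (1 + 1 / lb (deg T []))"

text \<open>Without hard constraints \<open>lb\<close> is constant and a first moment suffices.
  Otherwise the reciprocal of \<open>lb\<close> grows geometrically, like
  \<open>(M / m0) ^ D\<close> in the root degree D, which the exponential moments cover.\<close>

lemma dom_int: "integrable \<mu> dom"
proof (cases "\<forall>p s t. 0 < \<psi> p s t")
  case True
  then have "dom = (\<lambda>T. (1 + real (deg T [])) * (1 + 1 / m0))" by (auto simp: dom_def lb_def)
  then show ?thesis using deg_int by simp
next
  case False
  define K where "K = 1 + real CARD('x) * M / (m0 * m0)"
  define r where "r = ln (M / m0)"
  have r: "exp r = M / m0" "0 \<le> r" using Mm(1,2,3) by (auto simp: r_def)
  have "0 < M" using Mm(1) by linarith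
  then have K0: "1 \<le> K" using Mm(2) by (simp add: K_def)
  have bd: "dom T \<le> K * exp ((1 + r) * real (deg T []))" for T
  proof -
    let ?D = "deg T []"
    have "1 + real ?D \<le> exp (real ?D)" by (rule exp_ge_add_one_self)
    moreover have "1 + 1 / lb ?D \<le> K * exp (r * real ?D)"
    proof -
      have "1 / lb ?D = real CARD('x) * M / (m0 * m0) * (M / m0) ^ ?D"
        using False Mm(2) \<open>0 < M\<close> by (auto simp: lb_def field_simps power_divide)
      also have "(M / m0) ^ ?D = exp (r * real ?D)"
        unfolding r(1)[symmetric] by (simp add: exp_of_nat_mult[symmetric] mult.commute)
      finally have "1 / lb ?D = real CARD('x) * M / (m0 * m0) * exp (r * real ?D)" .
      moreover have "1 \<le> exp (r * real ?D)" using r(2) by simp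
      ultimately show ?thesis by (simp add: K_def algebra_simps)
    qed
    ultimately have "dom T \<le> exp (real ?D) * (K * exp (r * real ?D))"
      unfolding dom_def using lb_pos[of ?D] by (intro mult_mono) auto
    then show ?thesis by (simp add: exp_add[symmetric] algebra_simps)
  qed
  have d0: "0 \<le> dom T" for T unfolding dom_def using lb_pos[of "deg T []"] by simp
  have m: "dom \<in> borel_measurable \<mu>"
  proof -
    have "(\<lambda>T. (\<lambda>D. (1 + real D) * (1 + 1 / lb D)) (deg T [])) \<in> borel_measurable treeM"
      by (rule measurable_compose[OF measurable_deg]) simp
    then show ?thesis unfolding dom_def[abs_def] by (intro measurable_\<mu>)
  qed
  have "integrable \<mu> (\<lambda>T. exp ((1 + r) * real (deg T [])))" using H2 False by blast
  then have "integrable \<mu> (\<lambda>T. K * exp ((1 + r) * real (deg T [])))" by simp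
  then show ?thesis
    by (rule Bochner_Integration.integrable_bound[OF _ m]) (use bd d0 K0 in auto)
qed

lemma dom_ge: "1 + real (deg T []) \<le> dom T" "real (deg T []) / lb (deg T []) \<le> dom T" "0 \<le> dom T"
proof -
  let ?D = "real (deg T [])"
  have l: "0 < 1 / lb (deg T [])" using lb_pos by simp
  have "dom T = (1 + ?D) + (1 + ?D) * (1 / lb (deg T []))" by (simp add: dom_def algebra_simps)
  moreover have "?D * (1 / lb (deg T [])) \<le> (1 + ?D) * (1 / lb (deg T []))" using l by (intro mult_right_mono) auto
  moreover have "0 \<le> ?D * (1 / lb (deg T []))" using l by simp
  ultimately show "1 + ?D \<le> dom T" "?D / lb (deg T []) \<le> dom T" "0 \<le> dom T" by auto
qed

lemma msg: "p \<in> {lo..hi} \<Longrightarrow> is_message (h p)"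
  using Hstar by (auto simp: Hstar_def)

lemma msg_prob:
  assumes "p \<in> {lo..hi}" "utree T" "x \<in> T" "y \<in> T" "tadj x y"
  shows "0 \<le> h p T x y s" "(\<Sum>s\<in>UNIV. h p T x y s) = 1" "h p T x y s \<le> 1"
proof -
  show 0: "0 \<le> h p T x y s" for s by (rule is_messageD(2)[OF msg[OF assms(1)] assms(2-5)])
  show 1: "(\<Sum>s\<in>UNIV. h p T x y s) = 1" by (rule is_messageD(3)[OF msg[OF assms(1)] assms(2-5)])
  show "h p T x y s \<le> 1" unfolding 1[symmetric] by (rule member_le_sum) (auto simp: 0)
qed

definition EE :: "real \<Rightarrow> ('x \<Rightarrow> real) \<Rightarrow> ('x \<Rightarrow> real) \<Rightarrow> real" where
  "EE p x y = (\<Sum>a\<in>UNIV. \<Sum>s\<in>UNIV. \<psi> p a s * x s * y a)"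

lemma EE_sym: "EE p x y = EE p y x"
  unfolding EE_def by (subst sum.swap) (intro sum.cong refl, subst spin.w_sym[OF spin], simp add: mult_ac)

text \<open>The first argument may be signed, because increments of messages are inserted
  there.\<close>

lemma EE_abs_le:
  assumes p: "p \<in> {lo..hi}" and y: "\<And>a. 0 \<le> y a" "(\<Sum>a\<in>UNIV. y a) = 1"
  shows "\<bar>EE p x y\<bar> \<le> M * (\<Sum>s\<in>UNIV. \<bar>x s\<bar>)"
proof -
  have "\<bar>EE p x y\<bar> \<le> (\<Sum>a\<in>UNIV. \<Sum>s\<in>UNIV. \<bar>\<psi> p a s * x s * y a\<bar>)"
    unfolding EE_def by (rule order_trans[OF sum_abs sum_mono[OF sum_abs]])
  also have "\<dots> \<le> (\<Sum>a\<in>UNIV. \<Sum>s\<in>UNIV. M * \<bar>x s\<bar> * y a)"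
    unfolding abs_mult using spin.w_nn[OF spin] Mm(4)[OF p] y(1)
    by (intro sum_mono mult_mono) (use Mm(1) in auto)
  also have "\<dots> = M * (\<Sum>s\<in>UNIV. \<bar>x s\<bar>) * (\<Sum>a\<in>UNIV. y a)"
    by (simp add: sum_distrib_left sum_distrib_right mult_ac) (rule sum.swap)
  finally show ?thesis by (simp add: y)
qed

lemma EE_le:
  assumes p: "p \<in> {lo..hi}" and y: "\<And>a. 0 \<le> y a" "(\<Sum>a\<in>UNIV. y a) = 1" and x: "\<And>a. 0 \<le> x a" "(\<Sum>a\<in>UNIV. x a) = 1"
  shows "EE p x y \<le> M"
  using EE_abs_le[OF p y, of x] x by (simp add: abs_le_iff)

definition good :: "real \<Rightarrow> nat list set \<Rightarrow> bool" where
  "good p T \<longleftrightarrow> utree T \<and> (\<forall>x\<in>T. \<forall>y\<in>T. tadj x y \<longrightarrow> bp_fixed_at \<psi> \<psi>b p p (h p) T x y)"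

lemma AE_good: "p \<in> {lo..hi} \<Longrightarrow> AE T in \<mu>. good p T"
proof -
  assume "p \<in> {lo..hi}"
  from Hstar_all_edges[OF Hstar[OF this]] AE_utree show "AE T in \<mu>. good p T"
    unfolding good_def by eventually_elim simp
qed

definition Zr where "Zr p T = (\<Sum>a\<in>UNIV. \<psi>b p a * (\<Prod>j\<in>nbrs T []. \<Sum>s\<in>UNIV. \<psi> p a s * h p T j [] s))"

lemma root_edge: "utree T \<Longrightarrow> j \<in> nbrs T [] \<Longrightarrow> j \<in> T \<and> [] \<in> T \<and> tadj j [] \<and> tadj [] j"
  using utreeD(1) by (auto simp: nbrs_def tadj_sym)

lemma u_bounds:
  assumes p: "p \<in> {lo..hi}" and T: "utree T" and j: "j \<in> nbrs T []"
  shows "0 \<le> (\<Sum>s\<in>UNIV. \<psi> p a s * h p T j [] s)" "(\<Sum>s\<in>UNIV. \<psi> p a s * h p T j [] s) \<le> M" "m0 \<le> (\<Sum>s\<in>UNIV. \<psi> p sp s * h p T j [] s)"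
proof -
  note x = msg_prob[OF p T, of j "[]"] and e = root_edge[OF T j]
  show "0 \<le> (\<Sum>s\<in>UNIV. \<psi> p a s * h p T j [] s)"
    by (intro sum_nonneg mult_nonneg_nonneg spin.w_nn[OF spin] x) (use e in auto)
  have "(\<Sum>s\<in>UNIV. \<psi> p a s * h p T j [] s) \<le> (\<Sum>s\<in>UNIV. M * h p T j [] s)"
    by (intro sum_mono mult_right_mono Mm(4)[OF p] x) (use e in auto)
  then show "(\<Sum>s\<in>UNIV. \<psi> p a s * h p T j [] s) \<le> M" using x e by (simp add: sum_distrib_left[symmetric])
  have "(\<Sum>s\<in>UNIV. m0 * h p T j [] s) \<le> (\<Sum>s\<in>UNIV. \<psi> p sp s * h p T j [] s)"
    by (intro sum_mono mult_right_mono m0_sp[OF p] x) (use e in auto)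
  then show "m0 \<le> (\<Sum>s\<in>UNIV. \<psi> p sp s * h p T j [] s)" using x e by (simp add: sum_distrib_left[symmetric])
qed

lemma star_bounds:
  assumes p: "p \<in> {lo..hi}" and T: "utree T" and J: "J \<subseteq> nbrs T []"
  defines "F \<equiv> \<lambda>a. \<psi>b p a * (\<Prod>j\<in>J. \<Sum>s\<in>UNIV. \<psi> p a s * h p T j [] s)"
  shows "0 \<le> F a" "m0 * m0 ^ card J \<le> F sp" "(\<Sum>a\<in>UNIV. F a) \<le> real CARD('x) * M * M ^ card J" "m0 * m0 ^ card J \<le> (\<Sum>a\<in>UNIV. F a)"
proof -
  have u: "0 \<le> (\<Sum>s\<in>UNIV. \<psi> p a s * h p T j [] s)" "(\<Sum>s\<in>UNIV. \<psi> p a s * h p T j [] s) \<le> M" "m0 \<le> (\<Sum>s\<in>UNIV. \<psi> p sp s * h p T j [] s)" if "j \<in> J" for j a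
    using u_bounds[OF p T] that J by blast+
  have b: "0 \<le> \<psi>b p a" for a using spin.b_pos[OF spin] by (rule less_imp_le)
  show nn: "0 \<le> F a" for a unfolding F_def by (intro mult_nonneg_nonneg b prod_nonneg) (use u in auto)
  have p1: "m0 ^ card J \<le> (\<Prod>j\<in>J. \<Sum>s\<in>UNIV. \<psi> p sp s * h p T j [] s)"
    using prod_mono[of J "\<lambda>_. m0" "\<lambda>j. \<Sum>s\<in>UNIV. \<psi> p sp s * h p T j [] s"] u(3) Mm(2) by (simp add: less_imp_le)
  show 2: "m0 * m0 ^ card J \<le> F sp"
    unfolding F_def using p1 Mm(2) Mm(6)[OF p] b by (intro mult_mono) auto
  have "F a \<le> M * M ^ card J" for a
  proof -
    have "(\<Prod>j\<in>J. \<Sum>s\<in>UNIV. \<psi> p a s * h p T j [] s) \<le> M ^ card J"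
      using prod_mono[of J "\<lambda>j. \<Sum>s\<in>UNIV. \<psi> p a s * h p T j [] s" "\<lambda>_. M"] u by simp
    moreover have "0 \<le> (\<Prod>j\<in>J. \<Sum>s\<in>UNIV. \<psi> p a s * h p T j [] s)" by (rule prod_nonneg) (use u in auto)
    ultimately show ?thesis unfolding F_def using Mm(5)[OF p] b Mm(1) by (intro mult_mono) auto
  qed
  then show "(\<Sum>a\<in>UNIV. F a) \<le> real CARD('x) * M * M ^ card J"
    using sum_bounded_above[of UNIV F "M * M ^ card J"] by (simp add: mult_ac)
  have "F sp \<le> (\<Sum>a\<in>UNIV. F a)" by (rule member_le_sum) (auto simp: nn)
  then show "m0 * m0 ^ card J \<le> (\<Sum>a\<in>UNIV. F a)" using 2 by linarith
qed

text \<open>The recursion at an edge out of the root, which \<open>good\<close> includes; it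
  expresses the outgoing messages by the incoming ones.\<close>

lemma root_out:
  assumes p: "p \<in> {lo..hi}" and g: "good p T" and j: "j \<in> nbrs T []"
  defines "z \<equiv> (\<Sum>a\<in>UNIV. \<psi>b p a * (\<Prod>i\<in>nbrs T [] - {j}. \<Sum>s\<in>UNIV. \<psi> p a s * h p T i [] s))"
  shows "h p T [] j a = \<psi>b p a * (\<Prod>i\<in>nbrs T [] - {j}. \<Sum>s\<in>UNIV. \<psi> p a s * h p T i [] s) / z" "0 < z"
proof -
  have T: "utree T" using g by (simp add: good_def)
  have "bp_fixed_at \<psi> \<psi>b p p (h p) T [] j" using g root_edge[OF T j] by (simp add: good_def)
  then show "h p T [] j a = \<psi>b p a * (\<Prod>i\<in>nbrs T [] - {j}. \<Sum>s\<in>UNIV. \<psi> p a s * h p T i [] s) / z" "0 < z"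
    by (auto simp: bp_fixed_at_def bp_rhs_def z_def)
qed

text \<open>With positive weights every pair contributes with weight at least \<open>m0\<close>.
  Under hard constraints only root spin \<open>sp\<close> is sure to be compatible, so the outgoing
  message has to be bounded below at \<open>sp\<close>: its numerator and its normaliser are bounded
  by powers of \<open>m0\<close> and \<open>M\<close> in the degree.\<close>

lemma EE_lb:
  assumes p: "p \<in> {lo..hi}" and g: "good p T" and j: "j \<in> nbrs T []"
  shows "lb (deg T []) \<le> EE p (h p T j []) (h p T [] j)"
proof -
  have T: "utree T" using g by (simp add: good_def)
  note e = root_edge[OF T j]
  have x: "0 \<le> h p T j [] s" "(\<Sum>s\<in>UNIV. h p T j [] s) = 1" for s using msg_prob[OF p T, of j "[]"] e by auto
  have y: "0 \<le> h p T [] j s" "(\<Sum>s\<in>UNIV. h p T [] j s) = 1" for s using msg_prob[OF p T, of "[]" j] e by auto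
  have w: "0 \<le> \<psi> p a s" for a s by (rule spin.w_nn[OF spin])
  show ?thesis
  proof (cases "\<forall>p s t. 0 < \<psi> p s t")
    case True
    have "(\<Sum>a\<in>UNIV. \<Sum>s\<in>UNIV. m0 * h p T j [] s * h p T [] j a) \<le> EE p (h p T j []) (h p T [] j)"
      unfolding EE_def by (intro sum_mono mult_right_mono Mm(7)[OF p] x y) (use True in auto)
    moreover have "(\<Sum>a\<in>UNIV. \<Sum>s\<in>UNIV. m0 * h p T j [] s * h p T [] j a) = m0"
      by (simp add: sum_distrib_left[symmetric] sum_distrib_right[symmetric] x y)
    ultimately show ?thesis using True by (simp add: lb_def)
  next
    case False
    let ?J = "nbrs T [] - {j}"
    have fin: "finite (nbrs T [])" using finite_nbrs'[OF T] .
    have cJ: "card ?J \<le> deg T []" unfolding deg_def by (rule card_mono[OF fin]) auto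
    note sb = star_bounds[OF p T, of ?J] and ro = root_out(1)[OF p g j, of sp] root_out(2)[OF p g j]
    \<comment> \<open>The product runs over one neighbour less than the degree; as m0 \<le> 1 \<le>
      M, the full degree is a safe exponent.\<close>
    have num: "m0 * m0 ^ deg T [] \<le> m0 * m0 ^ card ?J"
      using Mm(2,3) cJ by (intro mult_left_mono power_decreasing) auto
    have den: "real CARD('x) * M * M ^ card ?J \<le> real CARD('x) * M * M ^ deg T []"
      using Mm(1) cJ by (intro mult_left_mono power_increasing) auto
    have sub: "?J \<subseteq> nbrs T []" by blast
    have "m0 * m0 ^ deg T [] / (real CARD('x) * M * M ^ deg T []) \<le> h p T [] j sp"
      unfolding ro(1) by (rule frac_le[OF sb(1)[OF sub] order_trans[OF num sb(2)[OF sub]] ro(2) order_trans[OF sb(3)[OF sub] den]])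
    then have "m0 * (m0 * m0 ^ deg T [] / (real CARD('x) * M * M ^ deg T [])) \<le> m0 * h p T [] j sp"
      using Mm(2) by (intro mult_left_mono) auto
    also have "m0 * h p T [] j sp = (\<Sum>s\<in>UNIV. m0 * h p T j [] s * h p T [] j sp)"
      by (simp add: sum_distrib_left[symmetric] sum_distrib_right[symmetric] x)
    also have "\<dots> \<le> (\<Sum>s\<in>UNIV. \<psi> p sp s * h p T j [] s * h p T [] j sp)"
      by (intro sum_mono mult_right_mono m0_sp[OF p] x y)
    also have "\<dots> \<le> EE p (h p T j []) (h p T [] j)"
      unfolding EE_def by (rule member_le_sum[where f="\<lambda>a. \<Sum>s\<in>UNIV. \<psi> p a s * h p T j [] s * h p T [] j a"])
        (auto intro!: sum_nonneg mult_nonneg_nonneg w x y)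
    finally show ?thesis unfolding lb_def if_not_P[OF False] .
  qed
qed

lemma Zr_bounds:
  assumes p: "p \<in> {lo..hi}" and T: "utree T"
  shows "m0 * m0 ^ deg T [] \<le> Zr p T" "Zr p T \<le> real CARD('x) * M * M ^ deg T []" "0 < Zr p T"
proof -
  show 1: "m0 * m0 ^ deg T [] \<le> Zr p T" "Zr p T \<le> real CARD('x) * M * M ^ deg T []"
    using star_bounds(3,4)[OF p T order_refl] by (auto simp: Zr_def deg_def)
  have "0 < m0 * m0 ^ deg T []" using Mm(2) by simp
  then show "0 < Zr p T" using 1(1) by linarith
qed

lemma PhiT_eq: "PhiT \<psi> \<psi>b p p (h p) T = ln (Zr p T) - 1/2 * (\<Sum>j\<in>nbrs T []. ln (EE p (h p T j []) (h p T [] j)))"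
  by (simp add: PhiT_def Zr_def EE_def)

text \<open>The logarithm of the star weight is at most linear in the degree. For an edge term, ln E
  \<le> M and -ln E \<le> 1 / E, where E is bounded below by \<open>lb\<close>; summed over the root
  edges this is what \<open>dom\<close> dominates.\<close>

lemma PhiT_bound: "\<exists>K. \<forall>p\<in>{lo..hi}. \<forall>T. good p T \<longrightarrow> \<bar>PhiT \<psi> \<psi>b p p (h p) T\<bar> \<le> K * dom T"
proof -
  define L where "L = ln (real CARD('x) * M) + \<bar>ln M\<bar> + \<bar>ln m0\<bar>"
  have CM: "1 \<le> real CARD('x) * M"
    using mult_mono[of 1 "real CARD('x)" 1 M] Mm(1) by (simp add: Suc_leI)
  have lnC: "0 \<le> ln (real CARD('x) * M)" using CM by simp
  then have L0: "0 \<le> L" by (simp add: L_def)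
  have LL: "ln M \<le> L" "- L \<le> ln m0" using lnC unfolding L_def by linarith+
  have "\<bar>PhiT \<psi> \<psi>b p p (h p) T\<bar> \<le> (L + M + 1) * dom T" if p: "p \<in> {lo..hi}" and g: "good p T" for p T
  proof -
    have T: "utree T" using g by (simp add: good_def)
    let ?D = "real (deg T [])"
    have "ln (Zr p T) \<le> ln (real CARD('x) * M * M ^ deg T [])"
      using Zr_bounds[OF p T] by (intro ln_mono) auto
    also have "\<dots> = ln (real CARD('x) * M) + ?D * ln M" using Mm(1) CM by (simp add: ln_mult ln_realpow)
    also have "\<dots> \<le> L * (1 + ?D)"
    proof -
      have "?D * ln M \<le> ?D * L" using LL by (intro mult_left_mono) auto
      moreover have "ln (real CARD('x) * M) \<le> L" by (simp add: L_def)
      ultimately show ?thesis by (simp add: algebra_simps)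
    qed
    finally have 1: "ln (Zr p T) \<le> L * (1 + ?D)" .
    have "ln (m0 * m0 ^ deg T []) \<le> ln (Zr p T)" using Zr_bounds[OF p T] Mm(2) by (intro ln_mono) auto
    moreover have "ln (m0 * m0 ^ deg T []) = (1 + ?D) * ln m0" using Mm(2) by (simp add: ln_mult ln_realpow algebra_simps)
    moreover have "- (L * (1 + ?D)) \<le> (1 + ?D) * ln m0"
    proof -
      have "(1 + ?D) * (- L) \<le> (1 + ?D) * ln m0" using LL by (intro mult_left_mono) auto
      then show ?thesis by (simp add: algebra_simps)
    qed
    ultimately have 2: "\<bar>ln (Zr p T)\<bar> \<le> L * (1 + ?D)" using 1 by linarith
    have "\<bar>\<Sum>j\<in>nbrs T []. ln (EE p (h p T j []) (h p T [] j))\<bar> \<le> (\<Sum>j\<in>nbrs T []. \<bar>ln (EE p (h p T j []) (h p T [] j))\<bar>)" by (rule sum_abs)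
    also have "\<dots> \<le> (\<Sum>j\<in>nbrs T []. M + 1 / lb (deg T []))"
    proof (rule sum_mono)
      fix j assume j: "j \<in> nbrs T []"
      let ?E = "EE p (h p T j []) (h p T [] j)"
      have l: "lb (deg T []) \<le> ?E" by (rule EE_lb[OF p g j])
      have E0: "0 < ?E" using l lb_pos[of "deg T []"] by linarith
      have "?E \<le> M" by (rule EE_le[OF p]) (use msg_prob[OF p T] root_edge[OF T j] in auto)
      then have a: "ln ?E \<le> M" using ln_le_minus_one[OF E0] by linarith
      have "- ln ?E = ln (1 / ?E)" using E0 by (simp add: ln_div)
      also have "\<dots> \<le> 1 / ?E" using ln_le_minus_one[of "1 / ?E"] E0 by simp
      also have "\<dots> \<le> 1 / lb (deg T [])" using l lb_pos by (intro divide_left_mono mult_pos_pos E0) auto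
      finally have b: "- ln ?E \<le> 1 / lb (deg T [])" .
      have "0 < 1 / lb (deg T [])" using lb_pos by simp
      then show "\<bar>ln ?E\<bar> \<le> M + 1 / lb (deg T [])" using a b Mm(1) by linarith
    qed
    also have "\<dots> = ?D * M + ?D / lb (deg T [])" by (simp add: deg_def algebra_simps)
    finally have 3: "\<bar>\<Sum>j\<in>nbrs T []. ln (EE p (h p T j []) (h p T [] j))\<bar> \<le> ?D * M + ?D / lb (deg T [])" .
    have "L * (1 + ?D) \<le> L * dom T" using dom_ge(1)[of T] L0 by (intro mult_left_mono) auto
    moreover have "?D * M \<le> dom T * M" using dom_ge(1)[of T] Mm(1) by (intro mult_right_mono) auto
    moreover have "0 \<le> dom T * M" using dom_ge(3)[of T] Mm(1) by simp
    ultimately show ?thesis using 2 3 dom_ge(2,3)[of T] unfolding PhiT_eq by (simp add: algebra_simps abs_le_iff)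
  qed
  then show ?thesis by blast
qed

end

section \<open>First-order increments of messages and of the functional\<close>

context bethe_path
begin

definition del :: "nat \<Rightarrow> real" where "del m = (hi - lo) / real m"

definition dh :: "nat \<Rightarrow> nat \<Rightarrow> nat list set \<Rightarrow> nat list \<Rightarrow> nat list \<Rightarrow> 'x \<Rightarrow> real" where
  "dh m k T x y s = h (gr m (Suc k)) T x y s - h (gr m k) T x y s"

text \<open>First-order change of the logarithm of the edge normalisation when only the message from y to x
  is varied.\<close>

definition cc :: "nat \<Rightarrow> nat \<Rightarrow> nat list set \<Rightarrow> nat list \<Rightarrow> nat list \<Rightarrow> real" where
  "cc m k T x y = EE (gr m k) (dh m k T y x) (h (gr m k) T x y) / EE (gr m k) (h (gr m k) T y x) (h (gr m k) T x y)"

text \<open>Continuity and bounded variation as seen on the grids. Only countably many parameters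
  are involved, so the property is measurable and unimodularity can spread it to edges out of the
  root, about which H3 says nothing directly.\<close>

definition smooth :: "real \<Rightarrow> nat list set \<Rightarrow> nat list \<Rightarrow> nat list \<Rightarrow> bool" where
  "smooth C T x y \<longleftrightarrow> (\<forall>s. (\<forall>m. (\<Sum>k<m. \<bar>dh m k T x y s\<bar>) \<le> C) \<and>
     (\<forall>n. \<exists>N. \<forall>m\<ge>N. \<forall>k\<in>{..<m}. \<bar>dh m k T x y s\<bar> \<le> 1 / real (Suc n)))"

lemma gr_in: "k \<le> m \<Longrightarrow> gr m k \<in> {lo..hi}"
  by (rule gp_in[OF lohi])

lemma h_meas: "p \<in> {lo..hi} \<Longrightarrow> (\<lambda>T. h p T x y s) \<in> borel_measurable treeM"
  by (rule is_messageD(1)[OF msg])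

lemma dh_meas: "k < m \<Longrightarrow> (\<lambda>T. dh m k T x y s) \<in> borel_measurable treeM"
  unfolding dh_def by (intro borel_measurable_diff h_meas gr_in) auto

lemma h_inv:
  assumes "p \<in> {lo..hi}" "utree T" "utree T'" "x \<in> T" "y \<in> T" "x' \<in> T'" "y' \<in> T'" "tadj x y" "riso2 T tadj x y T' tadj x' y'"
  shows "h p T x y s = h p T' x' y' s" "h p T y x s = h p T' y' x' s"
proof -
  show "h p T x y s = h p T' x' y' s" by (rule is_messageD(4)[OF msg[OF assms(1)]]) (use assms in auto)
  have "riso2 T tadj y x T' tadj y' x'" using assms(9) by (auto simp: riso2_def)
  then show "h p T y x s = h p T' y' x' s"
    by (intro is_messageD(4)[OF msg[OF assms(1)]]) (use assms tadj_sym in auto)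
qed

lemma AE_smooth: "\<exists>C\<ge>0. AE T in \<mu>. \<forall>x\<in>T. \<forall>y\<in>T. tadj x y \<longrightarrow> smooth C T x y"
proof -
  obtain C where C: "AE_up \<mu> (\<lambda>T x y. \<forall>s. continuous_on {lo..hi} (\<lambda>p. h p T x y s) \<and> tv_le (\<lambda>p. h p T x y s) lo hi C)"
    using H3 unfolding H3_def by blast
  have sm: "smooth (max 0 C) T x y" if "\<forall>s. continuous_on {lo..hi} (\<lambda>p. h p T x y s) \<and> tv_le (\<lambda>p. h p T x y s) lo hi C" for T x y
    unfolding smooth_def
  proof (intro allI conjI)
    fix s m
    \<comment> \<open>The grid is one of the sorted lists over which total variation is
      taken.\<close>
    let ?ts = "map (gr m) [0..<Suc m]"
    have "sorted ?ts" by (auto simp: sorted_iff_nth_mono intro: gp_mono[OF lohi] simp del: upt_Suc)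
    moreover have "set ?ts \<subseteq> {lo..hi}" using gr_in by auto
    ultimately have "(\<Sum>k<length ?ts - 1. \<bar>h (?ts ! Suc k) T x y s - h (?ts ! k) T x y s\<bar>) \<le> C"
      using that unfolding tv_le_def by blast
    moreover have "(\<Sum>k<length ?ts - 1. \<bar>h (?ts ! Suc k) T x y s - h (?ts ! k) T x y s\<bar>) = (\<Sum>k<m. \<bar>dh m k T x y s\<bar>)"
      by (rule sum.cong) (auto simp: dh_def nth_append simp del: upt_Suc)
    ultimately show "(\<Sum>k<m. \<bar>dh m k T x y s\<bar>) \<le> max 0 C" by simp
  next
    fix s n
    have "\<forall>\<^sub>F m in sequentially. \<forall>k<m. \<bar>h (gr m (Suc k)) T x y s - h (gr m k) T x y s\<bar> \<le> 1 / real (Suc n)"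
      by (rule osc_continuous[OF lohi]) (use that in auto)
    then show "\<exists>N. \<forall>m\<ge>N. \<forall>k\<in>{..<m}. \<bar>dh m k T x y s\<bar> \<le> 1 / real (Suc n)"
      by (auto simp: eventually_sequentially dh_def)
  qed
  have "AE T in \<mu>. \<forall>x\<in>T. \<forall>y\<in>T. tadj x y \<longrightarrow> smooth (max 0 C) T x y"
  proof (rule AE_up_all_edges)
    show "AE_up \<mu> (smooth (max 0 C))"
      using C unfolding AE_up_def by eventually_elim (use sm in blast)
    fix x y
    have [measurable]: "(\<lambda>T. \<Sum>k<m. \<bar>dh m k T x y s\<bar>) \<in> borel_measurable treeM" for m s
      by (intro borel_measurable_sum borel_measurable_abs dh_meas) auto
    have [measurable]: "Measurable.pred treeM (\<lambda>T. \<forall>k\<in>{..<m}. \<bar>dh m k T x y s\<bar> \<le> 1 / real (Suc n))" for m n s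
    proof (rule pred_intros_finite(3))
      fix k assume "k \<in> {..<m}"
      then have [measurable]: "(\<lambda>T. dh m k T x y s) \<in> borel_measurable treeM" by (intro dh_meas) auto
      show "Measurable.pred treeM (\<lambda>T. \<bar>dh m k T x y s\<bar> \<le> 1 / real (Suc n))" by measurable
    qed simp
    show "Measurable.pred treeM (\<lambda>T. smooth (max 0 C) T x y)" unfolding smooth_def by measurable
  next
    fix T T' x y x' y'
    assume a: "utree T" "utree T'" "x \<in> T" "y \<in> T" "x' \<in> T'" "y' \<in> T'" "tadj x y" "tadj x' y'" "riso2 T tadj x y T' tadj x' y'"
      and s: "smooth (max 0 C) T x y"
    \<comment> \<open>Invariance is known for parameters in the interval only; k < m keeps both grid
      points there.\<close>
    have "dh m k T' x' y' s = dh m k T x y s" if "k < m" for m k s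
      unfolding dh_def using h_inv(1)[OF _ a(1-7,9), of "gr m k"] h_inv(1)[OF _ a(1-7,9), of "gr m (Suc k)"] gr_in[of k m] gr_in[of "Suc k" m] that by simp
    then have "(\<Sum>k<m. \<bar>dh m k T' x' y' s\<bar>) = (\<Sum>k<m. \<bar>dh m k T x y s\<bar>)"
      "(\<forall>k\<in>{..<m}. \<bar>dh m k T' x' y' s\<bar> \<le> r) \<longleftrightarrow> (\<forall>k\<in>{..<m}. \<bar>dh m k T x y s\<bar> \<le> r)" for m s r by auto
    then show "smooth (max 0 C) T' x' y'" using s unfolding smooth_def by simp
  qed
  then show ?thesis by (intro exI[of _ "max 0 C"]) auto
qed

text \<open>In the last sum \<open>cc m k T [] j\<close> varies the message from j into the root and
  \<open>cc m k T j []\<close> the message from the root to j.\<close>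

definition om :: "nat \<Rightarrow> nat \<Rightarrow> nat list set \<Rightarrow> real" where
  "om m k T = del m * Gst (\<psi> (gr m k)) (\<psi>b (gr m k)) (c (gr m k)) (d (gr m k)) (nbrs T []) (\<lambda>j. h (gr m k) T j [])
     + 1/2 * (\<Sum>j\<in>nbrs T []. cc m k T [] j - cc m k T j [])"

lemma gd_msg:
  assumes T: "utree T" and e: "x \<in> T" "y \<in> T" "tadj x y" and s: "smooth C T x y"
  shows "gd (\<lambda>m k. h (gr m k) T x y s) (\<lambda>m k. dh m k T x y s)"
proof -
  have "gd (\<lambda>m k. h (gr m k) T x y s) (\<lambda>m k. h (gr m (Suc k)) T x y s - h (gr m k) T x y s)"
  proof (rule gd_raw[where C="max 1 C"])
    show "\<bar>h (gr m k) T x y s\<bar> \<le> max 1 C" if "k \<le> m" for m k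
      using msg_prob(1,3)[OF gr_in[OF that] T e, of s] by (auto simp: le_max_iff_disj)
    show "(\<Sum>k<m. \<bar>h (gr m (Suc k)) T x y s - h (gr m k) T x y s\<bar>) \<le> max 1 C" for m
      using s unfolding smooth_def dh_def by (auto simp: le_max_iff_disj)
    fix r :: real assume "0 < r"
    then obtain n where n: "1 / real (Suc n) < r" using nat_approx_posE by (metis inverse_eq_divide of_nat_Suc)
    obtain N where "\<forall>m\<ge>N. \<forall>k\<in>{..<m}. \<bar>dh m k T x y s\<bar> \<le> 1 / real (Suc n)" using s unfolding smooth_def by blast
    then show "\<forall>\<^sub>F m in sequentially. \<forall>k<m. \<bar>h (gr m (Suc k)) T x y s - h (gr m k) T x y s\<bar> \<le> r"
      using n unfolding eventually_sequentially dh_def by (meson lessThan_iff less_imp_le order_trans)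
  qed
  then show ?thesis by (simp add: dh_def)
qed

text \<open>Both logarithms are expanded by the rules for \<open>gd\<close>; on a fixed tree the
  bounds for the star weight and for the edge normalisation keep them away from 0. The fixed point
  algebra then rearranges the result to \<open>om\<close>.\<close>

lemma gd_Phi:
  assumes good: "\<And>m k. k \<le> m \<Longrightarrow> good (gr m k) T" and s: "\<forall>x\<in>T. \<forall>y\<in>T. tadj x y \<longrightarrow> smooth C T x y"
  shows "gd (\<lambda>m k. PhiT \<psi> \<psi>b (gr m k) (gr m k) (h (gr m k)) T) (\<lambda>m k. om m k T)"
proof -
  have T: "utree T" using good[of 0 0] by (simp add: good_def)
  let ?J = "nbrs T []"
  have fin: "finite ?J" using finite_nbrs'[OF T] .
  have psi: "gd (\<lambda>m k. \<psi> (gr m k) a t) (\<lambda>m k. \<psi> (gr m k) a t * d (gr m k) a t * del m)" for a t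
    unfolding del_def
    by (rule gd_C1[OF lohi]) (auto intro!: has_field_derivative_at_within psi_deriv continuous_intros psi_cont continuous_on_subset[OF d_cont])
  have psib: "gd (\<lambda>m k. \<psi>b (gr m k) a) (\<lambda>m k. \<psi>b (gr m k) a * c (gr m k) a * del m)" for a
    unfolding del_def
    by (rule gd_C1[OF lohi]) (auto intro!: has_field_derivative_at_within psib_deriv continuous_intros psib_cont continuous_on_subset[OF c_cont])
  have x: "gd (\<lambda>m k. h (gr m k) T j [] t) (\<lambda>m k. dh m k T j [] t)" "gd (\<lambda>m k. h (gr m k) T [] j t) (\<lambda>m k. dh m k T [] j t)" if "j \<in> ?J" for j t
    using root_edge[OF T that] s by (auto intro!: gd_msg[OF T])
  have wx: "gd (\<lambda>m k. \<psi> (gr m k) a t * h (gr m k) T j [] t)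
     (\<lambda>m k. \<psi> (gr m k) a t * dh m k T j [] t + h (gr m k) T j [] t * (\<psi> (gr m k) a t * d (gr m k) a t * del m))" if "j \<in> ?J" for j a t
    by (rule gd_mult[OF psi x(1)[OF that]])
  have u: "gd (\<lambda>m k. \<Sum>t\<in>UNIV. \<psi> (gr m k) a t * h (gr m k) T j [] t)
     (\<lambda>m k. \<Sum>t\<in>UNIV. \<psi> (gr m k) a t * dh m k T j [] t + h (gr m k) T j [] t * (\<psi> (gr m k) a t * d (gr m k) a t * del m))" if "j \<in> ?J" for j a
    by (rule gd_sum[OF finite wx[OF that]])
  have Z: "gd (\<lambda>m k. \<Sum>a\<in>UNIV. \<psi>b (gr m k) a * (\<Prod>j\<in>?J. \<Sum>t\<in>UNIV. \<psi> (gr m k) a t * h (gr m k) T j [] t))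
     (\<lambda>m k. \<Sum>a\<in>UNIV. \<psi>b (gr m k) a * (\<Sum>j\<in>?J. (\<Sum>t\<in>UNIV. \<psi> (gr m k) a t * dh m k T j [] t + h (gr m k) T j [] t * (\<psi> (gr m k) a t * d (gr m k) a t * del m)) * (\<Prod>i\<in>?J - {j}. \<Sum>t\<in>UNIV. \<psi> (gr m k) a t * h (gr m k) T i [] t))
        + (\<Prod>i\<in>?J. \<Sum>t\<in>UNIV. \<psi> (gr m k) a t * h (gr m k) T i [] t) * (\<psi>b (gr m k) a * c (gr m k) a * del m))"
    by (rule gd_sum[OF finite], rule gd_mult[OF psib], rule gd_prod[OF fin u])
  have lnZ: "gd (\<lambda>m k. ln (Zr (gr m k) T))
     (\<lambda>m k. (\<Sum>a\<in>UNIV. \<psi>b (gr m k) a * (\<Sum>j\<in>?J. (\<Sum>t\<in>UNIV. \<psi> (gr m k) a t * dh m k T j [] t + h (gr m k) T j [] t * (\<psi> (gr m k) a t * d (gr m k) a t * del m)) * (\<Prod>i\<in>?J - {j}. \<Sum>t\<in>UNIV. \<psi> (gr m k) a t * h (gr m k) T i [] t))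
        + (\<Prod>i\<in>?J. \<Sum>t\<in>UNIV. \<psi> (gr m k) a t * h (gr m k) T i [] t) * (\<psi>b (gr m k) a * c (gr m k) a * del m)) / Zr (gr m k) T)"
    unfolding Zr_def
  proof (rule gd_ln[OF Z])
    show "0 < m0 * m0 ^ deg T []" using Mm(2) by simp
    show "m0 * m0 ^ deg T [] \<le> (\<Sum>a\<in>UNIV. \<psi>b (gr m k) a * (\<Prod>j\<in>?J. \<Sum>t\<in>UNIV. \<psi> (gr m k) a t * h (gr m k) T j [] t))" if "k \<le> m" for m k
      using Zr_bounds(1)[OF gr_in[OF that] T] by (simp add: Zr_def)
  qed
  have E: "gd (\<lambda>m k. EE (gr m k) (h (gr m k) T j []) (h (gr m k) T [] j))
     (\<lambda>m k. \<Sum>a\<in>UNIV. \<Sum>t\<in>UNIV. \<psi> (gr m k) a t * h (gr m k) T j [] t * dh m k T [] j a + h (gr m k) T [] j a * (\<psi> (gr m k) a t * dh m k T j [] t + h (gr m k) T j [] t * (\<psi> (gr m k) a t * d (gr m k) a t * del m)))" if "j \<in> ?J" for j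
    unfolding EE_def
    by (rule gd_sum[OF finite], rule gd_sum[OF finite], rule gd_mult[OF wx[OF that] x(2)[OF that]])
  have lnE: "gd (\<lambda>m k. ln (EE (gr m k) (h (gr m k) T j []) (h (gr m k) T [] j)))
     (\<lambda>m k. (\<Sum>a\<in>UNIV. \<Sum>t\<in>UNIV. \<psi> (gr m k) a t * h (gr m k) T j [] t * dh m k T [] j a + h (gr m k) T [] j a * (\<psi> (gr m k) a t * dh m k T j [] t + h (gr m k) T j [] t * (\<psi> (gr m k) a t * d (gr m k) a t * del m)))
        / EE (gr m k) (h (gr m k) T j []) (h (gr m k) T [] j))" if "j \<in> ?J" for j
    by (rule gd_ln[OF E[OF that] lb_pos EE_lb[OF gr_in good that]])
  note main = gd_add[OF lnZ gd_cmult[OF gd_sum[OF fin lnE], where c="- (1/2)"]]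
  have Phi: "(\<lambda>m k. PhiT \<psi> \<psi>b (gr m k) (gr m k) (h (gr m k)) T) = (\<lambda>m k. ln (Zr (gr m k) T) + - (1/2) * (\<Sum>j\<in>?J. ln (EE (gr m k) (h (gr m k) T j []) (h (gr m k) T [] j))))"
    by (intro ext) (simp add: PhiT_eq)
  show ?thesis unfolding Phi
  proof (rule gd_cong[OF main])
    fix m k :: nat assume k: "k < m"
    then have p: "gr m k \<in> {lo..hi}" and g: "good (gr m k) T" using gr_in[of k m] good[of k m] by auto
    have alg: "Sum1 / Z + - (1/2) * S2 = R" if "Sum1 / Z - 1/2 * S2 = R" for Sum1 Z S2 R :: real using that by simp
    have R: "EE (gr m k) (dh m k T [] j) (h (gr m k) T j []) = (\<Sum>a\<in>UNIV. \<Sum>s\<in>UNIV. \<psi> (gr m k) a s * h (gr m k) T j [] s * dh m k T [] j a)" for j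
      by (subst EE_sym) (simp add: EE_def)
    have "om m k T = del m * Gst (\<psi> (gr m k)) (\<psi>b (gr m k)) (c (gr m k)) (d (gr m k)) ?J (\<lambda>j. h (gr m k) T j [])
       + 1/2 * (\<Sum>j\<in>?J. (\<Sum>a\<in>UNIV. \<Sum>s\<in>UNIV. \<psi> (gr m k) a s * dh m k T j [] s * h (gr m k) T [] j a) / EE (gr m k) (h (gr m k) T j []) (h (gr m k) T [] j)
          - (\<Sum>a\<in>UNIV. \<Sum>s\<in>UNIV. \<psi> (gr m k) a s * h (gr m k) T j [] s * dh m k T [] j a) / EE (gr m k) (h (gr m k) T j []) (h (gr m k) T [] j))"
      unfolding om_def cc_def R EE_sym[of "gr m k" "h (gr m k) T [] _" "h (gr m k) T _ []"] by (simp add: EE_def)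
    moreover note bethe_increment_algebra[where J="?J" and w="\<psi> (gr m k)" and b="\<psi>b (gr m k)" and c="c (gr m k)" and d="d (gr m k)"
       and x="\<lambda>j. h (gr m k) T j []" and y="\<lambda>j. h (gr m k) T [] j" and dx="\<lambda>j. dh m k T j []" and dy="\<lambda>j. dh m k T [] j" and \<delta>="del m"
       and Z="Zr (gr m k) T" and E="\<lambda>j. EE (gr m k) (h (gr m k) T j []) (h (gr m k) T [] j)",
       OF fin root_out[OF p g] Zr_def Zr_bounds(3)[OF p T] EE_def]
    ultimately show "(\<Sum>a\<in>UNIV. \<psi>b (gr m k) a * (\<Sum>j\<in>?J. (\<Sum>t\<in>UNIV. \<psi> (gr m k) a t * dh m k T j [] t + h (gr m k) T j [] t * (\<psi> (gr m k) a t * d (gr m k) a t * del m)) * (\<Prod>i\<in>?J - {j}. \<Sum>t\<in>UNIV. \<psi> (gr m k) a t * h (gr m k) T i [] t))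
        + (\<Prod>i\<in>?J. \<Sum>t\<in>UNIV. \<psi> (gr m k) a t * h (gr m k) T i [] t) * (\<psi>b (gr m k) a * c (gr m k) a * del m)) / Zr (gr m k) T
        + - (1/2) * (\<Sum>j\<in>?J. (\<Sum>a\<in>UNIV. \<Sum>t\<in>UNIV. \<psi> (gr m k) a t * h (gr m k) T j [] t * dh m k T [] j a + h (gr m k) T [] j a * (\<psi> (gr m k) a t * dh m k T j [] t + h (gr m k) T j [] t * (\<psi> (gr m k) a t * d (gr m k) a t * del m)))
        / EE (gr m k) (h (gr m k) T j []) (h (gr m k) T [] j)) = om m k T"
      by (intro alg) simp
  qed
qed

end

section \<open>Integration over the law of the tree\<close>

context bethe_path
begin

abbreviation gst where
  "gst p T \<equiv> Gst (\<psi> p) (\<psi>b p) (c p) (d p) (nbrs T []) (\<lambda>j. h p T j [])"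

lemma gst_at:
  assumes p: "p \<in> {lo..hi}" and K: "\<And>s. \<bar>c p s\<bar> \<le> K" "\<And>s t. \<bar>d p s t\<bar> \<le> K"
  shows "AE T in \<mu>. \<bar>gst p T\<bar> \<le> K * (1 + real (deg T []))" "gst p \<in> borel_measurable \<mu>" "integrable \<mu> (gst p)"
proof -
  interpret S: spin "\<psi> p" "\<psi>b p" sp by (rule spin)
  interpret L: lwc_spin "\<psi> p" "\<psi>b p" sp Gn \<mu> ..
  show "AE T in \<mu>. \<bar>gst p T\<bar> \<le> K * (1 + real (deg T []))"
    by (rule L.Gst_AE[OF refl refl uniq[OF p] Hstar[OF p] K])
  show "gst p \<in> borel_measurable \<mu>"
    by (rule L.Gst_m[OF refl refl uniq[OF p] Hstar[OF p] K])
  show "integrable \<mu> (gst p)"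
    by (rule L.Gst_int[OF refl refl uniq[OF p] Hstar[OF p] K])
qed

lemma gst_bound: "\<exists>K\<ge>0. \<forall>p\<in>{lo..hi}. (AE T in \<mu>. \<bar>gst p T\<bar> \<le> K * (1 + real (deg T []))) \<and> gst p \<in> borel_measurable \<mu> \<and> integrable \<mu> (gst p)"
proof -
  obtain K where K: "0 \<le> K" "\<And>p s. p \<in> {lo..hi} \<Longrightarrow> \<bar>c p s\<bar> \<le> K" "\<And>p s t. p \<in> {lo..hi} \<Longrightarrow> \<bar>d p s t\<bar> \<le> K"
    using cd_bound[of lo hi] by blast
  have "(AE T in \<mu>. \<bar>gst p T\<bar> \<le> K * (1 + real (deg T []))) \<and> gst p \<in> borel_measurable \<mu> \<and> integrable \<mu> (gst p)" if "p \<in> {lo..hi}" for p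
    using gst_at[OF that K(2)[OF that] K(3)[OF that]] by (intro conjI)
  then show ?thesis using K(1) by blast
qed

text \<open>Only messages into the root occur, for which H3 gives continuity directly. Continuity of
  g is what makes its Riemann sums converge.\<close>

lemma g_continuous: "continuous_on {lo..hi} g"
  unfolding continuous_on_sequentially
proof (intro allI ballI impI)
  fix x a assume x: "x \<in> {lo..hi}" and a: "(\<forall>n. a n \<in> {lo..hi}) \<and> a \<longlonglongrightarrow> x"
  obtain K where K: "\<And>p. p \<in> {lo..hi} \<Longrightarrow> AE T in \<mu>. \<bar>gst p T\<bar> \<le> K * (1 + real (deg T []))"
    "\<And>p. p \<in> {lo..hi} \<Longrightarrow> gst p \<in> borel_measurable \<mu>" using gst_bound by blast
  obtain C where C: "AE_up \<mu> (\<lambda>T x y. \<forall>s. continuous_on {lo..hi} (\<lambda>p. h p T x y s) \<and> tv_le (\<lambda>p. h p T x y s) lo hi C)"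
    using H3 unfolding H3_def by blast
  have "(\<lambda>n. \<integral>T. gst (a n) T \<partial>\<mu>) \<longlonglongrightarrow> (\<integral>T. gst x T \<partial>\<mu>)"
  proof (rule integral_dominated_convergence[where w="\<lambda>T. K * (1 + real (deg T []))"])
    show "gst x \<in> borel_measurable \<mu>" using K(2)[OF x] .
    show "gst (a n) \<in> borel_measurable \<mu>" for n using K(2)[of "a n"] a by blast
    show "integrable \<mu> (\<lambda>T. K * (1 + real (deg T [])))" using deg_int by simp
    show "AE T in \<mu>. norm (gst (a n) T) \<le> K * (1 + real (deg T []))" for n using K(1)[of "a n"] a by simp
    show "AE T in \<mu>. (\<lambda>n. gst (a n) T) \<longlonglongrightarrow> gst x T"
      using C[unfolded AE_up_def] AE_utree
    proof eventually_elim
      case (elim T)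
      have hc: "continuous_on {lo..hi} (\<lambda>p. h p T j [] s)" if "j \<in> nbrs T []" for j s
        using that elim by (auto simp: nbrs_root lev_def length_Suc_conv)
      have "continuous_on {lo..hi} (\<lambda>p. gst p T)" unfolding Gst_def
      proof (intro continuous_on_divide ballI)
        show "(\<Sum>a\<in>UNIV. \<psi>b p a * (\<Prod>j\<in>nbrs T []. \<Sum>s\<in>UNIV. \<psi> p a s * h p T j [] s)) \<noteq> 0" if "p \<in> {lo..hi}" for p
          using Zr_bounds(3)[OF that elim(2)] by (simp add: Zr_def)
      qed (intro continuous_intros hc psi_cont psib_cont continuous_on_subset[OF c_cont] continuous_on_subset[OF d_cont]; auto)+
      then show ?case using a x unfolding continuous_on_sequentially comp_def by blast
    qed
  qed
  then show "(g \<circ> a) \<longlonglongrightarrow> g x" unfolding comp_def g_def .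
qed

lemma cc_meas: "k < m \<Longrightarrow> (\<lambda>T. cc m k T x y) \<in> borel_measurable treeM"
  unfolding cc_def EE_def
  by (intro borel_measurable_divide borel_measurable_sum borel_measurable_times borel_measurable_const h_meas dh_meas gr_in) auto

lemma cc_inv:
  assumes k: "k < m" and a: "utree T" "utree T'" "x \<in> T" "y \<in> T" "x' \<in> T'" "y' \<in> T'" "tadj x y" "riso2 T tadj x y T' tadj x' y'"
  shows "cc m k T x y = cc m k T' x' y'"
proof -
  have "h (gr m k) T x y = h (gr m k) T' x' y'" "h (gr m k) T y x = h (gr m k) T' y' x'"
    "dh m k T y x = dh m k T' y' x'"
    unfolding dh_def using h_inv[OF gr_in a, of k m] h_inv[OF gr_in a, of "Suc k" m] k by (auto intro!: ext)
  then show ?thesis unfolding cc_def by simp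
qed

lemma cc_bound:
  assumes k: "k < m" and g: "good (gr m k) T" and j: "j \<in> nbrs T []"
  shows "\<bar>cc m k T [] j\<bar> \<le> M * (\<Sum>s\<in>UNIV. \<bar>dh m k T j [] s\<bar>) / lb (deg T [])"
    "\<bar>cc m k T j []\<bar> \<le> M * (\<Sum>s\<in>UNIV. \<bar>dh m k T [] j s\<bar>) / lb (deg T [])"
proof -
  have p: "gr m k \<in> {lo..hi}" using gr_in[of k m] k by simp
  have T: "utree T" using g by (simp add: good_def)
  note e = root_edge[OF T j] and l = EE_lb[OF p g j] lb_pos[of "deg T []"]
  have e2: "\<bar>x / y\<bar> \<le> z / w" if "\<bar>x\<bar> \<le> z" "w \<le> y" "0 < w" for x y z w :: real
    unfolding abs_divide using that by (intro frac_le) auto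
  show "\<bar>cc m k T [] j\<bar> \<le> M * (\<Sum>s\<in>UNIV. \<bar>dh m k T j [] s\<bar>) / lb (deg T [])"
    unfolding cc_def by (rule e2[OF EE_abs_le[OF p] l]) (use msg_prob[OF p T] e in auto)
  show "\<bar>cc m k T j []\<bar> \<le> M * (\<Sum>s\<in>UNIV. \<bar>dh m k T [] j s\<bar>) / lb (deg T [])"
    unfolding cc_def by (rule e2[OF EE_abs_le[OF p] l[folded EE_sym[of _ "h (gr m k) T [] j"]]]) (use msg_prob[OF p T] e in auto)
qed

lemma dh_le: "k < m \<Longrightarrow> utree T \<Longrightarrow> x \<in> T \<Longrightarrow> y \<in> T \<Longrightarrow> tadj x y \<Longrightarrow> \<bar>dh m k T x y s\<bar> \<le> 1"
  unfolding dh_def using msg_prob(1,3)[of "gr m k" T x y s] msg_prob(1,3)[of "gr m (Suc k)" T x y s] gr_in[of k m] gr_in[of "Suc k" m]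
  by (simp add: abs_le_iff)

text \<open>\<open>cc m k\<close> is an invariant function of a directed edge, so mass transport
  equates the means of its two orientations at the root. Domination uses that increments of
  probabilities are at most 1.\<close>

lemma cc_transport:
  assumes k: "k < m"
  shows "integrable \<mu> (\<lambda>T. \<Sum>j\<in>nbrs T []. cc m k T [] j - cc m k T j [])"
    "(\<integral>T. (\<Sum>j\<in>nbrs T []. cc m k T [] j - cc m k T j []) \<partial>\<mu>) = 0"
proof -
  have p: "gr m k \<in> {lo..hi}" using gr_in[of k m] k by simp
  have int: "integrable \<mu> (\<lambda>T. \<Sum>j\<in>nbrs T []. \<bar>cc m k T [] j\<bar>)"
  proof (rule Bochner_Integration.integrable_bound)
    show "integrable \<mu> (\<lambda>T. M * real CARD('x) * dom T)" using dom_int by simp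
    show "(\<lambda>T. \<Sum>j\<in>nbrs T []. \<bar>cc m k T [] j\<bar>) \<in> borel_measurable \<mu>"
      using measurable_\<mu>[OF measurable_sum_nbrs[where A="{}" and x="[]", OF borel_measurable_abs[OF cc_meas[OF k]]]] by simp
    show "AE T in \<mu>. norm (\<Sum>j\<in>nbrs T []. \<bar>cc m k T [] j\<bar>) \<le> norm (M * real CARD('x) * dom T)"
      using AE_good[OF p]
    proof eventually_elim
      case (elim T)
      have T: "utree T" using elim by (simp add: good_def)
      have "(\<Sum>j\<in>nbrs T []. \<bar>cc m k T [] j\<bar>) \<le> (\<Sum>j\<in>nbrs T []. M * real CARD('x) / lb (deg T []))"
      proof (rule sum_mono)
        fix j assume j: "j \<in> nbrs T []"
        have "(\<Sum>s\<in>UNIV. \<bar>dh m k T j [] s\<bar>) \<le> real CARD('x)"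
          using sum_bounded_above[of UNIV "\<lambda>s. \<bar>dh m k T j [] s\<bar>" 1] dh_le[OF k T] root_edge[OF T j] by simp
        then have "M * (\<Sum>s\<in>UNIV. \<bar>dh m k T j [] s\<bar>) / lb (deg T []) \<le> M * real CARD('x) / lb (deg T [])"
          using Mm(1) lb_pos[of "deg T []"] by (intro divide_right_mono mult_left_mono) auto
        then show "\<bar>cc m k T [] j\<bar> \<le> M * real CARD('x) / lb (deg T [])" using cc_bound(1)[OF k elim j] by linarith
      qed
      also have "\<dots> = M * real CARD('x) * (real (deg T []) / lb (deg T []))" by (simp add: deg_def)
      also have "\<dots> \<le> M * real CARD('x) * dom T" using dom_ge(2)[of T] Mm(1) by (intro mult_left_mono) auto
      finally show ?case using dom_ge(3)[of T] Mm(1) by (simp add: sum_nonneg)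
    qed
  qed
  note mt = mass_transport[of "cc m k", OF cc_meas[OF k] cc_inv[OF k] int]
  show "integrable \<mu> (\<lambda>T. \<Sum>j\<in>nbrs T []. cc m k T [] j - cc m k T j [])"
    unfolding sum_subtractf by (rule Bochner_Integration.integrable_diff[OF mt(1,2)])
  show "(\<integral>T. (\<Sum>j\<in>nbrs T []. cc m k T [] j - cc m k T j []) \<partial>\<mu>) = 0"
    unfolding sum_subtractf using Bochner_Integration.integral_diff[OF mt(1,2)] mt(3) by linarith
qed

lemma om_int:
  assumes k: "k < m"
  shows "integrable \<mu> (om m k)" "(\<integral>T. om m k T \<partial>\<mu>) = g (gr m k) * del m"
proof -
  have p: "gr m k \<in> {lo..hi}" using gr_in[of k m] k by simp
  have i: "integrable \<mu> (gst (gr m k))" using gst_bound p by blast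
  note i' = Bochner_Integration.integrable_mult_right[OF i, of "del m"] Bochner_Integration.integrable_mult_right[OF cc_transport(1)[OF k], of "1/2"]
  show "integrable \<mu> (om m k)"
    using Bochner_Integration.integrable_add[OF i'] unfolding om_def[abs_def] by simp
  show "(\<integral>T. om m k T \<partial>\<mu>) = g (gr m k) * del m"
    unfolding om_def Bochner_Integration.integral_add[OF i'] Bochner_Integration.integral_mult_right_zero cc_transport(2)[OF k] g_def by simp
qed

abbreviation Phi where "Phi p T \<equiv> PhiT \<psi> \<psi>b p p (h p) T"

lemma Phi_int: assumes p: "p \<in> {lo..hi}" shows "integrable \<mu> (Phi p)"
proof -
  obtain K where K: "\<And>p T. p \<in> {lo..hi} \<Longrightarrow> good p T \<Longrightarrow> \<bar>Phi p T\<bar> \<le> K * dom T" using PhiT_bound by blast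
  have [measurable]: "(\<lambda>T. h p T x y s) \<in> borel_measurable treeM" for x y s by (rule h_meas[OF p])
  have "Phi p \<in> borel_measurable treeM"
    unfolding PhiT_def[abs_def]
    by (rule measurable_via_finset[OF measurable_nbrs[of "[]"], where f="\<lambda>S T. ln (\<Sum>\<sigma>\<in>UNIV. \<psi>b p \<sigma> * (\<Prod>j\<in>S. \<Sum>s\<in>UNIV. \<psi> p \<sigma> s * h p T j [] s))
     - (1/2) * (\<Sum>j\<in>S. ln (\<Sum>\<sigma>\<in>UNIV. \<Sum>s\<in>UNIV. \<psi> p \<sigma> s * h p T j [] s * h p T [] j \<sigma>))"]) measurable
  from measurable_\<mu>[OF this] show ?thesis
  proof (rule Bochner_Integration.integrable_bound[rotated])
    show "integrable \<mu> (\<lambda>T. K * dom T)" using dom_int by simp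
    show "AE T in \<mu>. norm (Phi p T) \<le> norm (K * dom T)"
      using AE_good[OF p] by eventually_elim (use K[OF p] in \<open>auto intro: order_trans[OF _ abs_ge_self]\<close>)
  qed
qed

text \<open>Error of the first-order expansion along the m-th partition; its mean compares the
  increment of the Bethe functional with a Riemann sum of g.\<close>

definition X where "X m T = Phi (gr m m) T - Phi (gr m 0) T - (\<Sum>k<m. om m k T)"

lemma X_integral: "(\<integral>T. X m T \<partial>\<mu>) = PhiMu \<psi> \<psi>b \<mu> (gr m m) (gr m m) (h (gr m m)) - PhiMu \<psi> \<psi>b \<mu> (gr m 0) (gr m 0) (h (gr m 0)) - (\<Sum>k<m. g (gr m k) * del m)"
  "integrable \<mu> (X m)"
proof -
  note i = Phi_int[OF gr_in[of m m]] Phi_int[OF gr_in[of 0 m]]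
  have s: "integrable \<mu> (\<lambda>T. \<Sum>k<m. om m k T)" by (rule Bochner_Integration.integrable_sum) (auto intro: om_int)
  have "(\<integral>T. (\<Sum>k<m. om m k T) \<partial>\<mu>) = (\<Sum>k<m. \<integral>T. om m k T \<partial>\<mu>)" by (rule Bochner_Integration.integral_sum) (auto intro: om_int)
  then have "(\<integral>T. (\<Sum>k<m. om m k T) \<partial>\<mu>) = (\<Sum>k<m. g (gr m k) * del m)" by (simp add: om_int)
  then show "(\<integral>T. X m T \<partial>\<mu>) = PhiMu \<psi> \<psi>b \<mu> (gr m m) (gr m m) (h (gr m m)) - PhiMu \<psi> \<psi>b \<mu> (gr m 0) (gr m 0) (h (gr m 0)) - (\<Sum>k<m. g (gr m k) * del m)"
    unfolding X_def PhiMu_def using i s by simp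
  show "integrable \<mu> (X m)" unfolding X_def[abs_def] using i s by simp
qed

text \<open>Bounding the cells one by one would lose a factor m. Summed over the cells, the edge
  increments are controlled by total variation, whose constant does not depend on the tree, and the
  explicit part by the length of the interval.\<close>

lemma AE_X: "\<exists>K. AE T in \<mu>. (\<lambda>m. X m T) \<longlonglongrightarrow> 0 \<and> (\<forall>m. \<bar>X m T\<bar> \<le> K * dom T)"
proof -
  obtain C where C: "0 \<le> C" "AE T in \<mu>. \<forall>x\<in>T. \<forall>y\<in>T. tadj x y \<longrightarrow> smooth C T x y" using AE_smooth by blast
  obtain K where K: "\<And>p T. p \<in> {lo..hi} \<Longrightarrow> good p T \<Longrightarrow> \<bar>Phi p T\<bar> \<le> K * dom T" using PhiT_bound by blast
  obtain K' where K': "0 \<le> K'" "\<And>p. p \<in> {lo..hi} \<Longrightarrow> AE T in \<mu>. \<bar>gst p T\<bar> \<le> K' * (1 + real (deg T []))" using gst_bound by blast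
  \<comment> \<open>Only countably many grid points occur, so one null set serves all of
    them.\<close>
  have ok: "AE T in \<mu>. \<forall>m. \<forall>k. k \<le> m \<longrightarrow> good (gr m k) T \<and> \<bar>gst (gr m k) T\<bar> \<le> K' * (1 + real (deg T []))"
    unfolding AE_all_countable
  proof (intro allI)
    fix m k
    show "AE T in \<mu>. k \<le> m \<longrightarrow> good (gr m k) T \<and> \<bar>gst (gr m k) T\<bar> \<le> K' * (1 + real (deg T []))"
    proof (cases "k \<le> m")
      case True
      from AE_good[OF gr_in[OF this]] K'(2)[OF gr_in[OF this]] show ?thesis by eventually_elim simp
    qed simp
  qed
  let ?R = "2 * K + ((hi - lo) * K' + M * real CARD('x) * C)"
  have "AE T in \<mu>. (\<lambda>m. X m T) \<longlonglongrightarrow> 0 \<and> (\<forall>m. \<bar>X m T\<bar> \<le> ?R * dom T)"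
    using C(2) ok
  proof eventually_elim
    case (elim T)
    have good: "good (gr m k) T" if "k \<le> m" for m k using elim(2) that by blast
    have T: "utree T" using good[of 0 0] by (simp add: good_def)
    let ?D = "real (deg T [])" and ?l = "lb (deg T [])"
    have l: "0 < ?l" by (rule lb_pos)
    have lim: "(\<lambda>m. X m T) \<longlonglongrightarrow> 0" unfolding X_def
      using gd_telescope[OF gd_Phi[OF good elim(1)]] .
    have "\<bar>X m T\<bar> \<le> ?R * dom T" for m
    proof -
      have 1: "\<bar>Phi (gr m m) T\<bar> \<le> K * dom T" "\<bar>Phi (gr m 0) T\<bar> \<le> K * dom T"
        by (intro K gr_in good; simp)+
      have dn: "0 \<le> del m" using lohi by (simp add: del_def)
      have ds: "real m * del m \<le> hi - lo" using lohi by (simp add: del_def)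
      have c1: "(\<Sum>k<m. \<bar>cc m k T [] j\<bar>) \<le> M * (real CARD('x) * C) / ?l" "(\<Sum>k<m. \<bar>cc m k T j []\<bar>) \<le> M * (real CARD('x) * C) / ?l"
        if j: "j \<in> nbrs T []" for j
      proof -
        note e = root_edge[OF T j]
        have dh: "(\<Sum>k<m. M * (\<Sum>s\<in>UNIV. \<bar>dh m k T x y s\<bar>) / ?l) \<le> M * (real CARD('x) * C) / ?l" if "x \<in> T" "y \<in> T" "tadj x y" for x y
        proof -
          have "(\<Sum>k<m. \<Sum>s\<in>UNIV. \<bar>dh m k T x y s\<bar>) = (\<Sum>s\<in>UNIV. \<Sum>k<m. \<bar>dh m k T x y s\<bar>)" by (rule sum.swap)
          also have "\<dots> \<le> real CARD('x) * C"
            by (rule sum_bounded_above) (use elim(1) that in \<open>auto simp: smooth_def\<close>)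
          finally have "M * (\<Sum>k<m. \<Sum>s\<in>UNIV. \<bar>dh m k T x y s\<bar>) / ?l \<le> M * (real CARD('x) * C) / ?l"
            using Mm(1) l by (intro divide_right_mono mult_left_mono) auto
          then show ?thesis by (simp add: sum_divide_distrib[symmetric] sum_distrib_left[of M, symmetric])
        qed
        have "(\<Sum>k<m. \<bar>cc m k T [] j\<bar>) \<le> (\<Sum>k<m. M * (\<Sum>s\<in>UNIV. \<bar>dh m k T j [] s\<bar>) / ?l)"
          "(\<Sum>k<m. \<bar>cc m k T j []\<bar>) \<le> (\<Sum>k<m. M * (\<Sum>s\<in>UNIV. \<bar>dh m k T [] j s\<bar>) / ?l)"
          by (intro sum_mono cc_bound good j; simp)+
        then show "(\<Sum>k<m. \<bar>cc m k T [] j\<bar>) \<le> M * (real CARD('x) * C) / ?l" "(\<Sum>k<m. \<bar>cc m k T j []\<bar>) \<le> M * (real CARD('x) * C) / ?l"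
          using dh[of j "[]"] dh[of "[]" j] e by linarith+
      qed
      have "\<bar>\<Sum>k<m. om m k T\<bar> \<le> (\<Sum>k<m. \<bar>om m k T\<bar>)" by (rule sum_abs)
      also have "\<dots> \<le> (\<Sum>k<m. del m * (K' * (1 + ?D)) + 1/2 * (\<Sum>j\<in>nbrs T []. \<bar>cc m k T [] j\<bar> + \<bar>cc m k T j []\<bar>))"
      proof (rule sum_mono)
        fix k assume k: "k \<in> {..<m}"
        have "\<bar>del m * gst (gr m k) T\<bar> \<le> del m * (K' * (1 + ?D))"
          unfolding abs_mult using elim(2) k dn by (simp add: mult_left_mono)
        moreover have "\<bar>\<Sum>j\<in>nbrs T []. cc m k T [] j - cc m k T j []\<bar> \<le> (\<Sum>j\<in>nbrs T []. \<bar>cc m k T [] j\<bar> + \<bar>cc m k T j []\<bar>)"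
          by (rule order_trans[OF sum_abs sum_mono]) (rule abs_triangle_ineq4)
        ultimately show "\<bar>om m k T\<bar> \<le> del m * (K' * (1 + ?D)) + 1/2 * (\<Sum>j\<in>nbrs T []. \<bar>cc m k T [] j\<bar> + \<bar>cc m k T j []\<bar>)"
          unfolding om_def by linarith
      qed
      also have "\<dots> = real m * del m * (K' * (1 + ?D)) + 1/2 * (\<Sum>k<m. \<Sum>j\<in>nbrs T []. \<bar>cc m k T [] j\<bar> + \<bar>cc m k T j []\<bar>)"
        unfolding sum.distrib[of _ _ "{..<m}"] sum_distrib_left[symmetric] sum_constant by (simp only: card_lessThan mult_ac)
      also have "(\<Sum>k<m. \<Sum>j\<in>nbrs T []. \<bar>cc m k T [] j\<bar> + \<bar>cc m k T j []\<bar>) = (\<Sum>j\<in>nbrs T []. (\<Sum>k<m. \<bar>cc m k T [] j\<bar>) + (\<Sum>k<m. \<bar>cc m k T j []\<bar>))"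
        by (subst sum.swap) (simp add: sum.distrib)
      finally have "\<bar>\<Sum>k<m. om m k T\<bar> \<le> real m * del m * (K' * (1 + ?D)) + 1/2 * (\<Sum>j\<in>nbrs T []. (\<Sum>k<m. \<bar>cc m k T [] j\<bar>) + (\<Sum>k<m. \<bar>cc m k T j []\<bar>))" .
      moreover have "real m * del m * (K' * (1 + ?D)) \<le> (hi - lo) * (K' * dom T)"
        using ds K'(1) dom_ge(1)[of T] lohi by (intro mult_mono) auto
      moreover have "(\<Sum>j\<in>nbrs T []. (\<Sum>k<m. \<bar>cc m k T [] j\<bar>) + (\<Sum>k<m. \<bar>cc m k T j []\<bar>)) \<le> 2 * (M * (real CARD('x) * C) * dom T)"
      proof -
        have "(\<Sum>j\<in>nbrs T []. (\<Sum>k<m. \<bar>cc m k T [] j\<bar>) + (\<Sum>k<m. \<bar>cc m k T j []\<bar>)) \<le> (\<Sum>j\<in>nbrs T []. 2 * (M * (real CARD('x) * C) / ?l))"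
        proof (rule sum_mono)
          fix j assume "j \<in> nbrs T []"
          from add_mono[OF c1[OF this]] show "(\<Sum>k<m. \<bar>cc m k T [] j\<bar>) + (\<Sum>k<m. \<bar>cc m k T j []\<bar>) \<le> 2 * (M * (real CARD('x) * C) / ?l)"
            unfolding mult_2 .
        qed
        also have "\<dots> = 2 * (M * (real CARD('x) * C) * (?D / ?l))" by (simp add: deg_def)
        also have "\<dots> \<le> 2 * (M * (real CARD('x) * C) * dom T)"
          using dom_ge(2)[of T] Mm(1) C(1) by (intro mult_left_mono) auto
        finally show ?thesis .
      qed
      ultimately have "\<bar>\<Sum>k<m. om m k T\<bar> \<le> (hi - lo) * (K' * dom T) + M * (real CARD('x) * C) * dom T" by linarith
      moreover have "?R * dom T = K * dom T + K * dom T + ((hi - lo) * (K' * dom T) + M * (real CARD('x) * C) * dom T)" by (simp add: algebra_simps)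
      ultimately show ?thesis using 1 unfolding X_def by linarith
    qed
    then show ?case using lim by blast
  qed
  then show ?thesis by (rule exI[of _ ?R])
qed

lemma PhiMu_diff: "PhiMu \<psi> \<psi>b \<mu> hi hi (h hi) - PhiMu \<psi> \<psi>b \<mu> lo lo (h lo) = integral {lo..hi} g"
proof -
  obtain K where K: "AE T in \<mu>. (\<lambda>m. X m T) \<longlonglongrightarrow> 0 \<and> (\<forall>m. \<bar>X m T\<bar> \<le> K * dom T)" using AE_X by blast
  have "(\<lambda>m. \<integral>T. X m T \<partial>\<mu>) \<longlonglongrightarrow> (\<integral>T. 0 \<partial>\<mu>)"
  proof (rule integral_dominated_convergence[where w="\<lambda>T. K * dom T"])
    show "X m \<in> borel_measurable \<mu>" for m by (rule borel_measurable_integrable[OF X_integral(2)])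
    show "integrable \<mu> (\<lambda>T. K * dom T)" using dom_int by simp
    show "AE T in \<mu>. (\<lambda>m. X m T) \<longlonglongrightarrow> 0" using K by eventually_elim simp
    show "AE T in \<mu>. norm (X m T) \<le> K * dom T" for m using K by eventually_elim simp
  qed simp
  moreover have "(\<lambda>m. \<Sum>k<m. g (gr m k) * del m) \<longlonglongrightarrow> integral {lo..hi} g"
    unfolding del_def by (rule riemann_sums[OF lohi g_continuous])
  ultimately have "(\<lambda>m. (\<integral>T. X m T \<partial>\<mu>) + (\<Sum>k<m. g (gr m k) * del m)) \<longlonglongrightarrow> 0 + integral {lo..hi} g"
    by (intro tendsto_add) simp_all
  \<comment> \<open>The last grid point equals hi only for m > 0.\<close>
  moreover have "\<forall>\<^sub>F m in sequentially. (\<integral>T. X m T \<partial>\<mu>) + (\<Sum>k<m. g (gr m k) * del m) = PhiMu \<psi> \<psi>b \<mu> hi hi (h hi) - PhiMu \<psi> \<psi>b \<mu> lo lo (h lo)"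
    using eventually_gt_at_top[of 0] by eventually_elim (simp add: X_integral(1) gp_0 gp_m)
  ultimately have "(\<lambda>m. PhiMu \<psi> \<psi>b \<mu> hi hi (h hi) - PhiMu \<psi> \<psi>b \<mu> lo lo (h lo)) \<longlonglongrightarrow> integral {lo..hi} g"
    using tendsto_cong by force
  then show ?thesis by (simp add: LIMSEQ_const_iff)
qed

lemma phin_limit: "(\<lambda>n. phin \<psi> \<psi>b Gn n hi hi - phin \<psi> \<psi>b Gn n lo lo) \<longlonglongrightarrow> PhiMu \<psi> \<psi>b \<mu> hi hi (h hi) - PhiMu \<psi> \<psi>b \<mu> lo lo (h lo)"
  unfolding PhiMu_diff by (rule phin_integral(2))

end

section \<open>Specialisation to one moving parameter\<close>

lemma lwc_graphs_of_H2:
  fixes \<psi> :: "real \<Rightarrow> 'x::finite \<Rightarrow> 'x \<Rightarrow> real"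
  assumes lwc: "lwc Gn \<mu>" and H2: "H2 \<psi> \<mu>"
  shows "lwc_graphs Gn \<mu>" "(\<exists>\<beta> a b. \<psi> \<beta> a b = 0) \<Longrightarrow> integrable \<mu> (\<lambda>T. exp (k * real (deg T [])))"
proof -
  have "sets \<mu> = sets treeM" using lwc by (simp add: lwc_def)
  note cong = measurable_cong_sets[OF this refl]
  have D: "(\<lambda>T. deg T []) \<in> measurable \<mu> (count_space UNIV)"
    unfolding cong by (rule measurable_deg)
  have D': "(\<lambda>T. f (deg T [])) \<in> borel_measurable \<mu>" for f :: "nat \<Rightarrow> real" by (rule measurable_compose[OF D]) simp
  have int: "integrable \<mu> (\<lambda>T. f (deg T []))" if "\<And>n. 0 \<le> f n" "(\<integral>\<^sup>+T. ennreal (f (deg T [])) \<partial>\<mu>) < \<infinity>" for f :: "nat \<Rightarrow> real"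
    by (rule integrableI_nonneg[OF D']) (use that in auto)
  show "lwc_graphs Gn \<mu>" using lwc H2 int[of real] by (simp add: lwc_graphs_def H2_def)
  show "integrable \<mu> (\<lambda>T. exp (k * real (deg T [])))" if "\<exists>\<beta> a b. \<psi> \<beta> a b = 0"
    using H2 that int[of "\<lambda>n. exp (k * real n)"] by (simp add: H2_def)
qed

lemma phin_limit_diagonal:
  fixes \<psi> :: "real \<Rightarrow> 'x::finite \<Rightarrow> 'x \<Rightarrow> real"
  assumes H1: "H1 \<psi> \<psi>b" and lwc: "lwc Gn \<mu>" and H2: "H2 \<psi> \<mu>" and lohi: "lo \<le> hi"
    and u: "\<And>p. p \<in> {lo..hi} \<Longrightarrow> uniq \<psi> \<psi>b \<mu> p p" and h: "\<And>p. p \<in> {lo..hi} \<Longrightarrow> h p \<in> Hstar \<psi> \<psi>b \<mu> p p"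
    and H3: "H3 \<mu> h lo hi"
  shows "(\<lambda>n. phin \<psi> \<psi>b Gn n hi hi - phin \<psi> \<psi>b Gn n lo lo) \<longlonglongrightarrow> PhiMu \<psi> \<psi>b \<mu> hi hi (h hi) - PhiMu \<psi> \<psi>b \<mu> lo lo (h lo)"
proof -
  obtain sp c d where sf: "spin_family \<psi> \<psi>b sp c d" using H1_family[OF H1] by blast
  interpret spin_family \<psi> \<psi>b sp c d by (rule sf)
  interpret lwc_graphs Gn \<mu> by (rule lwc_graphs_of_H2(1)[OF lwc H2])
  have nn: "0 \<le> \<psi> p s t" for p s t by (rule spin.w_nn[OF spin])
  \<comment> \<open>Without zeros nonnegativity becomes positivity; with a zero, H2 provides all
    exponential moments.\<close>
  have dich: "(\<forall>p s t. 0 < \<psi> p s t) \<or> (\<forall>k. integrable \<mu> (\<lambda>T. exp (k * real (deg T []))))"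
  proof (cases "\<exists>\<beta> a b. \<psi> \<beta> a b = 0")
    case True
    show ?thesis by (intro disjI2 allI lwc_graphs_of_H2(2)[OF lwc H2 True])
  next
    case False
    then have "0 < \<psi> p s t" for p s t using nn[of p s t] by (simp add: less_le)
    then show ?thesis by simp
  qed
  have "lwc_family \<psi> \<psi>b sp c d Gn \<mu> lo hi h"
    by (rule lwc_family.intro[OF sf lwc_graphs_axioms lwc_family_axioms.intro[OF lohi u h]])
  then have "bethe_path \<psi> \<psi>b sp c d Gn \<mu> lo hi h"
    by (rule bethe_path.intro[OF _ bethe_path_axioms.intro[OF H3 dich]])
  then show ?thesis by (rule bethe_path.phin_limit)
qed

theorem mainTheorem6:
  fixes \<psi> :: "real \<Rightarrow> 'x::finite \<Rightarrow> 'x \<Rightarrow> real"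
    and \<psi>b :: "real \<Rightarrow> 'x \<Rightarrow> real"
    and Gn :: "nat \<Rightarrow> (nat \<Rightarrow> nat \<Rightarrow> bool) pmf"
    and \<mu> :: "nat list set measure"
  assumes "H1 \<psi> \<psi>b" and "lwc Gn \<mu>" and "H2 \<psi> \<mu>"
  shows "(\<forall>\<beta> B. uniq \<psi> \<psi>b \<mu> \<beta> B \<longrightarrow> singleton_mod_null \<mu> (Hstar \<psi> \<psi>b \<mu> \<beta> B))
    \<and> (\<forall>\<beta>0 \<beta>1 B h. \<beta>0 \<le> \<beta>1 \<and> (\<forall>\<beta>\<in>{\<beta>0..\<beta>1}. uniq \<psi> \<psi>b \<mu> \<beta> B) \<and>
          (\<forall>\<beta>\<in>{\<beta>0..\<beta>1}. h \<beta> \<in> Hstar \<psi> \<psi>b \<mu> \<beta> B) \<and> H3 \<mu> h \<beta>0 \<beta>1 \<longrightarrow>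
          (\<lambda>n. phin \<psi> \<psi>b Gn n \<beta>1 B - phin \<psi> \<psi>b Gn n \<beta>0 B)
            \<longlonglongrightarrow> PhiMu \<psi> \<psi>b \<mu> \<beta>1 B (h \<beta>1) - PhiMu \<psi> \<psi>b \<mu> \<beta>0 B (h \<beta>0))
    \<and> (\<forall>\<beta> B0 B1 h. B0 \<le> B1 \<and> (\<forall>B\<in>{B0..B1}. uniq \<psi> \<psi>b \<mu> \<beta> B) \<and>
          (\<forall>B\<in>{B0..B1}. h B \<in> Hstar \<psi> \<psi>b \<mu> \<beta> B) \<and> H3 \<mu> h B0 B1 \<longrightarrow>
          (\<lambda>n. phin \<psi> \<psi>b Gn n \<beta> B1 - phin \<psi> \<psi>b Gn n \<beta> B0)
            \<longlonglongrightarrow> PhiMu \<psi> \<psi>b \<mu> \<beta> B1 (h B1) - PhiMu \<psi> \<psi>b \<mu> \<beta> B0 (h B0))"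
proof (intro conjI allI impI)
  fix \<beta> B assume u: "uniq \<psi> \<psi>b \<mu> \<beta> B"
  obtain sp c d where "spin_family \<psi> \<psi>b sp c d" using H1_family[OF assms(1)] by blast
  then interpret spin_family \<psi> \<psi>b sp c d .
  interpret lwc_graphs Gn \<mu> by (rule lwc_graphs_of_H2(1)[OF assms(2,3)])
  \<comment> \<open>The family supplies the two weights at equal parameters; the conditions of
    \<open>spin\<close> concern them separately and share one permissive spin, so \<beta> and B may
    differ.\<close>
  have "spin (\<psi> \<beta>) (\<psi>b B) sp" using spin[of \<beta>] spin[of B] by (simp add: spin_def)
  then show "singleton_mod_null \<mu> (Hstar \<psi> \<psi>b \<mu> \<beta> B)"
    by (rule spin.singleton_fixed_point[where \<psi>=\<psi> and \<beta>=\<beta> and \<psi>b=\<psi>b and B=B, OF _ tree_law_axioms refl refl u])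
next
  fix \<beta>0 \<beta>1 B h
  assume a: "\<beta>0 \<le> \<beta>1 \<and> (\<forall>\<beta>\<in>{\<beta>0..\<beta>1}. uniq \<psi> \<psi>b \<mu> \<beta> B) \<and>
          (\<forall>\<beta>\<in>{\<beta>0..\<beta>1}. h \<beta> \<in> Hstar \<psi> \<psi>b \<mu> \<beta> B) \<and> H3 \<mu> h \<beta>0 \<beta>1"
  let ?b = "\<lambda>_. \<psi>b B"
  have H: "H1 \<psi> ?b" using assms(1) unfolding H1_def
    by (elim conjE) (intro conjI allI C1_differentiable_on_const; blast)
  have U: "uniq \<psi> ?b \<mu> \<beta> p = uniq \<psi> \<psi>b \<mu> \<beta> B" for \<beta> p
    unfolding uniq_def gibbs_def Zloc_def wloc_def by (rule refl)
  have S: "Hstar \<psi> ?b \<mu> \<beta> p = Hstar \<psi> \<psi>b \<mu> \<beta> B" for \<beta> p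
    unfolding Hstar_def bp_fixed_at_def bp_rhs_def by (rule refl)
  have F: "phin \<psi> ?b Gn n \<beta> p = phin \<psi> \<psi>b Gn n \<beta> B" "PhiMu \<psi> ?b \<mu> \<beta> p k = PhiMu \<psi> \<psi>b \<mu> \<beta> B k" for n \<beta> p k
    unfolding phin_def Zg_def PhiMu_def PhiT_def by (rule refl)+
  show "(\<lambda>n. phin \<psi> \<psi>b Gn n \<beta>1 B - phin \<psi> \<psi>b Gn n \<beta>0 B)
            \<longlonglongrightarrow> PhiMu \<psi> \<psi>b \<mu> \<beta>1 B (h \<beta>1) - PhiMu \<psi> \<psi>b \<mu> \<beta>0 B (h \<beta>0)"
    by (rule phin_limit_diagonal[of \<psi> ?b Gn \<mu> \<beta>0 \<beta>1 h, unfolded U S F, OF H assms(2,3)]) (use a in auto)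
next
  fix \<beta> B0 B1 h
  assume a: "B0 \<le> B1 \<and> (\<forall>B\<in>{B0..B1}. uniq \<psi> \<psi>b \<mu> \<beta> B) \<and>
          (\<forall>B\<in>{B0..B1}. h B \<in> Hstar \<psi> \<psi>b \<mu> \<beta> B) \<and> H3 \<mu> h B0 B1"
  let ?w = "\<lambda>_. \<psi> \<beta>"
  have H: "H1 ?w \<psi>b" using assms(1) C1_differentiable_on_const unfolding H1_def by (elim conjE) (intro conjI allI; blast)
  have H': "H2 ?w \<mu>" using assms(3) unfolding H2_def by blast
  have U: "uniq ?w \<psi>b \<mu> p B = uniq \<psi> \<psi>b \<mu> \<beta> B" for B p
    unfolding uniq_def gibbs_def Zloc_def wloc_def by (rule refl)
  have S: "Hstar ?w \<psi>b \<mu> p B = Hstar \<psi> \<psi>b \<mu> \<beta> B" for B p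
    unfolding Hstar_def bp_fixed_at_def bp_rhs_def by (rule refl)
  have F: "phin ?w \<psi>b Gn n p B = phin \<psi> \<psi>b Gn n \<beta> B" "PhiMu ?w \<psi>b \<mu> p B k = PhiMu \<psi> \<psi>b \<mu> \<beta> B k" for n B p k
    unfolding phin_def Zg_def PhiMu_def PhiT_def by (rule refl)+
  show "(\<lambda>n. phin \<psi> \<psi>b Gn n \<beta> B1 - phin \<psi> \<psi>b Gn n \<beta> B0)
            \<longlonglongrightarrow> PhiMu \<psi> \<psi>b \<mu> \<beta> B1 (h B1) - PhiMu \<psi> \<psi>b \<mu> \<beta> B0 (h B0)"
    by (rule phin_limit_diagonal[of ?w \<psi>b Gn \<mu> B0 B1 h, unfolded U S F, OF H assms(2) H']) (use a in auto)
qed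

end
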